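(* Let $A=(a_{ij}),B,C\in\Xi_{n,d}$, $h\in[1,n]$ and $b,c\in\mathbb N$. For $t=(t_i)_{-n\le i\le n}\in\mathbb N^N$ put $$\check A_{t,h}=A+\sum_{l=-n}^n t_lE^\theta_{h,l}-\sum_{l=-n}^n t_lE^\theta_{h-1,l},\qquad \hat A_{t,h}=A-\sum_{l=-n}^n t_lE^\theta_{h,l}+\sum_{l=-n}^n t_lE^\theta_{h-1,l}.$$ Then the following identities hold in the Schur algebra $\mathbb S^{\jmath}_{n,d}$ (all summation indices $k,l$ range over $[-n,n]$). (1) If $B-bE^\theta_{h,h-1}$ is diagonal and $\mathrm{col}(B)=\mathrm{row}(A)$, then $$[B][A]=\sum_t u^{-\delta_{h,1}\sum_{l>0}t_l}\,v^{\beta(t)}\prod_{l=-n}^n\overline{\begin{bmatrix}a_{h,l}+t_l\\ t_l\end{bmatrix}}\,[\check A_{t,h}],$$ where $t$ runs over $\mathbb N^N$ with $\sum_i t_i=b$ and with $t_i\le a_{h-1,i}$ for all $i$ if $h>1$, respectively $t_i+t_{-i}\le a_{h-1,i}$ for all $i$ if $h=1$, and $$\beta(t)=\sum_{k\le l}t_la_{h,k}-\sum_{k<l}t_l(a_{h-1,k}-t_k)+\delta_{h,1}\Big(\sum_{-l<k<l}t_lt_k+\sum_{l>0}\frac{t_l(t_l+3)}2\Big).$$ (2) Suppose $C-cE^\theta_{h-1,h}$ is diagonal and $\mathrm{col}(C)=\mathrm{row}(A)$. In the sums below $t$ runs over $\mathbb N^N$ with $\sum_it_i=c$ and $t_i\le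 a_{h,i}$ for all $i$. If $h\ne1$, then $$[C][A]=\sum_t v^{\beta'(t)}\prod_{l=-n}^n\overline{\begin{bmatrix}a_{h-1,l}+t_l\\ t_l\end{bmatrix}}\,[\hat A_{t,h}],\qquad \beta'(t)=\sum_{k\ge l}t_la_{h-1,k}-\sum_{k>l}t_l(a_{h,k}-t_k).$$ If $h=1$, then $$[C][A]=\sum_t u^{\sum_{l\le0}t_l}\,v^{\beta''(t)}\,\overline{\left(\frac{[a_{00}^\natural+t_0]^!_{\mathfrak c}}{[a_{00}^\natural]^!_{\mathfrak c}[t_0]!}\prod_{l=1}^n\frac{[a_{0,l}+t_l+t_{-l}]!}{[a_{0,l}]!\,[t_l]!\,[t_{-l}]!}\right)}\,[\hat A_{t,1}],$$ where $$\beta''(t)=\sum_{k\ge l}t_la_{0,k}-\sum_{k>l}t_l(a_{1,k}-t_k)+\sum_{l<k\le -l}t_lt_k+\sum_{l\le0}\frac{t_l(t_l-3)}2.$$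
   Context: Index conventions: $\mathbb N=\{0,1,2,\dots\}$; $[a,b]$ is an integer interval; $n,d\in\mathbb N$, $N=2n+1$, $D=2d+1$. $N\times N$ matrices have rows and columns indexed by $[-n,n]$; $E_{ij}$ are matrix units and $E^\theta_{ij}=E_{ij}+E_{-i,-j}$ (so $E^\theta_{00}=2E_{00}$). Weyl group: $W$ is the group of permutations $g$ of $[-d,d]$ with $g(-i)=-g(i)$, a Coxeter group with generators $s_0=(-1,1)$, $s_i=(i,i+1)(-i,-i-1)$ for $1\le i<d$; $\ell$ is its length function. $\Lambda_{n,d}$ is the set of tuples $\lambda=(\lambda_n,\dots,\lambda_1,2\lambda_0+1,\lambda_1,\dots,\lambda_n)$ with $\lambda_i\in\mathbb N$, $\sum_{i=0}^n\lambda_i=d$. Put $R^\lambda_0=[-\lambda_0,\lambda_0]$, $R^\lambda_i=[\lambda_0+\sum_{1\le j<i}\lambda_j+1,\ \lambda_0+\sum_{1\le j\le i}\lambda_j]$ and $R^\lambda_{-i}=-R^\lambda_i$ for $0<i\le n$. $W_\lambda$ is the (parabolic) subgroup of $w\in W$ with $w(R^\lambda_i)=R^\lambda_i$ for all $i$; $\mathscr D_{\lambda\mu}$ is the set of minimal length representatives of $W_\lambda\backslash W/W_\mu$. Matrices: $\Xi_{n,d}$ is the set of $N\times N$ matrices over $\mathbb N$ with $a_{ij}=a_{-i,-j}$, $a_{00}$ odd and $\sum_{ij}a_{ij}=D$. $\mathrm{row}(A)_k=\sum_ja_{kj}$, $\mathrm{col}(A)_k=\sum_ia_{ik}$. The map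 $\kappa(\lambda,g,\mu)=(|R_i^\lambda\cap gR_j^\mu|)_{ij}$ is a bijection from triples ($\lambda,\mu\in\Lambda_{n,d}$, $g\in\mathscr D_{\lambda\mu}$) to $\Xi_{n,d}$. Schur algebra: $\mathbb A=\mathbb Z[u^{\pm1},v^{\pm1}]$. The Hecke algebra $\mathbb H$ is the $\mathbb A$-algebra with basis $T_w$ ($w\in W$), $T_wT_{w'}=T_{ww'}$ if $\ell(ww')=\ell(w)+\ell(w')$, $(T_{s_0}+1)(T_{s_0}-u^2)=0$, $(T_{s_i}+1)(T_{s_i}-v^2)=0$ for $i\ge1$. Let $x_\lambda=\sum_{w\in W_\lambda}T_w$ and $\mathbb S^\jmath_{n,d}=\mathrm{End}_{\mathbb H}(\bigoplus_{\lambda\in\Lambda_{n,d}}x_\lambda\mathbb H)$ (right $\mathbb H$-linear endomorphisms). For $A=\kappa(\lambda,g,\mu)$, $e_A\in\mathrm{Hom}_{\mathbb H}(x_\mu\mathbb H,x_\lambda\mathbb H)$ is given by $e_A(x_\mu)=\sum_{w\in W_\lambda gW_\mu}T_w$; the $e_A$ ($A\in\Xi_{n,d}$) form an $\mathbb A$-basis. Standard basis: let $I_{\mathfrak a}=(\{0\}\times[1,n])\sqcup([1,n]\times[-n,n])$, $I_{\mathfrak c}=I_{\mathfrak a}\sqcup\{(0,0)\}$, $a_{00}^\natural=\frac12(a_{00}-1)$ and $a_{ij}^\natural=a_{ij}$ for $(i,j)\in I_{\mathfrak a}$. Put $$\hat\ell(A)=\tfrac12\sum_{(i,j)\in I_{\mathfrak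 c}}\Big(\sum_{x\le i,\,y>j}+\sum_{x\ge i,\,y<j}\Big)a^\natural_{ij}a_{xy},\quad \hat\ell_{\mathfrak c}(A)=\tfrac12\Big(\sum_{x\ge0,\,y<0}+\sum_{x\le0,\,y>0}\Big)a_{xy},\quad \hat\ell_{\mathfrak a}=\hat\ell-\hat\ell_{\mathfrak c},$$ and $[A]=u^{-\hat\ell_{\mathfrak c}(A)}v^{-\hat\ell_{\mathfrak a}(A)}e_A$. Quantum numbers: $[a]=\frac{v^{2a}-1}{v^2-1}$, $[t]!=\prod_{k=1}^t[k]$, $\begin{bmatrix}a\\ b\end{bmatrix}=\prod_{i=1}^b\frac{v^{2(a-i+1)}-1}{v^{2i}-1}$, $[2t]_{\mathfrak c}=[t](u^2v^{2(t-1)}+1)$, $[t]^!_{\mathfrak c}=\prod_{k=1}^t[2k]_{\mathfrak c}$. The bar on scalars is the ring involution $u\mapsto u^{-1}$, $v\mapsto v^{-1}$. *)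

theory Defs
  imports
    Complex_Main
    "HOL-Library.Poly_Mapping"
    "HOL-Combinatorics.Permutations"
    "HOL-Algebra.Module"
begin

section \<open>Scalars\<close>

text \<open>
  The ring \<open>\<int>[u\<^sup>\<plusminus>\<^sup>1, v\<^sup>\<plusminus>\<^sup>1]\<close>, realised as Laurent polynomials in \<open>u\<close> whose coefficients are
  Laurent polynomials in \<open>v\<close>. With this nesting the library makes it an integral domain.
\<close>

type_synonym laurent = "int \<Rightarrow>\<^sub>0 int \<Rightarrow>\<^sub>0 int"

definition u_pow :: "int \<Rightarrow> laurent" where
  "u_pow a = Poly_Mapping.single a 1"

definition v_pow :: "int \<Rightarrow> laurent" where
  "v_pow b = Poly_Mapping.single 0 (Poly_Mapping.single b 1)"

definition bar :: "laurent \<Rightarrow> laurent" where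
  "bar p = Poly_Mapping.map (Poly_Mapping.map_key uminus) (Poly_Mapping.map_key uminus p)"

text \<open>
  The quotient of \<open>x\<close> by \<open>y\<close> in the fraction field, when it lies in the ring of scalars; this is
  the case for every quotient formed below.
\<close>

definition exact_div :: "laurent \<Rightarrow> laurent \<Rightarrow> laurent" where
  "exact_div x y = (THE q. q * y = x)"

lemma exact_div_eqI:
  assumes "y \<noteq> 0" "q * y = x"
  shows "exact_div x y = q"
  unfolding exact_div_def
proof (rule the_equality)
  show "q' = q" if "q' * y = x" for q'
    using that assms mult_right_cancel[OF assms(1), of q' q] by simp
qed (rule assms(2))

definition qint :: "int \<Rightarrow> laurent" where
  "qint a = exact_div (v_pow (2 * a) - 1) (v_pow 2 - 1)"

definition qfact :: "nat \<Rightarrow> laurent" where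
  "qfact t = (\<Prod>k = 1..t. qint (int k))"

text \<open>The single factors of the quantum binomial need not be Laurent polynomials; their product is.\<close>

definition qbinom :: "int \<Rightarrow> nat \<Rightarrow> laurent" where
  "qbinom a b =
     exact_div (\<Prod>i = 1..b. v_pow (2 * (a - int i + 1)) - 1) (\<Prod>i = 1..b. v_pow (2 * int i) - 1)"

text \<open>\<open>qint_c t\<close> is \<open>[2t]\<^sub>c\<close>, and \<open>qfact_c t\<close> is \<open>[2]\<^sub>c [4]\<^sub>c \<dots> [2t]\<^sub>c\<close>.\<close>

definition qint_c :: "int \<Rightarrow> laurent" where
  "qint_c t = qint t * (u_pow 2 * v_pow (2 * (t - 1)) + 1)"

definition qfact_c :: "nat \<Rightarrow> laurent" where
  "qfact_c t = (\<Prod>k = 1..t. qint_c (int k))"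


section \<open>The Weyl group\<close>

text \<open>Signed permutations are extended by the identity outside \<open>[-d, d]\<close>; the product is composition.\<close>

definition weyl :: "nat \<Rightarrow> (int \<Rightarrow> int) set" where
  "weyl d = {g. g permutes {- int d..int d} \<and> (\<forall>i. g (- i) = - g i)}"

definition gen :: "nat \<Rightarrow> int \<Rightarrow> int" where
  "gen i = (if i = 0 then transpose (- 1) 1
            else transpose (int i) (int i + 1) \<circ> transpose (- int i) (- int i - 1))"

definition len :: "nat \<Rightarrow> (int \<Rightarrow> int) \<Rightarrow> nat" where
  "len d w = (LEAST k. \<exists>is. length is = k \<and> set is \<subseteq> {..<d} \<and> w = foldr (\<lambda>i g. gen i \<circ> g) is id)"

text \<open>
  The symmetric tuple \<open>(\<lambda>\<^sub>n, \<dots>, \<lambda>\<^sub>1, 2\<lambda>\<^sub>0 + 1, \<lambda>\<^sub>1, \<dots>, \<lambda>\<^sub>n)\<close> is represented by the function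
  \<open>i \<mapsto> \<lambda>\<^sub>i\<close>, extended by \<open>0\<close> to \<open>i > n\<close>.
\<close>

definition Lam :: "nat \<Rightarrow> nat \<Rightarrow> (nat \<Rightarrow> nat) set" where
  "Lam n d = {la. (\<forall>i>n. la i = 0) \<and> (\<Sum>i\<le>n. la i) = d}"

definition pos_block :: "(nat \<Rightarrow> nat) \<Rightarrow> nat \<Rightarrow> int set" where
  "pos_block la i = {int (la 0) + (\<Sum>j = 1..<i. int (la j)) + 1..int (la 0) + (\<Sum>j = 1..i. int (la j))}"

definition block :: "(nat \<Rightarrow> nat) \<Rightarrow> int \<Rightarrow> int set" where
  "block la i =
     (if i = 0 then {- int (la 0)..int (la 0)}
      else if i > 0 then pos_block la (nat i)
      else uminus ` pos_block la (nat (- i)))"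

definition parabolic :: "nat \<Rightarrow> (nat \<Rightarrow> nat) \<Rightarrow> (int \<Rightarrow> int) set" where
  "parabolic d la = {w \<in> weyl d. \<forall>i. w ` block la i = block la i}"

definition double_coset ::
    "nat \<Rightarrow> (nat \<Rightarrow> nat) \<Rightarrow> (int \<Rightarrow> int) \<Rightarrow> (nat \<Rightarrow> nat) \<Rightarrow> (int \<Rightarrow> int) set" where
  "double_coset d la g mu = {x \<circ> g \<circ> y | x y. x \<in> parabolic d la \<and> y \<in> parabolic d mu}"

definition min_reps :: "nat \<Rightarrow> (nat \<Rightarrow> nat) \<Rightarrow> (nat \<Rightarrow> nat) \<Rightarrow> (int \<Rightarrow> int) set" where
  "min_reps d la mu = {g \<in> weyl d. \<forall>w \<in> double_coset d la g mu. len d g \<le> len d w}"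


section \<open>Matrices\<close>

text \<open>
  Matrices with rows and columns indexed by \<open>[-n, n]\<close> are functions vanishing outside that range.
  Entries are integers so that subtraction is not truncated.
\<close>

type_synonym mat = "int \<Rightarrow> int \<Rightarrow> int"

definition idx :: "nat \<Rightarrow> int set" where
  "idx n = {- int n..int n}"

definition Xi :: "nat \<Rightarrow> nat \<Rightarrow> mat set" where
  "Xi n d = {A. (\<forall>i j. i \<notin> idx n \<or> j \<notin> idx n \<longrightarrow> A i j = 0) \<and>
                (\<forall>i j. 0 \<le> A i j) \<and>
                (\<forall>i j. A i j = A (- i) (- j)) \<and>
                odd (A 0 0) \<and>
                (\<Sum>i \<in> idx n. \<Sum>j \<in> idx n. A i j) = 2 * int d + 1}"

definition row :: "nat \<Rightarrow> mat \<Rightarrow> int \<Rightarrow> int" where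
  "row n A k = (\<Sum>j \<in> idx n. A k j)"

definition col :: "nat \<Rightarrow> mat \<Rightarrow> int \<Rightarrow> int" where
  "col n A k = (\<Sum>i \<in> idx n. A i k)"

definition diagonal :: "mat \<Rightarrow> bool" where
  "diagonal A \<longleftrightarrow> (\<forall>i j. i \<noteq> j \<longrightarrow> A i j = 0)"

definition unit_mat :: "int \<Rightarrow> int \<Rightarrow> mat" where
  "unit_mat i j = (\<lambda>x y. if x = i \<and> y = j then 1 else 0)"

definition E\<theta> :: "int \<Rightarrow> int \<Rightarrow> mat" where
  "E\<theta> i j = (\<lambda>x y. unit_mat i j x y + unit_mat (- i) (- j) x y)"

definition check_mat :: "nat \<Rightarrow> mat \<Rightarrow> (int \<Rightarrow> nat) \<Rightarrow> int \<Rightarrow> mat" where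
  "check_mat n A t h =
     (\<lambda>x y. A x y + (\<Sum>l \<in> idx n. int (t l) * E\<theta> h l x y) - (\<Sum>l \<in> idx n. int (t l) * E\<theta> (h - 1) l x y))"

definition hat_mat :: "nat \<Rightarrow> mat \<Rightarrow> (int \<Rightarrow> nat) \<Rightarrow> int \<Rightarrow> mat" where
  "hat_mat n A t h =
     (\<lambda>x y. A x y - (\<Sum>l \<in> idx n. int (t l) * E\<theta> h l x y) + (\<Sum>l \<in> idx n. int (t l) * E\<theta> (h - 1) l x y))"

definition kappa :: "(nat \<Rightarrow> nat) \<Rightarrow> (int \<Rightarrow> int) \<Rightarrow> (nat \<Rightarrow> nat) \<Rightarrow> mat" where
  "kappa la g mu = (\<lambda>i j. int (card (block la i \<inter> g ` block mu j)))"

definition kappa_dom :: "nat \<Rightarrow> nat \<Rightarrow> ((nat \<Rightarrow> nat) \<times> (int \<Rightarrow> int) \<times> (nat \<Rightarrow> nat)) set" where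
  "kappa_dom n d = {(la, g, mu). la \<in> Lam n d \<and> mu \<in> Lam n d \<and> g \<in> min_reps d la mu}"

definition kappa_inv :: "nat \<Rightarrow> nat \<Rightarrow> mat \<Rightarrow> (nat \<Rightarrow> nat) \<times> (int \<Rightarrow> int) \<times> (nat \<Rightarrow> nat)" where
  "kappa_inv n d = the_inv_into (kappa_dom n d) (\<lambda>(la, g, mu). kappa la g mu)"


section \<open>The Hecke algebra\<close>

text \<open>
  The Hecke algebra is given, up to isomorphism, by its characterisation: a unital associative
  algebra over the scalars with basis \<open>T w\<close> for \<open>w\<close> in the Weyl group, subject to the braid and
  quadratic relations.
\<close>

locale hecke_algebra = Modules.module smul
  for smul :: "laurent \<Rightarrow> 'h::ring_1 \<Rightarrow> 'h" +
  fixes d :: nat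
    and T :: "(int \<Rightarrow> int) \<Rightarrow> 'h"
  assumes smul_mult_left: "smul a x * y = smul a (x * y)"
    and smul_mult_right: "x * smul a y = smul a (x * y)"
    and T_inj: "inj_on T (weyl d)"
    and T_independent: "independent (T ` weyl d)"
    and T_span: "span (T ` weyl d) = UNIV"
    and T_mult: "\<lbrakk>w \<in> weyl d; w' \<in> weyl d; len d (w \<circ> w') = len d w + len d w'\<rbrakk>
                   \<Longrightarrow> T w * T w' = T (w \<circ> w')"
    and T_quadratic_0: "0 < d \<Longrightarrow> (T (gen 0) + 1) * (T (gen 0) - smul (u_pow 2) 1) = 0"
    and T_quadratic: "\<lbrakk>1 \<le> i; i < d\<rbrakk> \<Longrightarrow> (T (gen i) + 1) * (T (gen i) - smul (v_pow 2) 1) = 0"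


section \<open>The Schur algebra\<close>

definition x_elt :: "nat \<Rightarrow> ((int \<Rightarrow> int) \<Rightarrow> 'h::ring_1) \<Rightarrow> (nat \<Rightarrow> nat) \<Rightarrow> 'h" where
  "x_elt d T la = (\<Sum>w \<in> parabolic d la. T w)"

text \<open>The direct sum of the right ideals \<open>x\<^sub>\<lambda> H\<close> over \<open>\<lambda> \<in> \<Lambda>\<close>, as families indexed by \<open>\<lambda>\<close>.\<close>

definition perm_module ::
    "nat \<Rightarrow> nat \<Rightarrow> ((int \<Rightarrow> int) \<Rightarrow> 'h::ring_1) \<Rightarrow> ((nat \<Rightarrow> nat) \<Rightarrow> 'h) set" where
  "perm_module n d T =
     {f. (\<forall>la \<in> Lam n d. f la \<in> range (\<lambda>y. x_elt d T la * y)) \<and> (\<forall>la. la \<notin> Lam n d \<longrightarrow> f la = 0)}"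

definition embed :: "(nat \<Rightarrow> nat) \<Rightarrow> 'h::ring_1 \<Rightarrow> (nat \<Rightarrow> nat) \<Rightarrow> 'h" where
  "embed la y = (\<lambda>nu. if nu = la then y else 0)"

type_synonym 'h schur_elt = "((nat \<Rightarrow> nat) \<Rightarrow> 'h) \<Rightarrow> (nat \<Rightarrow> nat) \<Rightarrow> 'h"

text \<open>Linearity over the scalars is a consequence of right linearity over the unital Hecke algebra.\<close>

definition hecke_endos :: "nat \<Rightarrow> nat \<Rightarrow> ((int \<Rightarrow> int) \<Rightarrow> 'h::ring_1) \<Rightarrow> 'h schur_elt set" where
  "hecke_endos n d T =
     {\<phi> \<in> perm_module n d T \<rightarrow>\<^sub>E perm_module n d T.
        (\<forall>f \<in> perm_module n d T. \<forall>g \<in> perm_module n d T.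
           \<phi> (\<lambda>la. f la + g la) = (\<lambda>la. \<phi> f la + \<phi> g la)) \<and>
        (\<forall>f \<in> perm_module n d T. \<forall>y. \<phi> (\<lambda>la. f la * y) = (\<lambda>la. \<phi> f la * y))}"

definition schur_algebra ::
    "nat \<Rightarrow> nat \<Rightarrow> (laurent \<Rightarrow> 'h::ring_1 \<Rightarrow> 'h) \<Rightarrow> ((int \<Rightarrow> int) \<Rightarrow> 'h) \<Rightarrow> (laurent, 'h schur_elt) module" where
  "schur_algebra n d smul T =
     \<lparr>carrier = hecke_endos n d T,
      monoid.mult = compose (perm_module n d T),
      one = (\<lambda>f \<in> perm_module n d T. f),
      zero = (\<lambda>f \<in> perm_module n d T. \<lambda>la. 0),
      add = (\<lambda>\<phi> \<psi>. \<lambda>f \<in> perm_module n d T. \<lambda>la. \<phi> f la + \<psi> f la),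
      smult = (\<lambda>c \<phi>. \<lambda>f \<in> perm_module n d T. \<lambda>la. smul c (\<phi> f la))\<rparr>"

text \<open>
  For \<open>A = \<kappa>(\<lambda>, g, \<mu>)\<close>, the element \<open>e\<^sub>A\<close> of \<open>Hom(x\<^sub>\<mu> H, x\<^sub>\<lambda> H)\<close> is viewed as an endomorphism of the
  direct sum that vanishes on the other summands.
\<close>

definition e_elt :: "nat \<Rightarrow> nat \<Rightarrow> ((int \<Rightarrow> int) \<Rightarrow> 'h::ring_1) \<Rightarrow> mat \<Rightarrow> 'h schur_elt" where
  "e_elt n d T A =
     (case kappa_inv n d A of (la, g, mu) \<Rightarrow>
        THE \<phi>. \<phi> \<in> hecke_endos n d T \<and>
          \<phi> (embed mu (x_elt d T mu)) = embed la (\<Sum>w \<in> double_coset d la g mu. T w) \<and>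
          (\<forall>nu \<in> Lam n d - {mu}. \<phi> (embed nu (x_elt d T nu)) = (\<lambda>_. 0)))"


section \<open>The standard basis\<close>

definition I_a :: "nat \<Rightarrow> (int \<times> int) set" where
  "I_a n = ({0} \<times> {1..int n}) \<union> ({1..int n} \<times> idx n)"

definition I_c :: "nat \<Rightarrow> (int \<times> int) set" where
  "I_c n = insert (0, 0) (I_a n)"

definition natural :: "mat \<Rightarrow> mat" where
  "natural A = (\<lambda>i j. if i = 0 \<and> j = 0 then (A 0 0 - 1) div 2 else A i j)"

text \<open>For matrices in \<open>Xi n d\<close> the sums that are halved here are even.\<close>

definition ell_hat :: "nat \<Rightarrow> mat \<Rightarrow> int" where
  "ell_hat n A =
     (\<Sum>(i, j) \<in> I_c n.
        (\<Sum>(x, y) \<in> {(x, y) \<in> idx n \<times> idx n. x \<le> i \<and> y > j}. natural A i j * A x y) +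
        (\<Sum>(x, y) \<in> {(x, y) \<in> idx n \<times> idx n. x \<ge> i \<and> y < j}. natural A i j * A x y)) div 2"

definition ell_hat_c :: "nat \<Rightarrow> mat \<Rightarrow> int" where
  "ell_hat_c n A =
     ((\<Sum>(x, y) \<in> {(x, y) \<in> idx n \<times> idx n. x \<ge> 0 \<and> y < 0}. A x y) +
      (\<Sum>(x, y) \<in> {(x, y) \<in> idx n \<times> idx n. x \<le> 0 \<and> y > 0}. A x y)) div 2"

definition ell_hat_a :: "nat \<Rightarrow> mat \<Rightarrow> int" where
  "ell_hat_a n A = ell_hat n A - ell_hat_c n A"

definition std_basis ::
    "nat \<Rightarrow> nat \<Rightarrow> (laurent \<Rightarrow> 'h::ring_1 \<Rightarrow> 'h) \<Rightarrow> ((int \<Rightarrow> int) \<Rightarrow> 'h) \<Rightarrow> mat \<Rightarrow> 'h schur_elt" where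
  "std_basis n d smul T A =
     (u_pow (- ell_hat_c n A) * v_pow (- ell_hat_a n A)) \<odot>\<^bsub>schur_algebra n d smul T\<^esub> e_elt n d T A"


section \<open>Summation ranges and exponents\<close>

definition tuples :: "nat \<Rightarrow> nat \<Rightarrow> (int \<Rightarrow> nat) set" where
  "tuples n b = {t. (\<forall>i. i \<notin> idx n \<longrightarrow> t i = 0) \<and> (\<Sum>i \<in> idx n. t i) = b}"

definition beta :: "nat \<Rightarrow> int \<Rightarrow> mat \<Rightarrow> (int \<Rightarrow> nat) \<Rightarrow> int" where
  "beta n h A t =
     (\<Sum>(k, l) \<in> {(k, l) \<in> idx n \<times> idx n. k \<le> l}. int (t l) * A h k)
     - (\<Sum>(k, l) \<in> {(k, l) \<in> idx n \<times> idx n. k < l}. int (t l) * (A (h - 1) k - int (t k)))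
     + (if h = 1 then
          (\<Sum>(k, l) \<in> {(k, l) \<in> idx n \<times> idx n. - l < k \<and> k < l}. int (t l) * int (t k))
          + (\<Sum>l \<in> {l \<in> idx n. l > 0}. int (t l) * (int (t l) + 3) div 2)
        else 0)"

definition beta' :: "nat \<Rightarrow> int \<Rightarrow> mat \<Rightarrow> (int \<Rightarrow> nat) \<Rightarrow> int" where
  "beta' n h A t =
     (\<Sum>(k, l) \<in> {(k, l) \<in> idx n \<times> idx n. k \<ge> l}. int (t l) * A (h - 1) k)
     - (\<Sum>(k, l) \<in> {(k, l) \<in> idx n \<times> idx n. k > l}. int (t l) * (A h k - int (t k)))"

definition beta'' :: "nat \<Rightarrow> mat \<Rightarrow> (int \<Rightarrow> nat) \<Rightarrow> int" where
  "beta'' n A t =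
     (\<Sum>(k, l) \<in> {(k, l) \<in> idx n \<times> idx n. k \<ge> l}. int (t l) * A 0 k)
     - (\<Sum>(k, l) \<in> {(k, l) \<in> idx n \<times> idx n. k > l}. int (t l) * (A 1 k - int (t k)))
     + (\<Sum>(k, l) \<in> {(k, l) \<in> idx n \<times> idx n. l < k \<and> k \<le> - l}. int (t l) * int (t k))
     + (\<Sum>l \<in> {l \<in> idx n. l \<le> 0}. int (t l) * (int (t l) - 3) div 2)"

end

theory Submission imports Defs begin

text \<open>
  The product of two standard basis elements is computed in the Hecke algebra. The element \<open>e\<^sub>A\<close> acts as
  left multiplication by some \<open>h\<^sub>A\<close> with \<open>h\<^sub>A x\<^sub>\<mu> = \<Sum> T\<^sub>w\<close>, the sum over the double coset of \<open>A\<close>, so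
  \<open>e\<^sub>B e\<^sub>A\<close> is known as soon as \<open>h\<^sub>B\<close> has been multiplied with that sum (\<open>e_elt_lmult\<close>,
  \<open>std_basis_product\<close>).

  The sum over a double coset splits into right cosets of a parabolic subgroup. A right coset is recorded
  by a pattern, the signed word \<open>f\<close> that gives for each position \<open>z\<close> the block containing \<open>w z\<close>, where \<open>w\<close>
  is any element of the coset. If \<open>B\<close> is a diagonal matrix up to \<open>b\<close> units moved from row \<open>p\<close> to a
  neighbouring row \<open>q\<close>, then \<open>h\<^sub>B\<close> sends the coset sum of \<open>f\<close> to the weighted sum, over all sets \<open>X\<close> of \<open>b\<close>
  positions with letter \<open>p\<close>, of the coset sums of the words in which the letters at \<open>X\<close> are changed to
  \<open>q\<close> (\<open>left_mult_coset_sum\<close>). This holds for the weakly increasing word by inspection of the double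
  coset of \<open>B\<close> (\<open>orbit_B\<close>), and it is transported to all words because both sides behave in the same way
  under right multiplication by generators: an ascending swap of letters stays ascending after the change
  of letters or becomes a swap of equal letters, and in the latter case the weight gains the Hecke
  parameter (\<open>relabel_weight_step_up\<close>, \<open>relabel_weight_step_down\<close>).

  Collecting the coefficient of a fixed \<open>T\<^sub>w\<close> (\<open>hecke_product\<close>) leaves an enumeration of sets \<open>X\<close> with
  \<open>t\<^sub>l\<close> elements in each block \<open>l\<close>, weighted by crossings. Crossings between different blocks depend on \<open>t\<close>
  only. Within a block the sum is a Gaussian binomial coefficient if \<open>q\<close> is not the middle row
  (\<open>coefficient_nonzero_row\<close>). For the middle row the block around \<open>0\<close> yields its type B analogue, a
  quotient of the factorials \<open>qfact_c\<close> (\<open>gauss_B_qfact\<close>), and the pairs of opposite blocks yield trinomial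
  coefficients (\<open>coefficient_zero_row\<close>).

  Finally the normalisation of the standard basis is compared. The length \<open>ell_hat\<close> is, up to a linear
  term, a bilinear form in the matrix (\<open>ell_hat_eq\<close>), so its change under a move of units between
  neighbouring rows is an explicit quadratic expression in \<open>t\<close> (\<open>ne_form_move\<close>). The powers of \<open>u\<close> and \<open>v\<close>
  then match those in the formulas by identities between quadratic forms (\<open>ell_hat_up\<close>, \<open>ell_hat_down\<close>).
\<close>

section \<open>Laurent polynomials and quantum factorials\<close>

lemma v_pow_add: "v_pow (a + b) = v_pow a * v_pow b"
  by (simp add: v_pow_def mult_single)

lemma u_pow_add: "u_pow (a + b) = u_pow a * u_pow b"
  by (simp add: u_pow_def mult_single)

lemma v_pow_0 [simp]: "v_pow 0 = 1"
  by (simp add: v_pow_def)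

lemma u_pow_0 [simp]: "u_pow 0 = 1"
  by (simp add: u_pow_def)

lemma v_pow_inverse [simp]: "v_pow a * v_pow (- a) = 1" "v_pow (- a) * v_pow a = 1"
  by (simp_all flip: v_pow_add)

lemma u_pow_inverse [simp]: "u_pow a * u_pow (- a) = 1" "u_pow (- a) * u_pow a = 1"
  by (simp_all flip: u_pow_add)

lemma v_pow_nonzero [simp]: "v_pow a \<noteq> 0"
  using v_pow_inverse(1)[of a] by (metis mult_zero_left zero_neq_one)

lemma u_pow_nonzero [simp]: "u_pow a \<noteq> 0"
  using u_pow_inverse(1)[of a] by (metis mult_zero_left zero_neq_one)

lemma v_pow_eq_iff: "v_pow a = v_pow b \<longleftrightarrow> a = b"
  by (metis (no_types) lookup_single_eq lookup_single_not_eq v_pow_def zero_neq_one)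

lemma v_pow_sum: "finite I \<Longrightarrow> v_pow (\<Sum>i\<in>I. f i) = (\<Prod>i\<in>I. v_pow (f i))"
  by (induction I rule: finite_induct) (auto simp: v_pow_add)

lemma poly_mapping_sum_single:
  "p = (\<Sum>k \<in> Poly_Mapping.keys p. Poly_Mapping.single k (Poly_Mapping.lookup p k))"
  by (rule poly_mapping_eqI) (auto simp: lookup_sum lookup_single when_def not_in_keys_iff_lookup_eq_zero)

text \<open>The bar involution is built from maps on coefficients and exponents. By additivity its
multiplicativity reduces to monomials.\<close>

lemma multiplicative_on_singles:
  fixes g :: "('a::monoid_add \<Rightarrow>\<^sub>0 'b::semiring_0) \<Rightarrow> 'c::semiring_0"
  assumes zero: "g 0 = 0" and add: "\<And>p q. g (p + q) = g p + g q"
    and single: "\<And>a x b y. g (Poly_Mapping.single a x * Poly_Mapping.single b y)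
                   = g (Poly_Mapping.single a x) * g (Poly_Mapping.single b y)"
  shows "g (p * q) = g p * g q"
proof -
  have gsum: "g (\<Sum>i\<in>I. f i) = (\<Sum>i\<in>I. g (f i))" for f and I :: "'a set"
    by (induction I rule: infinite_finite_induct) (auto simp: zero add)
  show ?thesis
    apply (subst (1 2) poly_mapping_sum_single[of p])
    apply (subst (1 2) poly_mapping_sum_single[of q])
    by (simp only: sum_product gsum single)
qed

lemma map_key_uminus_single:
  "Poly_Mapping.map_key uminus (Poly_Mapping.single a x) = Poly_Mapping.single (- a) x"
  for a :: "'a::group_add"
  using map_key_single[of uminus "- a" x] by simp

lemma map_key_uminus_mult:
  "Poly_Mapping.map_key uminus (p * q) = Poly_Mapping.map_key uminus p * Poly_Mapping.map_key uminus q"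
  for p q :: "int \<Rightarrow>\<^sub>0 int"
  by (rule multiplicative_on_singles)
     (simp_all add: map_key_plus map_key_uminus_single mult_single map_key_zero)

lemma lookup_bar:
  "Poly_Mapping.lookup (bar p) a = Poly_Mapping.map_key uminus (Poly_Mapping.lookup p (- a))"
  by (simp add: bar_def Poly_Mapping.map.rep_eq map_key.rep_eq when_def map_key_zero)

lemma bar_add: "bar (p + q) = bar p + bar q"
  by (rule poly_mapping_eqI) (simp add: lookup_bar lookup_add map_key_plus)

lemma bar_0 [simp]: "bar 0 = 0"
  by (rule poly_mapping_eqI) (simp add: lookup_bar map_key_zero)

lemma bar_single:
  "bar (Poly_Mapping.single a x) = Poly_Mapping.single (- a) (Poly_Mapping.map_key uminus x)"
  by (rule poly_mapping_eqI) (auto simp: lookup_bar lookup_single when_def map_key_zero)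

lemma bar_mult: "bar (p * q) = bar p * bar q"
  by (rule multiplicative_on_singles)
     (simp_all add: bar_add bar_single mult_single map_key_uminus_mult)

lemma bar_u_pow [simp]: "bar (u_pow a) = u_pow (- a)"
proof -
  have "Poly_Mapping.map_key uminus (1 :: int \<Rightarrow>\<^sub>0 int) = 1"
    using map_key_uminus_single[of "0::int" "1::int"] by simp
  then show ?thesis by (simp add: u_pow_def bar_single)
qed

lemma bar_v_pow [simp]: "bar (v_pow a) = v_pow (- a)"
  by (simp add: v_pow_def bar_single map_key_uminus_single)

lemma bar_1 [simp]: "bar 1 = 1"
  using bar_u_pow[of 0] by simp

lemma bar_prod: "bar (\<Prod>i\<in>I. f i) = (\<Prod>i\<in>I. bar (f i))"
  by (induction I rule: infinite_finite_induct) (auto simp: bar_mult)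

text \<open>The quantum integer of a natural number as a sum of powers of \<open>v\<^sup>2\<close>; unlike the quotient
defining \<open>qint\<close>, the sum satisfies recursions that can be used without leaving the ring.\<close>

definition qnum :: "nat \<Rightarrow> laurent" where
  "qnum k = (\<Sum>i<k. v_pow (2 * int i))"

lemma qnum_0 [simp]: "qnum 0 = 0"
  by (simp add: qnum_def)

lemma qnum_add: "qnum (a + b) = qnum a + v_pow (2 * int a) * qnum b"
  by (simp add: qnum_def sum.atLeastLessThan_concat[of 0 a "a + b", symmetric] lessThan_atLeast0
      sum.shift_bounds_nat_ivl[of _ 0 a b, simplified add.commute[of b a] add_0_left] sum_distrib_left
      algebra_simps v_pow_add)

lemma qnum_1 [simp]: "qnum (Suc 0) = 1"
  by (simp add: qnum_def)

lemma v_pow_eq_1_iff: "v_pow a = 1 \<longleftrightarrow> a = 0"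
  using v_pow_eq_iff[of a 0] by simp

lemma v_pow_2_minus_1: "v_pow 2 - 1 \<noteq> 0"
  by (simp add: v_pow_eq_1_iff)

lemma qnum_times: "qnum k * (v_pow 2 - 1) = v_pow (2 * int k) - 1"
proof (induction k)
  case (Suc k)
  then show ?case
    using qnum_add[of k 1] by (simp add: algebra_simps flip: v_pow_add)
qed simp

lemma qint_nat: "qint (int k) = qnum k"
  unfolding qint_def by (rule exact_div_eqI[OF v_pow_2_minus_1]) (simp add: qnum_times)

lemma qnum_nonzero: "k \<noteq> 0 \<Longrightarrow> qnum k \<noteq> 0"
  using qnum_times[of k] v_pow_eq_1_iff[of "2 * int k"] by auto

lemma qfact_0 [simp]: "qfact 0 = 1"
  by (simp add: qfact_def)

lemma qfact_Suc: "qfact (Suc k) = qfact k * qnum (Suc k)"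
  by (simp add: qfact_def qint_nat del: of_nat_Suc)

lemma qfact_nonzero [simp]: "qfact k \<noteq> 0"
  by (induction k) (auto simp: qfact_Suc qnum_nonzero)

lemma qfact_c_0 [simp]: "qfact_c 0 = 1"
  by (simp add: qfact_c_def)

text \<open>The second factor never vanishes, since the exponents of \<open>u\<close> in its two terms differ; so type B
factorials can be cancelled.\<close>

lemma qfact_c_Suc:
  "qfact_c (Suc k) = qfact_c k * (qnum (Suc k) * (u_pow 2 * v_pow (2 * int k) + 1))"
  by (simp add: qfact_c_def qint_c_def qint_nat flip: of_nat_Suc) simp

lemma type_B_factor_nonzero: "u_pow 2 * v_pow a + 1 \<noteq> 0"
proof
  assume *: "u_pow 2 * v_pow a + 1 = 0"
  have "Poly_Mapping.lookup (u_pow 2 * v_pow a + 1) 0 = (1 :: int \<Rightarrow>\<^sub>0 int)"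
    by (simp add: u_pow_def v_pow_def mult_single lookup_add lookup_single)
  with * show False by simp
qed

lemma qfact_c_nonzero [simp]: "qfact_c k \<noteq> 0"
  by (induction k) (auto simp: qfact_c_Suc qnum_nonzero type_B_factor_nonzero)

lemma bar_qnum: "bar (qnum (Suc k)) = v_pow (- 2 * int k) * qnum (Suc k)"
proof -
  have "bar (qnum (Suc k)) * bar (v_pow 2 - 1) = bar (v_pow (2 * int (Suc k)) - 1)"
    by (simp add: qnum_times flip: bar_mult)
  moreover have "bar (x - 1) = bar x - 1" for x
    using bar_add[of "x - 1" 1] by simp
  ultimately have "bar (qnum (Suc k)) * (v_pow (- 2) - 1) = v_pow (- 2 * int (Suc k)) - 1"
    by simp
  then have "bar (qnum (Suc k)) * (v_pow (- 2) - 1) * v_pow (2 * int (Suc k))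
      = (v_pow (- 2 * int (Suc k)) - 1) * v_pow (2 * int (Suc k))"
    by simp
  also have "\<dots> = - (qnum (Suc k) * (v_pow 2 - 1))"
    by (simp only: qnum_times) (simp add: algebra_simps flip: v_pow_add)
  also have "bar (qnum (Suc k)) * (v_pow (- 2) - 1) * v_pow (2 * int (Suc k))
     = - (bar (qnum (Suc k)) * v_pow (2 * int k) * (v_pow 2 - 1))"
    by (simp add: algebra_simps flip: v_pow_add)
  finally have "bar (qnum (Suc k)) * v_pow (2 * int k) = qnum (Suc k)"
    using v_pow_2_minus_1 by simp
  then have "bar (qnum (Suc k)) * v_pow (2 * int k) * v_pow (- 2 * int k) = v_pow (- 2 * int k) * qnum (Suc k)"
    by (simp add: mult.commute)
  then show ?thesis
    by (simp add: mult.assoc flip: v_pow_add)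
qed

text \<open>The bar involution multiplies \<open>[k]\<close> by \<open>v_pow (- 2 * (k - 1))\<close>.\<close>

lemma bar_qfact: "bar (qfact k) = v_pow (- (int k * (int k - 1))) * qfact k"
proof (induction k)
  case (Suc k)
  have e: "- (int (Suc k) * (int (Suc k) - 1)) = - (int k * (int k - 1)) + - 2 * int k"
    by (simp add: algebra_simps)
  show ?case
    unfolding qfact_Suc bar_mult Suc bar_qnum e v_pow_add by (simp add: algebra_simps)
qed simp

lemma bar_qfact_c: "bar (qfact_c k) = u_pow (- 2 * int k) * v_pow (- 2 * (int k * (int k - 1))) * qfact_c k"
proof (induction k)
  case (Suc k)
  have e: "- 2 * (int (Suc k) * (int (Suc k) - 1)) = - 2 * (int k * (int k - 1)) + - 2 * int k + - 2 * int k"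
    by (simp add: algebra_simps)
  have e2: "- 2 * int (Suc k) = - 2 * int k + - 2" by simp
  have "bar (u_pow 2 * v_pow (2 * int k) + 1) = u_pow (- 2) * v_pow (- 2 * int k) * (u_pow 2 * v_pow (2 * int k) + 1)"
  proof -
    have "u_pow (- 2) * v_pow (- 2 * int k) * (u_pow 2 * v_pow (2 * int k))
       = (u_pow (- 2) * u_pow 2) * (v_pow (- 2 * int k) * v_pow (2 * int k))" by (simp only: ac_simps)
    also have "\<dots> = 1" by (simp flip: v_pow_add u_pow_add)
    finally show ?thesis by (simp add: bar_add bar_mult distrib_left)
  qed
  then show ?case
    unfolding qfact_c_Suc bar_mult Suc bar_qnum e e2 v_pow_add u_pow_add by (simp only: ac_simps)
qed simp

text \<open>The denominators of \<open>qbinom\<close> are cancelled once and for all; afterwards only products of factorials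
have to be compared.\<close>

lemma qbinom_eqI:
  assumes "q * qfact b * qfact a = qfact (a + b)"
  shows "qbinom (int (a + b)) b = q"
proof -
  define w where "w = v_pow 2 - 1"
  have num: "(\<Prod>i = 1..b. v_pow (2 * (int (a + b) - int i + 1)) - 1) * qfact a = w ^ b * qfact (a + b)"
  proof (induction b)
    case (Suc b)
    have "(\<Prod>i = 1..Suc b. v_pow (2 * (int (a + Suc b) - int i + 1)) - 1)
       = (v_pow (2 * (int (a + Suc b) - int 1 + 1)) - 1)
         * (\<Prod>i = Suc 1..Suc b. v_pow (2 * (int (a + Suc b) - int i + 1)) - 1)"
      by (rule prod.atLeast_Suc_atMost) simp
    also have "int (a + Suc b) - int 1 + 1 = int (a + Suc b)"
      by simp
    also have "(\<Prod>i = Suc 1..Suc b. v_pow (2 * (int (a + Suc b) - int i + 1)) - 1)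
       = (\<Prod>i = 1..b. v_pow (2 * (int (a + b) - int i + 1)) - 1)"
      by (subst prod.shift_bounds_cl_Suc_ivl) simp
    finally show ?case
      by (simp only: mult.assoc Suc)
         (simp only: qnum_times[symmetric] qfact_Suc add_Suc_right power_Suc w_def mult_ac)
  qed simp
  have den: "(\<Prod>i = 1..b. v_pow (2 * int i) - 1) = w ^ b * qfact b"
    unfolding qnum_times[symmetric] by (simp add: prod.distrib qfact_def qint_nat w_def mult.commute)
  have "w \<noteq> 0" using v_pow_2_minus_1 by (simp add: w_def)
  have "(q * (w ^ b * qfact b)) * qfact a = w ^ b * qfact (a + b)"
    by (simp add: algebra_simps flip: assms)
  also note num[symmetric]
  finally show ?thesis
    unfolding qbinom_def den using \<open>w \<noteq> 0\<close> by (intro exact_div_eqI) simp_all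
qed

section \<open>Signed permutations and their length\<close>

abbreviation winv :: "('a \<Rightarrow> 'b) \<Rightarrow> 'b \<Rightarrow> 'a" where
  "winv \<equiv> inv_into UNIV"

lemma weylI: "g permutes {- int d..int d} \<Longrightarrow> (\<And>i. g (- i) = - g i) \<Longrightarrow> g \<in> weyl d"
  by (simp add: weyl_def)

lemma weyl_odd: "g \<in> weyl d \<Longrightarrow> g (- i) = - g i"
  by (simp add: weyl_def)

lemma weyl_permutes: "g \<in> weyl d \<Longrightarrow> g permutes {- int d..int d}"
  by (simp add: weyl_def)

lemma weyl_zero: "g \<in> weyl d \<Longrightarrow> g 0 = 0"
  using weyl_odd[of g d 0] by simp

lemma weyl_bij: "g \<in> weyl d \<Longrightarrow> bij g"
  by (rule permutes_bij[OF weyl_permutes])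

lemma weyl_inj: "g \<in> weyl d \<Longrightarrow> inj g"
  by (rule bij_is_inj[OF weyl_bij])

lemma weyl_outside: "g \<in> weyl d \<Longrightarrow> int d < \<bar>z\<bar> \<Longrightarrow> g z = z"
  by (rule permutes_not_in[OF weyl_permutes]) auto

lemma weyl_range: "g \<in> weyl d \<Longrightarrow> \<bar>g z\<bar> \<le> int d \<longleftrightarrow> \<bar>z\<bar> \<le> int d"
  using permutes_in_image[OF weyl_permutes, of g d z] by (auto simp: abs_le_iff)

lemma weyl_image: "g \<in> weyl d \<Longrightarrow> g ` {- int d..int d} = {- int d..int d}"
  by (rule permutes_image[OF weyl_permutes])

lemma finite_weyl: "finite (weyl d)"
  by (rule finite_subset[OF _ finite_permutations[of "{- int d..int d}"]]) (auto simp: weyl_def)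

lemma weyl_comp: "g \<in> weyl d \<Longrightarrow> h \<in> weyl d \<Longrightarrow> g \<circ> h \<in> weyl d"
  by (auto simp: weyl_def permutes_compose)

lemma weyl_id: "id \<in> weyl d"
  by (auto simp: weyl_def permutes_id)

lemma weyl_inv: "g \<in> weyl d \<Longrightarrow> winv g \<in> weyl d"
proof (rule weylI)
  assume g: "g \<in> weyl d"
  show "winv g permutes {- int d..int d}"
    by (rule permutes_inv[OF weyl_permutes[OF g]])
  show "winv g (- i) = - winv g i" for i
    using weyl_odd[OF g, of "winv g i"] weyl_bij[OF g]
    by (metis bij_inv_eq_iff)
qed

lemma weyl_inv_comp: "g \<in> weyl d \<Longrightarrow> winv g \<circ> g = id" "g \<in> weyl d \<Longrightarrow> g \<circ> winv g = id"
  by (auto simp: weyl_inj permutes_inv_o[OF weyl_permutes])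

lemma gen_0_apply: "gen 0 z = (if z = 1 then - 1 else if z = - 1 then 1 else z)"
  by (auto simp: gen_def transpose_def)

lemma gen_apply: "i \<noteq> 0 \<Longrightarrow> gen i z = (if z = int i then int i + 1 else if z = int i + 1 then int i
   else if z = - int i then - int i - 1 else if z = - int i - 1 then - int i else z)"
  by (auto simp: gen_def transpose_def)

lemma gen_gen [simp]: "gen i (gen i z) = z"
  by (cases "i = 0") (auto simp: gen_0_apply gen_apply)

lemma gen_comp_gen: "gen i \<circ> gen i = id"
  by auto

lemma gen_odd: "gen i (- z) = - gen i z"
  by (cases "i = 0") (auto simp: gen_0_apply gen_apply)

lemma gen_zero [simp]: "gen i 0 = 0"
  by (cases "i = 0") (auto simp: gen_0_apply gen_apply)

lemma gen_eq_iff [simp]: "gen i x = gen i y \<longleftrightarrow> x = y"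
  by (metis gen_gen)

lemma gen_eq_0_iff [simp]: "gen i x = 0 \<longleftrightarrow> x = 0"
  using gen_eq_iff[of i x 0] by simp

lemma inj_gen: "inj_on (gen i) A"
  by (auto simp: inj_on_def)

lemma gen_bij: "bij (gen i)"
  by (rule o_bij[OF gen_comp_gen gen_comp_gen])

lemma gen_inv: "winv (gen i) = gen i"
  by (rule inv_unique_comp[OF gen_comp_gen gen_comp_gen])

lemma gen_weyl: "i < d \<Longrightarrow> gen i \<in> weyl d"
proof (rule weylI)
  assume i: "i < d"
  show "gen i permutes {- int d..int d}"
    unfolding permutes_def
  proof (intro conjI allI impI)
    fix z assume "z \<notin> {- int d..int d}"
    then show "gen i z = z"
      using i by (cases "i = 0") (auto simp: gen_0_apply gen_apply)
  next
    fix y show "\<exists>!x. gen i x = y"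
      by (metis gen_gen)
  qed
qed (rule gen_odd)

lemma gen_image_interval:
  assumes "i < d"
  shows "gen i ` ({- int d..int d} - {0}) = {- int d..int d} - {0}"
proof -
  have "gen i ` ({- int d..int d} - {0}) = gen i ` {- int d..int d} - gen i ` {0}"
    by (rule image_set_diff[OF inj_gen])
  then show ?thesis
    by (simp add: weyl_image[OF gen_weyl[OF assms]])
qed

text \<open>The only pairs of nonzero positions \<open>x < y\<close> whose order is reversed by the generator \<open>i\<close>.\<close>

definition adjacent :: "nat \<Rightarrow> int \<Rightarrow> int \<Rightarrow> bool" where
  "adjacent i x y \<longleftrightarrow> (if i = 0 then x = - 1 \<and> y = 1
     else x = int i \<and> y = int i + 1 \<or> x = - int i - 1 \<and> y = - int i)"

lemma exchange_less_iff:
  fixes j x y :: int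
  assumes "0 < j" "x \<noteq> 0" "y \<noteq> 0"
  shows "(if x = j then j + 1 else if x = j + 1 then j
      else if x = - j then - j - 1 else if x = - j - 1 then - j else x)
    < (if y = j then j + 1 else if y = j + 1 then j
      else if y = - j then - j - 1 else if y = - j - 1 then - j else y)
    \<longleftrightarrow> (x < y \<and> \<not> (x = j \<and> y = j + 1 \<or> x = - j - 1 \<and> y = - j))
      \<or> (y = j \<and> x = j + 1 \<or> y = - j - 1 \<and> x = - j)"
  using assms by (smt (verit))

text \<open>Positions are compared only away from \<open>0\<close>: the generator \<open>0\<close> exchanges \<open>-1\<close> and \<open>1\<close>, which are
neighbours only if \<open>0\<close> is left out.\<close>

lemma gen_less_iff:
  assumes "x \<noteq> 0" "y \<noteq> 0"
  shows "gen i x < gen i y \<longleftrightarrow> (x < y \<and> \<not> adjacent i x y) \<or> adjacent i y x"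
proof (cases "i = 0")
  case True
  then show ?thesis using assms by (simp add: gen_0_apply adjacent_def) (smt (verit))
next
  case False
  then have j: "0 < int i" by simp
  show ?thesis
    unfolding gen_apply[OF False] adjacent_def if_not_P[OF False]
    by (rule exchange_less_iff[OF j assms])
qed

lemma adjacent_less: "adjacent i x y \<Longrightarrow> x < y"
  by (auto simp: adjacent_def split: if_splits)

lemma of_bool_gen_less:
  assumes "x \<noteq> 0" "y \<noteq> 0"
  shows "of_bool (gen i x < gen i y) = (of_bool (x < y) - of_bool (adjacent i x y) + of_bool (adjacent i y x) :: int)"
  using adjacent_less[of i x y] adjacent_less[of i y x] by (auto simp: gen_less_iff[OF assms])

text \<open>For an odd function \<open>f\<close>, such as a signed permutation or the pattern of a coset, a strict ascent at
the generator \<open>i\<close>. For \<open>i = 0\<close> it compares \<open>f (-1) < f 1\<close>, that is, \<open>0 < f 1\<close>.\<close>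

definition ascent :: "(int \<Rightarrow> int) \<Rightarrow> nat \<Rightarrow> bool" where
  "ascent f i \<longleftrightarrow> (if i = 0 then 0 < f 1 else f (int i) < f (int i + 1))"

lemma ascent_adjacent:
  assumes "\<And>z. f (- z) = - f z" "adjacent i x y" "ascent f i"
  shows "f x < f y"
proof (cases "i = 0")
  case True
  then show ?thesis using assms(2,3) assms(1)[of 1] by (simp add: adjacent_def ascent_def)
next
  case False
  have "f (- int i - 1) = - f (int i + 1)" "f (- int i) = - f (int i)"
    using assms(1)[of "int i + 1"] assms(1)[of "int i"] by simp_all
  then show ?thesis using assms(2,3) False by (auto simp: adjacent_def ascent_def)
qed

lemma ascent_gen_not:
  assumes "w \<in> weyl d" "i < d"
  shows "ascent (w \<circ> gen i) i \<longleftrightarrow> \<not> ascent w i"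
proof -
  have "w 1 \<noteq> w 0" "w (int i) \<noteq> w (int i + 1)"
    by (simp_all add: inj_eq[OF weyl_inj[OF assms(1)]])
  then show ?thesis
    using weyl_zero[OF assms(1)] weyl_odd[OF assms(1), of 1] by (auto simp: ascent_def gen_0_apply gen_apply)
qed

text \<open>Twice the length, in a form that is easy to sum over: an inversion \<open>(x, y)\<close> with \<open>y \<noteq> -x\<close> occurs
together with \<open>(-y, -x)\<close>, and a self-paired inversion \<open>(-x, x)\<close> is counted a second time by the last
sum.\<close>

definition inversion_count :: "nat \<Rightarrow> (int \<Rightarrow> int) \<Rightarrow> int" where
  "inversion_count d w = (\<Sum>x \<in> {- int d..int d} - {0}. \<Sum>y \<in> {- int d..int d} - {0}. of_bool (x < y \<and> w y < w x))
     + (\<Sum>x = 1..int d. of_bool (w x < 0))"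

text \<open>Right multiplication by a generator permutes the positions and changes the order of the adjacent pairs
only. There are two such pairs if \<open>i > 0\<close>; if \<open>i = 0\<close> there is one, and the count of negative values
changes as well.\<close>

lemma inversion_count_gen:
  assumes w: "w \<in> weyl d" and i: "i < d"
  shows "inversion_count d (w \<circ> gen i) = inversion_count d w + (if ascent w i then 2 else - 2)"
proof -
  define N where "N = {- int d..int d} - {0}"
  have fin: "finite N" by (simp add: N_def)
  have img: "gen i ` N = N"
    unfolding N_def by (rule gen_image_interval[OF i])
  have ne: "w x \<noteq> w y" if "x \<noteq> y" for x y
    using that by (simp add: inj_eq[OF weyl_inj[OF w]])
  have re: "(\<Sum>x\<in>N. f (gen i x)) = sum f N" for f :: "int \<Rightarrow> int"
    using sum.reindex[OF inj_gen, of f i N] img by (simp add: o_def)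
  have "(\<Sum>x\<in>N. \<Sum>y\<in>N. of_bool (x < y \<and> (w \<circ> gen i) y < (w \<circ> gen i) x))
      = (\<Sum>x\<in>N. \<Sum>y\<in>N. of_bool (gen i (gen i x) < gen i (gen i y) \<and> w (gen i y) < w (gen i x)) :: int)"
    by simp
  also have "\<dots> = (\<Sum>x\<in>N. \<Sum>y\<in>N. of_bool (gen i x < gen i y \<and> w y < w x))"
    by (subst re[symmetric]) (rule sum.cong[OF refl], rule re)
  also have "\<dots> = (\<Sum>x\<in>N. \<Sum>y\<in>N. of_bool (x < y \<and> w y < w x)
      + (of_bool (adjacent i y x \<and> w y < w x) - of_bool (adjacent i x y \<and> w y < w x)))"
    by (intro sum.cong refl) (auto simp: gen_less_iff N_def dest: adjacent_less)
  also have "\<dots> = (\<Sum>x\<in>N. \<Sum>y\<in>N. of_bool (x < y \<and> w y < w x))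
      + ((\<Sum>x\<in>N. \<Sum>y\<in>N. of_bool (adjacent i y x \<and> w y < w x)) - (\<Sum>x\<in>N. \<Sum>y\<in>N. of_bool (adjacent i x y \<and> w y < w x)))"
    by (simp add: sum.distrib sum_subtractf)
  finally have 1: "(\<Sum>x\<in>N. \<Sum>y\<in>N. of_bool (x < y \<and> (w \<circ> gen i) y < (w \<circ> gen i) x)) = \<dots>" .
  have one: "(\<Sum>x\<in>N. \<Sum>y\<in>N. of_bool (x = a \<and> y = b \<and> P)) = (of_bool P :: int)" if "a \<in> N" "b \<in> N" for a b P
  proof -
    have "(\<Sum>y\<in>N. of_bool (x = a \<and> y = b \<and> P)) = (if x = a then of_bool P else 0 :: int)" for x
      using fin that by (cases "x = a"; cases P) (auto simp: of_bool_def)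
    then show ?thesis using fin that by simp
  qed
  show ?thesis
  proof (cases "i = 0")
    case True
    have m: "1 \<in> N" "- 1 \<in> N" using i by (auto simp: N_def)
    have a: "(\<Sum>x\<in>N. \<Sum>y\<in>N. of_bool (adjacent i y x \<and> w y < w x)) = (of_bool (w (- 1) < w 1) :: int)"
      by (rule trans[OF sum.cong[OF refl sum.cong[OF refl]] one[OF m]]) (auto simp: adjacent_def True)
    have b: "(\<Sum>x\<in>N. \<Sum>y\<in>N. of_bool (adjacent i x y \<and> w y < w x)) = (of_bool (w 1 < w (- 1)) :: int)"
      by (rule trans[OF sum.cong[OF refl sum.cong[OF refl]] one[OF m(2,1)]]) (auto simp: adjacent_def True)
    have s: "{1..int d} = insert 1 {2..int d}" using i by auto
    have "(\<Sum>x = 1..int d. of_bool ((w \<circ> gen i) x < 0)) - (\<Sum>x = 1..int d. of_bool (w x < 0))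
       = (of_bool (w (- 1) < 0) - of_bool (w 1 < 0) :: int)"
    proof -
      have "(\<Sum>x = 2..int d. of_bool ((w \<circ> gen i) x < 0)) = (\<Sum>x = 2..int d. of_bool (w x < 0) :: int)"
        by (intro sum.cong refl) (simp add: True gen_0_apply)
      moreover have "(w \<circ> gen i) 1 = w (- 1)"
        by (simp add: True gen_0_apply)
      ultimately show ?thesis unfolding s by (simp del: o_apply)
    qed
    then show ?thesis
      using 1 a b weyl_odd[OF w, of 1] ne[of 1 0] weyl_zero[OF w]
      unfolding inversion_count_def N_def[symmetric] by (auto simp: ascent_def True split: if_splits)
  next
    case False
    have m: "int i \<in> N" "int i + 1 \<in> N" "- int i - 1 \<in> N" "- int i \<in> N" using i False by (auto simp: N_def)
    have a: "(\<Sum>x\<in>N. \<Sum>y\<in>N. of_bool (adjacent i y x \<and> w y < w x))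
        = (of_bool (w (int i) < w (int i + 1)) + of_bool (w (- int i - 1) < w (- int i)) :: int)"
    proof -
      have "(\<Sum>x\<in>N. \<Sum>y\<in>N. of_bool (adjacent i y x \<and> w y < w x))
        = (\<Sum>x\<in>N. \<Sum>y\<in>N. of_bool (x = int i + 1 \<and> y = int i \<and> w (int i) < w (int i + 1))
            + (of_bool (x = - int i \<and> y = - int i - 1 \<and> w (- int i - 1) < w (- int i)) :: int))"
        using False by (intro sum.cong refl) (auto simp: adjacent_def)
      then show ?thesis by (simp only: sum.distrib one[OF m(2,1)] one[OF m(4,3)])
    qed
    have b: "(\<Sum>x\<in>N. \<Sum>y\<in>N. of_bool (adjacent i x y \<and> w y < w x))
        = (of_bool (w (int i + 1) < w (int i)) + of_bool (w (- int i) < w (- int i - 1)) :: int)"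
    proof -
      have "(\<Sum>x\<in>N. \<Sum>y\<in>N. of_bool (adjacent i x y \<and> w y < w x))
        = (\<Sum>x\<in>N. \<Sum>y\<in>N. of_bool (x = int i \<and> y = int i + 1 \<and> w (int i + 1) < w (int i))
            + (of_bool (x = - int i - 1 \<and> y = - int i \<and> w (- int i) < w (- int i - 1)) :: int))"
        using False by (intro sum.cong refl) (auto simp: adjacent_def)
      then show ?thesis by (simp only: sum.distrib one[OF m(1,2)] one[OF m(3,4)])
    qed
    have im: "gen i ` {1..int d} = {1..int d}"
    proof -
      have "gen i ` {1..int d} \<subseteq> {1..int d}"
        using i False by (auto simp: gen_apply)
      then show ?thesis
        by (intro endo_inj_surj) (auto simp: inj_gen)
    qed
    have "(\<Sum>x = 1..int d. of_bool ((w \<circ> gen i) x < 0)) = (\<Sum>x = 1..int d. of_bool (w x < 0) :: int)"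
      using sum.reindex[OF inj_gen, of "\<lambda>x. of_bool (w x < 0) :: int" i "{1..int d}"] im by (simp add: o_def)
    moreover have "w (- int i - 1) = - w (int i + 1)" "w (- int i) = - w (int i)"
      using weyl_odd[OF w, of "int i + 1"] weyl_odd[OF w, of "int i"] by simp_all
    ultimately show ?thesis
      using 1 a b ne[of "int i" "int i + 1"] False
      unfolding inversion_count_def N_def[symmetric] by (auto simp: ascent_def)
  qed
qed

lemma inversion_count_id: "inversion_count d id = 0"
  unfolding inversion_count_def by (auto intro!: sum.neutral)

lemma inversion_count_nonneg: "0 \<le> inversion_count d w"
  unfolding inversion_count_def by (intro add_nonneg_nonneg sum_nonneg) auto

text \<open>Ascents everywhere force \<open>w k \<ge> k\<close> for all \<open>k \<ge> 0\<close>, and a signed permutation of \<open>[-d, d]\<close> has no room to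
be larger.\<close>

lemma weyl_ascending_id:
  assumes w: "w \<in> weyl d" and a: "\<And>i. i < d \<Longrightarrow> ascent w i"
  shows "w = id"
proof -
  have le: "int k \<le> w (int k)" if "k \<le> d" for k
    using that
  proof (induction k)
    case (Suc k)
    then show ?case
      using a[of k] weyl_zero[OF w] by (cases "k = 0") (auto simp: ascent_def add.commute)
  qed (simp add: weyl_zero[OF w])
  have ge: "w (int d - int k) \<le> int d - int k" if "k \<le> d" for k
    using that
  proof (induction k)
    case 0
    show ?case using weyl_range[OF w, of "int d"] by auto
  next
    case (Suc k)
    show ?case
    proof (cases "Suc k = d")
      case True
      then show ?thesis using weyl_zero[OF w] by simp
    next
      case False
      then have "w (int (d - Suc k)) < w (int (d - Suc k) + 1)"
        using a[of "d - Suc k"] Suc by (auto simp: ascent_def split: if_splits)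
      then show ?thesis using Suc by (simp add: of_nat_diff)
    qed
  qed
  have eq: "w (int k) = int k" if "k \<le> d" for k
    using le[OF that] ge[of "d - k"] that by (simp add: of_nat_diff)
  show ?thesis
  proof
    fix z
    consider "int d < \<bar>z\<bar>" | "\<bar>z\<bar> \<le> int d" "0 \<le> z" | "\<bar>z\<bar> \<le> int d" "z < 0" by linarith
    then show "w z = id z"
    proof cases
      case 2
      then show ?thesis using eq[of "nat z"] by simp
    next
      case 3
      then show ?thesis using eq[of "nat (- z)"] weyl_odd[OF w, of "- z"] by simp
    qed (use weyl_outside[OF w] in simp)
  qed
qed

definition word :: "nat list \<Rightarrow> int \<Rightarrow> int" where
  "word is = foldr (\<lambda>i g. gen i \<circ> g) is id"

lemma word_Nil [simp]: "word [] = id" and word_Cons: "word (i # is) = gen i \<circ> word is"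
  by (simp_all add: word_def)

lemma word_append: "word (is @ js) = word is \<circ> word js"
  by (induction "is") (auto simp: word_Cons o_assoc)

lemma word_snoc: "word (is @ [i]) = word is \<circ> gen i"
  by (simp add: word_append word_Cons)

lemma bij_word: "bij (word is)"
  by (induction "is") (simp_all only: word_Nil bij_id word_Cons bij_comp gen_bij)

lemma word_rev: "word (rev is) = winv (word is)"
proof (induction "is")
  case (Cons i "is")
  show ?case
    unfolding rev.simps word_snoc word_Cons Cons o_inv_distrib[OF gen_bij bij_word] gen_inv ..
qed simp

lemma word_weyl: "set is \<subseteq> {..<d} \<Longrightarrow> word is \<in> weyl d"
  by (induction "is") (auto simp: word_Cons weyl_id intro!: weyl_comp gen_weyl)

lemma inversion_count_word: "set is \<subseteq> {..<d} \<Longrightarrow> inversion_count d (word is) \<le> 2 * int (length is)"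
proof (induction "is" rule: rev_induct)
  case (snoc i "is")
  have "inversion_count d (word (is @ [i])) \<le> inversion_count d (word is) + 2"
    unfolding word_snoc using snoc.prems inversion_count_gen[of "word is" d i] word_weyl[of "is" d] by simp
  then show ?case
    using snoc by simp
qed (simp add: inversion_count_id)

text \<open>As long as \<open>w\<close> has a descent, multiplying by the generator in question lowers the inversion count by
\<open>2\<close>; a signed permutation without descents is the identity.\<close>

lemma word_exists:
  assumes "w \<in> weyl d"
  shows "\<exists>is. set is \<subseteq> {..<d} \<and> w = word is \<and> inversion_count d w = 2 * int (length is)"
  using assms
proof (induction "nat (inversion_count d w)" arbitrary: w rule: less_induct)
  case less
  show ?case
  proof (cases "\<forall>i<d. ascent w i")
    case True
    then have "w = id" using weyl_ascending_id[OF less.prems] by blast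
    then show ?thesis by (intro exI[of _ "[]"]) (simp add: inversion_count_id)
  next
    case False
    then obtain i where i: "i < d" "\<not> ascent w i" by blast
    let ?w = "w \<circ> gen i"
    have w': "?w \<in> weyl d" using less.prems i by (simp add: weyl_comp gen_weyl)
    have J: "inversion_count d ?w = inversion_count d w - 2" using inversion_count_gen[OF less.prems i(1)] i by simp
    with inversion_count_nonneg[of d ?w] obtain "is" where
      "is": "set is \<subseteq> {..<d}" "?w = word is" "inversion_count d ?w = 2 * int (length is)"
      using less.hyps[OF _ w'] by fastforce
    have "w = ?w \<circ> gen i" by (simp add: o_assoc[symmetric] gen_comp_gen)
    then have "w = word (is @ [i])" using "is" by (simp add: word_snoc)
    then show ?thesis using "is" i J by (intro exI[of _ "is @ [i]"]) auto
  qed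
qed

lemma len_le: "set is \<subseteq> {..<d} \<Longrightarrow> len d (word is) \<le> length is"
  unfolding len_def by (rule Least_le) (auto simp: word_def)

lemma len_word:
  assumes "w \<in> weyl d"
  obtains "is" where "set is \<subseteq> {..<d}" "w = word is" "length is = len d w"
proof -
  have "\<exists>k is. length is = k \<and> set is \<subseteq> {..<d} \<and> w = foldr (\<lambda>i g. gen i \<circ> g) is id"
    using word_exists[OF assms] by (auto simp: word_def)
  then have "\<exists>is. length is = len d w \<and> set is \<subseteq> {..<d} \<and> w = foldr (\<lambda>i g. gen i \<circ> g) is id"
    unfolding len_def by (rule LeastI_ex)
  then show ?thesis using that by (auto simp: word_def)
qed

text \<open>A word cannot have more inversions than twice its number of letters, and some word attains this.\<close>

lemma inversion_count_len:
  assumes "w \<in> weyl d"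
  shows "inversion_count d w = 2 * int (len d w)"
proof -
  obtain "is" where 1: "set is \<subseteq> {..<d}" "w = word is" "inversion_count d w = 2 * int (length is)"
    using word_exists[OF assms] by blast
  obtain js where 2: "set js \<subseteq> {..<d}" "w = word js" "length js = len d w"
    using len_word[OF assms] .
  show ?thesis
    using len_le[OF 1(1)] inversion_count_word[OF 2(1)] 1 2 by simp
qed

lemma len_id [simp]: "len d id = 0"
  using len_le[of "[]" d] by simp

lemma len_inv:
  assumes "w \<in> weyl d"
  shows "len d (winv w) = len d w"
proof -
  have *: "len d (winv w) \<le> len d w" if w: "w \<in> weyl d" for w
  proof -
    obtain js where 2: "set js \<subseteq> {..<d}" "w = word js" "length js = len d w"
      using len_word[OF w] .
    then show ?thesis using len_le[of "rev js" d] by (simp add: word_rev)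
  qed
  show ?thesis
    using *[OF assms] *[OF weyl_inv[OF assms]] by (simp add: inv_inv_eq weyl_bij[OF assms])
qed

lemma len_gen_right:
  assumes "w \<in> weyl d" "i < d"
  shows "ascent w i \<Longrightarrow> len d (w \<circ> gen i) = Suc (len d w)"
    and "\<not> ascent w i \<Longrightarrow> len d w = Suc (len d (w \<circ> gen i))"
  using inversion_count_gen[OF assms] inversion_count_len[OF assms(1)] inversion_count_len[OF weyl_comp[OF assms(1) gen_weyl[OF assms(2)]]]
  by (auto split: if_splits)

lemma len_gen_left:
  assumes "w \<in> weyl d" "i < d"
  shows "ascent (winv w) i \<Longrightarrow> len d (gen i \<circ> w) = Suc (len d w)"
    and "\<not> ascent (winv w) i \<Longrightarrow> len d w = Suc (len d (gen i \<circ> w))"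
proof -
  have "winv (gen i \<circ> w) = winv w \<circ> gen i"
    by (simp add: o_inv_distrib gen_bij gen_inv weyl_bij[OF assms(1)])
  then have e: "len d (gen i \<circ> w) = len d (winv w \<circ> gen i)"
    using len_inv[OF weyl_comp[OF gen_weyl[OF assms(2)] assms(1)]] by simp
  show "ascent (winv w) i \<Longrightarrow> len d (gen i \<circ> w) = Suc (len d w)"
    and "\<not> ascent (winv w) i \<Longrightarrow> len d w = Suc (len d (gen i \<circ> w))"
    unfolding e using len_gen_right[OF weyl_inv[OF assms(1)] assms(2)] len_inv[OF assms(1)] by auto
qed

lemma len_gen: "i < d \<Longrightarrow> len d (gen i) = 1"
  using len_gen_right(1)[OF weyl_id, of i d] by (auto simp: ascent_def)

section \<open>Generating functions of subsets\<close>

definition crossings :: "int set \<Rightarrow> int set \<Rightarrow> int" where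
  "crossings A B = (\<Sum>a\<in>A. \<Sum>b\<in>B. of_bool (b < a))"

text \<open>The weight enumerator of \<open>k\<close>-subsets by crossings with their complement, which is the Gaussian
binomial coefficient in \<open>v\<^sup>2\<close>.\<close>

definition gauss :: "int set \<Rightarrow> nat \<Rightarrow> laurent" where
  "gauss Y k = (\<Sum>X | X \<subseteq> Y \<and> card X = k. v_pow (2 * crossings X (Y - X)))"

lemma subsets_insert_card:
  assumes "finite Y" "r \<notin> Y"
  shows "{X. X \<subseteq> insert r Y \<and> card X = Suc k}
    = {X. X \<subseteq> Y \<and> card X = Suc k} \<union> insert r ` {X. X \<subseteq> Y \<and> card X = k}"
proof (intro Set.set_eqI iffI)
  fix X assume X: "X \<in> {X. X \<subseteq> insert r Y \<and> card X = Suc k}"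
  show "X \<in> {X. X \<subseteq> Y \<and> card X = Suc k} \<union> insert r ` {X. X \<subseteq> Y \<and> card X = k}"
  proof (cases "r \<in> X")
    case True
    then have "X = insert r (X - {r})" "X - {r} \<subseteq> Y" "card (X - {r}) = k"
      using X by auto
    then show ?thesis by blast
  qed (use X in auto)
next
  fix X assume X: "X \<in> {X. X \<subseteq> Y \<and> card X = Suc k} \<union> insert r ` {X. X \<subseteq> Y \<and> card X = k}"
  then show "X \<in> {X. X \<subseteq> insert r Y \<and> card X = Suc k}"
    using assms by (auto simp: card_insert_if finite_subset subset_iff)
qed

lemma gauss_0: "finite Y \<Longrightarrow> gauss Y 0 = 1"
proof -
  assume "finite Y"
  then have "{X. X \<subseteq> Y \<and> card X = 0} = {{}}"
    by (auto dest: finite_subset)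
  then show ?thesis by (simp add: gauss_def crossings_def)
qed

lemma gauss_large: "finite Y \<Longrightarrow> card Y < k \<Longrightarrow> gauss Y k = 0"
proof -
  assume "finite Y" "card Y < k"
  then have "{X. X \<subseteq> Y \<and> card X = k} = {}"
    by (auto dest: card_mono)
  then show ?thesis unfolding gauss_def by (simp only: sum.empty)
qed

text \<open>The \<open>q\<close>-Pascal rule: if the largest element is chosen, it crosses all elements that are not.\<close>

lemma gauss_insert_max:
  assumes "finite Y" "\<forall>y\<in>Y. y < r"
  shows "gauss (insert r Y) (Suc k) = gauss Y (Suc k) + v_pow (2 * (int (card Y) - int k)) * gauss Y k"
proof -
  have r: "r \<notin> Y" using assms by auto
  have fin: "finite {X. X \<subseteq> Y \<and> card X = k}" for k
    using assms(1) by simp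
  have inj: "inj_on (insert r) {X. X \<subseteq> Y \<and> card X = k}"
    using r by (auto simp: inj_on_def)
  have "gauss (insert r Y) (Suc k) = (\<Sum>X | X \<subseteq> Y \<and> card X = Suc k. v_pow (2 * crossings X (insert r Y - X)))
     + (\<Sum>X | X \<subseteq> Y \<and> card X = k. v_pow (2 * crossings (insert r X) (insert r Y - insert r X)))"
    unfolding gauss_def subsets_insert_card[OF assms(1) r] using r
    by (subst sum.union_disjoint) (auto simp: fin inj sum.reindex)
  also have "(\<Sum>X | X \<subseteq> Y \<and> card X = Suc k. v_pow (2 * crossings X (insert r Y - X))) = gauss Y (Suc k)"
    unfolding gauss_def
  proof (rule sum.cong[OF refl])
    fix X assume X: "X \<in> {X. X \<subseteq> Y \<and> card X = Suc k}"
    then have e: "insert r Y - X = insert r (Y - X)" using r by auto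
    have "r \<notin> Y - X" "finite (Y - X)" using r assms by auto
    moreover have "\<not> r < x" if "x \<in> X" for x using that X assms(2) by force
    ultimately have E: "(\<Sum>b\<in>insert r (Y - X). of_bool (b < x)) = (\<Sum>b\<in>Y - X. of_bool (b < x) :: int)" if "x \<in> X" for x
      using that by simp
    have "crossings X (insert r Y - X) = crossings X (Y - X)"
      unfolding crossings_def e by (rule sum.cong[OF refl E])
    then show "v_pow (2 * crossings X (insert r Y - X)) = v_pow (2 * crossings X (Y - X))" by simp
  qed
  also have "(\<Sum>X | X \<subseteq> Y \<and> card X = k. v_pow (2 * crossings (insert r X) (insert r Y - insert r X)))
     = v_pow (2 * (int (card Y) - int k)) * gauss Y k"
    unfolding gauss_def sum_distrib_left
  proof (rule sum.cong[OF refl])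
    fix X assume X: "X \<in> {X. X \<subseteq> Y \<and> card X = k}"
    then have e: "insert r Y - insert r X = Y - X" using r by auto
    have fX: "finite X" "r \<notin> X" using X assms r by (auto dest: finite_subset)
    have "(\<Sum>b\<in>Y - X. of_bool (b < r)) = (\<Sum>b\<in>Y - X. 1 :: int)"
      using assms(2) by (intro sum.cong) auto
    also have "\<dots> = int (card Y) - int k"
      using X card_mono[OF assms(1), of X] by (simp add: card_Diff_subset fX of_nat_diff)
    finally have "crossings (insert r X) (insert r Y - insert r X) = (int (card Y) - int k) + crossings X (Y - X)"
      unfolding e crossings_def using fX by simp
    then show "v_pow (2 * crossings (insert r X) (insert r Y - insert r X))
       = v_pow (2 * (int (card Y) - int k)) * v_pow (2 * crossings X (Y - X))"
      by (simp add: distrib_left v_pow_add)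
  qed
  finally show ?thesis .
qed

lemma gauss_qfact:
  assumes "finite Y"
  shows "a + k = card Y \<Longrightarrow> gauss Y k * qfact k * qfact a = qfact (card Y)"
  using assms
proof (induction Y arbitrary: a k rule: finite_linorder_max_induct)
  case empty
  then show ?case by (simp add: gauss_0)
next
  case (insert r Y)
  have card: "card (insert r Y) = Suc (card Y)" using insert by auto
  show ?case
  proof (cases k)
    case 0
    then show ?thesis using insert by (simp add: gauss_0)
  next
    case (Suc j)
    have aj: "a + j = card Y" using insert.prems card Suc by simp
    have 1: "gauss Y (Suc j) * qfact (Suc j) * qfact a = qnum a * qfact (card Y)"
    proof (cases a)
      case 0
      then show ?thesis using aj by (simp add: gauss_large insert.hyps)
    next
      case (Suc a')
      then show ?thesis using insert.IH[of a' "Suc j"] aj by (simp add: qfact_Suc[of a'] mult_ac)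
    qed
    have 2: "gauss Y j * qfact j * qfact a = qfact (card Y)"
      using insert.IH aj by simp
    have e: "int (card Y) - int j = int a" using aj by linarith
    have "gauss (insert r Y) k * qfact k * qfact a
       = gauss Y (Suc j) * qfact (Suc j) * qfact a + v_pow (2 * int a) * qnum (Suc j) * (gauss Y j * qfact j * qfact a)"
      unfolding Suc gauss_insert_max[OF insert.hyps(1,2)] e by (simp add: qfact_Suc algebra_simps)
    also have "\<dots> = (qnum a + v_pow (2 * int a) * qnum (Suc j)) * qfact (card Y)"
      unfolding 1 2 by (simp add: algebra_simps)
    also have "\<dots> = qfact (card (insert r Y))"
      unfolding card using qnum_add[of a "Suc j"] aj by (simp add: qfact_Suc)
    finally show ?thesis .
  qed
qed

text \<open>Replacing a subset by its complement exchanges the two possible directions of counting crossings;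
the two directions belong to moving units down and up.\<close>

lemma gauss_complement:
  assumes "finite Y" "a + k = card Y"
  shows "(\<Sum>X | X \<subseteq> Y \<and> card X = k. v_pow (2 * crossings (Y - X) X)) = gauss Y a"
  unfolding gauss_def using assms
  by (intro sum.reindex_bij_witness[of _ "\<lambda>X. Y - X" "\<lambda>X. Y - X"])
     (auto simp: double_diff card_Diff_subset finite_subset card_mono)

lemma gauss_complement_qfact:
  assumes "finite Y" "a + k = card Y"
  shows "(\<Sum>X | X \<subseteq> Y \<and> card X = k. v_pow (2 * crossings (Y - X) X)) * qfact k * qfact a = qfact (card Y)"
  unfolding gauss_complement[OF assms] using gauss_qfact[of Y k a] assms by (simp add: mult_ac add.commute)

text \<open>The weights below are local to the blocks of a composition apart from a constant factor; therefore
the structure coefficients factor into one contribution for each block.\<close>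

lemma sum_subsets_partition:
  fixes g :: "'i \<Rightarrow> 'a set \<Rightarrow> 'c::comm_semiring_1"
  assumes "finite I" "\<And>i. i \<in> I \<Longrightarrow> finite (Y i)"
    and "\<And>i j. i \<in> I \<Longrightarrow> j \<in> I \<Longrightarrow> i \<noteq> j \<Longrightarrow> Y i \<inter> Y j = {}"
  shows "(\<Sum>X | X \<subseteq> (\<Union>i\<in>I. Y i) \<and> (\<forall>i\<in>I. P i (X \<inter> Y i)). \<Prod>i\<in>I. g i (X \<inter> Y i))
       = (\<Prod>i\<in>I. \<Sum>X | X \<subseteq> Y i \<and> P i X. g i X)"
  using assms
proof (induction I rule: finite_induct)
  case empty
  then show ?case by simp
next
  case (insert m I)
  define U where "U = (\<Union>i\<in>I. Y i)"
  have disj: "Y m \<inter> U = {}" using insert.prems(2) insert.hyps(2) by (fastforce simp: U_def)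
  have sub: "Y i \<subseteq> U" "Y i \<inter> Y m = {}" if "i \<in> I" for i
    using that insert.prems(2)[of i m] insert.hyps(2) by (auto simp: U_def)
  have IH: "(\<Sum>X | X \<subseteq> U \<and> (\<forall>i\<in>I. P i (X \<inter> Y i)). \<Prod>i\<in>I. g i (X \<inter> Y i))
     = (\<Prod>i\<in>I. \<Sum>X | X \<subseteq> Y i \<and> P i X. g i X)"
    unfolding U_def by (rule insert.IH) (use insert.prems in auto)
  have local: "(X1 \<union> X2) \<inter> Y i = X2 \<inter> Y i" if "X1 \<subseteq> Y m" "i \<in> I" for X1 X2 i
    using that(1) sub[OF that(2)] by blast
  have local': "X \<inter> U \<inter> Y i = X \<inter> Y i" if "i \<in> I" for X i
    using sub(1)[OF that] by blast
  have top: "(X1 \<union> X2) \<inter> Y m = X1" "(X1 \<union> X2) \<inter> U = X2" if "X1 \<subseteq> Y m" "X2 \<subseteq> U" for X1 X2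
    using that disj by auto
  have "(\<Prod>i\<in>insert m I. \<Sum>X | X \<subseteq> Y i \<and> P i X. g i X)
     = (\<Sum>X1 | X1 \<subseteq> Y m \<and> P m X1. g m X1) * (\<Sum>X2 | X2 \<subseteq> U \<and> (\<forall>i\<in>I. P i (X2 \<inter> Y i)). \<Prod>i\<in>I. g i (X2 \<inter> Y i))"
    using insert.hyps by (simp add: IH)
  also have "\<dots> = (\<Sum>(X1, X2) \<in> {X1. X1 \<subseteq> Y m \<and> P m X1} \<times> {X2. X2 \<subseteq> U \<and> (\<forall>i\<in>I. P i (X2 \<inter> Y i))}.
      g m X1 * (\<Prod>i\<in>I. g i (X2 \<inter> Y i)))"
    by (simp add: sum_product sum.cartesian_product)
  also have "\<dots> = (\<Sum>X | X \<subseteq> (\<Union>i\<in>insert m I. Y i) \<and> (\<forall>i\<in>insert m I. P i (X \<inter> Y i)).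
      \<Prod>i\<in>insert m I. g i (X \<inter> Y i))"
  proof (rule sum.reindex_bij_witness[of _ "\<lambda>X. (X \<inter> Y m, X \<inter> U)" "\<lambda>(X1, X2). X1 \<union> X2"])
    fix p assume p: "p \<in> {X1. X1 \<subseteq> Y m \<and> P m X1} \<times> {X2. X2 \<subseteq> U \<and> (\<forall>i\<in>I. P i (X2 \<inter> Y i))}"
    obtain X1 X2 where pp: "p = (X1, X2)" by (cases p)
    have sb: "X1 \<subseteq> Y m" "X2 \<subseteq> U" using p pp by auto
    show "(case p of (X1, X2) \<Rightarrow> X1 \<union> X2) \<in> {X. X \<subseteq> (\<Union>i\<in>insert m I. Y i) \<and> (\<forall>i\<in>insert m I. P i (X \<inter> Y i))}"
      using p pp sb top[OF sb] local[OF sb(1)] by (auto simp: U_def)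
    show "((case p of (X1, X2) \<Rightarrow> X1 \<union> X2) \<inter> Y m, (case p of (X1, X2) \<Rightarrow> X1 \<union> X2) \<inter> U) = p"
      using pp top[OF sb] by simp
    show "(\<Prod>i\<in>insert m I. g i ((case p of (X1, X2) \<Rightarrow> X1 \<union> X2) \<inter> Y i))
      = (case p of (X1, X2) \<Rightarrow> g m X1 * (\<Prod>i\<in>I. g i (X2 \<inter> Y i)))"
      using pp top[OF sb] local[OF sb(1)] insert.hyps by simp
  next
    fix X assume X: "X \<in> {X. X \<subseteq> (\<Union>i\<in>insert m I. Y i) \<and> (\<forall>i\<in>insert m I. P i (X \<inter> Y i))}"
    then have "X \<subseteq> Y m \<union> U" by (auto simp: U_def)
    then show "(case (X \<inter> Y m, X \<inter> U) of (X1, X2) \<Rightarrow> X1 \<union> X2) = X" by auto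
    show "(X \<inter> Y m, X \<inter> U) \<in> {X1. X1 \<subseteq> Y m \<and> P m X1} \<times> {X2. X2 \<subseteq> U \<and> (\<forall>i\<in>I. P i (X2 \<inter> Y i))}"
      using X local' by auto
  qed
  finally show ?case by simp
qed

text \<open>Choices of some elements of \<open>S\<close>, each with a sign. They describe which positions in a block that is
symmetric about \<open>0\<close> have their letter changed.\<close>

definition signed :: "int set \<Rightarrow> int set set" where
  "signed S = {X. X \<subseteq> S \<union> uminus ` S \<and> X \<inter> uminus ` X = {}}"

definition neg_count :: "int set \<Rightarrow> int" where
  "neg_count X = (\<Sum>x\<in>X. of_bool (x < 0))"

definition neg_pairs :: "int set \<Rightarrow> int" where
  "neg_pairs X = (\<Sum>x\<in>X. \<Sum>y\<in>X. of_bool (x < y \<and> x + y < 0))"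

definition unused :: "int set \<Rightarrow> int set \<Rightarrow> int set" where
  "unused S X = S \<union> uminus ` S - X - uminus ` X"

text \<open>The type B analogue of the Gaussian binomial coefficient. The weight is that of a relabelling in the
middle block, where \<open>unused S X\<close> are the positions whose letter remains \<open>0\<close>.\<close>

definition gauss_B :: "int set \<Rightarrow> nat \<Rightarrow> laurent" where
  "gauss_B S k = (\<Sum>X | X \<in> signed S \<and> card X = k. u_pow (2 * neg_count X) * v_pow (2 * (crossings (unused S X) X + neg_pairs X)))"

lemma finite_signed: "finite S \<Longrightarrow> finite (signed S)"
  by (rule finite_subset[of _ "Pow (S \<union> uminus ` S)"]) (auto simp: signed_def)

lemma signed_finite: "finite S \<Longrightarrow> X \<in> signed S \<Longrightarrow> finite X"
  by (auto simp: signed_def intro: finite_subset)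

lemma signed_abs:
  assumes "\<forall>x\<in>S. 0 < x" "X \<in> signed S" "x \<in> X"
  shows "\<bar>x\<bar> \<in> S"
proof -
  have "x \<in> S \<or> - x \<in> S" using assms(2,3) by (force simp: signed_def)
  then show ?thesis
  proof
    assume "x \<in> S" then show ?thesis using assms(1) by force
  next
    assume "- x \<in> S" then show ?thesis using assms(1) by force
  qed
qed

lemma unused_abs:
  assumes "\<forall>x\<in>S. 0 < x" "z \<in> unused S X"
  shows "\<bar>z\<bar> \<in> S"
proof -
  have "z \<in> S \<or> - z \<in> S" using assms(2) by (force simp: unused_def)
  then show ?thesis
  proof
    assume "z \<in> S" then show ?thesis using assms(1) by force
  next
    assume "- z \<in> S" then show ?thesis using assms(1) by force
  qed
qed

lemma gauss_B_0: "finite S \<Longrightarrow> gauss_B S 0 = 1"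
proof -
  assume "finite S"
  then have "{X. X \<in> signed S \<and> card X = 0} = {{}}"
    by (auto simp: signed_finite) (simp add: signed_def)
  then show ?thesis by (simp add: gauss_B_def crossings_def neg_count_def neg_pairs_def)
qed

lemma card_unused:
  assumes "finite S" "\<forall>x\<in>S. 0 < x" "X \<in> signed S"
  shows "int (card (unused S X)) = 2 * int (card S) - 2 * int (card X)"
proof -
  have "card (unused S X) = card (S \<union> uminus ` S) - card (X \<union> uminus ` X)"
    unfolding unused_def Diff_Diff_Int[symmetric] using assms
    by (subst card_Diff_subset[symmetric]) (auto simp: signed_def signed_finite Diff_eq Int_assoc)
  moreover have "card (X \<union> uminus ` X) \<le> card (S \<union> uminus ` S)"
    using assms by (intro card_mono) (auto simp: signed_def)
  moreover have "card (S \<union> uminus ` S) = 2 * card S"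
  proof -
    have "S \<inter> uminus ` S = {}"
    proof (rule ccontr)
      assume "S \<inter> uminus ` S \<noteq> {}"
      then obtain x where "x \<in> S" "- x \<in> S" by auto
      then have "0 < x" "0 < - x" using assms(2) by blast+
      then show False by simp
    qed
    moreover have "card (uminus ` S) = card S" by (rule card_image) simp
    ultimately show ?thesis using assms(1) by (simp add: card_Un_disjoint)
  qed
  moreover have "card (X \<union> uminus ` X) = 2 * card X"
  proof -
    have "X \<inter> uminus ` X = {}" using assms(3) by (simp add: signed_def)
    moreover have "card (uminus ` X) = card X" by (rule card_image) simp
    ultimately show ?thesis using signed_finite[OF assms(1,3)] by (simp add: card_Un_disjoint)
  qed
  ultimately show ?thesis by simp
qed

lemma signed_card_le:
  assumes "finite S" "\<forall>x\<in>S. 0 < x" "X \<in> signed S"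
  shows "card X \<le> card S"
  using card_unused[OF assms] by linarith

lemma signed_insert:
  assumes "finite S" "\<forall>x\<in>S. 0 < x \<and> x < r" "0 < r"
  shows "{X. X \<in> signed (insert r S) \<and> card X = Suc k} = {X. X \<in> signed S \<and> card X = Suc k}
     \<union> insert r ` {X. X \<in> signed S \<and> card X = k} \<union> insert (- r) ` {X. X \<in> signed S \<and> card X = k}"
    (is "?L = ?A \<union> ?B \<union> ?C")
proof (intro Set.set_eqI iffI)
  fix X assume X: "X \<in> ?L"
  then have fin: "finite X" using card.infinite by force
  show "X \<in> ?A \<union> ?B \<union> ?C"
  proof (cases "r \<in> X \<or> - r \<in> X")
    case True
    then consider "r \<in> X" "- r \<notin> X" | "- r \<in> X" "r \<notin> X"
      using X by (auto simp: signed_def)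
    then show ?thesis
    proof cases
      case 1
      then have "X - {r} \<in> signed S" "card (X - {r}) = k" "X = insert r (X - {r})"
        using X by (auto simp: signed_def)
      then show ?thesis by blast
    next
      case 2
      then have "X - {- r} \<in> signed S" "card (X - {- r}) = k" "X = insert (- r) (X - {- r})"
        using X by (auto simp: signed_def)
      then show ?thesis by blast
    qed
  qed (use X in \<open>auto simp: signed_def\<close>)
next
  fix X assume X: "X \<in> ?A \<union> ?B \<union> ?C"
  have *: "insert r Y \<in> ?L" "insert (- r) Y \<in> ?L" if "Y \<in> signed S" "card Y = k" for Y
  proof -
    have "\<forall>x\<in>S. 0 < x" "r \<notin> S" using assms by auto
    then have "r \<notin> Y" "- r \<notin> Y" "finite Y"
      using signed_abs[of S Y r] signed_abs[of S Y "- r"] that(1) assms(3) signed_finite[OF assms(1) that(1)] by auto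
    moreover from this have "r \<notin> uminus ` Y" "- r \<notin> uminus ` Y"
      by (auto simp: image_iff)
    ultimately show "insert r Y \<in> ?L" "insert (- r) Y \<in> ?L"
      using that assms(3) by (auto simp: signed_def)
  qed
  have "X \<in> ?L" if "X \<in> ?A"
  proof -
    have "X \<subseteq> insert r S \<union> uminus ` insert r S" "X \<inter> uminus ` X = {}" "card X = Suc k"
      using that unfolding signed_def by blast+
    then show ?thesis unfolding signed_def by blast
  qed
  then show "X \<in> ?L"
    using X * by blast
qed

text \<open>The largest position \<open>r\<close> is left out, chosen with a positive sign, or chosen with a negative sign. In
the first case \<open>r\<close> and \<open>-r\<close> remain in the middle, and of these \<open>r\<close> crosses every chosen element; in the
last case \<open>-r\<close> is crossed by all remaining elements and pairs negatively with every chosen one.\<close>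

lemma gauss_B_insert_max:
  assumes "finite S" "\<forall>x\<in>S. 0 < x \<and> x < r" "0 < r"
  shows "gauss_B (insert r S) (Suc k) = v_pow (2 * int (Suc k)) * gauss_B S (Suc k)
     + (1 + u_pow 2 * v_pow (2 * (2 * int (card S) - int k))) * gauss_B S k"
proof -
  define w where "w S X = u_pow (2 * neg_count X) * v_pow (2 * (crossings (unused S X) X + neg_pairs X))" for S X
  \<comment> \<open>The three classes of choices: without \<open>r\<close>, with \<open>r\<close>, and with \<open>- r\<close>.\<close>
  define A B C where "A = {X. X \<in> signed S \<and> card X = Suc k}"
    and "B = insert r ` {X. X \<in> signed S \<and> card X = k}"
    and "C = insert (- r) ` {X. X \<in> signed S \<and> card X = k}"
  have bd: "\<bar>x\<bar> < r" if "X \<in> signed S" "x \<in> X" for X x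
    using signed_abs[OF _ that] assms(2) by auto
  have nin: "r \<notin> X" "- r \<notin> X" if "X \<in> signed S" for X
    using bd[OF that, of r] bd[OF that, of "- r"] by auto
  have fX: "finite X" if "X \<in> signed S" for X
    using signed_finite[OF assms(1) that] .
  have fu: "finite (unused S X)" "r \<notin> unused S X" "- r \<notin> unused S X" for X
    using assms by (auto simp: unused_def)
  have fin: "finite A" "finite B" "finite C"
    using finite_signed[OF assms(1)] by (auto simp: A_def B_def C_def)
  have disj: "A \<inter> B = {}" "(A \<union> B) \<inter> C = {}"
  proof -
    have "\<forall>X\<in>A. r \<notin> X \<and> - r \<notin> X" "\<forall>X\<in>B. r \<in> X"
      using nin by (auto simp: A_def B_def)
    moreover have "\<forall>X\<in>C. r \<notin> X \<and> - r \<in> X"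
      using nin assms(3) by (auto simp: C_def)
    ultimately show "A \<inter> B = {}" "(A \<union> B) \<inter> C = {}" by blast+
  qed
  have inj: "inj_on (insert s) {X. X \<in> signed S \<and> card X = k}" if "s = r \<or> s = - r" for s
  proof (rule inj_onI)
    fix X Y assume "X \<in> {X. X \<in> signed S \<and> card X = k}" "Y \<in> {X. X \<in> signed S \<and> card X = k}" "insert s X = insert s Y"
    then show "X = Y" using nin that insert_ident[of s X Y] by blast
  qed
  have "gauss_B (insert r S) (Suc k) = sum (w (insert r S)) (A \<union> B \<union> C)"
    unfolding gauss_B_def signed_insert[OF assms] A_def B_def C_def by (rule sum.cong[OF refl]) (simp only: w_def)
  also have "\<dots> = sum (w (insert r S)) A + sum (w (insert r S)) B + sum (w (insert r S)) C"
    using fin disj by (simp add: sum.union_disjoint)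
  also have "sum (w (insert r S)) A = v_pow (2 * int (Suc k)) * gauss_B S (Suc k)"
    unfolding gauss_B_def A_def sum_distrib_left
  proof (rule sum.cong[OF refl])
    fix X assume X: "X \<in> {X. X \<in> signed S \<and> card X = Suc k}"
    have u: "unused (insert r S) X = insert r (insert (- r) (unused S X))"
      using X nin[of X] by (auto simp: unused_def)
    have "(\<Sum>b\<in>X. of_bool (b < r)) = (\<Sum>b\<in>X. 1 :: int)"
      using X bd[of X] by (intro sum.cong) force+
    moreover have "(\<Sum>b\<in>X. of_bool (b < - r)) = (\<Sum>b\<in>X. 0 :: int)"
      using X bd[of X] by (intro sum.cong) force+
    ultimately have "crossings (unused (insert r S) X) X = int (Suc k) + crossings (unused S X) X"
      unfolding u crossings_def using fu X assms(3) by simp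
    then show "w (insert r S) X = v_pow (2 * int (Suc k)) * (u_pow (2 * neg_count X) * v_pow (2 * (crossings (unused S X) X + neg_pairs X)))"
      by (simp add: w_def distrib_left v_pow_add mult_ac)
  qed
  also have "sum (w (insert r S)) B = gauss_B S k"
    unfolding gauss_B_def B_def sum.reindex[OF inj[OF disjI1[OF refl]]] o_def
  proof (rule sum.cong[OF refl])
    fix X assume X: "X \<in> {X. X \<in> signed S \<and> card X = k}"
    then have n: "r \<notin> X" "- r \<notin> X" "finite X" using nin fX by auto
    have u: "unused (insert r S) (insert r X) = unused S X"
      using n fu[of X] assms by (auto simp: unused_def)
    have lt: "\<not> r < z" if "z \<in> unused S X" for z
      using unused_abs[OF _ that] assms(2) by fastforce
    have "crossings (unused S X) (insert r X) = crossings (unused S X) X"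
      unfolding crossings_def using n lt by (intro sum.cong[OF refl]) simp
    moreover have "neg_count (insert r X) = neg_count X"
      using n assms(3) by (simp add: neg_count_def)
    moreover have "neg_pairs (insert r X) = neg_pairs X"
    proof -
      have a: "\<not> r < y" "\<not> (y < r \<and> y + r < 0)" if "y \<in> X" for y
        using bd[of X y] that X by auto
      have z1: "(\<Sum>y\<in>X. of_bool (r < y \<and> r + y < 0)) = (0 :: int)"
        by (intro sum.neutral ballI) (simp add: a)
      have z2: "of_bool (y < r \<and> y + r < 0) = (0 :: int)" if "y \<in> X" for y
        using a(2)[OF that] by simp
      show ?thesis
        unfolding neg_pairs_def using n z1 z2 by simp
    qed
    ultimately show "w (insert r S) (insert r X) = u_pow (2 * neg_count X) * v_pow (2 * (crossings (unused S X) X + neg_pairs X))"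
      unfolding w_def u by simp
  qed
  also have "sum (w (insert r S)) C = u_pow 2 * v_pow (2 * (2 * int (card S) - int k)) * gauss_B S k"
    unfolding gauss_B_def C_def sum.reindex[OF inj[OF disjI2[OF refl]]] o_def sum_distrib_left
  proof (rule sum.cong[OF refl])
    fix X assume X: "X \<in> {X. X \<in> signed S \<and> card X = k}"
    then have n: "r \<notin> X" "- r \<notin> X" "finite X" using nin fX by auto
    have u: "unused (insert r S) (insert (- r) X) = unused S X"
      using n fu[of X] assms by (auto simp: unused_def)
    have lt: "- r < z" if "z \<in> unused S X" for z
      using unused_abs[OF _ that] assms(2) by fastforce
    have "crossings (unused S X) (insert (- r) X) = (\<Sum>z\<in>unused S X. 1 + (\<Sum>x\<in>X. of_bool (x < z)))"
      unfolding crossings_def using n lt by (intro sum.cong) auto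
    also have "\<dots> = int (card (unused S X)) + crossings (unused S X) X"
      by (simp add: sum.distrib crossings_def)
    finally have 1: "crossings (unused S X) (insert (- r) X) = 2 * int (card S) - 2 * int k + crossings (unused S X) X"
      using card_unused[of S X] assms X by auto
    have 2: "neg_count (insert (- r) X) = 1 + neg_count X"
      using n assms(3) by (simp add: neg_count_def)
    have 3: "neg_pairs (insert (- r) X) = int k + neg_pairs X"
    proof -
      have 1: "- r < y" "y < r" if "y \<in> X" for y
        using bd[of X y] that X by auto
      have 2: "(\<Sum>y\<in>X. of_bool (- r < y \<and> - r + y < 0)) = (\<Sum>y\<in>X. 1 :: int)"
        using 1 by (intro sum.cong) auto
      have 3: "of_bool (x < - r \<and> x + - r < 0) = (0 :: int)" if "x \<in> X" for x
        using 1[OF that] by auto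
      show ?thesis
        unfolding neg_pairs_def using n 2 3 assms(3) X by (simp add: sum.distrib)
    qed
    have e: "2 * (2 * int (card S) - 2 * int k + crossings (unused S X) X + (int k + neg_pairs X))
       = 2 * (2 * int (card S) - int k) + 2 * (crossings (unused S X) X + neg_pairs X)" by simp
    show "w (insert r S) (insert (- r) X) = u_pow 2 * v_pow (2 * (2 * int (card S) - int k))
        * (u_pow (2 * neg_count X) * v_pow (2 * (crossings (unused S X) X + neg_pairs X)))"
      unfolding w_def u 1 2 3 e v_pow_add by (simp add: distrib_left u_pow_add mult_ac)
  qed
  finally show ?thesis by (simp add: algebra_simps)
qed

lemma gauss_B_large:
  assumes "finite S" "\<forall>x\<in>S. 0 < x" "card S < k"
  shows "gauss_B S k = 0"
proof -
  have "{X. X \<in> signed S \<and> card X = k} = {}"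
    using signed_card_le[OF assms(1,2)] assms(3) by fastforce
  then show ?thesis unfolding gauss_B_def by (simp only: sum.empty)
qed

text \<open>Both sides satisfy the same recursion on the largest element. The factor \<open>u_pow 2 * v_pow (2 * (m - 1)) + 1\<close> of
\<open>qint_c m\<close> splits the step into the contributions of the two signs.\<close>

lemma gauss_B_qfact:
  assumes "finite S"
  shows "\<forall>x\<in>S. 0 < x \<Longrightarrow> a + k = card S \<Longrightarrow> gauss_B S k * (qfact_c a * qfact k) = qfact_c (card S)"
  using assms
proof (induction S arbitrary: a k rule: finite_linorder_max_induct)
  case empty
  then show ?case by (simp add: gauss_B_0)
next
  case (insert r S)
  have card: "card (insert r S) = Suc (card S)" using insert by auto
  show ?case
  proof (cases k)
    case 0
    then show ?thesis using insert by (simp add: gauss_B_0)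
  next
    case (Suc j)
    have aj: "a + j = card S" using insert.prems card Suc by simp
    have pos: "\<forall>x\<in>S. 0 < x" "0 < r" using insert.prems by auto
    define ca where "ca = qnum a * (u_pow 2 * v_pow (2 * (int a - 1)) + 1)"
    have 1: "gauss_B S (Suc j) * (qfact_c a * qfact (Suc j)) = ca * qfact_c (card S)"
    proof (cases a)
      case 0
      then show ?thesis using aj by (simp add: gauss_B_large insert.hyps pos ca_def)
    next
      case (Suc a')
      then show ?thesis using insert.IH[of a' "Suc j", symmetric] aj pos by (simp add: qfact_c_Suc[of a'] ca_def mult_ac)
    qed
    have 2: "gauss_B S j * (qfact_c a * qfact j) = qfact_c (card S)"
      using insert.IH aj pos by simp
    have e: "2 * int (card S) - int j = 2 * int a + int j" using aj by linarith
    have "gauss_B (insert r S) k * (qfact_c a * qfact k)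
       = v_pow (2 * int (Suc j)) * (gauss_B S (Suc j) * (qfact_c a * qfact (Suc j)))
         + (1 + u_pow 2 * v_pow (2 * (2 * int a + int j))) * qnum (Suc j) * (gauss_B S j * (qfact_c a * qfact j))"
      using gauss_B_insert_max[of S r j] insert.hyps pos unfolding Suc e by (simp add: qfact_Suc algebra_simps)
    also have "\<dots> = (v_pow (2 * int (Suc j)) * ca + (1 + u_pow 2 * v_pow (2 * (2 * int a + int j))) * qnum (Suc j)) * qfact_c (card S)"
      unfolding 1 2 by (simp add: algebra_simps)
    also have "v_pow (2 * int (Suc j)) * ca + (1 + u_pow 2 * v_pow (2 * (2 * int a + int j))) * qnum (Suc j)
       = qnum (Suc (a + j)) * (u_pow 2 * v_pow (2 * int (a + j)) + 1)"
    proof -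
      have q1: "qnum (Suc (a + j)) = qnum (Suc j) + v_pow (2 * int (Suc j)) * qnum a"
        using qnum_add[of "Suc j" a] by (simp add: add.commute)
      have q2: "qnum (Suc (a + j)) = qnum a + v_pow (2 * int a) * qnum (Suc j)"
        using qnum_add[of a "Suc j"] by simp
      have "v_pow (2 * int (Suc j)) * v_pow (2 * (int a - 1)) = v_pow (2 * int (a + j))"
        by (simp add: algebra_simps flip: v_pow_add)
      moreover have "v_pow (2 * (2 * int a + int j)) = v_pow (2 * int a) * v_pow (2 * int (a + j))"
        by (simp add: algebra_simps flip: v_pow_add)
      moreover have "J * (qA * (u * J' + 1)) + (1 + u * (A * M)) * qJ = (qJ + J * qA) + u * M * (qA + A * qJ)"
        if "J * J' = M" for J J' M qA qJ A u :: laurent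
        unfolding that[symmetric] by (simp add: algebra_simps)
      ultimately have "v_pow (2 * int (Suc j)) * ca + (1 + u_pow 2 * v_pow (2 * (2 * int a + int j))) * qnum (Suc j)
         = (qnum (Suc j) + v_pow (2 * int (Suc j)) * qnum a) + u_pow 2 * v_pow (2 * int (a + j)) * (qnum a + v_pow (2 * int a) * qnum (Suc j))"
        unfolding ca_def by metis
      then show ?thesis unfolding q1[symmetric] q2[symmetric] by (simp add: algebra_simps)
    qed
    also have "\<dots> * qfact_c (card S) = qfact_c (card (insert r S))"
      unfolding card aj qfact_c_Suc by (simp add: mult_ac)
    finally show ?thesis .
  qed
qed

section \<open>Blocks, patterns and double cosets\<close>

text \<open>The index of the block containing \<open>z\<close>, extended to an odd monotone function on all integers: for
\<open>la \<in> Lam n d\<close> it takes the values \<open>\<plusminus>(n + 1)\<close> outside \<open>[-d, d]\<close>. The parabolic subgroup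
consists of the \<open>w\<close> with \<open>block_index n la \<circ> w = block_index n la\<close>, and the right coset of \<open>w\<close> is recorded by the pattern \<open>block_index n la \<circ> w\<close>, a signed word.\<close>

definition block_index :: "nat \<Rightarrow> (nat \<Rightarrow> nat) \<Rightarrow> int \<Rightarrow> int" where
  "block_index n la z = sgn z * int (card {k \<in> {..n}. int (\<Sum>i\<le>k. la i) < \<bar>z\<bar>})"

lemma block_index_odd: "block_index n la (- z) = - block_index n la z"
  by (simp add: block_index_def)

lemma block_index_zero [simp]: "block_index n la 0 = 0"
  by (simp add: block_index_def)

lemma block_index_pos: "0 < z \<Longrightarrow> block_index n la z = int (card {k \<in> {..n}. int (\<Sum>i\<le>k. la i) < z})"
  by (simp add: block_index_def)

lemma block_index_nonneg: "0 \<le> z \<Longrightarrow> 0 \<le> block_index n la z"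
  by (cases "z = 0") (auto simp: block_index_pos)

lemma block_index_mono: "x \<le> y \<Longrightarrow> block_index n la x \<le> block_index n la y"
proof -
  have pos: "block_index n la x \<le> block_index n la y" if "0 \<le> x" "x \<le> y" for x y
  proof (cases "x = 0")
    case True
    then show ?thesis using that block_index_nonneg by simp
  next
    case False
    then show ?thesis using that by (auto simp: block_index_pos intro!: card_mono)
  qed
  assume "x \<le> y"
  then consider "0 \<le> x" | "x < 0" "0 \<le> y" | "y < 0" by linarith
  then show ?thesis
  proof cases
    case 1
    then show ?thesis using pos \<open>x \<le> y\<close> by blast
  next
    case 2
    then show ?thesis
      using block_index_nonneg[of "- x" n la] block_index_nonneg[of y n la] by (simp add: block_index_odd)
  next
    case 3
    then show ?thesis using pos[of "- y" "- x"] \<open>x \<le> y\<close> by (simp add: block_index_odd)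
  qed
qed

lemma card_initial_segment:
  assumes "\<And>k l. k \<le> l \<Longrightarrow> P l \<Longrightarrow> P k"
  shows "c \<le> n \<Longrightarrow> card {k \<in> {..n}. P k} = c \<longleftrightarrow> (\<forall>k<c. P k) \<and> \<not> P c"
    and "card {k \<in> {..n}. P k} = Suc n \<longleftrightarrow> P n"
proof -
  have len: "card {k \<in> {..n}. P k} = c" if "c \<le> n" "\<forall>k<c. P k" "\<not> P c" for c
  proof -
    have "{k \<in> {..n}. P k} = {..<c}"
    proof (intro Set.set_eqI iffI)
      fix k assume "k \<in> {k \<in> {..n}. P k}"
      then show "k \<in> {..<c}" using assms[of c k] that(3) by (cases "k < c") auto
    qed (use that in auto)
    then show ?thesis by simp
  qed
  have all: "card {k \<in> {..n}. P k} = Suc n" if "P n"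
  proof -
    have "{k \<in> {..n}. P k} = {..n}" using assms[of _ n] that by auto
    then show ?thesis by simp
  qed
  have ex: "\<exists>c\<le>n. (\<forall>k<c. P k) \<and> \<not> P c" if "\<not> P n"
  proof -
    define c where "c = (LEAST c. \<not> P c)"
    have "\<not> P c" "c \<le> n"
      unfolding c_def using LeastI[of "\<lambda>c. \<not> P c" n] Least_le[of "\<lambda>c. \<not> P c" n] that by blast+
    moreover have "\<forall>k<c. P k" unfolding c_def using not_less_Least by blast
    ultimately show ?thesis by blast
  qed
  show "c \<le> n \<Longrightarrow> card {k \<in> {..n}. P k} = c \<longleftrightarrow> (\<forall>k<c. P k) \<and> \<not> P c"
    using len all ex by (metis Suc_n_not_le_n)
  show "card {k \<in> {..n}. P k} = Suc n \<longleftrightarrow> P n"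
    using len all ex by (metis Suc_n_not_le_n)
qed

lemma psum_mono:
  fixes la :: "nat \<Rightarrow> nat"
  assumes "k \<le> l" "int (\<Sum>i\<le>l. la i) < z"
  shows "int (\<Sum>i\<le>k. la i) < z"
proof -
  have "(\<Sum>i\<le>k. la i) \<le> (\<Sum>i\<le>l. la i)"
    by (rule sum_mono2) (use assms(1) in auto)
  then show ?thesis using assms(2) by linarith
qed

lemma Lam_sum: "la \<in> Lam n d \<Longrightarrow> (\<Sum>i\<le>n. la i) = d"
  and Lam_zero: "la \<in> Lam n d \<Longrightarrow> n < i \<Longrightarrow> la i = 0"
  by (auto simp: Lam_def)

lemma psum_alt: "int (\<Sum>i\<le>k. la i) = int (la 0) + (\<Sum>j = 1..k. int (la j))" for la :: "nat \<Rightarrow> nat"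
proof -
  have "{..k} = insert 0 {1..k}" by auto
  then show ?thesis by simp
qed

lemma pos_block_iff:
  assumes "1 \<le> i" "i \<le> n"
  shows "z \<in> pos_block la i \<longleftrightarrow> 0 < z \<and> block_index n la z = int i"
proof -
  have e: "int (la 0) + (\<Sum>j = 1..<i. int (la j)) = int (\<Sum>j\<le>i - 1. la j)"
    unfolding psum_alt using assms atLeastLessThanSuc_atLeastAtMost[of 1 "i - 1"] by simp
  have "(\<forall>k<i. int (\<Sum>j\<le>k. la j) < z) \<longleftrightarrow> int (\<Sum>j\<le>i - 1. la j) < z"
    using assms psum_mono[of _ "i - 1" la z] by (metis Suc_pred' diff_less le_less_Suc_eq less_Suc_eq_le less_one not_le zero_less_iff_neq_zero less_le_trans zero_less_one)
  then have "z \<in> pos_block la i \<longleftrightarrow> (\<forall>k<i. int (\<Sum>j\<le>k. la j) < z) \<and> \<not> int (\<Sum>j\<le>i. la j) < z"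
    unfolding pos_block_def e psum_alt[symmetric] by auto
  also have "\<dots> \<longleftrightarrow> card {k \<in> {..n}. int (\<Sum>i\<le>k. la i) < z} = i"
    by (rule card_initial_segment(1)[symmetric]) (use psum_mono assms in auto)
  finally have *: "z \<in> pos_block la i \<longleftrightarrow> card {k \<in> {..n}. int (\<Sum>i\<le>k. la i) < z} = i" .
  show ?thesis
  proof (cases "0 < z")
    case True
    then show ?thesis unfolding * by (simp add: block_index_pos)
  next
    case False
    moreover have "0 \<le> int (\<Sum>j\<le>i - 1. la j)" by (rule of_nat_0_le_iff)
    ultimately have "z \<notin> pos_block la i" unfolding pos_block_def e by (auto simp del: of_nat_sum)
    then show ?thesis using False by simp
  qed
qed

lemma block_index_eq_0_iff: "block_index n la z = 0 \<longleftrightarrow> \<bar>z\<bar> \<le> int (la 0)"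
proof (cases "z = 0")
  case False
  have "card {k \<in> {..n}. int (\<Sum>i\<le>k. la i) < \<bar>z\<bar>} = 0 \<longleftrightarrow> \<not> int (\<Sum>i\<le>0. la i) < \<bar>z\<bar>"
    using card_initial_segment(1)[of "\<lambda>k. int (\<Sum>i\<le>k. la i) < \<bar>z\<bar>" 0 n] psum_mono by auto
  then show ?thesis using False by (simp add: block_index_def sgn_if not_less)
qed simp

lemma block_iff:
  assumes "i \<in> idx n"
  shows "z \<in> block la i \<longleftrightarrow> block_index n la z = i"
proof -
  consider "i = 0" | "0 < i" | "i < 0" by linarith
  then show ?thesis
  proof cases
    case 1
    then show ?thesis by (auto simp: block_def block_index_eq_0_iff)
  next
    case 2
    then have "z \<in> block la i \<longleftrightarrow> 0 < z \<and> block_index n la z = i"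
      using pos_block_iff[of "nat i" n z la] assms by (simp add: block_def idx_def)
    then show ?thesis
      using 2 block_index_nonneg[of "- z" n la] by (cases "0 < z") (auto simp: block_index_odd)
  next
    case 3
    then have "- z \<in> pos_block la (nat (- i)) \<longleftrightarrow> 0 < - z \<and> block_index n la (- z) = - i"
      using pos_block_iff[of "nat (- i)" n "- z" la] assms by (simp add: idx_def)
    moreover have "z \<in> uminus ` pos_block la (nat (- i)) \<longleftrightarrow> - z \<in> pos_block la (nat (- i))"
      by (force simp: image_iff)
    ultimately have "z \<in> block la i \<longleftrightarrow> z < 0 \<and> block_index n la z = i"
      using 3 by (simp add: block_def block_index_odd)
    then show ?thesis
      using 3 block_index_nonneg[of z n la] by (cases "z < 0") auto
  qed
qed

lemma block_outside:
  assumes "la \<in> Lam n d" "i \<notin> idx n"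
  shows "block la i = {}"
proof -
  have "pos_block la k = {}" if "n < k" for k
  proof -
    have "{1..k} = insert k {1..<k}" using that by auto
    then show ?thesis using Lam_zero[OF assms(1) that] by (simp add: pos_block_def)
  qed
  then show ?thesis using assms(2) by (auto simp: block_def idx_def)
qed

lemma block_index_in_idx:
  assumes "la \<in> Lam n d"
  shows "block_index n la z \<in> idx n \<longleftrightarrow> \<bar>z\<bar> \<le> int d"
proof (cases "z = 0")
  case False
  have "card {k \<in> {..n}. int (\<Sum>i\<le>k. la i) < \<bar>z\<bar>} = Suc n \<longleftrightarrow> int d < \<bar>z\<bar>"
    using card_initial_segment(2)[of "\<lambda>k. int (\<Sum>i\<le>k. la i) < \<bar>z\<bar>" n] psum_mono
    unfolding Lam_sum[OF assms, symmetric] by blast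
  moreover have "card {k \<in> {..n}. int (\<Sum>i\<le>k. la i) < \<bar>z\<bar>} \<le> Suc n"
    by (rule order_trans[OF card_mono[of "{..n}"]]) auto
  ultimately show ?thesis
    using False by (auto simp: block_index_def idx_def sgn_if)
qed (simp add: idx_def)

lemma block_index_outside:
  assumes "la \<in> Lam n d" "int d < \<bar>z\<bar>"
  shows "block_index n la z = sgn z * (int n + 1)"
proof -
  have "card {k \<in> {..n}. int (\<Sum>i\<le>k. la i) < \<bar>z\<bar>} = Suc n"
    using card_initial_segment(2)[of "\<lambda>k. int (\<Sum>i\<le>k. la i) < \<bar>z\<bar>" n] psum_mono assms
    unfolding Lam_sum[OF assms(1), symmetric] by blast
  then show ?thesis by (simp add: block_index_def)
qed

lemma card_block:
  shows "card (block la 0) = 2 * la 0 + 1" and "0 < i \<Longrightarrow> card (block la (int i)) = la i"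
proof -
  show "card (block la 0) = 2 * la 0 + 1" by (simp add: block_def)
  assume "0 < i"
  then have "{1..i} = insert i {1..<i}" by auto
  then show "card (block la (int i)) = la i"
    using \<open>0 < i\<close> by (simp add: block_def pos_block_def)
qed

lemma finite_block: "finite (block la i)"
  by (auto simp: block_def pos_block_def)

text \<open>This replaces the condition on all blocks by one equation between functions, which is stable under
composition.\<close>

lemma parabolic_iff:
  assumes "la \<in> Lam n d"
  shows "w \<in> parabolic d la \<longleftrightarrow> w \<in> weyl d \<and> block_index n la \<circ> w = block_index n la"
proof (intro iffI conjI)
  assume w: "w \<in> parabolic d la"
  then show W: "w \<in> weyl d" by (simp add: parabolic_def)
  show "block_index n la \<circ> w = block_index n la"
  proof
    fix z
    show "(block_index n la \<circ> w) z = block_index n la z"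
    proof (cases "\<bar>z\<bar> \<le> int d")
      case True
      then have i: "block_index n la z \<in> idx n" using block_index_in_idx[OF assms] by simp
      then have "z \<in> block la (block_index n la z)" by (simp add: block_iff)
      then have "w z \<in> block la (block_index n la z)" using w by (auto simp: parabolic_def)
      then show ?thesis using i by (simp add: block_iff)
    next
      case False
      then show ?thesis using weyl_outside[OF W, of z] by simp
    qed
  qed
next
  assume w: "w \<in> weyl d \<and> block_index n la \<circ> w = block_index n la"
  have "w ` block la i = block la i" for i
  proof (cases "i \<in> idx n")
    case True
    have "block_index n la (w z) = block_index n la z" for z
      using w by (metis comp_apply)
    then have "w ` block la i \<subseteq> block la i"
      using True by (auto simp: block_iff)
    then show ?thesis
      using w by (intro endo_inj_surj finite_block) (auto intro: inj_on_subset[OF weyl_inj])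
  qed (simp add: block_outside[OF assms])
  then show "w \<in> parabolic d la" using w by (simp add: parabolic_def)
qed

lemma parabolic_comp: "x \<in> parabolic d la \<Longrightarrow> y \<in> parabolic d la \<Longrightarrow> x \<circ> y \<in> parabolic d la"
  unfolding parabolic_def mem_Collect_eq image_comp[symmetric] by (simp add: weyl_comp)

lemma parabolic_id: "id \<in> parabolic d la"
  by (simp add: parabolic_def weyl_id)

lemma parabolic_inv:
  assumes "x \<in> parabolic d la"
  shows "winv x \<in> parabolic d la"
proof -
  have x: "x \<in> weyl d" "\<And>i. x ` block la i = block la i"
    using assms by (simp_all add: parabolic_def)
  have "winv x ` (x ` block la i) = block la i" for i
    by (rule image_inv_f_f[OF weyl_inj[OF x(1)]])
  then show ?thesis
    by (simp add: parabolic_def x weyl_inv)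
qed

lemma parabolic_weyl: "x \<in> parabolic d la \<Longrightarrow> x \<in> weyl d"
  by (simp add: parabolic_def)

lemma double_coset_weyl: "g \<in> weyl d \<Longrightarrow> w \<in> double_coset d la g mu \<Longrightarrow> w \<in> weyl d"
  by (auto simp: double_coset_def intro!: weyl_comp dest: parabolic_weyl)

lemma double_coset_refl: "g \<in> double_coset d la g mu"
proof -
  have "g = id \<circ> g \<circ> id" by simp
  then show ?thesis unfolding double_coset_def using parabolic_id by blast
qed

lemma double_coset_trans:
  "w \<in> double_coset d la v mu \<Longrightarrow> v \<in> double_coset d la g mu \<Longrightarrow> w \<in> double_coset d la g mu"
proof -
  assume "w \<in> double_coset d la v mu" "v \<in> double_coset d la g mu"
  then obtain x y x' y' where *: "w = x \<circ> v \<circ> y" "v = x' \<circ> g \<circ> y'" "x \<in> parabolic d la" "x' \<in> parabolic d la"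
    "y \<in> parabolic d mu" "y' \<in> parabolic d mu" by (auto simp: double_coset_def)
  then have "w = (x \<circ> x') \<circ> g \<circ> (y' \<circ> y)" by (simp add: o_assoc)
  then show ?thesis using * parabolic_comp unfolding double_coset_def by blast
qed

lemma double_coset_sym: "w \<in> double_coset d la g mu \<Longrightarrow> g \<in> double_coset d la w mu"
proof -
  assume "w \<in> double_coset d la g mu"
  then obtain x y where *: "w = x \<circ> g \<circ> y" "x \<in> parabolic d la" "y \<in> parabolic d mu"
    by (auto simp: double_coset_def)
  have "winv x (x z) = z" "y (winv y z) = z" for z
    using weyl_inv_comp[OF parabolic_weyl[OF *(2)]] weyl_inv_comp[OF parabolic_weyl[OF *(3)]]
    by (metis comp_apply id_apply)+
  then have "g = winv x \<circ> w \<circ> winv y"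
    by (simp add: *(1) fun_eq_iff)
  then show ?thesis using *(2,3) parabolic_inv unfolding double_coset_def by blast
qed

text \<open>Positions are counted by the block they lie in and the block they are sent to.\<close>

lemma kappa_eq:
  assumes "la \<in> Lam n d" "mu \<in> Lam n d" "w \<in> weyl d"
  shows "kappa la w mu i j = (if i \<in> idx n \<and> j \<in> idx n
     then int (card {z. block_index n la (w z) = i \<and> block_index n mu z = j}) else 0)"
proof (cases "i \<in> idx n \<and> j \<in> idx n")
  case True
  have "block la i \<inter> w ` block mu j = w ` {z. block_index n la (w z) = i \<and> block_index n mu z = j}"
    using True by (auto simp: block_iff)
  moreover have "inj_on w A" for A
    using weyl_inj[OF assms(3)] by (auto intro: inj_on_subset)
  ultimately show ?thesis using True by (simp add: kappa_def card_image)
next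
  case False
  then show ?thesis
    using block_outside[OF assms(1), of i] block_outside[OF assms(2), of j] by (auto simp: kappa_def)
qed

lemma kappa_double_coset:
  assumes "la \<in> Lam n d" "mu \<in> Lam n d" "g \<in> weyl d" "w \<in> double_coset d la g mu"
  shows "kappa la w mu = kappa la g mu"
proof -
  obtain x y where *: "w = x \<circ> g \<circ> y" "x \<in> parabolic d la" "y \<in> parabolic d mu"
    using assms(4) by (auto simp: double_coset_def)
  have x: "block_index n la (x z) = block_index n la z" and y: "block_index n mu (y z) = block_index n mu z" for z
    using *(2,3) parabolic_iff[OF assms(1)] parabolic_iff[OF assms(2)] by (metis comp_apply)+
  have Y: "y \<in> weyl d" using *(3) by (rule parabolic_weyl)
  have "card {z. block_index n la (w z) = i \<and> block_index n mu z = j} = card {z. block_index n la (g z) = i \<and> block_index n mu z = j}" for i j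
  proof (rule bij_betw_same_card[of y])
    show "bij_betw y {z. block_index n la (w z) = i \<and> block_index n mu z = j} {z. block_index n la (g z) = i \<and> block_index n mu z = j}"
    proof (rule bij_betw_subset[OF weyl_bij[OF Y]])
      show "y ` {z. block_index n la (w z) = i \<and> block_index n mu z = j} = {z. block_index n la (g z) = i \<and> block_index n mu z = j}"
      proof (intro Set.set_eqI iffI)
        fix z assume z: "z \<in> {z. block_index n la (g z) = i \<and> block_index n mu z = j}"
        obtain z' where "z = y z'" using weyl_bij[OF Y] by (meson bij_pointE)
        then show "z \<in> y ` {z. block_index n la (w z) = i \<and> block_index n mu z = j}"
          using z by (auto simp: *(1) x y)
      qed (auto simp: *(1) x y)
    qed simp
  qed
  then show ?thesis
    using kappa_eq[OF assms(1-3)] kappa_eq[OF assms(1,2) double_coset_weyl[OF assms(3,4)]] by (auto simp: fun_eq_iff)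
qed

lemma gen_parabolic:
  assumes "la \<in> Lam n d" "i < d" "block_index n la \<circ> gen i = block_index n la"
  shows "gen i \<in> parabolic d la"
  using assms parabolic_iff gen_weyl by blast

text \<open>Multiplying by a generator in one of the two parabolic subgroups stays in the double coset, so a
minimal representative has no descent there.\<close>

lemma min_reps_ascending:
  assumes "la \<in> Lam n d" "mu \<in> Lam n d" "g \<in> min_reps d la mu" "i < d"
  shows "block_index n mu \<circ> gen i = block_index n mu \<Longrightarrow> ascent g i"
    and "block_index n la \<circ> gen i = block_index n la \<Longrightarrow> ascent (winv g) i"
proof -
  have g: "g \<in> weyl d" "\<And>w. w \<in> double_coset d la g mu \<Longrightarrow> len d g \<le> len d w"
    using assms(3) by (auto simp: min_reps_def)
  show "ascent g i" if "block_index n mu \<circ> gen i = block_index n mu"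
  proof (rule ccontr)
    assume "\<not> ascent g i"
    then have "len d g = Suc (len d (g \<circ> gen i))" by (rule len_gen_right(2)[OF g(1) assms(4)])
    moreover have "id \<circ> g \<circ> gen i \<in> double_coset d la g mu"
      unfolding double_coset_def using gen_parabolic[OF assms(2,4) that] parabolic_id by blast
    ultimately show False using g(2)[of "g \<circ> gen i"] by simp
  qed
  show "ascent (winv g) i" if "block_index n la \<circ> gen i = block_index n la"
  proof (rule ccontr)
    assume "\<not> ascent (winv g) i"
    then have "len d g = Suc (len d (gen i \<circ> g))" by (rule len_gen_left(2)[OF g(1) assms(4)])
    moreover have "gen i \<circ> g \<circ> id \<in> double_coset d la g mu"
      unfolding double_coset_def using gen_parabolic[OF assms(1,4) that] parabolic_id by blast
    ultimately show False using g(2)[of "gen i \<circ> g"] by simp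
  qed
qed

text \<open>Within a block the ascents at neighbouring positions chain together. The block around \<open>0\<close> needs the
generator \<open>0\<close> as well, which gives positivity and hence handles a pair of opposite signs.\<close>

lemma increasing_on_blocks:
  assumes h: "h \<in> weyl d"
    and a: "\<And>i. i < d \<Longrightarrow> block_index n la \<circ> gen i = block_index n la \<Longrightarrow> ascent h i"
    and xy: "x < y" "block_index n la x = block_index n la y" "\<bar>x\<bar> \<le> int d" "\<bar>y\<bar> \<le> int d"
  shows "h x < h y"
proof -
  have same: "block_index n la \<circ> gen i = block_index n la" if "block_index n la (int i) = block_index n la (int i + 1)" for i
  proof
    fix z
    show "(block_index n la \<circ> gen i) z = block_index n la z"
    proof (cases "i = 0")
      case True
      then show ?thesis using that block_index_odd[of n la 1] by (auto simp: gen_0_apply)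
    next
      case False
      have "block_index n la (- int i) = block_index n la (- int i - 1)"
        using that block_index_odd[of n la "int i"] block_index_odd[of n la "int i + 1"] by simp
      then show ?thesis using that False by (auto simp: gen_apply)
    qed
  qed
  have step: "h z < h (z + 1)" if "block_index n la z = block_index n la (z + 1)" "\<bar>z\<bar> \<le> int d" "\<bar>z + 1\<bar> \<le> int d" for z
  proof -
    have pos: "h (int i) < h (int i + 1)" if "block_index n la (int i) = block_index n la (int i + 1)" "i < d" for i
      using a[OF that(2) same[OF that(1)]] weyl_zero[OF h] by (auto simp: ascent_def split: if_splits)
    show ?thesis
    proof (cases "0 \<le> z")
      case True
      then show ?thesis using pos[of "nat z"] that by simp
    next
      case False
      have "block_index n la (- (z + 1)) = block_index n la (- z)"
        using that(1) block_index_odd[of n la z] block_index_odd[of n la "z + 1"] by simp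
      then have "h (- (z + 1)) < h (- z)"
        using False pos[of "nat (- (z + 1))"] that by simp
      then show ?thesis using weyl_odd[OF h, of z] weyl_odd[OF h, of "z + 1"] by simp
    qed
  qed
  have "h x < h (x + 1 + int k)" if "x + 1 + int k \<le> y" for k
    using that
  proof (induction k)
    case 0
    have "block_index n la x = block_index n la (x + 1)"
      using block_index_mono[of x "x + 1" n la] block_index_mono[of "x + 1" y n la] xy by simp
    then show ?case using step[of x] xy by simp
  next
    case (Suc k)
    have "block_index n la (x + 1 + int k) = block_index n la (x + 1 + int k + 1)"
      using block_index_mono[of x "x + 1 + int k" n la] block_index_mono[of "x + 1 + int k" "x + 1 + int k + 1" n la]
        block_index_mono[of "x + 1 + int k + 1" y n la] xy Suc.prems by simp
    then have "h (x + 1 + int k) < h (x + 1 + int k + 1)"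
      using xy Suc.prems by (intro step) simp_all
    then show ?case using Suc by (simp add: ac_simps)
  qed
  from this[of "nat (y - x - 1)"] show ?thesis using xy(1) by simp
qed

text \<open>A weakly increasing function is recovered from the number of points below each of its levels. This is
how a minimal representative will be recovered from its matrix.\<close>

lemma increasing_le_iff:
  fixes f :: "int \<Rightarrow> int"
  assumes "finite R" "z \<in> R" "\<And>x y. x \<in> R \<Longrightarrow> y \<in> R \<Longrightarrow> x \<le> y \<Longrightarrow> f x \<le> f y"
  shows "f z \<le> k \<longleftrightarrow> card {y \<in> R. y < z} < card {y \<in> R. f y \<le> k}"
proof
  assume k: "f z \<le> k"
  have "f y \<le> k" if "y \<in> R" "y < z" for y
    using assms(3)[OF that(1) assms(2)] that(2) k by simp
  then have "{y \<in> R. y < z} \<subset> {y \<in> R. f y \<le> k}"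
    using assms(2) k by blast
  then show "card {y \<in> R. y < z} < card {y \<in> R. f y \<le> k}"
    using assms(1) by (intro psubset_card_mono) auto
next
  assume c: "card {y \<in> R. y < z} < card {y \<in> R. f y \<le> k}"
  show "f z \<le> k"
  proof (rule ccontr)
    assume "\<not> f z \<le> k"
    then have "y < z" if "y \<in> R" "f y \<le> k" for y
      using assms(3)[OF assms(2) that(1)] that(2) by (cases "y < z") auto
    then have "{y \<in> R. f y \<le> k} \<subseteq> {y \<in> R. y < z}"
      by blast
    then show False using c card_mono[of "{y \<in> R. y < z}" "{y \<in> R. f y \<le> k}"] assms(1) by auto
  qed
qed

lemma finite_fibre:
  assumes "mu \<in> Lam n d" "j \<in> idx n"
  shows "finite {z. block_index n mu z = j \<and> P z}"
  by (rule finite_subset[of _ "{- int d..int d}"]) (use assms block_index_in_idx in force)+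

text \<open>A minimal representative \<open>g\<close> is increasing on the blocks of \<open>mu\<close>, so the pattern \<open>block_index n la \<circ> g\<close>
is weakly increasing on each of them and is determined by the column of the matrix. The inverse of \<open>g\<close>
is increasing on the blocks of \<open>la\<close>, so \<open>g\<close> is in turn determined by its pattern.\<close>

lemma min_reps_unique:
  assumes L: "la \<in> Lam n d" "mu \<in> Lam n d"
    and g: "g \<in> min_reps d la mu" and g': "g' \<in> min_reps d la mu"
    and k: "kappa la g mu = kappa la g' mu"
  shows "g = g'"
proof -
  have W: "g \<in> weyl d" "g' \<in> weyl d" using g g' by (auto simp: min_reps_def)
  have incr: "h x < h y" if "h \<in> min_reps d la mu" "x < y" "block_index n mu x = block_index n mu y" "\<bar>x\<bar> \<le> int d" "\<bar>y\<bar> \<le> int d" for h x y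
    by (rule increasing_on_blocks[of h d n mu]) (use that min_reps_ascending(1)[OF L that(1)] in \<open>auto simp: min_reps_def\<close>)
  have incr': "winv h x < winv h y" if "h \<in> min_reps d la mu" "x < y" "block_index n la x = block_index n la y" "\<bar>x\<bar> \<le> int d" "\<bar>y\<bar> \<le> int d" for h x y
    by (rule increasing_on_blocks[of "winv h" d n la])
       (use that min_reps_ascending(2)[OF L that(1)] in \<open>auto simp: min_reps_def weyl_inv\<close>)
  have f: "block_index n la (g z) = block_index n la (g' z)" for z
  proof (cases "\<bar>z\<bar> \<le> int d")
    case True
    define R where "R = {y. block_index n mu y = block_index n mu z}"
    have j: "block_index n mu z \<in> idx n" using block_index_in_idx[OF L(2)] True by simp
    have fin: "finite R" unfolding R_def using finite_fibre[OF L(2) j, of "\<lambda>_. True"] by simp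
    have R: "\<bar>y\<bar> \<le> int d" if "y \<in> R" for y
      using that j block_index_in_idx[OF L(2), of y] by (simp add: R_def)
    have mono: "block_index n la (h x) \<le> block_index n la (h y)" if "h \<in> min_reps d la mu" "x \<in> R" "y \<in> R" "x \<le> y" for h x y
      using incr[OF that(1), of x y] that R by (cases "x = y") (auto simp: R_def intro!: block_index_mono)
    have cnt: "int (card {y \<in> R. block_index n la (h y) \<le> k}) = (\<Sum>i | i \<in> idx n \<and> i \<le> k. kappa la h mu i (block_index n mu z))"
      if h: "h \<in> min_reps d la mu" for h k
    proof -
      have hW: "h \<in> weyl d" using h by (simp add: min_reps_def)
      have "{y \<in> R. block_index n la (h y) \<le> k} = (\<Union>i \<in> {i \<in> idx n. i \<le> k}. {y. block_index n la (h y) = i \<and> block_index n mu y = block_index n mu z})"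
        using R block_index_in_idx[OF L(1)] weyl_range[OF hW] by (auto simp: R_def)
      also have "int (card \<dots>) = (\<Sum>i | i \<in> idx n \<and> i \<le> k. int (card {y. block_index n la (h y) = i \<and> block_index n mu y = block_index n mu z}))"
      proof (subst card_UN_disjoint)
        show "\<forall>i\<in>{i \<in> idx n. i \<le> k}. finite {y. block_index n la (h y) = i \<and> block_index n mu y = block_index n mu z}"
          using fin by (auto simp: R_def intro: finite_subset[rotated])
      qed (auto simp: idx_def intro: finite_subset[of _ "{- int n..int n}"])
      also have "\<dots> = (\<Sum>i | i \<in> idx n \<and> i \<le> k. kappa la h mu i (block_index n mu z))"
        using j by (intro sum.cong refl) (simp add: kappa_eq[OF L hW])
      finally show ?thesis .
    qed
    have "block_index n la (g z) \<le> k \<longleftrightarrow> block_index n la (g' z) \<le> k" for k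
    proof -
      have z: "z \<in> R" by (simp add: R_def)
      have "card {y \<in> R. block_index n la (g y) \<le> k} = card {y \<in> R. block_index n la (g' y) \<le> k}"
        using cnt[OF g, of k] cnt[OF g', of k] \<open>kappa la g mu = kappa la g' mu\<close> by simp
      then show ?thesis
        using increasing_le_iff[OF fin z, of "\<lambda>y. block_index n la (g y)" k] increasing_le_iff[OF fin z, of "\<lambda>y. block_index n la (g' y)" k]
          mono[OF g] mono[OF g'] by simp
    qed
    then show ?thesis by (meson order.antisym order.refl)
  next
    case False
    then show ?thesis using weyl_outside[OF W(1), of z] weyl_outside[OF W(2), of z] by simp
  qed
  have cmp: "h y < h z \<longleftrightarrow> block_index n la (h y) < block_index n la (h z) \<or> block_index n la (h y) = block_index n la (h z) \<and> y < z"
    if "h \<in> min_reps d la mu" "\<bar>y\<bar> \<le> int d" "\<bar>z\<bar> \<le> int d" for h y z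
  proof -
    have hW: "h \<in> weyl d" using that(1) by (simp add: min_reps_def)
    have inv: "winv h (h y) = y" for y by (simp add: weyl_inj[OF hW])
    have up: "y < z" if "block_index n la (h y) = block_index n la (h z)" "h y < h z" "\<bar>y\<bar> \<le> int d" "\<bar>z\<bar> \<le> int d" for y z
      using incr'[OF \<open>h \<in> min_reps d la mu\<close> that(2,1)] that weyl_range[OF hW] inv by simp
    have lt: "h y < h z" if "block_index n la (h y) < block_index n la (h z)" for y z
      using that block_index_mono[of "h z" "h y" n la] by linarith
    show ?thesis
    proof (cases "h y = h z")
      case True
      then have "y = z" by (metis inv)
      then show ?thesis by simp
    next
      case False
      then consider "h y < h z" | "h z < h y" by linarith
      then show ?thesis
      proof cases
        case 1
        then show ?thesis using up[of y z] that block_index_mono[of "h y" "h z" n la] by auto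
      next
        case 2
        then show ?thesis using up[of z y] that block_index_mono[of "h z" "h y" n la] by auto
      qed
    qed
  qed
  show ?thesis
  proof
    fix z
    show "g z = g' z"
    proof (cases "\<bar>z\<bar> \<le> int d")
      case True
      have cnt: "int (card {y. \<bar>y\<bar> \<le> int d \<and> h y < h z}) = h z + int d" if hW: "h \<in> weyl d" for h
      proof -
        have "h ` {y. \<bar>y\<bar> \<le> int d \<and> h y < h z} = {- int d..<h z}"
        proof (intro Set.set_eqI iffI)
          fix x assume x: "x \<in> {- int d..<h z}"
          then have "\<bar>x\<bar> \<le> int d" using weyl_range[OF hW, of z] True by auto
          obtain y where y: "x = h y" using weyl_bij[OF hW] by (meson bij_pointE)
          with \<open>\<bar>x\<bar> \<le> int d\<close> have "\<bar>y\<bar> \<le> int d" using weyl_range[OF hW] by simp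
          then show "x \<in> h ` {y. \<bar>y\<bar> \<le> int d \<and> h y < h z}" using x y by auto
        next
          fix x assume "x \<in> h ` {y. \<bar>y\<bar> \<le> int d \<and> h y < h z}"
          then obtain y where y: "\<bar>y\<bar> \<le> int d" "h y < h z" "x = h y" by blast
          then have "\<bar>h y\<bar> \<le> int d" using weyl_range[OF hW, of y] by simp
          then show "x \<in> {- int d..<h z}" using y(2,3) by auto
        qed
        then have "card {y. \<bar>y\<bar> \<le> int d \<and> h y < h z} = card {- int d..<h z}"
          using card_image[OF inj_on_subset[OF weyl_inj[OF hW] subset_UNIV], of "{y. \<bar>y\<bar> \<le> int d \<and> h y < h z}"] by simp
        then show ?thesis using weyl_range[OF hW, of z] True by simp
      qed
      have "{y. \<bar>y\<bar> \<le> int d \<and> g y < g z} = {y. \<bar>y\<bar> \<le> int d \<and> g' y < g' z}"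
        using cmp[OF g _ True] cmp[OF g' _ True] f by auto
      then show ?thesis using cnt[OF W(1)] cnt[OF W(2)] by simp
    next
      case False
      then show ?thesis using weyl_outside[OF W(1), of z] weyl_outside[OF W(2), of z] by simp
    qed
  qed
qed

lemma min_rep_exists:
  assumes "la \<in> Lam n d" "mu \<in> Lam n d" "w \<in> weyl d"
  obtains g where "g \<in> min_reps d la mu" "g \<in> double_coset d la w mu"
proof -
  define g where "g = arg_min_on (len d) (double_coset d la w mu)"
  have fin: "finite (double_coset d la w mu)"
    by (rule finite_subset[OF _ finite_weyl[of d]]) (use double_coset_weyl[OF assms(3)] in blast)
  have ne: "double_coset d la w mu \<noteq> {}" using double_coset_refl by blast
  have g: "g \<in> double_coset d la w mu" unfolding g_def by (rule arg_min_if_finite(1)[OF fin ne])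
  have "len d g \<le> len d v" if "v \<in> double_coset d la g mu" for v
    unfolding g_def by (rule arg_min_least[OF fin ne]) (use double_coset_trans[OF that g] in simp)
  then have "g \<in> min_reps d la mu"
    using double_coset_weyl[OF assms(3) g] by (simp add: min_reps_def)
  with g show ?thesis using that by blast
qed

text \<open>A permutation with the same matrix lies in a double coset with a minimal representative of its own,
which equals \<open>g\<close> by uniqueness.\<close>

lemma double_coset_eq_kappa:
  assumes L: "la \<in> Lam n d" "mu \<in> Lam n d" and g: "g \<in> min_reps d la mu"
  shows "double_coset d la g mu = {w \<in> weyl d. kappa la w mu = kappa la g mu}"
proof (intro Set.set_eqI iffI)
  have W: "g \<in> weyl d" using g by (simp add: min_reps_def)
  fix w assume "w \<in> double_coset d la g mu"
  then show "w \<in> {w \<in> weyl d. kappa la w mu = kappa la g mu}"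
    using double_coset_weyl[OF W] kappa_double_coset[OF L W] by simp
next
  fix w assume w: "w \<in> {w \<in> weyl d. kappa la w mu = kappa la g mu}"
  then obtain h where h: "h \<in> min_reps d la mu" "h \<in> double_coset d la w mu"
    using min_rep_exists[OF L] by blast
  have "kappa la h mu = kappa la w mu" using kappa_double_coset[OF L _ h(2)] w by simp
  then have "h = g" using min_reps_unique[OF L h(1) g] w by simp
  then show "w \<in> double_coset d la g mu" using double_coset_sym[OF h(2)] by simp
qed

section \<open>Coset sums in the Hecke algebra\<close>

definition hecke_param :: "nat \<Rightarrow> laurent" where
  "hecke_param i = (if i = 0 then u_pow 2 else v_pow 2)"

definition hecke_param_inv :: "nat \<Rightarrow> laurent" where
  "hecke_param_inv i = (if i = 0 then u_pow (- 2) else v_pow (- 2))"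

lemma hecke_param_inverse: "hecke_param_inv i * hecke_param i = 1"
  by (simp add: hecke_param_def hecke_param_inv_def)

context hecke_algebra
begin

lemma smul_one_mult: "smul a 1 * x = smul a x" "x * smul a 1 = smul a x"
  by (simp_all add: smul_mult_left smul_mult_right)

lemma T_gen_square:
  assumes "i < d"
  shows "T (gen i) * T (gen i) = smul (hecke_param i - 1) (T (gen i)) + smul (hecke_param i) 1"
proof -
  have "(T (gen i) + 1) * (T (gen i) - smul (hecke_param i) 1) = 0"
    using T_quadratic_0 T_quadratic[of i] assms by (cases "i = 0") (auto simp: hecke_param_def)
  then have "T (gen i) * T (gen i) - smul (hecke_param i) (T (gen i)) + T (gen i) - smul (hecke_param i) 1 = 0"
    by (simp add: algebra_simps smul_one_mult)
  then show ?thesis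
    by (simp add: scale_left_diff_distrib algebra_simps)
qed

lemma T_gen_right:
  assumes "w \<in> weyl d" "i < d"
  shows "ascent w i \<Longrightarrow> T w * T (gen i) = T (w \<circ> gen i)"
    and "\<not> ascent w i \<Longrightarrow> T w * T (gen i) = smul (hecke_param i) (T (w \<circ> gen i)) + smul (hecke_param i - 1) (T w)"
proof -
  have g: "gen i \<in> weyl d" using assms gen_weyl by simp
  have ascent: "T w * T (gen i) = T (w \<circ> gen i)" if "w \<in> weyl d" "ascent w i" for w
    using T_mult[OF that(1) g] len_gen_right(1)[OF that(1) assms(2) that(2)] len_gen[OF assms(2)] by simp
  show "ascent w i \<Longrightarrow> T w * T (gen i) = T (w \<circ> gen i)" using ascent assms by blast
  assume "\<not> ascent w i"
  then have "T (w \<circ> gen i) * T (gen i) = T w"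
    using ascent[of "w \<circ> gen i"] ascent_gen_not[OF assms] weyl_comp[OF assms(1) g]
    by (simp add: o_assoc[symmetric] gen_comp_gen)
  then have "T w * T (gen i) = T (w \<circ> gen i) * (T (gen i) * T (gen i))"
    by (simp add: mult.assoc[symmetric])
  then show "T w * T (gen i) = smul (hecke_param i) (T (w \<circ> gen i)) + smul (hecke_param i - 1) (T w)"
    using \<open>T (w \<circ> gen i) * T (gen i) = T w\<close>
    by (simp add: T_gen_square[OF assms(2)] distrib_left smul_mult_right add.commute)
qed

lemma T_gen_left:
  assumes "w \<in> weyl d" "i < d" "ascent (winv w) i"
  shows "T (gen i) * T w = T (gen i \<circ> w)"
  using T_mult[OF gen_weyl[OF assms(2)] assms(1)] len_gen_left(1)[OF assms] len_gen[OF assms(2)] by simp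

definition T_gen_inv :: "nat \<Rightarrow> 'h" where
  "T_gen_inv i = smul (hecke_param_inv i) (T (gen i) - smul (hecke_param i - 1) 1)"

lemma T_gen_inv:
  assumes "i < d"
  shows "T (gen i) * T_gen_inv i = 1" "T_gen_inv i * T (gen i) = 1"
  unfolding T_gen_inv_def
  by (simp_all add: smul_mult_right smul_mult_left right_diff_distrib left_diff_distrib T_gen_square[OF assms] hecke_param_inverse)

lemma mult_T_gen_cancel:
  assumes "i < d"
  shows "x * T (gen i) = y \<Longrightarrow> x = y * T_gen_inv i" "T (gen i) * x = y \<Longrightarrow> x = T_gen_inv i * y"
  using T_gen_inv[OF assms] by (auto simp: mult.assoc) (simp add: mult.assoc[symmetric])

text \<open>If \<open>\<beta>\<close> is the block index of a composition, this is the sum over a right coset of the parabolic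
subgroup, indexed by the common pattern \<open>f\<close> of its elements, and \<open>coset_sum \<beta> \<beta>\<close> is \<open>x_elt\<close>.\<close>

definition coset_sum :: "(int \<Rightarrow> int) \<Rightarrow> (int \<Rightarrow> int) \<Rightarrow> 'h" where
  "coset_sum \<beta> f = (\<Sum>w | w \<in> weyl d \<and> \<beta> \<circ> w = f. T w)"

text \<open>All elements of the coset have an ascent at \<open>i\<close> because their pattern does, so lengths add; the
pattern of the product is the swapped one.\<close>

lemma coset_sum_ascent:
  assumes mono: "\<And>x y. x \<le> y \<Longrightarrow> \<beta> x \<le> \<beta> y" and zero: "\<beta> 0 = 0" and i: "i < d" and f: "ascent f i"
  shows "coset_sum \<beta> f * T (gen i) = coset_sum \<beta> (f \<circ> gen i)"
proof -
  have "T w * T (gen i) = T (w \<circ> gen i)" if "w \<in> weyl d" "\<beta> \<circ> w = f" for w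
  proof (rule T_gen_right(1)[OF that(1) i])
    show "ascent w i"
      using f that(2) mono[of "w 1" 0] mono[of "w (int i + 1)" "w (int i)"] zero
      by (force simp: ascent_def fun_eq_iff not_less[symmetric])
  qed
  then have "coset_sum \<beta> f * T (gen i) = (\<Sum>w | w \<in> weyl d \<and> \<beta> \<circ> w = f. T (w \<circ> gen i))"
    unfolding coset_sum_def sum_distrib_right by (intro sum.cong) auto
  also have "\<dots> = coset_sum \<beta> (f \<circ> gen i)"
    unfolding coset_sum_def
    by (rule sum.reindex_bij_witness[of _ "\<lambda>w. w \<circ> gen i" "\<lambda>w. w \<circ> gen i"])
       (auto simp: fun_eq_iff intro!: weyl_comp gen_weyl i)
  finally show ?thesis .
qed

text \<open>The coset is stable under the exchange, and the quadratic relation makes its sum an eigenvector with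
eigenvalue the Hecke parameter.\<close>

lemma coset_sum_fixed:
  assumes i: "i < d" and f: "f \<circ> gen i = f"
  shows "coset_sum \<beta> f * T (gen i) = smul (hecke_param i) (coset_sum \<beta> f)"
proof -
  define C where "C = {w. w \<in> weyl d \<and> \<beta> \<circ> w = f}"
  have fin: "finite C" unfolding C_def using finite_weyl by simp
  have C: "w \<circ> gen i \<in> C" if "w \<in> C" for w
    using that f i by (auto simp: C_def weyl_comp gen_weyl o_assoc)
  have split: "sum h C = sum h {w \<in> C. ascent w i} + sum h {w \<in> C. \<not> ascent w i}" for h :: "_ \<Rightarrow> 'h"
    by (subst sum.union_disjoint[symmetric]) (auto simp: fin intro: sum.cong)
  have cc: "w \<circ> gen i \<circ> gen i = w" for w :: "int \<Rightarrow> int"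
    by (simp only: o_assoc[symmetric] gen_comp_gen comp_id)
  have na: "ascent (w \<circ> gen i) i \<longleftrightarrow> \<not> ascent w i" if "w \<in> C" for w
    by (rule ascent_gen_not) (use that i in \<open>simp_all add: C_def\<close>)
  have swap1: "(\<Sum>w | w \<in> C \<and> ascent w i. T (w \<circ> gen i)) = (\<Sum>w | w \<in> C \<and> \<not> ascent w i. T w)"
    by (rule sum.reindex_bij_witness[of _ "\<lambda>w. w \<circ> gen i" "\<lambda>w. w \<circ> gen i"])
       (simp_all only: mem_Collect_eq cc C na not_not simp_thms)
  have swap2: "(\<Sum>w | w \<in> C \<and> \<not> ascent w i. T (w \<circ> gen i)) = (\<Sum>w | w \<in> C \<and> ascent w i. T w)"
    by (rule sum.reindex_bij_witness[of _ "\<lambda>w. w \<circ> gen i" "\<lambda>w. w \<circ> gen i"])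
       (simp_all only: mem_Collect_eq cc C na not_not simp_thms)
  have "coset_sum \<beta> f * T (gen i) = (\<Sum>w\<in>C. T w * T (gen i))"
    unfolding coset_sum_def sum_distrib_right C_def ..
  also have "\<dots> = (\<Sum>w | w \<in> C \<and> ascent w i. T (w \<circ> gen i))
     + (\<Sum>w | w \<in> C \<and> \<not> ascent w i. smul (hecke_param i) (T (w \<circ> gen i)) + smul (hecke_param i - 1) (T w))"
    unfolding split by (intro arg_cong2[of _ _ _ _ "(+)"] sum.cong refl) (auto simp: C_def T_gen_right i)
  also have "\<dots> = (\<Sum>w | w \<in> C \<and> \<not> ascent w i. T w) + smul (hecke_param i) (\<Sum>w | w \<in> C \<and> ascent w i. T w)
     + smul (hecke_param i - 1) (\<Sum>w | w \<in> C \<and> \<not> ascent w i. T w)"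
    by (simp only: sum.distrib swap1 swap2 scale_sum_right[symmetric] add.assoc)
  also have "\<dots> = smul (hecke_param i) (sum T C)"
    unfolding split by (simp add: scale_left_diff_distrib scale_right_distrib)
  finally show ?thesis by (simp add: coset_sum_def C_def)
qed

text \<open>A letter swap that is neither an ascent nor trivial is undone by another swap which is an ascent; so
multiplication by generators can always be read in the ascending direction.\<close>

lemma ascent_trichotomy:
  assumes "\<And>z. f (- z) = - f z"
  obtains "ascent f i" | "f \<circ> gen i = f" | "ascent (f \<circ> gen i) i"
proof -
  have "ascent f i \<or> f \<circ> gen i = f \<or> ascent (f \<circ> gen i) i"
  proof (cases "i = 0")
    case True
    then show ?thesis
      using assms[of 1] by (auto simp: ascent_def gen_0_apply fun_eq_iff)
  next
    case False
    have "f (- int i) = - f (int i)" "f (- int i - 1) = - f (int i + 1)"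
      using assms[of "int i"] assms[of "int i + 1"] by simp_all
    then show ?thesis
      using False by (cases "f (int i) = f (int i + 1)") (auto simp: ascent_def gen_apply fun_eq_iff)
  qed
  then show ?thesis using that by blast
qed

text \<open>Follow a word for a coset representative letter by letter. Each letter turns the current coset sum
into the next one up to multiplication by \<open>T (gen i)\<close> or its inverse, or fixes it.\<close>

lemma coset_sum_in_ideal:
  assumes mono: "\<And>x y. x \<le> y \<Longrightarrow> \<beta> x \<le> \<beta> y" and odd: "\<And>z. \<beta> (- z) = - \<beta> z"
  shows "\<exists>y. coset_sum \<beta> f = coset_sum \<beta> \<beta> * y"
proof -
  have zero: "\<beta> 0 = 0" using odd[of 0] by simp
  have word: "\<exists>y. coset_sum \<beta> (\<beta> \<circ> word is) = coset_sum \<beta> \<beta> * y" if "set is \<subseteq> {..<d}" for "is"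
    using that
  proof (induction "is" rule: rev_induct)
    case Nil
    show ?case by (intro exI[of _ 1]) simp
  next
    case (snoc i "is")
    define f where "f = \<beta> \<circ> word is"
    have i: "i < d" using snoc.prems by simp
    have W: "word is \<in> weyl d" using snoc.prems by (simp add: word_weyl)
    have f_odd: "f (- z) = - f z" for z
      by (simp add: f_def odd weyl_odd[OF W])
    have e: "\<beta> \<circ> word (is @ [i]) = f \<circ> gen i" by (simp add: f_def word_snoc o_assoc)
    have "set is \<subseteq> {..<d}" using snoc.prems by simp
    then obtain y where y: "coset_sum \<beta> f = coset_sum \<beta> \<beta> * y" using snoc.IH unfolding f_def by blast
    show ?case
    proof (rule ascent_trichotomy[of f i, OF f_odd])
      assume a: "ascent f i"
      have "coset_sum \<beta> (f \<circ> gen i) = coset_sum \<beta> f * T (gen i)"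
        by (rule coset_sum_ascent[of \<beta>, OF mono zero i a, symmetric])
      also have "\<dots> = coset_sum \<beta> \<beta> * (y * T (gen i))"
        unfolding y by (rule mult.assoc)
      finally have "coset_sum \<beta> (f \<circ> gen i) = coset_sum \<beta> \<beta> * (y * T (gen i))" .
      then show ?thesis unfolding e by blast
    next
      assume "f \<circ> gen i = f"
      then show ?thesis unfolding e using y by auto
    next
      assume "ascent (f \<circ> gen i) i"
      then have "coset_sum \<beta> (f \<circ> gen i) * T (gen i) = coset_sum \<beta> f"
        using coset_sum_ascent[of \<beta>, OF mono zero i] by (simp add: o_assoc[symmetric] gen_comp_gen)
      from mult_T_gen_cancel(1)[OF i this]
      have "coset_sum \<beta> (f \<circ> gen i) = coset_sum \<beta> \<beta> * (y * T_gen_inv i)"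
        unfolding y by (simp only: mult.assoc)
      then show ?thesis unfolding e by blast
    qed
  qed
  show ?thesis
  proof (cases "\<exists>w\<in>weyl d. \<beta> \<circ> w = f")
    case True
    then show ?thesis using word word_exists by blast
  next
    case False
    then have "{w. w \<in> weyl d \<and> \<beta> \<circ> w = f} = {}" by blast
    then have "coset_sum \<beta> f = coset_sum \<beta> \<beta> * 0" unfolding coset_sum_def by (simp only: sum.empty mult_zero_right)
    then show ?thesis by blast
  qed
qed

text \<open>The mirror image: left cosets are recorded by the patterns of the inverses of their elements.\<close>

definition left_coset_sum :: "(int \<Rightarrow> int) \<Rightarrow> (int \<Rightarrow> int) \<Rightarrow> 'h" where
  "left_coset_sum \<beta> f = (\<Sum>w | w \<in> weyl d \<and> \<beta> \<circ> winv w = f. T w)"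

lemma left_coset_sum_ascent:
  assumes mono: "\<And>x y. x \<le> y \<Longrightarrow> \<beta> x \<le> \<beta> y" and zero: "\<beta> 0 = 0" and i: "i < d" and f: "ascent f i"
  shows "T (gen i) * left_coset_sum \<beta> f = left_coset_sum \<beta> (f \<circ> gen i)"
proof -
  have "T (gen i) * T w = T (gen i \<circ> w)" if "w \<in> weyl d" "\<beta> \<circ> winv w = f" for w
  proof (rule T_gen_left[OF that(1) i])
    show "ascent (winv w) i"
      using f that(2) mono[of "winv w 1" 0] mono[of "winv w (int i + 1)" "winv w (int i)"] zero
      by (force simp: ascent_def fun_eq_iff not_less[symmetric])
  qed
  then have "T (gen i) * left_coset_sum \<beta> f = (\<Sum>w | w \<in> weyl d \<and> \<beta> \<circ> winv w = f. T (gen i \<circ> w))"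
    unfolding left_coset_sum_def sum_distrib_left by (intro sum.cong) auto
  also have "\<dots> = left_coset_sum \<beta> (f \<circ> gen i)"
  proof -
    have inv: "winv (gen i \<circ> w) = winv w \<circ> gen i" if "w \<in> weyl d" for w
      by (simp add: o_inv_distrib gen_bij gen_inv weyl_bij[OF that])
    have f2: "f \<circ> gen i \<circ> gen i = f" by (simp add: o_assoc[symmetric] gen_comp_gen)
    show ?thesis
      unfolding left_coset_sum_def
    proof (rule sum.reindex_bij_witness[of _ "\<lambda>w. gen i \<circ> w" "\<lambda>w. gen i \<circ> w"])
      fix w assume w: "w \<in> {w. w \<in> weyl d \<and> \<beta> \<circ> winv w = f}"
      then show "gen i \<circ> (gen i \<circ> w) = w" by (simp add: o_assoc gen_comp_gen)
      show "gen i \<circ> w \<in> {w. w \<in> weyl d \<and> \<beta> \<circ> winv w = f \<circ> gen i}"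
        using w by (simp only: mem_Collect_eq inv o_assoc) (simp add: weyl_comp gen_weyl i)
    next
      fix w assume w: "w \<in> {w. w \<in> weyl d \<and> \<beta> \<circ> winv w = f \<circ> gen i}"
      then show "gen i \<circ> (gen i \<circ> w) = w" by (simp add: o_assoc gen_comp_gen)
      show "gen i \<circ> w \<in> {w. w \<in> weyl d \<and> \<beta> \<circ> winv w = f}"
        using w by (simp only: mem_Collect_eq inv o_assoc f2) (simp add: weyl_comp gen_weyl i f2)
    qed simp
  qed
  finally show ?thesis .
qed

lemma left_coset_sum_in_ideal:
  assumes mono: "\<And>x y. x \<le> y \<Longrightarrow> \<beta> x \<le> \<beta> y" and odd: "\<And>z. \<beta> (- z) = - \<beta> z"
  shows "\<exists>y. left_coset_sum \<beta> f = y * left_coset_sum \<beta> \<beta>"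
proof -
  have zero: "\<beta> 0 = 0" using odd[of 0] by simp
  have word: "\<exists>y. left_coset_sum \<beta> (\<beta> \<circ> word is) = y * left_coset_sum \<beta> \<beta>" if "set is \<subseteq> {..<d}" for "is"
    using that
  proof (induction "is" rule: rev_induct)
    case Nil
    show ?case by (intro exI[of _ 1]) simp
  next
    case (snoc i "is")
    define f where "f = \<beta> \<circ> word is"
    have i: "i < d" using snoc.prems by simp
    have W: "word is \<in> weyl d" using snoc.prems by (simp add: word_weyl)
    have f_odd: "f (- z) = - f z" for z
      by (simp add: f_def odd weyl_odd[OF W])
    have e: "\<beta> \<circ> word (is @ [i]) = f \<circ> gen i" by (simp add: f_def word_snoc o_assoc)
    have "set is \<subseteq> {..<d}" using snoc.prems by simp
    then obtain y where y: "left_coset_sum \<beta> f = y * left_coset_sum \<beta> \<beta>" using snoc.IH unfolding f_def by blast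
    show ?case
    proof (rule ascent_trichotomy[of f i, OF f_odd])
      assume a: "ascent f i"
      have "left_coset_sum \<beta> (f \<circ> gen i) = T (gen i) * left_coset_sum \<beta> f"
        by (rule left_coset_sum_ascent[of \<beta>, OF mono zero i a, symmetric])
      also have "\<dots> = (T (gen i) * y) * left_coset_sum \<beta> \<beta>"
        unfolding y by (rule mult.assoc[symmetric])
      finally have "left_coset_sum \<beta> (f \<circ> gen i) = (T (gen i) * y) * left_coset_sum \<beta> \<beta>" .
      then show ?thesis unfolding e by blast
    next
      assume "f \<circ> gen i = f"
      then show ?thesis unfolding e using y by auto
    next
      assume "ascent (f \<circ> gen i) i"
      then have "T (gen i) * left_coset_sum \<beta> (f \<circ> gen i) = left_coset_sum \<beta> f"
        using left_coset_sum_ascent[of \<beta>, OF mono zero i] by (simp add: o_assoc[symmetric] gen_comp_gen)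
      from mult_T_gen_cancel(2)[OF i this]
      have "left_coset_sum \<beta> (f \<circ> gen i) = (T_gen_inv i * y) * left_coset_sum \<beta> \<beta>"
        unfolding y by (simp only: mult.assoc)
      then show ?thesis unfolding e by blast
    qed
  qed
  show ?thesis
  proof (cases "\<exists>w\<in>weyl d. \<beta> \<circ> w = f")
    case True
    then show ?thesis using word word_exists by blast
  next
    case False
    then have "{w. w \<in> weyl d \<and> \<beta> \<circ> winv w = f} = {}" using weyl_inv by blast
    then have "left_coset_sum \<beta> f = 0 * left_coset_sum \<beta> \<beta>" unfolding left_coset_sum_def by (simp only: sum.empty mult_zero_left)
    then show ?thesis by blast
  qed
qed

text \<open>Each single coset sum is a multiple of the parabolic sum, hence so is a sum over a union of cosets. This is applied on both sides to the sum over a double coset.\<close>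

lemma sum_T_in_right_ideal:
  assumes mono: "\<And>x y. x \<le> y \<Longrightarrow> \<beta> x \<le> \<beta> y" and odd: "\<And>z. \<beta> (- z) = - \<beta> z"
    and D: "D \<subseteq> weyl d" "\<And>v w. v \<in> D \<Longrightarrow> w \<in> weyl d \<Longrightarrow> \<beta> \<circ> v = \<beta> \<circ> w \<Longrightarrow> w \<in> D"
  shows "\<exists>y. sum T D = coset_sum \<beta> \<beta> * y"
proof -
  have fin: "finite D" by (rule finite_subset[OF D(1) finite_weyl])
  have "\<forall>f. \<exists>y. coset_sum \<beta> f = coset_sum \<beta> \<beta> * y"
    using coset_sum_in_ideal[of \<beta>, OF mono odd] by blast
  then obtain y where y: "\<And>f. coset_sum \<beta> f = coset_sum \<beta> \<beta> * y f"
    unfolding choice_iff by blast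
  have "sum T D = (\<Sum>f \<in> (\<lambda>w. \<beta> \<circ> w) ` D. \<Sum>w | w \<in> D \<and> \<beta> \<circ> w = f. T w)"
    using sum.image_gen[OF fin, of T "\<lambda>w. \<beta> \<circ> w"] .
  also have "\<dots> = (\<Sum>f \<in> (\<lambda>w. \<beta> \<circ> w) ` D. coset_sum \<beta> f)"
    unfolding coset_sum_def
  proof (intro sum.cong refl)
    fix f assume "f \<in> (\<lambda>w. \<beta> \<circ> w) ` D"
    then obtain v where v: "v \<in> D" "f = \<beta> \<circ> v" by blast
    have "w \<in> D" if "w \<in> weyl d" "\<beta> \<circ> w = f" for w
      by (rule D(2)[OF v(1) that(1)]) (simp only: that(2) v(2))
    then show "{w. w \<in> D \<and> \<beta> \<circ> w = f} = {w. w \<in> weyl d \<and> \<beta> \<circ> w = f}"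
      using D(1) by blast
  qed
  also have "\<dots> = coset_sum \<beta> \<beta> * (\<Sum>f \<in> (\<lambda>w. \<beta> \<circ> w) ` D. y f)"
    unfolding sum_distrib_left by (rule sum.cong[OF refl y])
  finally show ?thesis by blast
qed

lemma sum_T_in_left_ideal:
  assumes mono: "\<And>x y. x \<le> y \<Longrightarrow> \<beta> x \<le> \<beta> y" and odd: "\<And>z. \<beta> (- z) = - \<beta> z"
    and D: "D \<subseteq> weyl d" "\<And>v w. v \<in> D \<Longrightarrow> w \<in> weyl d \<Longrightarrow> \<beta> \<circ> winv v = \<beta> \<circ> winv w \<Longrightarrow> w \<in> D"
  shows "\<exists>y. sum T D = y * left_coset_sum \<beta> \<beta>"
proof -
  have fin: "finite D" by (rule finite_subset[OF D(1) finite_weyl])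
  have "\<forall>f. \<exists>y. left_coset_sum \<beta> f = y * left_coset_sum \<beta> \<beta>"
    using left_coset_sum_in_ideal[of \<beta>, OF mono odd] by blast
  then obtain y where y: "\<And>f. left_coset_sum \<beta> f = y f * left_coset_sum \<beta> \<beta>"
    unfolding choice_iff by blast
  have "sum T D = (\<Sum>f \<in> (\<lambda>w. \<beta> \<circ> winv w) ` D. \<Sum>w | w \<in> D \<and> \<beta> \<circ> winv w = f. T w)"
    using sum.image_gen[OF fin, of T "\<lambda>w. \<beta> \<circ> winv w"] .
  also have "\<dots> = (\<Sum>f \<in> (\<lambda>w. \<beta> \<circ> winv w) ` D. left_coset_sum \<beta> f)"
    unfolding left_coset_sum_def
  proof (intro sum.cong refl)
    fix f assume "f \<in> (\<lambda>w. \<beta> \<circ> winv w) ` D"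
    then obtain v where v: "v \<in> D" "f = \<beta> \<circ> winv v" by blast
    have "w \<in> D" if "w \<in> weyl d" "\<beta> \<circ> winv w = f" for w
      by (rule D(2)[OF v(1) that(1)]) (simp only: that(2) v(2))
    then show "{w. w \<in> D \<and> \<beta> \<circ> winv w = f} = {w. w \<in> weyl d \<and> \<beta> \<circ> winv w = f}"
      using D(1) by blast
  qed
  also have "\<dots> = (\<Sum>f \<in> (\<lambda>w. \<beta> \<circ> winv w) ` D. y f) * left_coset_sum \<beta> \<beta>"
    unfolding sum_distrib_right by (rule sum.cong[OF refl y])
  finally show ?thesis by blast
qed

lemma left_coset_sum_base: "left_coset_sum \<beta> \<beta> = coset_sum \<beta> \<beta>"
proof -
  have "\<beta> \<circ> winv w = \<beta> \<longleftrightarrow> \<beta> \<circ> w = \<beta>" if "w \<in> weyl d" for w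
    using weyl_inv_comp[OF that] by (metis comp_id o_assoc)
  then show ?thesis unfolding left_coset_sum_def coset_sum_def by (intro sum.cong) auto
qed

end

section \<open>Lengths of matrices\<close>

text \<open>
  Sums with truth-valued weights are kept in this form from here to the end of the section, so that
  sums with different conditions can be added termwise.\<close>

declare sum_of_bool_mult_eq [simp del] sum_mult_of_bool_eq [simp del]

text \<open>The evenness of the sums that are halved in \<open>ell_hat\<close> comes from the half turn of the index square,
which pairs off all terms except those it fixes.\<close>

lemma even_sum_involution:
  fixes g :: "'a \<Rightarrow> int"
  assumes "finite S" "\<And>s. s \<in> S \<Longrightarrow> \<iota> s \<in> S" "\<And>s. s \<in> S \<Longrightarrow> \<iota> (\<iota> s) = s" "\<And>s. s \<in> S \<Longrightarrow> g (\<iota> s) = g s"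
  shows "even (sum g S - sum g {s \<in> S. \<iota> s = s})"
  using assms
proof (induction "card S" arbitrary: S rule: less_induct)
  case less
  show ?case
  proof (cases "\<forall>s\<in>S. \<iota> s = s")
    case True
    then have "{s \<in> S. \<iota> s = s} = S" by blast
    then show ?thesis by simp
  next
    case False
    then obtain s where s: "s \<in> S" "\<iota> s \<noteq> s" by blast
    define S' where "S' = S - {s, \<iota> s}"
    have S: "S = insert s (insert (\<iota> s) S')" "s \<notin> insert (\<iota> s) S'" "\<iota> s \<notin> S'" "finite S'"
      using s less.prems(1,2) by (auto simp: S'_def)
    have "even (sum g S' - sum g {s \<in> S'. \<iota> s = s})"
    proof (rule less.hyps)
      show "card S' < card S"
        using s less.prems(1) unfolding S'_def by (intro psubset_card_mono) auto
      fix x assume x: "x \<in> S'"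
      then have xS: "x \<in> S" by (simp add: S'_def)
      show "\<iota> (\<iota> x) = x" "g (\<iota> x) = g x" using less.prems(3,4)[OF xS] by auto
      show "\<iota> x \<in> S'"
        using x less.prems(2,3)[OF xS] less.prems(3)[OF s(1)] by (auto simp: S'_def)
    qed (use S in auto)
    moreover have "{s \<in> S. \<iota> s = s} = {s \<in> S'. \<iota> s = s}"
      using s less.prems(3)[OF s(1)] by (auto simp: S'_def)
    moreover have "sum g S = 2 * g s + sum g S'"
      using S less.prems(4)[OF s(1)] by (subst S(1)) simp
    ultimately show ?thesis by simp
  qed
qed

lemma finite_idx [simp]: "finite (idx n)"
  by (simp add: idx_def)

lemma idx_uminus [simp]: "- i \<in> idx n \<longleftrightarrow> i \<in> idx n"
  by (auto simp: idx_def)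

lemma sum_idx_uminus: "(\<Sum>i\<in>idx n. f (- i)) = (\<Sum>i\<in>idx n. f i)"
  by (rule sum.reindex_bij_witness[of _ uminus uminus]) auto

lemma sum_idx_halves: "(\<Sum>l\<in>idx n. f l) = f 0 + (\<Sum>l = 1..int n. f l + f (- l))" for f :: "int \<Rightarrow> int"
proof -
  have "idx n = insert 0 ({1..int n} \<union> uminus ` {1..int n})"
  proof (intro Set.set_eqI iffI)
    fix z assume z: "z \<in> idx n"
    consider "z = 0" | "0 < z" | "z < 0" by linarith
    then show "z \<in> insert 0 ({1..int n} \<union> uminus ` {1..int n})"
    proof cases
      case 3
      then have "- z \<in> {1..int n}" using z by (simp add: idx_def)
      then have "z \<in> uminus ` {1..int n}" by force
      then show ?thesis by blast
    qed (use z in \<open>simp_all add: idx_def\<close>)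
  qed (auto simp: idx_def)
  moreover have "sum f (uminus ` {1..int n}) = (\<Sum>l = 1..int n. f (- l))" by (subst sum.reindex) auto
  moreover have "{1..int n} \<inter> uminus ` {1..int n} = {}" "0 \<notin> {1..int n} \<union> uminus ` {1..int n}" by auto
  ultimately show ?thesis by (simp add: sum.union_disjoint sum.distrib)
qed

lemma sum_idx_uminus2: "(\<Sum>x\<in>idx n. \<Sum>y\<in>idx n. f (- x) (- y)) = (\<Sum>x\<in>idx n. \<Sum>y\<in>idx n. f x y)"
proof -
  have "(\<Sum>x\<in>idx n. \<Sum>y\<in>idx n. f (- x) (- y)) = (\<Sum>x\<in>idx n. \<Sum>y\<in>idx n. f (- x) y)"
    by (rule sum.cong[OF refl]) (rule sum_idx_uminus)
  then show ?thesis using sum_idx_uminus[of "\<lambda>x. \<Sum>y\<in>idx n. f x y" n] by (rule trans)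
qed

text \<open>The double sum behind \<open>ell_hat\<close>, extended over all positions. It is bilinear, so that its change under
moving units between rows can be expanded.\<close>

definition ne_form :: "nat \<Rightarrow> mat \<Rightarrow> mat \<Rightarrow> int" where
  "ne_form n P R = (\<Sum>i\<in>idx n. \<Sum>j\<in>idx n. \<Sum>x\<in>idx n. \<Sum>y\<in>idx n. of_bool (x \<le> i \<and> j < y) * (P i j * R x y))"

definition corner_sum :: "nat \<Rightarrow> mat \<Rightarrow> int \<Rightarrow> int \<Rightarrow> int" where
  "corner_sum n A i j = (\<Sum>x\<in>idx n. \<Sum>y\<in>idx n. of_bool (x \<le> i \<and> j < y) * A x y)
     + (\<Sum>x\<in>idx n. \<Sum>y\<in>idx n. of_bool (i \<le> x \<and> y < j) * A x y)"

definition west_sum :: "nat \<Rightarrow> mat \<Rightarrow> int" where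
  "west_sum n A = (\<Sum>x\<in>idx n. \<Sum>y\<in>idx n. of_bool (0 \<le> x \<and> y < 0) * A x y)"

definition central_symm :: "mat \<Rightarrow> bool" where
  "central_symm A \<longleftrightarrow> (\<forall>i j. A (- i) (- j) = A i j)"

lemma ne_form_add: "ne_form n (\<lambda>i j. P i j + M i j) (\<lambda>i j. P i j + M i j)
   = ne_form n P P + ne_form n P M + ne_form n M P + ne_form n M M"
  unfolding ne_form_def sum.distrib[symmetric] by (intro sum.cong refl) (simp add: algebra_simps)

lemma sum_swap4:
  "(\<Sum>i\<in>I. \<Sum>j\<in>I. \<Sum>x\<in>I. \<Sum>y\<in>I. f i j x y) = (\<Sum>x\<in>I. \<Sum>y\<in>I. \<Sum>i\<in>I. \<Sum>j\<in>I. f i j x y)"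
  for f :: "'a \<Rightarrow> 'a \<Rightarrow> 'a \<Rightarrow> 'a \<Rightarrow> 'b::comm_monoid_add"
proof -
  have "(\<Sum>i\<in>I. \<Sum>j\<in>I. \<Sum>x\<in>I. \<Sum>y\<in>I. f i j x y) = (\<Sum>i\<in>I. \<Sum>x\<in>I. \<Sum>j\<in>I. \<Sum>y\<in>I. f i j x y)"
    by (rule sum.cong[OF refl], rule sum.swap)
  also have "\<dots> = (\<Sum>x\<in>I. \<Sum>i\<in>I. \<Sum>j\<in>I. \<Sum>y\<in>I. f i j x y)"
    by (rule sum.swap)
  also have "\<dots> = (\<Sum>x\<in>I. \<Sum>i\<in>I. \<Sum>y\<in>I. \<Sum>j\<in>I. f i j x y)"
    by (rule sum.cong[OF refl], rule sum.cong[OF refl], rule sum.swap)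
  also have "\<dots> = (\<Sum>x\<in>I. \<Sum>y\<in>I. \<Sum>i\<in>I. \<Sum>j\<in>I. f i j x y)"
    by (rule sum.cong[OF refl], rule sum.swap)
  finally show ?thesis .
qed

lemma corner_sum_form:
  "(\<Sum>i\<in>idx n. \<Sum>j\<in>idx n. M i j * corner_sum n A i j) = ne_form n M A + ne_form n A M"
proof -
  have e: "ne_form n A M = (\<Sum>i\<in>idx n. \<Sum>j\<in>idx n. \<Sum>x\<in>idx n. \<Sum>y\<in>idx n. of_bool (i \<le> x \<and> y < j) * (A x y * M i j))"
    unfolding ne_form_def by (rule sum_swap4)
  show ?thesis
    unfolding e unfolding ne_form_def corner_sum_def
    by (simp only: distrib_left sum_distrib_left sum.distrib) (simp only: mult_ac)
qed

lemma corner_sum_central_symm: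
  assumes "central_symm A"
  shows "corner_sum n A (- i) (- j) = corner_sum n A i j"
proof -
  have "corner_sum n A (- i) (- j)
    = (\<Sum>x\<in>idx n. \<Sum>y\<in>idx n. of_bool (- x \<le> - i \<and> - j < - y) * A (- x) (- y))
     + (\<Sum>x\<in>idx n. \<Sum>y\<in>idx n. of_bool (- i \<le> - x \<and> - y < - j) * A (- x) (- y))"
    unfolding corner_sum_def
      sum_idx_uminus2[of "\<lambda>x y. of_bool (x \<le> - i \<and> - j < y) * A x y"]
      sum_idx_uminus2[of "\<lambda>x y. of_bool (- i \<le> x \<and> y < - j) * A x y"] ..
  then show ?thesis
    using assms unfolding corner_sum_def central_symm_def by simp
qed

lemma corner_sum_zero:
  assumes "central_symm A"
  shows "corner_sum n A 0 0 = 2 * west_sum n A"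
proof -
  have "west_sum n A = (\<Sum>x\<in>idx n. \<Sum>y\<in>idx n. of_bool (0 \<le> - x \<and> - y < 0) * A (- x) (- y))"
    unfolding west_sum_def sum_idx_uminus2[of "\<lambda>x y. of_bool (0 \<le> x \<and> y < 0) * A x y"] ..
  also have "\<dots> = (\<Sum>x\<in>idx n. \<Sum>y\<in>idx n. of_bool (x \<le> 0 \<and> 0 < y) * A x y)"
    using assms by (simp add: central_symm_def)
  finally show ?thesis
    unfolding corner_sum_def west_sum_def by simp
qed

lemma sum_filter_of_bool:
  "finite I \<Longrightarrow> finite J \<Longrightarrow> (\<Sum>(x, y) \<in> {(x, y) \<in> I \<times> J. P x y}. f x y) = (\<Sum>x\<in>I. \<Sum>y\<in>J. of_bool (P x y) * f x y)"
  for f :: "'a \<Rightarrow> 'b \<Rightarrow> int"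
proof -
  assume fin: "finite I" "finite J"
  have "(\<Sum>x\<in>I. \<Sum>y\<in>J. of_bool (P x y) * f x y) = (\<Sum>(x, y) \<in> I \<times> J. of_bool (P x y) * f x y)"
    by (rule sum.cartesian_product)
  also have "\<dots> = (\<Sum>p \<in> I \<times> J. if case p of (x, y) \<Rightarrow> P x y then case p of (x, y) \<Rightarrow> f x y else 0)"
    by (rule sum.cong) auto
  also have "\<dots> = (\<Sum>(x, y) \<in> {(x, y) \<in> I \<times> J. P x y}. f x y)"
  proof -
    have "{(x, y) \<in> I \<times> J. P x y} = {p \<in> I \<times> J. case p of (x, y) \<Rightarrow> P x y}"
      by auto
    then show ?thesis
      using sum.inter_filter[of "I \<times> J" "\<lambda>(x, y). f x y" "\<lambda>(x, y). P x y"] fin by simp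
  qed
  finally show ?thesis ..
qed

lemma ell_hat_c_eq:
  assumes "central_symm A"
  shows "ell_hat_c n A = west_sum n A"
proof -
  have "ell_hat_c n A = (corner_sum n A 0 0) div 2"
    unfolding ell_hat_c_def corner_sum_def by (simp only: sum_filter_of_bool[OF finite_idx finite_idx] add.commute)
  then show ?thesis using corner_sum_zero[OF assms] by simp
qed

lemma idx_I_a:
  "idx n \<times> idx n = insert (0, 0) (I_a n \<union> (\<lambda>(i, j). (- i, - j)) ` I_a n)"
  "(0, 0) \<notin> I_a n \<union> (\<lambda>(i, j). (- i, - j)) ` I_a n"
  "I_a n \<inter> (\<lambda>(i, j). (- i, - j)) ` I_a n = {}"
proof -
  have im: "(i, j) \<in> (\<lambda>(i, j). (- i, - j)) ` I_a n \<longleftrightarrow> (- i, - j) \<in> I_a n" for i j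
    by (force simp: image_iff)
  have mem: "(i, j) \<in> I_a n \<longleftrightarrow> i \<in> idx n \<and> j \<in> idx n \<and> (0 < i \<or> i = 0 \<and> 0 < j)" for i j
    by (auto simp: I_a_def idx_def)
  show "idx n \<times> idx n = insert (0, 0) (I_a n \<union> (\<lambda>(i, j). (- i, - j)) ` I_a n)"
  proof (rule Set.set_eqI)
    fix p :: "int \<times> int"
    obtain i j where p: "p = (i, j)" by (cases p)
    show "p \<in> idx n \<times> idx n \<longleftrightarrow> p \<in> insert (0, 0) (I_a n \<union> (\<lambda>(i, j). (- i, - j)) ` I_a n)"
      unfolding p insert_iff Un_iff im mem by (auto simp: idx_def)
  qed
  show "(0, 0) \<notin> I_a n \<union> (\<lambda>(i, j). (- i, - j)) ` I_a n"
    using im[of 0 0] mem[of 0 0] by auto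
  show "I_a n \<inter> (\<lambda>(i, j). (- i, - j)) ` I_a n = {}"
  proof (rule equals0I)
    fix p assume "p \<in> I_a n \<inter> (\<lambda>(i, j). (- i, - j)) ` I_a n"
    then show False using im[of "fst p" "snd p"] mem[of "fst p" "snd p"] mem[of "- fst p" "- snd p"] by auto
  qed
qed

lemma finite_I_a: "finite (I_a n)"
  by (auto simp: I_a_def)

text \<open>The index set \<open>I_a\<close> contains one position from each pair of opposite positions other than \<open>(0, 0)\<close>, and
the corner sums agree on opposite positions. The corner sum at \<open>(0, 0)\<close>, which enters with the
halved entry, accounts for the correction term.\<close>

lemma ell_hat_sum:
  assumes "central_symm A" "odd (A 0 0)"
  shows "(\<Sum>(i, j) \<in> I_c n.
        (\<Sum>(x, y) \<in> {(x, y) \<in> idx n \<times> idx n. x \<le> i \<and> y > j}. natural A i j * A x y) +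
        (\<Sum>(x, y) \<in> {(x, y) \<in> idx n \<times> idx n. x \<ge> i \<and> y < j}. natural A i j * A x y))
     = ne_form n A A - west_sum n A"
proof -
  define G where "G = (\<lambda>(i, j). corner_sum n A i j)"
  have L: "(\<Sum>(i, j) \<in> I_c n.
        (\<Sum>(x, y) \<in> {(x, y) \<in> idx n \<times> idx n. x \<le> i \<and> y > j}. natural A i j * A x y) +
        (\<Sum>(x, y) \<in> {(x, y) \<in> idx n \<times> idx n. x \<ge> i \<and> y < j}. natural A i j * A x y))
     = (\<Sum>(i, j) \<in> I_c n. natural A i j * corner_sum n A i j)"
    by (rule sum.cong[OF refl], clarify)
       (simp only: sum_filter_of_bool[OF finite_idx finite_idx] corner_sum_def distrib_left sum_distrib_left mult.left_commute)
  have 0: "(0, 0) \<notin> I_a n" using idx_I_a(2) by blast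
  have a: "(\<Sum>(i, j) \<in> I_c n. natural A i j * corner_sum n A i j)
     = natural A 0 0 * corner_sum n A 0 0 + (\<Sum>(i, j) \<in> I_a n. A i j * corner_sum n A i j)"
  proof -
    have "(\<Sum>(i, j) \<in> I_a n. natural A i j * corner_sum n A i j) = (\<Sum>(i, j) \<in> I_a n. A i j * corner_sum n A i j)"
      using 0 by (intro sum.cong refl) (auto simp: natural_def)
    then show ?thesis using 0 finite_I_a by (simp add: I_c_def)
  qed
  have inj: "inj_on (\<lambda>(i, j). (- i, - j)) (I_a n)" for n
    by (auto simp: inj_on_def)
  have "2 * ne_form n A A = (\<Sum>i\<in>idx n. \<Sum>j\<in>idx n. A i j * corner_sum n A i j)"
    unfolding corner_sum_form by simp
  also have "\<dots> = (\<Sum>(i, j) \<in> idx n \<times> idx n. A i j * corner_sum n A i j)"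
    by (simp add: sum.cartesian_product)
  also have "\<dots> = A 0 0 * corner_sum n A 0 0 + ((\<Sum>(i, j) \<in> I_a n. A i j * corner_sum n A i j)
      + (\<Sum>(i, j) \<in> (\<lambda>(i, j). (- i, - j)) ` I_a n. A i j * corner_sum n A i j))"
    unfolding idx_I_a(1) using idx_I_a(2,3) finite_I_a by (subst sum.insert; simp add: sum.union_disjoint)
  also have "(\<Sum>(i, j) \<in> (\<lambda>(i, j). (- i, - j)) ` I_a n. A i j * corner_sum n A i j)
      = (\<Sum>(i, j) \<in> I_a n. A i j * corner_sum n A i j)"
    using assms(1) corner_sum_central_symm[OF assms(1)]
    by (subst sum.reindex[OF inj]) (auto intro!: sum.cong simp: central_symm_def)
  finally have "2 * ne_form n A A = A 0 0 * corner_sum n A 0 0 + 2 * (\<Sum>(i, j) \<in> I_a n. A i j * corner_sum n A i j)"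
    by simp
  moreover have "A 0 0 = 2 * natural A 0 0 + 1"
    using assms(2) by (auto simp: natural_def elim!: oddE)
  ultimately have "2 * ne_form n A A = 2 * (natural A 0 0 * corner_sum n A 0 0 + (\<Sum>(i, j) \<in> I_a n. A i j * corner_sum n A i j))
     + corner_sum n A 0 0"
    by (simp add: algebra_simps)
  then show ?thesis
    unfolding L a using corner_sum_zero[OF assms(1), of n] by simp
qed

text \<open>The half turn exchanges the two positions of a pair and negates them. The pairs it fixes consist of
opposite positions and contribute squares of entries, which have the parity of the entries
themselves.\<close>

lemma ne_form_parity:
  assumes "central_symm A"
  shows "even (ne_form n A A - west_sum n A)"
proof -
  define S where "S = {(i, j, x, y). i \<in> idx n \<and> j \<in> idx n \<and> x \<in> idx n \<and> y \<in> idx n \<and> x \<le> i \<and> j < y}"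
  define g where "g = (\<lambda>(i, j, x, y). A i j * A x y)"
  \<comment> \<open>Exchange the two positions and apply the half turn; this preserves the relative position.\<close>
  define \<iota> where "\<iota> = (\<lambda>(i, j, x, y). (- x, - y, - i, - j) :: int \<times> int \<times> int \<times> int)"
  have fin: "finite S"
    by (rule finite_subset[of _ "idx n \<times> idx n \<times> idx n \<times> idx n"]) (auto simp: S_def)
  have even1: "even (sum g S - sum g {s \<in> S. \<iota> s = s})"
    by (rule even_sum_involution[OF fin]) (use assms in \<open>auto simp: S_def g_def \<iota>_def central_symm_def\<close>)
  have ne: "sum g S = ne_form n A A"
  proof -
    have "ne_form n A A = (\<Sum>p \<in> idx n \<times> idx n \<times> idx n \<times> idx n. if p \<in> S then g p else 0)"
      unfolding ne_form_def sum.cartesian_product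
      by (intro sum.cong) (auto simp: S_def g_def)
    also have "\<dots> = sum g {p \<in> idx n \<times> idx n \<times> idx n \<times> idx n. p \<in> S}"
      by (rule sum.inter_filter[symmetric]) simp
    also have "{p \<in> idx n \<times> idx n \<times> idx n \<times> idx n. p \<in> S} = S"
      by (auto simp: S_def)
    finally show ?thesis by simp
  qed
  have even2: "even (sum g {s \<in> S. \<iota> s = s} - west_sum n A)"
  proof -
    define R where "R = {(i, j) \<in> idx n \<times> idx n. 0 \<le> i \<and> j < 0}"
    have fixed: "\<iota> (i, j, x, y) = (i, j, x, y) \<longleftrightarrow> x = - i \<and> y = - j" for i j x y
      unfolding \<iota>_def prod.case prod.inject by linarith
    have "{s \<in> S. \<iota> s = s} = (\<lambda>(i, j). (i, j, - i, - j)) ` R"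
    proof (intro Set.set_eqI iffI)
      fix s assume s: "s \<in> {s \<in> S. \<iota> s = s}"
      obtain i j x y where e: "s = (i, j, x, y)" by (cases s)
      have "x = - i" "y = - j" using s fixed[of i j x y] by (simp_all add: e)
      moreover have "(i, j) \<in> R" using s calculation by (simp add: e S_def R_def)
      ultimately show "s \<in> (\<lambda>(i, j). (i, j, - i, - j)) ` R" unfolding e by (intro image_eqI[of _ _ "(i, j)"]) simp_all
    next
      fix s assume "s \<in> (\<lambda>(i, j). (i, j, - i, - j)) ` R"
      then obtain r where r: "r \<in> R" "s = (case r of (i, j) \<Rightarrow> (i, j, - i, - j))" by blast
      obtain i j where "r = (i, j)" by (cases r)
      with r have e: "s = (i, j, - i, - j)" "(i, j) \<in> R" by simp_all
      then have "s \<in> S" by (simp add: S_def R_def)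
      then show "s \<in> {s \<in> S. \<iota> s = s}" using fixed[of i j "- i" "- j"] by (simp add: e)
    qed
    then have "sum g {s \<in> S. \<iota> s = s} = (\<Sum>r\<in>R. g (case r of (i, j) \<Rightarrow> (i, j, - i, - j)))"
      by (simp add: sum.reindex inj_on_def case_prod_beta prod_eq_iff)
    also have "\<dots> = (\<Sum>(i, j) \<in> {(i, j) \<in> idx n \<times> idx n. 0 \<le> i \<and> j < 0}. A i j * A i j)"
      unfolding R_def[symmetric]
    proof (rule sum.cong[OF refl], clarify)
      fix i j
      have "A (- i) (- j) = A i j" using assms by (simp add: central_symm_def)
      then show "g (i, j, - i, - j) = A i j * A i j" by (simp add: g_def)
    qed
    finally have 1: "sum g {s \<in> S. \<iota> s = s} = (\<Sum>(i, j) \<in> {(i, j) \<in> idx n \<times> idx n. 0 \<le> i \<and> j < 0}. A i j * A i j)" .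
    have 2: "(\<Sum>(i, j) \<in> {(i, j) \<in> idx n \<times> idx n. 0 \<le> i \<and> j < 0}. A i j * A i j) - west_sum n A = (\<Sum>i\<in>idx n. \<Sum>j\<in>idx n. of_bool (0 \<le> i \<and> j < 0) * (A i j * A i j - A i j))"
      unfolding west_sum_def
      by (simp only: sum_filter_of_bool[OF finite_idx finite_idx] right_diff_distrib sum_subtractf)
    show ?thesis
      unfolding 1 2
    proof (intro dvd_sum dvd_mult)
      show "even (A i j * A i j - A i j)" for i j by simp
    qed
  qed
  show ?thesis using dvd_add[OF even1 even2] ne by simp
qed

lemma ell_hat_eq:
  assumes "central_symm A" "odd (A 0 0)"
  shows "2 * ell_hat n A = ne_form n A A - west_sum n A"
proof -
  have "ell_hat n A = (ne_form n A A - west_sum n A) div 2"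
    using arg_cong[OF ell_hat_sum[OF assms, of n], of "\<lambda>x. x div 2"] unfolding ell_hat_def .
  then show ?thesis using ne_form_parity[OF assms(1), of n] by simp
qed

lemma ell_hat_a_eq:
  assumes "central_symm A" "odd (A 0 0)"
  shows "2 * ell_hat_a n A = ne_form n A A - 3 * west_sum n A"
  using ell_hat_eq[OF assms, of n] ell_hat_c_eq[OF assms(1), of n] by (simp add: ell_hat_a_def)

text \<open>Moving \<open>t\<^sub>l\<close> units from row \<open>h - 1\<close> to row \<open>h\<close> in each column \<open>l\<close>, together with the opposite
entries. Negative values of \<open>t\<close> are allowed, so that the same formulas cover moves in the other
direction.\<close>

definition move :: "int \<Rightarrow> (int \<Rightarrow> int) \<Rightarrow> mat" where
  "move h t = (\<lambda>i j. t j * (of_bool (i = h) - of_bool (i = h - 1)) + t (- j) * (of_bool (- i = h) - of_bool (- i = h - 1)))"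

lemma central_symm_move: "central_symm (move h t)"
  by (auto simp: central_symm_def move_def)

lemma sum_move:
  assumes h: "1 \<le> h" "h \<le> int n" and G: "\<And>i j. G (- i) (- j) = G i j"
  shows "(\<Sum>i\<in>idx n. \<Sum>j\<in>idx n. move h t i j * G i j) = 2 * (\<Sum>j\<in>idx n. t j * (G h j - G (h - 1) j))"
proof -
  have hm: "h \<in> idx n" "h - 1 \<in> idx n" using h by (auto simp: idx_def)
  have one: "(\<Sum>i\<in>idx n. (of_bool (i = h) - of_bool (i = h - 1)) * f i) = f h - f (h - 1)" for f :: "int \<Rightarrow> int"
    using hm by (simp add: left_diff_distrib sum_subtractf of_bool_def if_distrib[of "\<lambda>x. x * _"] cong: if_cong)
  define K where "K i j = t j * (of_bool (i = h) - of_bool (i = h - 1)) * G i j" for i j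
  have e: "move h t i j * G i j = K i j + K (- i) (- j)" for i j
    by (simp add: move_def K_def G algebra_simps)
  have "(\<Sum>i\<in>idx n. \<Sum>j\<in>idx n. K i j) = (\<Sum>j\<in>idx n. \<Sum>i\<in>idx n. (of_bool (i = h) - of_bool (i = h - 1)) * (t j * G i j))"
    unfolding K_def by (subst sum.swap) (simp add: mult_ac)
  also have "\<dots> = (\<Sum>j\<in>idx n. t j * (G h j - G (h - 1) j))"
    unfolding one by (simp add: algebra_simps)
  finally have 1: "(\<Sum>i\<in>idx n. \<Sum>j\<in>idx n. K i j) = (\<Sum>j\<in>idx n. t j * (G h j - G (h - 1) j))" .
  have 2: "(\<Sum>i\<in>idx n. \<Sum>j\<in>idx n. K (- i) (- j)) = (\<Sum>i\<in>idx n. \<Sum>j\<in>idx n. K i j)"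
    by (rule sum_idx_uminus2)
  show ?thesis unfolding e sum.distrib 2 1 by simp
qed

lemma corner_sum_diff:
  assumes "1 \<le> h" "h \<le> int n"
  shows "corner_sum n A h j - corner_sum n A (h - 1) j
     = (\<Sum>y\<in>idx n. of_bool (j < y) * A h y) - (\<Sum>y\<in>idx n. of_bool (y < j) * A (h - 1) y)"
proof -
  have hm: "h \<in> idx n" "h - 1 \<in> idx n" using assms by (auto simp: idx_def)
  have pick: "(\<Sum>x\<in>idx n. of_bool (x = k) * f x) = f k" if "k \<in> idx n" for k and f :: "int \<Rightarrow> int"
    using that by (simp add: of_bool_def if_distrib[of "\<lambda>x. x * _"] cong: if_cong)
  have 1: "(\<Sum>x\<in>idx n. \<Sum>y\<in>idx n. of_bool (x \<le> h \<and> j < y) * A x y)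
     - (\<Sum>x\<in>idx n. \<Sum>y\<in>idx n. of_bool (x \<le> h - 1 \<and> j < y) * A x y)
     = (\<Sum>x\<in>idx n. of_bool (x = h) * (\<Sum>y\<in>idx n. of_bool (j < y) * A x y))"
    unfolding sum_subtractf[symmetric] sum_distrib_left by (intro sum.cong refl) auto
  have 2: "(\<Sum>x\<in>idx n. \<Sum>y\<in>idx n. of_bool (h - 1 \<le> x \<and> y < j) * A x y)
     - (\<Sum>x\<in>idx n. \<Sum>y\<in>idx n. of_bool (h \<le> x \<and> y < j) * A x y)
     = (\<Sum>x\<in>idx n. of_bool (x = h - 1) * (\<Sum>y\<in>idx n. of_bool (y < j) * A x y))"
    unfolding sum_subtractf[symmetric] sum_distrib_left by (intro sum.cong refl) auto
  show ?thesis
    using 1 2 unfolding pick[OF hm(1)] pick[OF hm(2)] corner_sum_def by linarith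
qed

text \<open>Only the rows \<open>h\<close> and \<open>h - 1\<close> and their negatives change, so in the difference of the two corner sums
all other rows cancel.\<close>

lemma ne_form_move:
  assumes h: "1 \<le> h" "h \<le> int n" and A: "central_symm A"
  shows "ne_form n (\<lambda>i j. A i j + move h t i j) (\<lambda>i j. A i j + move h t i j) - ne_form n A A
     = (\<Sum>j\<in>idx n. t j * (\<Sum>y\<in>idx n. of_bool (j < y) * (2 * A h y + t y)
          - of_bool (y < j) * (2 * A (h - 1) y - t y - of_bool (h = 1) * t (- y))))"
proof -
  have F: "ne_form n M A' + ne_form n A' M = 2 * (\<Sum>j\<in>idx n. t j * ((\<Sum>y\<in>idx n. of_bool (j < y) * A' h y) - (\<Sum>y\<in>idx n. of_bool (y < j) * A' (h - 1) y)))"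
    if "central_symm A'" "M = move h t" for A' M
    unfolding corner_sum_form[symmetric] that(2)
    by (subst sum_move[of h n "corner_sum n A'", OF h corner_sum_central_symm[OF that(1)]]) (simp add: corner_sum_diff[OF h])
  have m: "move h t h y = t y" "move h t (h - 1) y = - t y - of_bool (h = 1) * t (- y)" for y
    using h by (auto simp: move_def)
  have "2 * ne_form n (move h t) (move h t) = 2 * (\<Sum>j\<in>idx n. t j * ((\<Sum>y\<in>idx n. of_bool (j < y) * t y)
      - (\<Sum>y\<in>idx n. of_bool (y < j) * (- t y - of_bool (h = 1) * t (- y)))))"
    using F[of "move h t" "move h t", OF central_symm_move refl] by (simp add: m)
  then have 1: "ne_form n (move h t) (move h t) = (\<Sum>j\<in>idx n. t j * ((\<Sum>y\<in>idx n. of_bool (j < y) * t y)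
      - (\<Sum>y\<in>idx n. of_bool (y < j) * (- t y - of_bool (h = 1) * t (- y)))))"
    by linarith
  have 2: "ne_form n A (move h t) + ne_form n (move h t) A = (\<Sum>j\<in>idx n. t j * (2 * ((\<Sum>y\<in>idx n. of_bool (j < y) * A h y)
      - (\<Sum>y\<in>idx n. of_bool (y < j) * A (h - 1) y))))"
    using F[OF A refl] by (simp only: sum_distrib_left mult_ac add.commute)
  have inner: "(\<Sum>y\<in>idx n. of_bool (j < y) * (2 * A h y + t y)
        - of_bool (y < j) * (2 * A (h - 1) y - t y - of_bool (h = 1) * t (- y)))
     = 2 * ((\<Sum>y\<in>idx n. of_bool (j < y) * A h y) - (\<Sum>y\<in>idx n. of_bool (y < j) * A (h - 1) y))
       + ((\<Sum>y\<in>idx n. of_bool (j < y) * t y) - (\<Sum>y\<in>idx n. of_bool (y < j) * (- t y - of_bool (h = 1) * t (- y))))" for j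
    unfolding sum_subtractf[symmetric] sum_distrib_left sum.distrib[symmetric]
    by (rule sum.cong[OF refl]) (simp add: algebra_simps)
  have "ne_form n A A + ne_form n A (move h t) + ne_form n (move h t) A + ne_form n (move h t) (move h t) - ne_form n A A
     = (ne_form n A (move h t) + ne_form n (move h t) A) + ne_form n (move h t) (move h t)" by simp
  then show ?thesis
    unfolding ne_form_add inner 1 2 sum.distrib[symmetric] distrib_left[symmetric] .
qed

lemma west_sum_move:
  assumes h: "1 \<le> h" "h \<le> int n"
  shows "west_sum n (\<lambda>i j. A i j + move h t i j) = west_sum n A - of_bool (h = 1) * (\<Sum>l\<in>idx n. of_bool (0 < l) * t l)"
proof -
  have hm: "h \<in> idx n" "h - 1 \<in> idx n" using h by (auto simp: idx_def)
  have pick: "(\<Sum>x\<in>idx n. of_bool (x = k) * f x) = f k" if "k \<in> idx n" for k and f :: "int \<Rightarrow> int"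
    using that by (simp add: of_bool_def if_distrib[of "\<lambda>x. x * _"] cong: if_cong)
  have e: "of_bool (0 \<le> x \<and> y < 0) * move h t x y = of_bool (x = h) * (of_bool (y < 0) * t y)
      - of_bool (x = h - 1) * (of_bool (y < 0) * (t y + of_bool (h = 1) * t (- y)))" for x y
    using h by (auto simp: move_def)
  have "west_sum n (move h t) = (\<Sum>x\<in>idx n. of_bool (x = h) * (\<Sum>y\<in>idx n. of_bool (y < 0) * t y))
      - (\<Sum>x\<in>idx n. of_bool (x = h - 1) * (\<Sum>y\<in>idx n. of_bool (y < 0) * (t y + of_bool (h = 1) * t (- y))))"
    unfolding west_sum_def e by (simp only: sum_subtractf sum_distrib_left)
  also have "\<dots> = - of_bool (h = 1) * (\<Sum>y\<in>idx n. of_bool (y < 0) * t (- y))"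
    unfolding pick[OF hm(1)] pick[OF hm(2)] by (simp add: distrib_left sum.distrib)
  also have "(\<Sum>y\<in>idx n. of_bool (y < 0) * t (- y)) = (\<Sum>l\<in>idx n. of_bool (0 < l) * t l)"
    by (subst sum_idx_uminus[symmetric]) simp
  finally show ?thesis
    unfolding west_sum_def by (simp add: distrib_left sum.distrib)
qed

lemma ne_form_diagonal: "diagonal D \<Longrightarrow> ne_form n D D = 0"
proof -
  assume D: "diagonal D"
  have "of_bool (x \<le> i \<and> j < y) * (D i j * D x y) = 0" for i j x y
    using D by (cases "i = j"; cases "x = y") (auto simp: diagonal_def)
  then show ?thesis unfolding ne_form_def by (intro sum.neutral ballI)
qed

lemma west_sum_diagonal: "diagonal D \<Longrightarrow> west_sum n D = 0"
  unfolding west_sum_def diagonal_def by (intro sum.neutral ballI) auto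

declare sum_of_bool_mult_eq [simp] sum_mult_of_bool_eq [simp]

section \<open>Matrices of double cosets\<close>

lemma card_pair_filter:
  assumes "x \<noteq> y"
  shows "card {a \<in> {x, y}. P a} = of_bool (P x) + of_bool (P y)"
proof -
  have "{a \<in> {x, y}. P a} = (if P x then {x} else {}) \<union> (if P y then {y} else {})" by auto
  then show ?thesis using assms by simp
qed

text \<open>Match one orbit of size two with another one carrying the same labels, remove both, and repeat: the
equality of the label counts is preserved since both orbits carry the labels \<open>l\<close> and \<open>-l\<close>.\<close>

lemma equivariant_bijection:
  fixes p :: "'a \<Rightarrow> int" and q :: "'b \<Rightarrow> int"
  assumes "finite X" "finite Y"
    and X: "\<And>x. x \<in> X \<Longrightarrow> f x \<in> X \<and> f (f x) = x \<and> f x \<noteq> x \<and> p (f x) = - p x"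
    and Y: "\<And>y. y \<in> Y \<Longrightarrow> g y \<in> Y \<and> g (g y) = y \<and> g y \<noteq> y \<and> q (g y) = - q y"
    and cards: "\<And>l. card {x \<in> X. p x = l} = card {y \<in> Y. q y = l}"
  shows "\<exists>\<phi>. bij_betw \<phi> X Y \<and> (\<forall>x\<in>X. q (\<phi> x) = p x \<and> \<phi> (f x) = g (\<phi> x))"
  using assms
proof (induction "card X" arbitrary: X Y rule: less_induct)
  case less
  show ?case
  proof (cases "X = {}")
    case True
    then have "{y \<in> Y. q y = l} = {}" for l
      using less.prems(5)[of l] less.prems(2) by simp
    then have "Y = {}" by blast
    then show ?thesis using True by (auto simp: bij_betw_def)
  next
    case False
    then obtain x where x: "x \<in> X" by blast
    have "{x' \<in> X. p x' = p x} \<noteq> {}" using x by blast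
    then have "card {y \<in> Y. q y = p x} \<noteq> 0"
      using less.prems(5)[of "p x", symmetric] less.prems(1) by simp
    then have "{y \<in> Y. q y = p x} \<noteq> {}" by (metis card.empty)
    then obtain y where y: "y \<in> Y" "q y = p x" by blast
    define X' Y' where "X' = X - {x, f x}" and "Y' = Y - {y, g y}"
    have fx: "f x \<in> X" "f (f x) = x" "f x \<noteq> x" "p (f x) = - p x" using less.prems(3)[OF x] by auto
    have gy: "g y \<in> Y" "g (g y) = y" "g y \<noteq> y" "q (g y) = - p x" using less.prems(4)[OF y(1)] y(2) by auto
    have XX: "X = insert x (insert (f x) X')" "x \<notin> insert (f x) X'" "f x \<notin> X'" "finite X'"
      using x fx less.prems(1) by (auto simp: X'_def)
    have YY: "Y = insert y (insert (g y) Y')" "y \<notin> insert (g y) Y'" "g y \<notin> Y'" "finite Y'"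
      using y gy less.prems(2) by (auto simp: Y'_def)
    have "\<exists>\<phi>. bij_betw \<phi> X' Y' \<and> (\<forall>x\<in>X'. q (\<phi> x) = p x \<and> \<phi> (f x) = g (\<phi> x))"
    proof (rule less.hyps)
      show "card X' < card X"
        using x less.prems(1) unfolding X'_def by (intro psubset_card_mono) auto
      show "finite X'" "finite Y'" using XX YY by auto
      show "f a \<in> X' \<and> f (f a) = a \<and> f a \<noteq> a \<and> p (f a) = - p a" if "a \<in> X'" for a
      proof -
        have a: "a \<in> X" "a \<noteq> x" "a \<noteq> f x" using that by (auto simp: X'_def)
        then have "f a \<noteq> x" "f a \<noteq> f x" using less.prems(3)[OF a(1)] fx by metis+
        then show ?thesis using less.prems(3)[OF a(1)] by (simp add: X'_def)
      qed
      show "g a \<in> Y' \<and> g (g a) = a \<and> g a \<noteq> a \<and> q (g a) = - q a" if "a \<in> Y'" for a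
      proof -
        have a: "a \<in> Y" "a \<noteq> y" "a \<noteq> g y" using that by (auto simp: Y'_def)
        then have "g a \<noteq> y" "g a \<noteq> g y" using less.prems(4)[OF a(1)] gy by metis+
        then show ?thesis using less.prems(4)[OF a(1)] by (simp add: Y'_def)
      qed
      show "card {x \<in> X'. p x = l} = card {y \<in> Y'. q y = l}" for l
      proof -
        have "{x \<in> X'. p x = l} = {x \<in> X. p x = l} - {a \<in> {x, f x}. p a = l}"
          "{y \<in> Y'. q y = l} = {y \<in> Y. q y = l} - {b \<in> {y, g y}. q b = l}"
          by (auto simp: X'_def Y'_def)
        moreover have "card {a \<in> {x, f x}. p a = l} = card {b \<in> {y, g y}. q b = l}"
        proof -
          have "card {a \<in> {x, f x}. p a = l} = of_bool (p x = l) + of_bool (- p x = l)"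
            using card_pair_filter[of x "f x" "\<lambda>a. p a = l"] fx(3,4) by metis
          moreover have "card {b \<in> {y, g y}. q b = l} = of_bool (p x = l) + of_bool (- p x = l)"
            using card_pair_filter[of y "g y" "\<lambda>a. q a = l"] gy(3,4) y(2) by metis
          ultimately show ?thesis by simp
        qed
        moreover have "{a \<in> {x, f x}. p a = l} \<subseteq> {x \<in> X. p x = l}" "{b \<in> {y, g y}. q b = l} \<subseteq> {y \<in> Y. q y = l}"
          using x fx y gy by auto
        ultimately show ?thesis
          using less.prems(5)[of l] by (simp add: card_Diff_subset finite_subset)
      qed
    qed
    then obtain \<phi> where \<phi>: "bij_betw \<phi> X' Y'" "\<And>a. a \<in> X' \<Longrightarrow> q (\<phi> a) = p a \<and> \<phi> (f a) = g (\<phi> a)" by blast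
    define \<psi> where "\<psi> = \<phi>(f x := g y, x := y)"
    have \<psi>: "\<psi> x = y" "\<psi> (f x) = g y" "\<And>a. a \<in> X' \<Longrightarrow> \<psi> a = \<phi> a"
      using XX fx by (auto simp: \<psi>_def)
    have "bij_betw \<psi> X' Y'" using \<phi>(1) \<psi>(3) by (simp cong: bij_betw_cong)
    then have "bij_betw \<psi> (insert (f x) X') (insert (g y) Y')"
      using notIn_Un_bij_betw[of "f x" X' \<psi> Y'] XX(3) YY(3) \<psi>(2) by simp
    then have "bij_betw \<psi> X Y"
      using notIn_Un_bij_betw[of x "insert (f x) X'" \<psi> "insert (g y) Y'"] XX(1,2) YY(1,2) \<psi>(1) by simp
    moreover have "q (\<psi> a) = p a \<and> \<psi> (f a) = g (\<psi> a)" if a: "a \<in> X" for a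
    proof -
      consider "a = x" | "a = f x" | "a \<in> X'" using a XX(1) by blast
      then show ?thesis
      proof cases
        case 3
        then have "f a \<in> X'"
          using less.prems(3)[OF a] fx by (auto simp: X'_def)
        then show ?thesis using 3 \<phi>(2) \<psi>(3) by simp
      qed (use \<psi> fx gy y in simp_all)
    qed
    ultimately show ?thesis by blast
  qed
qed

lemma card_block_block_index:
  assumes "la \<in> Lam n d" "i \<in> idx n"
  shows "{z. block_index n la z = i} = block la i"
  using block_iff[OF assms(2)] by auto

text \<open>The nonzero positions, labelled by \<open>f\<close> and by the block index, are two label-preservingly isomorphic
sets with the involution \<open>z \<mapsto> -z\<close>; an isomorphism is the required signed permutation.\<close>

lemma pattern_exists:
  assumes la: "la \<in> Lam n d"
    and odd: "\<And>z. f (- z) = - f z"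
    and out: "\<And>z. int d < \<bar>z\<bar> \<Longrightarrow> f z = block_index n la z"
    and range: "\<And>z. \<bar>z\<bar> \<le> int d \<Longrightarrow> f z \<in> idx n"
    and cards: "\<And>i. i \<in> idx n \<Longrightarrow> card {z. f z = i} = card (block la i)"
  obtains w where "w \<in> weyl d" "block_index n la \<circ> w = f"
proof -
  define N where "N = {- int d..int d} - {0}"
  have f0: "f 0 = 0" using odd[of 0] by simp
  have fin: "finite {z. f z = i}" if "i \<in> idx n" for i
  proof (rule finite_subset)
    show "{z. f z = i} \<subseteq> {- int d..int d}"
    proof
      fix z assume "z \<in> {z. f z = i}"
      then have "f z \<in> idx n" using that by simp
      then have "\<bar>z\<bar> \<le> int d" using out[of z] block_index_in_idx[OF la, of z] by (cases "\<bar>z\<bar> \<le> int d") auto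
      then show "z \<in> {- int d..int d}" by auto
    qed
  qed simp
  have fr: "f z \<in> idx n \<longleftrightarrow> \<bar>z\<bar> \<le> int d" for z
    using range[of z] out[of z] block_index_in_idx[OF la, of z] by (cases "\<bar>z\<bar> \<le> int d") auto
  have c: "card {x \<in> N. f x = l} = card {y \<in> N. block_index n la y = l}" for l
  proof (cases "l \<in> idx n")
    case True
    have "{x \<in> N. f x = l} = {z. f z = l} - {0}"
      using True fr by (auto simp: N_def abs_le_iff)
    moreover have "{x \<in> N. block_index n la x = l} = {z. block_index n la z = l} - {0}"
      using True block_index_in_idx[OF la] by (auto simp: N_def abs_le_iff)
    moreover have "0 \<in> {z. f z = l} \<longleftrightarrow> 0 \<in> {z. block_index n la z = l}"
      using f0 by simp
    ultimately show ?thesis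
      using cards[OF True] card_block_block_index[OF la True] by (simp add: card_Diff_singleton_if)
  next
    case False
    have "\<bar>x\<bar> \<le> int d" if "x \<in> N" for x using that by (auto simp: N_def)
    then have e: "{x \<in> N. f x = l} = {}" "{y \<in> N. block_index n la y = l} = {}"
      using False fr block_index_in_idx[OF la] by blast+
    show ?thesis unfolding e ..
  qed
  have "\<exists>\<phi>. bij_betw \<phi> N N \<and> (\<forall>x\<in>N. block_index n la (\<phi> x) = f x \<and> \<phi> (- x) = - \<phi> x)"
    by (rule equivariant_bijection) (use c odd block_index_odd in \<open>auto simp: N_def\<close>)
  then obtain \<phi> where \<phi>: "bij_betw \<phi> N N" "\<And>x. x \<in> N \<Longrightarrow> block_index n la (\<phi> x) = f x \<and> \<phi> (- x) = - \<phi> x" by blast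
  define w where "w z = (if z \<in> N then \<phi> z else z)" for z
  have "bij_betw w N N" using \<phi>(1) by (simp add: w_def cong: bij_betw_cong)
  then have "w permutes N" by (rule bij_imp_permutes) (simp add: w_def)
  then have "w permutes {- int d..int d}" by (rule permutes_subset) (auto simp: N_def)
  moreover have "w (- z) = - w z" for z
    using \<phi>(2)[of z] by (auto simp: w_def N_def)
  ultimately have "w \<in> weyl d" by (rule weylI)
  moreover have "block_index n la \<circ> w = f"
  proof
    fix z
    show "(block_index n la \<circ> w) z = f z"
      using \<phi>(2)[of z] out[of z] f0 by (cases "z = 0") (auto simp: w_def N_def abs_le_iff not_le)
  qed
  ultimately show ?thesis using that by blast
qed

text \<open>The composition whose blocks have the sizes \<open>r i\<close>; the middle block has the odd size \<open>r 0\<close>.\<close>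

definition comp_of :: "nat \<Rightarrow> (int \<Rightarrow> int) \<Rightarrow> nat \<Rightarrow> nat" where
  "comp_of n r i = (if i = 0 then nat ((r 0 - 1) div 2) else if i \<le> n then nat (r (int i)) else 0)"

lemma comp_of_block_sizes:
  assumes "la \<in> Lam n d" "\<And>i. i \<in> idx n \<Longrightarrow> r i = int (card (block la i))"
  shows "comp_of n r = la"
proof
  fix i
  show "comp_of n r i = la i"
  proof (cases "i \<le> n")
    case True
    then have "int i \<in> idx n" by (simp add: idx_def)
    then show ?thesis
      using assms(2)[of "int i"] card_block(1)[of la] card_block(2)[of i la] True by (cases "i = 0") (auto simp: comp_of_def)
  next
    case False
    then show ?thesis using Lam_zero[OF assms(1), of i] by (simp add: comp_of_def)
  qed
qed

lemma sum_idx_split: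
  fixes r :: "int \<Rightarrow> int"
  assumes "\<And>i. r (- i) = r i"
  shows "(\<Sum>i\<in>idx n. r i) = r 0 + 2 * (\<Sum>i = 1..n. r (int i))"
proof -
  have "idx n = insert 0 (int ` {1..n} \<union> (\<lambda>i. - int i) ` {1..n})"
  proof (intro Set.set_eqI iffI)
    fix x assume x: "x \<in> idx n"
    consider "x = 0" | "0 < x" | "x < 0" by linarith
    then show "x \<in> insert 0 (int ` {1..n} \<union> (\<lambda>i. - int i) ` {1..n})"
    proof cases
      case 2
      then have "x = int (nat x)" "nat x \<in> {1..n}" using x by (auto simp: idx_def)
      then show ?thesis by blast
    next
      case 3
      then have "x = - int (nat (- x))" "nat (- x) \<in> {1..n}" using x by (auto simp: idx_def)
      then show ?thesis by blast
    qed simp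
  qed (auto simp: idx_def)
  moreover have "sum r (int ` {1..n}) = (\<Sum>i = 1..n. r (int i))"
    by (subst sum.reindex) (auto simp: inj_on_def)
  moreover have "sum r ((\<lambda>i. - int i) ` {1..n}) = (\<Sum>i = 1..n. r (int i))"
    by (subst sum.reindex) (auto simp: inj_on_def assms)
  moreover have "int ` {1..n} \<inter> (\<lambda>i. - int i) ` {1..n} = {}" "0 \<notin> int ` {1..n} \<union> (\<lambda>i. - int i) ` {1..n}"
    by auto
  ultimately show ?thesis by (simp add: sum.union_disjoint)
qed

lemma comp_of_Lam:
  assumes sym: "\<And>i. r (- i) = r i" and pos: "\<And>i. 0 \<le> r i" and odd: "odd (r 0)"
    and tot: "(\<Sum>i\<in>idx n. r i) = 2 * int d + 1"
  shows "comp_of n r \<in> Lam n d" and "i \<in> idx n \<Longrightarrow> int (card (block (comp_of n r) i)) = r i"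
proof -
  obtain c where c: "r 0 = 2 * c + 1" using odd by (rule oddE)
  have r0: "r 0 = 2 * int (comp_of n r 0) + 1"
    using c pos[of 0] by (simp add: comp_of_def)
  have ri: "r (int i) = int (comp_of n r i)" if "1 \<le> i" "i \<le> n" for i
    using that pos[of "int i"] by (simp add: comp_of_def)
  have "2 * int d + 1 = 2 * (int (comp_of n r 0) + (\<Sum>i = 1..n. int (comp_of n r i))) + 1"
    unfolding tot[symmetric] sum_idx_split[of r, OF sym] r0 by (simp add: ri)
  then have "int d = int (\<Sum>i\<le>n. comp_of n r i)" unfolding psum_alt by simp
  then have "(\<Sum>i\<le>n. comp_of n r i) = d" by (simp only: of_nat_eq_iff)
  moreover have "comp_of n r i = 0" if "n < i" for i using that by (simp add: comp_of_def)
  ultimately show "comp_of n r \<in> Lam n d" unfolding Lam_def by blast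
  assume i: "i \<in> idx n"
  have "card (block (comp_of n r) (- int k)) = card (block (comp_of n r) (int k))" if "0 < k" for k
    using that by (simp add: block_def card_image)
  then have "card (block (comp_of n r) i) = card (block (comp_of n r) \<bar>i\<bar>)"
    using zero_less_nat_eq[of "- i"] by (cases "i < 0") (metis abs_of_neg abs_of_nonneg int_nat_eq minus_minus neg_0_less_iff_less nat_0_le order_less_imp_le linorder_not_less)+
  also have "int \<dots> = r \<bar>i\<bar>"
  proof (cases "i = 0")
    case True
    then show ?thesis by (simp add: card_block(1) r0)
  next
    case False
    then have "1 \<le> nat \<bar>i\<bar>" "nat \<bar>i\<bar> \<le> n" using i by (auto simp: idx_def)
    then show ?thesis using card_block(2)[of "nat \<bar>i\<bar>" "comp_of n r"] ri[of "nat \<bar>i\<bar>"] by simp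
  qed
  also have "r \<bar>i\<bar> = r i" using sym[of i] by (cases "i < 0") auto
  finally show "int (card (block (comp_of n r) i)) = r i" .
qed

lemma XiD:
  assumes "A \<in> Xi n d"
  shows "i \<notin> idx n \<or> j \<notin> idx n \<Longrightarrow> A i j = 0" "0 \<le> A i j" "A (- i) (- j) = A i j" "odd (A 0 0)"
    "(\<Sum>i \<in> idx n. \<Sum>j \<in> idx n. A i j) = 2 * int d + 1"
  using assms by (auto simp: Xi_def)

lemma odd_symmetric_sum:
  fixes r :: "int \<Rightarrow> int"
  assumes "\<And>i. r (- i) = r i" "odd (r 0)"
  shows "odd (\<Sum>i\<in>idx n. r i)"
  using sum_idx_split[of r n, OF assms(1)] assms(2) by simp

lemma row_Lam:
  assumes "A \<in> Xi n d"
  shows "comp_of n (row n A) \<in> Lam n d" "i \<in> idx n \<Longrightarrow> int (card (block (comp_of n (row n A)) i)) = row n A i"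
proof -
  have sym: "row n A (- i) = row n A i" for i
    unfolding row_def by (subst sum_idx_uminus[symmetric]) (simp add: XiD(3)[OF assms])
  have pos: "0 \<le> row n A i" for i unfolding row_def by (intro sum_nonneg XiD(2)[OF assms])
  have odd: "odd (row n A 0)"
    unfolding row_def by (rule odd_symmetric_sum) (use XiD(3)[OF assms, of 0] XiD(4)[OF assms] in simp_all)
  have tot: "(\<Sum>i\<in>idx n. row n A i) = 2 * int d + 1" unfolding row_def by (rule XiD(5)[OF assms])
  show "comp_of n (row n A) \<in> Lam n d" "i \<in> idx n \<Longrightarrow> int (card (block (comp_of n (row n A)) i)) = row n A i"
    using comp_of_Lam[of "row n A", OF sym pos odd tot] by auto
qed

lemma col_Lam:
  assumes "A \<in> Xi n d"
  shows "comp_of n (col n A) \<in> Lam n d" "i \<in> idx n \<Longrightarrow> int (card (block (comp_of n (col n A)) i)) = col n A i"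
proof -
  have sym: "col n A (- i) = col n A i" for i
    unfolding col_def by (subst sum_idx_uminus[symmetric]) (simp add: XiD(3)[OF assms])
  have pos: "0 \<le> col n A i" for i unfolding col_def by (intro sum_nonneg XiD(2)[OF assms])
  have odd: "odd (col n A 0)"
    unfolding col_def by (rule odd_symmetric_sum) (use XiD(3)[OF assms, of _ 0] XiD(4)[OF assms] in simp_all)
  have tot: "(\<Sum>i\<in>idx n. col n A i) = 2 * int d + 1" unfolding col_def by (subst sum.swap) (rule XiD(5)[OF assms])
  show "comp_of n (col n A) \<in> Lam n d" "i \<in> idx n \<Longrightarrow> int (card (block (comp_of n (col n A)) i)) = col n A i"
    using comp_of_Lam[of "col n A", OF sym pos odd tot] by auto
qed

lemma finite_pattern:
  assumes "mu \<in> Lam n d" "j \<in> idx n"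
  shows "finite {z. P z \<and> block_index n mu z = j}"
  using finite_fibre[OF assms, of P] by (simp add: conj_commute)

lemma kappa_row:
  assumes L: "la \<in> Lam n d" "mu \<in> Lam n d" "w \<in> weyl d" and i: "i \<in> idx n"
  shows "row n (kappa la w mu) i = int (card (block la i))"
proof -
  have "row n (kappa la w mu) i = (\<Sum>j\<in>idx n. int (card {z. block_index n la (w z) = i \<and> block_index n mu z = j}))"
    unfolding row_def using i by (intro sum.cong refl) (simp add: kappa_eq[OF L])
  also have "\<dots> = int (card (\<Union>j\<in>idx n. {z. block_index n la (w z) = i \<and> block_index n mu z = j}))"
    using finite_pattern[OF L(2)] by (subst card_UN_disjoint) auto
  also have "(\<Union>j\<in>idx n. {z. block_index n la (w z) = i \<and> block_index n mu z = j}) = {z. block_index n la (w z) = i}"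
    using i block_index_in_idx[OF L(1)] block_index_in_idx[OF L(2)] weyl_range[OF L(3)] by auto
  also have "card \<dots> = card (w ` {z. block_index n la (w z) = i})"
    by (rule card_image[symmetric, OF inj_on_subset[OF weyl_inj[OF L(3)] subset_UNIV]])
  also have "w ` {z. block_index n la (w z) = i} = block la i"
  proof (intro Set.set_eqI iffI)
    fix x assume "x \<in> block la i"
    moreover obtain z where "x = w z" using weyl_bij[OF L(3)] by (meson bij_pointE)
    ultimately show "x \<in> w ` {z. block_index n la (w z) = i}" using i by (auto simp: block_iff)
  qed (use i in \<open>auto simp: block_iff\<close>)
  finally show ?thesis .
qed

lemma kappa_col:
  assumes L: "la \<in> Lam n d" "mu \<in> Lam n d" "w \<in> weyl d" and j: "j \<in> idx n"
  shows "col n (kappa la w mu) j = int (card (block mu j))"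
proof -
  have "col n (kappa la w mu) j = (\<Sum>i\<in>idx n. int (card {z. block_index n la (w z) = i \<and> block_index n mu z = j}))"
    unfolding col_def using j by (intro sum.cong refl) (simp add: kappa_eq[OF L])
  also have "\<dots> = int (card (\<Union>i\<in>idx n. {z. block_index n la (w z) = i \<and> block_index n mu z = j}))"
    using finite_pattern[OF L(2) j] by (subst card_UN_disjoint) auto
  also have "(\<Union>i\<in>idx n. {z. block_index n la (w z) = i \<and> block_index n mu z = j}) = {z. block_index n mu z = j}"
    using j block_index_in_idx[OF L(1)] block_index_in_idx[OF L(2)] weyl_range[OF L(3)] by auto
  also have "\<dots> = block mu j" by (rule card_block_block_index[OF L(2) j])
  finally show ?thesis .
qed

text \<open>Take a set \<open>Z\<close> with \<open>A i j\<close> points over each position and an involution over the half turn. Its only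
fixed point is the middle point over \<open>(0, 0)\<close>, since \<open>A 0 0\<close> is odd. Identifying the remaining points
with the nonzero positions, once by columns and once by rows, gives the permutation.\<close>

lemma kappa_surj:
  assumes A: "A \<in> Xi n d"
  obtains w where "w \<in> weyl d" "kappa (comp_of n (row n A)) w (comp_of n (col n A)) = A"
proof -
  define la mu where "la = comp_of n (row n A)" and "mu = comp_of n (col n A)"
  have L: "la \<in> Lam n d" "mu \<in> Lam n d" unfolding la_def mu_def by (rule row_Lam(1)[OF A], rule col_Lam(1)[OF A])
  define N where "N = {- int d..int d} - {0}"
  obtain c where c1: "A 0 0 = 2 * c + 1" using XiD(4)[OF A] by (rule oddE)
  have c: "A 0 0 = 2 * c + 1" "0 \<le> c" using c1 XiD(2)[OF A, of 0 0] by simp_all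
  \<comment> \<open>The third component numbers the points over a position; reversing the numbering makes the half turn an involution whose only fixed point is the middle one.\<close>
  define Z where "Z = {(i, j, k). i \<in> idx n \<and> j \<in> idx n \<and> 0 \<le> k \<and> k < A i j}"
  define Z0 where "Z0 = Z - {(0, 0, c)}"
  define g where "g = (\<lambda>(i, j, k). (- i, - j, A i j - 1 - k) :: int \<times> int \<times> int)"
  have finZ: "finite Z"
  proof -
    have "Z = (SIGMA i : idx n. SIGMA j : idx n. {0..<A i j})" by (auto simp: Z_def)
    then show ?thesis by simp
  qed
  have cZ: "(0, 0, c) \<in> Z" using c by (auto simp: Z_def idx_def)
  have slice: "card {z \<in> Z. fst z = i \<and> fst (snd z) = j} = nat (A i j)" if "i \<in> idx n" "j \<in> idx n" for i j
  proof -
    have "{z \<in> Z. fst z = i \<and> fst (snd z) = j} = (\<lambda>k. (i, j, k)) ` {0..<A i j}"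
      using that by (auto simp: Z_def)
    then show ?thesis by (simp add: card_image inj_on_def)
  qed
  have colZ: "int (card {z \<in> Z. fst (snd z) = j}) = col n A j" if "j \<in> idx n" for j
  proof -
    have "{z \<in> Z. fst (snd z) = j} = (\<Union>i\<in>idx n. {z \<in> Z. fst z = i \<and> fst (snd z) = j})"
      by (auto simp: Z_def)
    also have "int (card \<dots>) = (\<Sum>i\<in>idx n. int (card {z \<in> Z. fst z = i \<and> fst (snd z) = j}))"
      by (subst card_UN_disjoint) (use finZ in \<open>auto intro: finite_subset[OF _ finZ]\<close>)
    also have "\<dots> = col n A j"
      unfolding col_def using that XiD(2)[OF A] by (intro sum.cong refl) (simp add: slice)
    finally show ?thesis .
  qed
  have rowZ: "int (card {z \<in> Z. fst z = i}) = row n A i" if "i \<in> idx n" for i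
  proof -
    have "{z \<in> Z. fst z = i} = (\<Union>j\<in>idx n. {z \<in> Z. fst z = i \<and> fst (snd z) = j})"
      by (auto simp: Z_def)
    also have "int (card \<dots>) = (\<Sum>j\<in>idx n. int (card {z \<in> Z. fst z = i \<and> fst (snd z) = j}))"
      by (subst card_UN_disjoint) (use finZ in \<open>auto intro: finite_subset[OF _ finZ]\<close>)
    also have "\<dots> = row n A i"
      unfolding row_def using that XiD(2)[OF A] by (intro sum.cong refl) (simp add: slice)
    finally show ?thesis .
  qed
  have "\<exists>\<phi>. bij_betw \<phi> N Z0 \<and> (\<forall>x\<in>N. fst (snd (\<phi> x)) = block_index n mu x \<and> \<phi> (- x) = g (\<phi> x))"
  proof (rule equivariant_bijection)
    show "finite N" "finite Z0" using finZ by (auto simp: N_def Z0_def)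
    show "- x \<in> N \<and> - (- x) = x \<and> - x \<noteq> x \<and> block_index n mu (- x) = - block_index n mu x" if "x \<in> N" for x
      using that by (auto simp: N_def block_index_odd)
    show "g z \<in> Z0 \<and> g (g z) = z \<and> g z \<noteq> z \<and> fst (snd (g z)) = - fst (snd z)" if "z \<in> Z0" for z
    proof -
      obtain i j k where z: "z = (i, j, k)" by (cases z)
      have m: "i \<in> idx n" "j \<in> idx n" "0 \<le> k" "k < A i j" "\<not> (i = 0 \<and> j = 0 \<and> k = c)"
        using that z by (auto simp: Z0_def Z_def)
      show ?thesis
        using m c(1) XiD(3)[OF A, of i j] by (auto simp: z g_def Z0_def Z_def)
    qed
    show "card {x \<in> N. block_index n mu x = l} = card {y \<in> Z0. fst (snd y) = l}" for l
    proof (cases "l \<in> idx n")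
      case True
      have e1: "{x \<in> N. block_index n mu x = l} = block mu l - {0}"
        using True block_index_in_idx[OF L(2)] unfolding card_block_block_index[OF L(2) True, symmetric] by (auto simp: N_def abs_le_iff)
      have e2: "{y \<in> Z0. fst (snd y) = l} = {z \<in> Z. fst (snd z) = l} - {(0, 0, c)}" by (auto simp: Z0_def)
      have e3: "card (block mu l) = card {z \<in> Z. fst (snd z) = l}"
        using colZ[OF True] col_Lam(2)[OF A True] by (simp add: mu_def)
      have e4: "0 \<in> block mu l \<longleftrightarrow> (0, 0, c) \<in> {z \<in> Z. fst (snd z) = l}"
        using cZ True by (auto simp: block_iff)
      show ?thesis unfolding e1 e2 card_Diff_singleton_if e3 e4 ..
    next
      case False
      have "\<bar>x\<bar> \<le> int d" if "x \<in> N" for x using that by (auto simp: N_def)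
      then have e1: "{x \<in> N. block_index n mu x = l} = {}"
        using False block_index_in_idx[OF L(2)] by blast
      have e2: "{y \<in> Z0. fst (snd y) = l} = {}"
        using False by (auto simp: Z0_def Z_def)
      show ?thesis unfolding e1 e2 by simp
    qed
  qed
  then obtain \<phi> where \<phi>: "bij_betw \<phi> N Z0" "\<And>x. x \<in> N \<Longrightarrow> fst (snd (\<phi> x)) = block_index n mu x \<and> \<phi> (- x) = g (\<phi> x)" by blast
  define \<psi> where "\<psi> = \<phi>(0 := (0, 0, c))"
  have \<psi>N: "\<psi> x = \<phi> x" if "x \<in> N" for x using that by (auto simp: \<psi>_def N_def)
  have D: "{- int d..int d} = insert 0 N" "0 \<notin> N" "\<And>z. \<bar>z\<bar> \<le> int d \<longleftrightarrow> z = 0 \<or> z \<in> N" by (auto simp: N_def)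
  have "bij_betw \<psi> N Z0" using \<phi>(1) \<psi>N by (simp cong: bij_betw_cong)
  then have bij: "bij_betw \<psi> {- int d..int d} Z"
    using notIn_Un_bij_betw[of 0 N \<psi> Z0] D cZ by (auto simp: \<psi>_def Z0_def insert_absorb)
  have \<psi>mu: "fst (snd (\<psi> z)) = block_index n mu z" if "\<bar>z\<bar> \<le> int d" for z
    using that D(3)[of z] \<phi>(2)[of z] \<psi>N[of z] by (auto simp: \<psi>_def)
  have g1: "fst (g z) = - fst z" for z by (cases z) (simp add: g_def)
  define f where "f z = (if \<bar>z\<bar> \<le> int d then fst (\<psi> z) else block_index n la z)" for z
  have \<psi>Z: "\<psi> z \<in> Z" if "\<bar>z\<bar> \<le> int d" for z
    using bij_betwE[OF bij] that by (auto simp: abs_le_iff)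
  have trans: "card {z. \<bar>z\<bar> \<le> int d \<and> P (\<psi> z)} = card {z \<in> Z. P z}" for P
  proof (rule bij_betw_same_card[of \<psi>], rule bij_betw_subset[OF bij])
    show "{z. \<bar>z\<bar> \<le> int d \<and> P (\<psi> z)} \<subseteq> {- int d..int d}" by auto
    show "\<psi> ` {z. \<bar>z\<bar> \<le> int d \<and> P (\<psi> z)} = {z \<in> Z. P z}"
      using bij_betw_imp_surj_on[OF bij] \<psi>Z by (auto simp: image_iff abs_le_iff)
  qed
  obtain w where w: "w \<in> weyl d" "block_index n la \<circ> w = f"
  proof (rule pattern_exists[of la n d f])
    show "la \<in> Lam n d" by (rule L)
    show "f (- z) = - f z" for z
    proof (cases "z \<in> N")
      case True
      then have "- z \<in> N" by (auto simp: N_def)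
      then show ?thesis using True \<phi>(2)[OF True] g1 D(3) by (simp add: f_def \<psi>N)
    next
      case False
      then show ?thesis using D(3)[of z] by (cases "z = 0") (auto simp: f_def \<psi>_def block_index_odd)
    qed
    show "f z = block_index n la z" if "int d < \<bar>z\<bar>" for z using that by (simp add: f_def)
    show fr: "f z \<in> idx n" if "\<bar>z\<bar> \<le> int d" for z
      using \<psi>Z[OF that] that by (auto simp: f_def Z_def)
    show "card {z. f z = i} = card (block la i)" if i: "i \<in> idx n" for i
    proof -
      have "f z = i \<longleftrightarrow> \<bar>z\<bar> \<le> int d \<and> fst (\<psi> z) = i" for z
        using i block_index_in_idx[OF L(1), of z] by (cases "\<bar>z\<bar> \<le> int d") (auto simp: f_def)
      then have "{z. f z = i} = {z. \<bar>z\<bar> \<le> int d \<and> fst (\<psi> z) = i}" by blast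
      then have "card {z. f z = i} = card {z \<in> Z. fst z = i}" using trans[of "\<lambda>p. fst p = i"] by simp
      then show ?thesis using rowZ[OF i] row_Lam(2)[OF A i] by (simp add: la_def)
    qed
  qed (use that in blast)
  have "kappa la w mu i j = A i j" for i j
  proof (cases "i \<in> idx n \<and> j \<in> idx n")
    case True
    have "block_index n la (w z) = i \<and> block_index n mu z = j \<longleftrightarrow> \<bar>z\<bar> \<le> int d \<and> (fst (\<psi> z) = i \<and> fst (snd (\<psi> z)) = j)" for z
      using True block_index_in_idx[OF L(2), of z] \<psi>mu[of z] fun_cong[OF w(2), of z]
      by (cases "\<bar>z\<bar> \<le> int d") (auto simp: f_def)
    then have "{z. block_index n la (w z) = i \<and> block_index n mu z = j} = {z. \<bar>z\<bar> \<le> int d \<and> (fst (\<psi> z) = i \<and> fst (snd (\<psi> z)) = j)}"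
      by blast
    then show ?thesis
      using True trans[of "\<lambda>p. fst p = i \<and> fst (snd p) = j"] slice[of i j] XiD(2)[OF A, of i j]
      by (simp add: kappa_eq[OF L w(1)])
  next
    case False
    then show ?thesis using XiD(1)[OF A, of i j] by (auto simp: kappa_eq[OF L w(1)])
  qed
  then have "kappa la w mu = A" by (simp add: fun_eq_iff)
  then show ?thesis using that w(1) unfolding la_def mu_def by blast
qed

text \<open>Existence comes from surjectivity together with a shortest element of the double coset; uniqueness
from the recovery of compositions from row and column sums and of \<open>g\<close> from its matrix.\<close>

lemma kappa_inv_props:
  assumes A: "A \<in> Xi n d"
  obtains g where "kappa_inv n d A = (comp_of n (row n A), g, comp_of n (col n A))"
    "g \<in> min_reps d (comp_of n (row n A)) (comp_of n (col n A))"
    "kappa (comp_of n (row n A)) g (comp_of n (col n A)) = A"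
proof -
  define la mu where "la = comp_of n (row n A)" and "mu = comp_of n (col n A)"
  have L: "la \<in> Lam n d" "mu \<in> Lam n d" unfolding la_def mu_def by (rule row_Lam(1)[OF A], rule col_Lam(1)[OF A])
  obtain w where w: "w \<in> weyl d" "kappa la w mu = A"
    using kappa_surj[OF A] unfolding la_def mu_def by blast
  obtain g where g: "g \<in> min_reps d la mu" "g \<in> double_coset d la w mu"
    using min_rep_exists[OF L w(1)] .
  have k: "kappa la g mu = A" using kappa_double_coset[OF L w(1) g(2)] w(2) by simp
  have W: "g \<in> weyl d" using g(1) by (simp add: min_reps_def)
  have "kappa_inv n d A = (la, g, mu)"
    unfolding kappa_inv_def the_inv_into_def
  proof (rule the_equality)
    show "(la, g, mu) \<in> kappa_dom n d \<and> (case (la, g, mu) of (la, g, mu) \<Rightarrow> kappa la g mu) = A"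
      using L g k by (simp add: kappa_dom_def)
    fix t assume t: "t \<in> kappa_dom n d \<and> (case t of (la, g, mu) \<Rightarrow> kappa la g mu) = A"
    obtain la' g' mu' where tt: "t = (la', g', mu')" by (cases t)
    have t': "la' \<in> Lam n d" "mu' \<in> Lam n d" "g' \<in> min_reps d la' mu'" "kappa la' g' mu' = A"
      using t tt by (auto simp: kappa_dom_def)
    have W': "g' \<in> weyl d" using t'(3) by (simp add: min_reps_def)
    have "la' = la" unfolding la_def
      by (rule comp_of_block_sizes[OF t'(1), symmetric]) (use kappa_row[OF t'(1,2) W'] t'(4) in simp)
    moreover have "mu' = mu" unfolding mu_def
      by (rule comp_of_block_sizes[OF t'(2), symmetric]) (use kappa_col[OF t'(1,2) W'] t'(4) in simp)
    ultimately show "t = (la, g, mu)"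
      using min_reps_unique[OF L _ g(1)] t'(3,4) k tt by simp
  qed
  then show ?thesis using that g(1) k unfolding la_def mu_def by blast
qed

section \<open>Endomorphisms given by left multiplication\<close>

lemma finite_Lam: "finite (Lam n d)"
proof (rule finite_subset)
  show "Lam n d \<subseteq> {f. \<forall>x. (x \<in> {..n} \<longrightarrow> f x \<in> {..d}) \<and> (x \<notin> {..n} \<longrightarrow> f x = 0)}"
  proof clarify
    fix la x assume la: "la \<in> Lam n d"
    have "la x \<le> d" if "x \<le> n"
      using member_le_sum[of x "{..n}" la] that Lam_sum[OF la] by simp
    then show "(x \<in> {..n} \<longrightarrow> la x \<in> {..d}) \<and> (x \<notin> {..n} \<longrightarrow> la x = 0)"
      using Lam_zero[OF la] by simp
  qed
qed (rule finite_set_of_finite_funs; simp)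

abbreviation row_comp :: "nat \<Rightarrow> mat \<Rightarrow> nat \<Rightarrow> nat" where
  "row_comp n A \<equiv> comp_of n (row n A)"

abbreviation col_comp :: "nat \<Rightarrow> mat \<Rightarrow> nat \<Rightarrow> nat" where
  "col_comp n A \<equiv> comp_of n (col n A)"

text \<open>The double coset with matrix \<open>A\<close>.\<close>

definition orbit :: "nat \<Rightarrow> nat \<Rightarrow> mat \<Rightarrow> (int \<Rightarrow> int) set" where
  "orbit n d A = {w \<in> weyl d. kappa (row_comp n A) w (col_comp n A) = A}"

definition std_coeff :: "nat \<Rightarrow> mat \<Rightarrow> laurent" where
  "std_coeff n A = u_pow (- ell_hat_c n A) * v_pow (- ell_hat_a n A)"

context hecke_algebra
begin

lemma x_elt_coset_sum:
  "la \<in> Lam n d \<Longrightarrow> x_elt d T la = coset_sum (block_index n la) (block_index n la)"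
  unfolding x_elt_def coset_sum_def by (rule sum.cong) (auto simp: parabolic_iff)

text \<open>Membership in the orbit depends on the pattern of \<open>w\<close> only.\<close>

lemma orbit_sum_right:
  assumes A: "A \<in> Xi n d"
  shows "\<exists>y. sum T (orbit n d A) = x_elt d T (row_comp n A) * y"
  unfolding x_elt_coset_sum[OF row_Lam(1)[OF A]]
proof (rule sum_T_in_right_ideal[of "block_index n (row_comp n A)", OF block_index_mono block_index_odd])
  fix v w assume v: "v \<in> orbit n d A" and w: "w \<in> weyl d" "block_index n (row_comp n A) \<circ> v = block_index n (row_comp n A) \<circ> w"
  have v_weyl: "v \<in> weyl d" using v by (simp add: orbit_def)
  have "block_index n (row_comp n A) (v z) = block_index n (row_comp n A) (w z)" for z using fun_cong[OF w(2)] by simp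
  then have "kappa (row_comp n A) w (col_comp n A) = kappa (row_comp n A) v (col_comp n A)"
    using v_weyl w(1) by (intro ext) (simp add: kappa_eq[OF row_Lam(1)[OF A] col_Lam(1)[OF A]])
  then show "w \<in> orbit n d A" using v w(1) by (simp add: orbit_def)
qed (auto simp: orbit_def)

lemma orbit_sum_left:
  assumes A: "A \<in> Xi n d"
  shows "\<exists>h. sum T (orbit n d A) = h * x_elt d T (col_comp n A)"
  unfolding x_elt_coset_sum[OF col_Lam(1)[OF A]] left_coset_sum_base[symmetric]
proof (rule sum_T_in_left_ideal[of "block_index n (col_comp n A)", OF block_index_mono block_index_odd])
  fix v w assume v: "v \<in> orbit n d A" and w: "w \<in> weyl d" "block_index n (col_comp n A) \<circ> winv v = block_index n (col_comp n A) \<circ> winv w"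
  have v_weyl: "v \<in> weyl d" using v by (simp add: orbit_def)
  have e: "block_index n (col_comp n A) (winv v z) = block_index n (col_comp n A) (winv w z)" for z using fun_cong[OF w(2)] by simp
  have "card {z. block_index n la (u z) = i \<and> block_index n mu z = j} = card {y. block_index n la y = i \<and> block_index n mu (winv u y) = j}"
    if "u \<in> weyl d" for u i j la mu
  proof (rule bij_betw_same_card[of u], rule bij_betw_subset[OF weyl_bij[OF that]])
    have "u (winv u y) = y" "winv u (u y) = y" for y
      using weyl_inv_comp[OF that] by (metis comp_apply id_apply)+
    then show "u ` {z. block_index n la (u z) = i \<and> block_index n mu z = j} = {y. block_index n la y = i \<and> block_index n mu (winv u y) = j}"
      by (auto simp: image_iff) metis
  qed simp
  then have "kappa (row_comp n A) w (col_comp n A) = kappa (row_comp n A) v (col_comp n A)"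
    using v_weyl w(1) e by (intro ext) (simp add: kappa_eq[OF row_Lam(1)[OF A] col_Lam(1)[OF A]])
  then show "w \<in> orbit n d A" using v w(1) by (simp add: orbit_def)
qed (auto simp: orbit_def)

lemma perm_module_component:
  "f \<in> perm_module n d T \<Longrightarrow> la \<in> Lam n d \<Longrightarrow> \<exists>y. f la = x_elt d T la * y"
  by (auto simp: perm_module_def)

lemma perm_module_add:
  assumes "f \<in> perm_module n d T" "g \<in> perm_module n d T"
  shows "(\<lambda>la. f la + g la) \<in> perm_module n d T"
proof -
  have "f la + g la \<in> range (\<lambda>y. x_elt d T la * y)" if la: "la \<in> Lam n d" for la
  proof -
    obtain y z where "f la = x_elt d T la * y" "g la = x_elt d T la * z"
      using perm_module_component[OF assms(1) la] perm_module_component[OF assms(2) la] by blast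
    then have "f la + g la = x_elt d T la * (y + z)" by (simp add: distrib_left)
    then show ?thesis by blast
  qed
  then show ?thesis using assms by (simp add: perm_module_def)
qed

lemma perm_module_mult:
  assumes "f \<in> perm_module n d T"
  shows "(\<lambda>la. f la * y) \<in> perm_module n d T"
proof -
  have "f la * y \<in> range (\<lambda>y. x_elt d T la * y)" if la: "la \<in> Lam n d" for la
  proof -
    obtain z where "f la = x_elt d T la * z"
      using perm_module_component[OF assms(1) la] by blast
    then have "f la * y = x_elt d T la * (z * y)" by (simp add: mult.assoc)
    then show ?thesis by blast
  qed
  then show ?thesis using assms by (simp add: perm_module_def)
qed

lemma perm_module_zero: "(\<lambda>_. 0) \<in> perm_module n d T"
proof -
  have "0 \<in> range (\<lambda>y. x * y)" for x :: 'h by (rule range_eqI[of _ _ 0]) simp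
  then show ?thesis by (simp add: perm_module_def)
qed

lemma embed_perm_module:
  assumes "la \<in> Lam n d"
  shows "embed la (x_elt d T la * y) \<in> perm_module n d T"
proof -
  have "0 \<in> range (\<lambda>y. x * y)" for x :: 'h by (rule range_eqI[of _ _ 0]) simp
  then show ?thesis using assms by (auto simp: perm_module_def embed_def)
qed

lemma embed_perm_module_1: "la \<in> Lam n d \<Longrightarrow> embed la (x_elt d T la) \<in> perm_module n d T"
  using embed_perm_module[of la n 1] by simp

lemma hecke_endosD:
  assumes "\<phi> \<in> hecke_endos n d T"
  shows "f \<in> perm_module n d T \<Longrightarrow> g \<in> perm_module n d T \<Longrightarrow> \<phi> (\<lambda>la. f la + g la) = (\<lambda>la. \<phi> f la + \<phi> g la)"
    and "f \<in> perm_module n d T \<Longrightarrow> \<phi> (\<lambda>la. f la * y) = (\<lambda>la. \<phi> f la * y)"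
    and "f \<in> perm_module n d T \<Longrightarrow> \<phi> f \<in> perm_module n d T"
    and "f \<notin> perm_module n d T \<Longrightarrow> \<phi> f = undefined"
  using assms by (auto simp: hecke_endos_def PiE_def Pi_def extensional_def)

text \<open>Every element of the permutation module is a finite sum of right multiples of the generators, which
is shown by cutting off the components one at a time.\<close>

lemma hecke_endos_ext:
  assumes \<phi>: "\<phi> \<in> hecke_endos n d T" and \<psi>: "\<psi> \<in> hecke_endos n d T"
    and gens: "\<And>nu. nu \<in> Lam n d \<Longrightarrow> \<phi> (embed nu (x_elt d T nu)) = \<psi> (embed nu (x_elt d T nu))"
  shows "\<phi> = \<psi>"
proof
  fix f
  show "\<phi> f = \<psi> f"
  proof (cases "f \<in> perm_module n d T")
    case True
    define cut where "cut F = (\<lambda>la. if la \<in> F then f la else 0)" for F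
    have "cut F \<in> perm_module n d T \<and> \<phi> (cut F) = \<psi> (cut F)" if "finite F" "F \<subseteq> Lam n d" for F
      using that
    proof (induction F rule: finite_induct)
      case empty
      have e: "cut {} = (\<lambda>_. 0)" by (simp add: cut_def)
      have "\<phi> (\<lambda>_. 0) = (\<lambda>_. 0)" if "\<phi> \<in> hecke_endos n d T" for \<phi>
        using hecke_endosD(2)[OF that perm_module_zero, of 0] by simp
      then show ?case unfolding e using \<phi> \<psi> perm_module_zero by simp
    next
      case (insert nu F)
      then have nu: "nu \<in> Lam n d" and IH: "cut F \<in> perm_module n d T" "\<phi> (cut F) = \<psi> (cut F)" by auto
      obtain y where y: "f nu = x_elt d T nu * y" using perm_module_component[OF True nu] by blast
      define g where "g = (\<lambda>la. embed nu (x_elt d T nu) la * y)"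
      have g: "g \<in> perm_module n d T"
        unfolding g_def by (rule perm_module_mult[OF embed_perm_module_1[OF nu]])
      have c: "cut (insert nu F) = (\<lambda>la. cut F la + g la)"
      proof (rule ext)
        fix la
        show "cut (insert nu F) la = cut F la + g la"
          using insert.hyps y by (cases "la = nu") (simp_all add: cut_def g_def embed_def)
      qed
      have "\<phi> g = \<psi> g"
        unfolding g_def using hecke_endosD(2)[OF \<phi> embed_perm_module_1[OF nu]]
          hecke_endosD(2)[OF \<psi> embed_perm_module_1[OF nu]] gens[OF nu] by simp
      then show ?case
        unfolding c using hecke_endosD(1)[OF \<phi> IH(1) g] hecke_endosD(1)[OF \<psi> IH(1) g] IH perm_module_add[OF IH(1) g] by simp
    qed
    moreover have "cut (Lam n d) = f"
      using True by (auto simp: cut_def perm_module_def fun_eq_iff)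
    ultimately show ?thesis using finite_Lam[of n d] by (metis order.refl)
  next
    case False
    then show ?thesis using hecke_endosD(4)[OF \<phi>] hecke_endosD(4)[OF \<psi>] by simp
  qed
qed

text \<open>The basis elements are realised in this form because composition of endomorphisms then becomes
multiplication in the Hecke algebra. The multiplier is determined only up to its effect on
\<open>x_elt d T mu\<close>.\<close>

definition lmult :: "nat \<Rightarrow> 'h \<Rightarrow> (nat \<Rightarrow> nat) \<Rightarrow> (nat \<Rightarrow> nat) \<Rightarrow> 'h schur_elt" where
  "lmult n h la mu = (\<lambda>f \<in> perm_module n d T. embed la (h * f mu))"

lemma lmult_endo:
  assumes la: "la \<in> Lam n d" and mu: "mu \<in> Lam n d" and h: "h * x_elt d T mu = x_elt d T la * y"
  shows "lmult n h la mu \<in> hecke_endos n d T"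
proof -
  have "embed la (h * f mu) \<in> perm_module n d T" if f: "f \<in> perm_module n d T" for f
  proof -
    obtain z where "f mu = x_elt d T mu * z" using perm_module_component[OF f mu] by blast
    then have "h * f mu = x_elt d T la * (y * z)" using h by (simp add: mult.assoc[symmetric])
    then show ?thesis using embed_perm_module[OF la] by simp
  qed
  then show ?thesis
    using perm_module_add perm_module_mult
    by (auto simp: hecke_endos_def lmult_def embed_def fun_eq_iff distrib_left mult.assoc)
qed

lemma lmult_cong:
  assumes "mu \<in> Lam n d" "h * x_elt d T mu = k * x_elt d T mu"
  shows "lmult n h la mu = lmult n k la mu"
  unfolding lmult_def
proof (rule restrict_ext)
  fix f assume "f \<in> perm_module n d T"
  then obtain z where "f mu = x_elt d T mu * z" using perm_module_component assms(1) by blast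
  then have "h * f mu = k * f mu" using assms(2) by (simp add: mult.assoc[symmetric])
  then show "embed la (h * f mu) = embed la (k * f mu)" by simp
qed

text \<open>The defining description of \<open>e_elt\<close> is satisfied by a left multiplication and determines it, since it
prescribes the values on all generators.\<close>

lemma e_elt_lmult:
  assumes A: "A \<in> Xi n d" and h: "sum T (orbit n d A) = h * x_elt d T (col_comp n A)"
  shows "e_elt n d T A = lmult n h (row_comp n A) (col_comp n A)"
proof -
  define la mu where "la = row_comp n A" and "mu = col_comp n A"
  have L: "la \<in> Lam n d" "mu \<in> Lam n d" unfolding la_def mu_def by (rule row_Lam(1)[OF A], rule col_Lam(1)[OF A])
  obtain g where g: "kappa_inv n d A = (la, g, mu)" "g \<in> min_reps d la mu" "kappa la g mu = A"
    using kappa_inv_props[OF A] unfolding la_def mu_def .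
  have dc: "(\<Sum>w \<in> double_coset d la g mu. T w) = h * x_elt d T mu"
    unfolding double_coset_eq_kappa[OF L g(2)] g(3) using h by (simp add: orbit_def la_def mu_def)
  obtain y where y: "h * x_elt d T mu = x_elt d T la * y"
    using orbit_sum_right[OF A] h unfolding la_def mu_def by metis
  have endo: "lmult n h la mu \<in> hecke_endos n d T" by (rule lmult_endo[OF L y])
  \<comment> \<open>The two conditions that characterise \<open>e_elt\<close>.\<close>
  have val: "lmult n h la mu (embed mu (x_elt d T mu)) = embed la (h * x_elt d T mu)"
    "nu \<in> Lam n d - {mu} \<Longrightarrow> lmult n h la mu (embed nu (x_elt d T nu)) = (\<lambda>_. 0)" for nu
    using embed_perm_module_1 L by (auto simp: lmult_def embed_def)
  have "(THE \<phi>. \<phi> \<in> hecke_endos n d T \<and>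
          \<phi> (embed mu (x_elt d T mu)) = embed la (\<Sum>w \<in> double_coset d la g mu. T w) \<and>
          (\<forall>nu \<in> Lam n d - {mu}. \<phi> (embed nu (x_elt d T nu)) = (\<lambda>_. 0))) = lmult n h la mu"
  proof (rule the_equality)
    fix \<phi> assume *: "\<phi> \<in> hecke_endos n d T \<and>
          \<phi> (embed mu (x_elt d T mu)) = embed la (\<Sum>w \<in> double_coset d la g mu. T w) \<and>
          (\<forall>nu \<in> Lam n d - {mu}. \<phi> (embed nu (x_elt d T nu)) = (\<lambda>_. 0))"
    show "\<phi> = lmult n h la mu"
    proof (rule hecke_endos_ext[OF _ endo])
      show "\<phi> (embed nu (x_elt d T nu)) = lmult n h la mu (embed nu (x_elt d T nu))" if "nu \<in> Lam n d" for nu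
        using * val dc that by (cases "nu = mu") auto
    qed (use * in simp)
  qed (use endo val dc in simp)
  then show ?thesis unfolding e_elt_def g(1) la_def mu_def by simp
qed

lemma lmult_compose:
  assumes "la \<in> Lam n d" "mu \<in> Lam n d" "k * x_elt d T mu = x_elt d T la * y"
  shows "compose (perm_module n d T) (lmult n h nu la) (lmult n k la mu) = lmult n (h * k) nu mu"
  unfolding compose_def lmult_def
proof (rule restrict_ext)
  fix f assume f: "f \<in> perm_module n d T"
  have "embed la (k * f mu) \<in> perm_module n d T"
    using hecke_endosD(3)[OF lmult_endo[OF assms] f] f by (simp add: lmult_def)
  then show "(\<lambda>f \<in> perm_module n d T. embed nu (h * f la)) ((\<lambda>f \<in> perm_module n d T. embed la (k * f mu)) f) = embed nu (h * k * f mu)"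
    using f by (simp add: embed_def mult.assoc)
qed

lemma lmult_smult: "c \<odot>\<^bsub>schur_algebra n d smul T\<^esub> lmult n h la mu = lmult n (smul c h) la mu"
  by (auto simp: schur_algebra_def lmult_def embed_def smul_mult_left intro!: restrict_ext)

lemma schur_add_monoid: "abelian_monoid (schur_algebra n d smul T)"
proof (rule abelian_monoidI)
  let ?S = "schur_algebra n d smul T"
  have car: "carrier ?S = hecke_endos n d T" by (simp add: schur_algebra_def)
  have add: "\<phi> \<oplus>\<^bsub>?S\<^esub> \<psi> = (\<lambda>f \<in> perm_module n d T. \<lambda>la. \<phi> f la + \<psi> f la)" for \<phi> \<psi>
    by (simp add: schur_algebra_def)
  have zero: "\<zero>\<^bsub>?S\<^esub> = (\<lambda>f \<in> perm_module n d T. \<lambda>la. 0)" by (simp add: schur_algebra_def)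
  fix \<phi> \<psi> \<chi> assume \<phi>: "\<phi> \<in> carrier ?S" and \<psi>: "\<psi> \<in> carrier ?S"
  show "\<phi> \<oplus>\<^bsub>?S\<^esub> \<psi> \<in> carrier ?S"
    using hecke_endosD[OF \<phi>[unfolded car]] hecke_endosD[OF \<psi>[unfolded car]] perm_module_add perm_module_mult
    unfolding car add by (auto simp: hecke_endos_def fun_eq_iff algebra_simps)
  show "\<phi> \<oplus>\<^bsub>?S\<^esub> \<psi> \<oplus>\<^bsub>?S\<^esub> \<chi> = \<phi> \<oplus>\<^bsub>?S\<^esub> (\<psi> \<oplus>\<^bsub>?S\<^esub> \<chi>)"
    unfolding add by (rule restrict_ext) (simp add: add.assoc)
  show "\<zero>\<^bsub>?S\<^esub> \<oplus>\<^bsub>?S\<^esub> \<phi> = \<phi>"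
    using hecke_endosD(4)[OF \<phi>[unfolded car]] unfolding add zero by (auto simp: fun_eq_iff restrict_def)
  show "\<phi> \<oplus>\<^bsub>?S\<^esub> \<psi> = \<psi> \<oplus>\<^bsub>?S\<^esub> \<phi>"
    unfolding add by (rule restrict_ext) (simp add: add.commute)
next
  show "\<zero>\<^bsub>schur_algebra n d smul T\<^esub> \<in> carrier (schur_algebra n d smul T)"
    using perm_module_zero perm_module_add perm_module_mult by (auto simp: schur_algebra_def hecke_endos_def)
qed

lemma finsum_lmult:
  assumes "finite I" "\<And>t. t \<in> I \<Longrightarrow> lmult n (h t) la mu \<in> hecke_endos n d T"
  shows "finsum (schur_algebra n d smul T) (\<lambda>t. lmult n (h t) la mu) I = lmult n (\<Sum>t\<in>I. h t) la mu"
proof -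
  interpret S: abelian_monoid "schur_algebra n d smul T" by (rule schur_add_monoid)
  have car: "carrier (schur_algebra n d smul T) = hecke_endos n d T" by (simp add: schur_algebra_def)
  show ?thesis
    using assms
  proof (induction I rule: finite_induct)
    case empty
    have "(\<lambda>_::nat \<Rightarrow> nat. 0) = embed la (0::'h)" by (rule ext) (simp add: embed_def)
    then show ?case unfolding S.finsum_empty by (simp add: schur_algebra_def lmult_def)
  next
    case (insert t I)
    then have "finsum (schur_algebra n d smul T) (\<lambda>t. lmult n (h t) la mu) (insert t I)
       = lmult n (h t) la mu \<oplus>\<^bsub>schur_algebra n d smul T\<^esub> lmult n (\<Sum>t\<in>I. h t) la mu"
      by (subst S.finsum_insert) (auto simp: car)
    also have "\<dots> = lmult n (h t + (\<Sum>t\<in>I. h t)) la mu"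
      by (auto simp: schur_algebra_def lmult_def embed_def distrib_right intro!: restrict_ext)
    finally show ?case using insert.hyps by simp
  qed
qed

text \<open>Choose a multiplier \<open>h\<close> with \<open>h * x\<^sub>\<mu> = \<Sum> T w\<close> for each matrix. Both sides of the formula are then
left multiplications between the same two summands, and they agree once they agree on the generator.
The multiplier of \<open>B\<close> is universally quantified since only its product with the generator is known.\<close>

lemma std_basis_product:
  assumes A: "A \<in> Xi n d" and B: "B \<in> Xi n d" and BA: "col_comp n B = row_comp n A"
    and I: "finite I" "\<And>t. t \<in> I \<Longrightarrow> M t \<in> Xi n d \<and> row_comp n (M t) = row_comp n B \<and> col_comp n (M t) = col_comp n A"
    and H: "\<And>h. h * x_elt d T (row_comp n A) = sum T (orbit n d B) \<Longrightarrow>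
       smul (std_coeff n B * std_coeff n A) (h * sum T (orbit n d A))
         = (\<Sum>t\<in>I. smul (c t * std_coeff n (M t)) (sum T (orbit n d (M t))))"
  shows "std_basis n d smul T B \<otimes>\<^bsub>schur_algebra n d smul T\<^esub> std_basis n d smul T A
     = (\<Oplus>\<^bsub>schur_algebra n d smul T\<^esub> t\<in>I. c t \<odot>\<^bsub>schur_algebra n d smul T\<^esub> std_basis n d smul T (M t))"
proof -
  have "\<exists>h. sum T (orbit n d A) = h * x_elt d T (col_comp n A)" if "A \<in> Xi n d" for A
    by (rule orbit_sum_left[OF that])
  then obtain hh where hh: "\<And>A. A \<in> Xi n d \<Longrightarrow> sum T (orbit n d A) = hh A * x_elt d T (col_comp n A)" by metis
  have std: "std_basis n d smul T A = lmult n (smul (std_coeff n A) (hh A)) (row_comp n A) (col_comp n A)" if "A \<in> Xi n d" for A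
    unfolding std_basis_def e_elt_lmult[OF that hh[OF that]] lmult_smult std_coeff_def ..
  have L: "row_comp n A \<in> Lam n d" "col_comp n A \<in> Lam n d" "row_comp n B \<in> Lam n d"
    using row_Lam(1) col_Lam(1) A B by auto
  have fac: "\<exists>y. smul c (hh A) * x_elt d T (col_comp n A) = x_elt d T (row_comp n A) * y" if A: "A \<in> Xi n d" for A c
  proof -
    obtain y where "sum T (orbit n d A) = x_elt d T (row_comp n A) * y" using orbit_sum_right[OF A] by blast
    then have "smul c (hh A) * x_elt d T (col_comp n A) = x_elt d T (row_comp n A) * smul c y"
      using hh[OF A] by (simp add: smul_mult_left smul_mult_right)
    then show ?thesis by blast
  qed
  have lhs: "std_basis n d smul T B \<otimes>\<^bsub>schur_algebra n d smul T\<^esub> std_basis n d smul T A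
     = lmult n (smul (std_coeff n B) (hh B) * smul (std_coeff n A) (hh A)) (row_comp n B) (col_comp n A)"
  proof -
    obtain y where "smul (std_coeff n A) (hh A) * x_elt d T (col_comp n A) = x_elt d T (row_comp n A) * y" using fac[OF A] by blast
    then show ?thesis
      using lmult_compose[OF L(1,2)] unfolding std[OF A] std[OF B] BA by (simp add: schur_algebra_def)
  qed
  have summand: "c t \<odot>\<^bsub>schur_algebra n d smul T\<^esub> std_basis n d smul T (M t)
     = lmult n (smul (c t * std_coeff n (M t)) (hh (M t))) (row_comp n B) (col_comp n A)" if "t \<in> I" for t
    using I(2)[OF that] by (simp add: std lmult_smult)
  have endo: "lmult n (smul (c t * std_coeff n (M t)) (hh (M t))) (row_comp n B) (col_comp n A) \<in> hecke_endos n d T" if t: "t \<in> I" for t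
  proof -
    obtain y where "smul (c t * std_coeff n (M t)) (hh (M t)) * x_elt d T (col_comp n (M t)) = x_elt d T (row_comp n (M t)) * y"
      using fac[of "M t"] I(2)[OF t] by blast
    then show ?thesis using lmult_endo[OF L(3,2)] I(2)[OF t] by simp
  qed
  interpret S: abelian_monoid "schur_algebra n d smul T" by (rule schur_add_monoid)
  have "(\<Oplus>\<^bsub>schur_algebra n d smul T\<^esub> t\<in>I. c t \<odot>\<^bsub>schur_algebra n d smul T\<^esub> std_basis n d smul T (M t))
     = (\<Oplus>\<^bsub>schur_algebra n d smul T\<^esub> t\<in>I. lmult n (smul (c t * std_coeff n (M t)) (hh (M t))) (row_comp n B) (col_comp n A))"
    by (rule S.finsum_cong') (use summand endo in \<open>auto simp: schur_algebra_def\<close>)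
  also have "\<dots> = lmult n (\<Sum>t\<in>I. smul (c t * std_coeff n (M t)) (hh (M t))) (row_comp n B) (col_comp n A)"
    by (rule finsum_lmult[OF I(1) endo])
  also have "\<dots> = lmult n (smul (std_coeff n B) (hh B) * smul (std_coeff n A) (hh A)) (row_comp n B) (col_comp n A)"
  proof (rule lmult_cong[OF L(2)])
    have "smul (std_coeff n B) (hh B) * smul (std_coeff n A) (hh A) * x_elt d T (col_comp n A)
       = smul (std_coeff n B * std_coeff n A) (hh B * sum T (orbit n d A))"
      using hh[OF A] by (simp add: smul_mult_left smul_mult_right mult.assoc mult.commute)
    also have "\<dots> = (\<Sum>t\<in>I. smul (c t * std_coeff n (M t)) (sum T (orbit n d (M t))))"
      by (rule H) (use hh[OF B] BA in simp)
    also have "\<dots> = (\<Sum>t\<in>I. smul (c t * std_coeff n (M t)) (hh (M t))) * x_elt d T (col_comp n A)"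
      unfolding sum_distrib_right
    proof (rule sum.cong[OF refl])
      fix t assume "t \<in> I"
      then show "smul (c t * std_coeff n (M t)) (sum T (orbit n d (M t)))
        = smul (c t * std_coeff n (M t)) (hh (M t)) * x_elt d T (col_comp n A)"
        using I(2) hh[of "M t"] by (simp add: smul_mult_left)
    qed
    finally show "(\<Sum>t\<in>I. smul (c t * std_coeff n (M t)) (hh (M t))) * x_elt d T (col_comp n A)
      = smul (std_coeff n B) (hh B) * smul (std_coeff n A) (hh A) * x_elt d T (col_comp n A)" ..
  qed
  finally show ?thesis using lhs by simp
qed

end

section \<open>Changing letters of a pattern\<close>

text \<open>The values at \<open>-X\<close> are changed in parallel so that the pattern stays odd.\<close>

definition relabel :: "int set \<Rightarrow> int \<Rightarrow> (int \<Rightarrow> int) \<Rightarrow> int \<Rightarrow> int" where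
  "relabel X q f z = (if z \<in> X then q else if - z \<in> X then - q else f z)"

text \<open>The sets of \<open>b\<close> positions at which the letter \<open>p\<close> may be changed. If \<open>p = 0\<close>, two
opposite positions carry the same letter, and at most one of them is chosen.\<close>

definition selections :: "nat \<Rightarrow> int \<Rightarrow> nat \<Rightarrow> (int \<Rightarrow> int) \<Rightarrow> int set set" where
  "selections d p b f = {X. X \<subseteq> {- int d..int d} \<and> X \<inter> uminus ` X = {} \<and> (\<forall>x\<in>X. f x = p) \<and> card X = b}"

definition letter_positions :: "nat \<Rightarrow> int \<Rightarrow> (int \<Rightarrow> int) \<Rightarrow> int set" where
  "letter_positions d q f = {z \<in> {- int d..int d} - {0}. f z = q}"

text \<open>The power of the parameters gained by a change of letters from \<open>p\<close> to \<open>q\<close>. It counts the positions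
that already carry the letter \<open>q\<close> on the wrong side of the changed ones. If \<open>q = 0\<close>, the changed
positions also cross the negatives of each other, and each negative changed position contributes
\<open>u\<^sup>2\<close> in place of one factor \<open>v\<close>.\<close>

definition relabel_weight :: "nat \<Rightarrow> int \<Rightarrow> int \<Rightarrow> (int \<Rightarrow> int) \<Rightarrow> int set \<Rightarrow> laurent" where
  "relabel_weight d p q f X = (if p < q then v_pow (2 * crossings X (letter_positions d q f))
     else if q = 0 then u_pow (2 * neg_count X) * v_pow (2 * crossings (letter_positions d q f) X + crossings (uminus ` X) X - neg_count X)
     else v_pow (2 * crossings (letter_positions d q f) X))"

lemma finite_letter_positions: "finite (letter_positions d q f)"
  by (rule finite_subset[of _ "{- int d..int d}"]) (auto simp: letter_positions_def)

lemma selections_finite: "X \<in> selections d p b f \<Longrightarrow> finite X"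
  by (auto simp: selections_def intro: finite_subset)

lemma finite_selections: "finite (selections d p b f)"
  by (rule finite_subset[of _ "Pow {- int d..int d}"]) (auto simp: selections_def)

lemma selections_not_zero: "X \<in> selections d p b f \<Longrightarrow> 0 \<notin> X"
  by (force simp: selections_def)

lemma selections_value: "X \<in> selections d p b f \<Longrightarrow> x \<in> X \<Longrightarrow> f x = p"
  by (simp add: selections_def)

lemma selections_sign: "X \<in> selections d p b f \<Longrightarrow> x \<in> X \<Longrightarrow> - x \<notin> X"
  by (force simp: selections_def)

lemma selections_bound: "X \<in> selections d p b f \<Longrightarrow> x \<in> X \<Longrightarrow> \<bar>x\<bar> \<le> int d"
  by (auto simp: selections_def abs_le_iff)

lemma relabel_odd:
  assumes "\<And>z. f (- z) = - f z" "X \<in> selections d p b f"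
  shows "relabel X q f (- z) = - relabel X q f z"
  using assms selections_sign[OF assms(2), of z] by (auto simp: relabel_def)

lemma letter_positions_gen:
  assumes "i < d"
  shows "letter_positions d q (f \<circ> gen i) = gen i ` letter_positions d q f"
proof (intro Set.set_eqI iffI)
  have img: "gen i z \<in> {- int d..int d} - {0} \<longleftrightarrow> z \<in> {- int d..int d} - {0}" for z
    using gen_image_interval[OF assms] by (metis gen_gen image_eqI)
  fix z
  show "z \<in> gen i ` letter_positions d q f" if z: "z \<in> letter_positions d q (f \<circ> gen i)"
  proof -
    have "gen i z \<in> letter_positions d q f" using z img[of z] by (simp add: letter_positions_def)
    then show ?thesis by (metis gen_gen image_eqI)
  qed
  show "z \<in> letter_positions d q (f \<circ> gen i)" if z: "z \<in> gen i ` letter_positions d q f"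
  proof -
    obtain y where y: "z = gen i y" "y \<in> letter_positions d q f" using z by blast
    then have "z \<in> {- int d..int d} - {0}" using img[of y] by (simp add: letter_positions_def)
    then show ?thesis using y by (simp add: letter_positions_def)
  qed
qed

lemma sum_of_bool_pair:
  assumes "finite A" "finite B"
  shows "(\<Sum>x\<in>A. \<Sum>y\<in>B. of_bool (x = a \<and> y = b)) = (of_bool (a \<in> A \<and> b \<in> B) :: int)"
proof -
  have "(\<Sum>y\<in>B. of_bool (x = a \<and> y = b)) = (if x = a then of_bool (b \<in> B) else 0 :: int)" for x
    using assms(2) by (cases "x = a") (auto simp: of_bool_def)
  then show ?thesis using assms(1) by (simp add: of_bool_def)
qed

lemma sum_adjacent_0:
  assumes "finite A" "finite B"
  shows "(\<Sum>x\<in>A. \<Sum>y\<in>B. of_bool (adjacent 0 x y)) = (of_bool (- 1 \<in> A \<and> 1 \<in> B) :: int)"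
  unfolding sum_of_bool_pair[OF assms, symmetric] by (intro sum.cong refl) (simp add: adjacent_def)

lemma sum_adjacent_pos:
  assumes "finite A" "finite B" "i \<noteq> 0"
  shows "(\<Sum>x\<in>A. \<Sum>y\<in>B. of_bool (adjacent i x y))
    = (of_bool (int i \<in> A \<and> int i + 1 \<in> B) + of_bool (- int i - 1 \<in> A \<and> - int i \<in> B) :: int)"
proof -
  have "(\<Sum>x\<in>A. \<Sum>y\<in>B. of_bool (adjacent i x y))
    = (\<Sum>x\<in>A. \<Sum>y\<in>B. of_bool (x = int i \<and> y = int i + 1) + (of_bool (x = - int i - 1 \<and> y = - int i) :: int))"
    using assms(3) by (intro sum.cong refl) (auto simp: adjacent_def)
  then show ?thesis by (simp only: sum.distrib sum_of_bool_pair[OF assms(1,2)])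
qed

lemma crossings_gen:
  assumes "0 \<notin> A" "0 \<notin> B"
  shows "crossings (gen i ` A) (gen i ` B) = crossings A B
    + (\<Sum>a\<in>A. \<Sum>b\<in>B. of_bool (adjacent i a b)) - (\<Sum>b\<in>B. \<Sum>a\<in>A. of_bool (adjacent i b a))"
proof -
  have "crossings (gen i ` A) (gen i ` B) = (\<Sum>a\<in>A. \<Sum>b\<in>B. of_bool (gen i b < gen i a))"
    unfolding crossings_def by (simp add: sum.reindex[OF inj_gen])
  also have "\<dots> = (\<Sum>a\<in>A. \<Sum>b\<in>B. of_bool (b < a) - of_bool (adjacent i b a) + of_bool (adjacent i a b))"
    by (intro sum.cong refl of_bool_gen_less) (use assms in auto)
  also have "\<dots> = crossings A B + (\<Sum>a\<in>A. \<Sum>b\<in>B. of_bool (adjacent i a b)) - (\<Sum>a\<in>A. \<Sum>b\<in>B. of_bool (adjacent i b a))"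
    by (simp add: crossings_def sum.distrib sum_subtractf)
  also have "(\<Sum>a\<in>A. \<Sum>b\<in>B. of_bool (adjacent i b a)) = (\<Sum>b\<in>B. \<Sum>a\<in>A. of_bool (adjacent i b a) :: int)"
    by (rule sum.swap)
  finally show ?thesis .
qed

lemma sum_adjacent_descent:
  assumes "\<And>z. f (- z) = - f z" "ascent f i" "\<And>a. a \<in> A \<Longrightarrow> f a = r" "\<And>b. b \<in> B \<Longrightarrow> f b = s" "s \<le> r"
  shows "(\<Sum>a\<in>A. \<Sum>b\<in>B. of_bool (adjacent i a b)) = (0 :: int)"
proof -
  have "\<not> adjacent i a b" if "a \<in> A" "b \<in> B" for a b
    using ascent_adjacent[OF assms(1) _ assms(2), of a b] assms(3)[OF that(1)] assms(4)[OF that(2)] assms(5) by auto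
  then show ?thesis by (intro sum.neutral ballI) simp
qed

lemma neg_count_gen:
  assumes "finite X" "0 \<notin> X"
  shows "neg_count (gen i ` X) = neg_count X + of_bool (i = 0) * (of_bool (1 \<in> X) - of_bool (- 1 \<in> X))"
proof -
  have one: "(\<Sum>x\<in>X. of_bool (x = a)) = (of_bool (a \<in> X) :: int)" for a
    using assms(1) by (simp add: of_bool_def)
  have e: "neg_count (gen i ` X) = (\<Sum>x\<in>X. of_bool (gen i x < 0))"
    unfolding neg_count_def by (simp add: sum.reindex[OF inj_gen])
  show ?thesis
  proof (cases "i = 0")
    case True
    have "neg_count (gen i ` X) = (\<Sum>x\<in>X. of_bool (x < 0) + of_bool (x = 1) - of_bool (x = - 1))"
      unfolding e by (intro sum.cong refl) (auto simp: True gen_0_apply)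
    then show ?thesis by (simp only: True sum.distrib sum_subtractf one neg_count_def) simp
  next
    case False
    have "neg_count (gen i ` X) = (\<Sum>x\<in>X. of_bool (x < 0))"
      unfolding e using False assms(2) by (intro sum.cong refl) (auto simp: gen_apply)
    then show ?thesis using False by (simp add: neg_count_def)
  qed
qed

lemma relabel_gen: "relabel (gen i ` X) q (f \<circ> gen i) = relabel X q f \<circ> gen i"
proof
  fix z
  have "z \<in> gen i ` X \<longleftrightarrow> gen i z \<in> X" for z by (metis gen_gen image_iff)
  then show "relabel (gen i ` X) q (f \<circ> gen i) z = (relabel X q f \<circ> gen i) z"
    by (simp add: relabel_def gen_odd)
qed

lemma fixed_if_equal:
  assumes "\<And>z. F (- z) = - F z" "i \<noteq> 0" "F (int i) = F (int i + 1)"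
  shows "F \<circ> gen i = F"
proof
  fix z
  have "F (- int i) = F (- int i - 1)"
    using assms(1)[of "int i"] assms(1)[of "int i + 1"] assms(3) by simp
  then show "(F \<circ> gen i) z = F z" using assms(2,3) by (auto simp: gen_apply)
qed

text \<open>An ascent of \<open>f\<close> at \<open>i\<close> compares two neighbouring letters. After the change of letters it remains an
ascent unless the smaller letter was raised to the larger one, or the larger one lowered to the smaller
one; in that case the two letters become equal, and exchanging them creates exactly one new crossing,
worth the Hecke parameter. Since a coset sum with equal neighbouring letters is multiplied by this
parameter, both cases are compatible with right multiplication by \<open>T (gen i)\<close>.\<close>

lemma relabel_weight_step_up:
  assumes odd: "\<And>z. f (- z) = - f z" and a: "ascent f i" and i: "i < d" and X: "X \<in> selections d p b f"
    and pq: "0 \<le> p" "q = p + 1"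
  shows "ascent (relabel X q f) i \<and> relabel_weight d p q (f \<circ> gen i) (gen i ` X) = relabel_weight d p q f X
    \<or> relabel X q f \<circ> gen i = relabel X q f \<and> relabel_weight d p q (f \<circ> gen i) (gen i ` X) = hecke_param i * relabel_weight d p q f X"
proof -
  define Y where "Y = letter_positions d q f"
  note fin = selections_finite[OF X] finite_letter_positions[of d q f, folded Y_def]
  have nz: "0 \<notin> X" "0 \<notin> Y" using selections_not_zero[OF X] by (auto simp: Y_def letter_positions_def)
  have Y: "f y = q" if "y \<in> Y" for y using that by (simp add: Y_def letter_positions_def)
  note Xp = selections_value[OF X]
  have desc: "(\<Sum>y\<in>Y. \<Sum>x\<in>X. of_bool (adjacent i y x)) = (0 :: int)"
    by (rule sum_adjacent_descent[OF odd a Y Xp]) (use pq in simp_all)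
  have w: "relabel_weight d p q (f \<circ> gen i) (gen i ` X) = v_pow (2 * (crossings X Y + (\<Sum>x\<in>X. \<Sum>y\<in>Y. of_bool (adjacent i x y))))"
    using pq crossings_gen[OF nz, of i] desc unfolding relabel_weight_def letter_positions_gen[OF i] Y_def[symmetric] by simp
  have w0: "relabel_weight d p q f X = v_pow (2 * crossings X Y)"
    using pq by (simp add: relabel_weight_def Y_def)
  show ?thesis
  proof (cases "i = 0")
    case True
    have f1: "0 < f 1" "f (- 1) = - f 1" using a True odd[of 1] by (auto simp: ascent_def)
    have "- 1 \<notin> X" using Xp[of "- 1"] f1 pq by auto
    then have "ascent (relabel X q f) i" "(\<Sum>x\<in>X. \<Sum>y\<in>Y. of_bool (adjacent i x y)) = (0 :: int)"
      using True f1 pq sum_adjacent_0[OF fin] by (simp_all add: ascent_def relabel_def)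
    then show ?thesis using w w0 by simp
  next
    case False
    have lt: "f (int i) < f (int i + 1)" using a False by (simp add: ascent_def)
    have Ymem: "int i + 1 \<in> Y \<longleftrightarrow> f (int i + 1) = q" "- int i \<in> Y \<longleftrightarrow> f (int i) = - q"
      using i False odd[of "int i"] by (auto simp: Y_def letter_positions_def)
    have x: "int i \<in> X \<Longrightarrow> f (int i) = p" "- int i \<in> X \<Longrightarrow> f (int i) = - p"
      "int i + 1 \<in> X \<Longrightarrow> f (int i + 1) = p" "- int i - 1 \<in> X \<Longrightarrow> f (int i + 1) = - p"
      using Xp[of "int i"] Xp[of "- int i"] Xp[of "int i + 1"] Xp[of "- int i - 1"] odd[of "int i"] odd[of "int i + 1"] by auto
    define F G where "F = relabel X q f (int i)" and "G = relabel X q f (int i + 1)"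
    have FG: "F = (if int i \<in> X then q else if - int i \<in> X then - q else f (int i))"
      "G = (if int i + 1 \<in> X then q else if - int i - 1 \<in> X then - q else f (int i + 1))"
      by (simp_all add: F_def G_def relabel_def)
    define c where "c = (of_bool (int i \<in> X \<and> int i + 1 \<in> Y) + of_bool (- int i - 1 \<in> X \<and> - int i \<in> Y) :: int)"
    have c: "(\<Sum>x\<in>X. \<Sum>y\<in>Y. of_bool (adjacent i x y)) = c"
      unfolding c_def by (rule sum_adjacent_pos[OF fin False])
    have "F < G \<and> c = 0 \<or> F = G \<and> c = 1"
      using x lt pq selections_sign[OF X, of "int i"] selections_sign[OF X, of "int i + 1"] unfolding FG c_def Ymem
      by (cases "int i \<in> X"; cases "- int i \<in> X"; cases "int i + 1 \<in> X"; cases "- int i - 1 \<in> X") auto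
    then show ?thesis
    proof
      assume "F < G \<and> c = 0"
      then show ?thesis using w w0 c False by (simp add: ascent_def F_def G_def)
    next
      assume *: "F = G \<and> c = 1"
      then have "relabel X q f \<circ> gen i = relabel X q f"
        by (intro fixed_if_equal relabel_odd[OF odd X] False) (simp add: F_def G_def)
      moreover have "relabel_weight d p q (f \<circ> gen i) (gen i ` X) = v_pow 2 * relabel_weight d p q f X"
        unfolding w w0 c using * by (simp add: distrib_left v_pow_add mult.commute)
      ultimately show ?thesis using False by (simp add: hecke_param_def)
    qed
  qed
qed

lemma relabel_weight_step_down:
  assumes odd: "\<And>z. f (- z) = - f z" and a: "ascent f i" and i: "i < d" and X: "X \<in> selections d p b f"
    and pq: "0 \<le> q" "p = q + 1"
  shows "ascent (relabel X q f) i \<and> relabel_weight d p q (f \<circ> gen i) (gen i ` X) = relabel_weight d p q f X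
    \<or> relabel X q f \<circ> gen i = relabel X q f \<and> relabel_weight d p q (f \<circ> gen i) (gen i ` X) = hecke_param i * relabel_weight d p q f X"
proof -
  define Y where "Y = letter_positions d q f"
  define N where "N = uminus ` X"
  note fin = selections_finite[OF X] finite_letter_positions[of d q f, folded Y_def]
  have finN: "finite N" using fin by (simp add: N_def)
  have nz: "0 \<notin> X" "0 \<notin> Y" "0 \<notin> N" using selections_not_zero[OF X] by (auto simp: Y_def letter_positions_def N_def)
  have Y: "f y = q" if "y \<in> Y" for y using that by (simp add: Y_def letter_positions_def)
  note Xp = selections_value[OF X]
  have Np: "f y = - p" if "y \<in> N" for y using that Xp odd by (auto simp: N_def)
  have N: "y \<in> N \<longleftrightarrow> - y \<in> X" for y by (force simp: N_def)
  have gN: "uminus ` gen i ` X = gen i ` N"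
    by (simp add: N_def image_image gen_odd)
  have "(\<Sum>x\<in>X. \<Sum>y\<in>Y. of_bool (adjacent i x y)) = (0 :: int)"
    by (rule sum_adjacent_descent[OF odd a Xp Y]) (use pq in simp_all)
  then have c1: "crossings (gen i ` Y) (gen i ` X) = crossings Y X + (\<Sum>y\<in>Y. \<Sum>x\<in>X. of_bool (adjacent i y x))"
    using crossings_gen[OF nz(2,1), of i] by simp
  have "(\<Sum>x\<in>X. \<Sum>y\<in>N. of_bool (adjacent i x y)) = (0 :: int)"
    by (rule sum_adjacent_descent[OF odd a Xp Np]) (use pq in simp_all)
  then have c2: "crossings (gen i ` N) (gen i ` X) = crossings N X + (\<Sum>y\<in>N. \<Sum>x\<in>X. of_bool (adjacent i y x))"
    using crossings_gen[OF nz(3,1), of i] by simp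
  define c e where "c = (\<Sum>y\<in>Y. \<Sum>x\<in>X. of_bool (adjacent i y x) :: int)" and "e = (\<Sum>y\<in>N. \<Sum>x\<in>X. of_bool (adjacent i y x) :: int)"
  have w: "relabel_weight d p q (f \<circ> gen i) (gen i ` X) = (if q = 0
      then u_pow (2 * neg_count (gen i ` X)) * v_pow (2 * (crossings Y X + c) + (crossings N X + e) - neg_count (gen i ` X))
      else v_pow (2 * (crossings Y X + c)))"
    using pq unfolding relabel_weight_def letter_positions_gen[OF i] gN Y_def[symmetric] c1 c2 c_def[symmetric] e_def[symmetric] by simp
  have w0: "relabel_weight d p q f X = (if q = 0
      then u_pow (2 * neg_count X) * v_pow (2 * crossings Y X + crossings N X - neg_count X)
      else v_pow (2 * crossings Y X))"
    using pq by (simp add: relabel_weight_def Y_def N_def)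
  show ?thesis
  proof (cases "i = 0")
    case True
    have f1: "0 < f 1" "f (- 1) = - f 1" using a True odd[of 1] by (auto simp: ascent_def)
    have m1: "- 1 \<notin> X" using Xp[of "- 1"] f1 pq by auto
    have Ym: "- 1 \<notin> Y" using Y[of "- 1"] f1 pq by auto
    have c0: "c = 0" unfolding c_def True sum_adjacent_0[OF fin(2,1)] using Ym by simp
    have e0: "e = of_bool (1 \<in> X)" unfolding e_def True sum_adjacent_0[OF finN fin(1)] by (simp add: N)
    have ng: "neg_count (gen i ` X) = neg_count X + of_bool (1 \<in> X)"
      using neg_count_gen[OF fin(1) nz(1), of i] True m1 by simp
    show ?thesis
    proof (cases "q = 0 \<and> 1 \<in> X")
      case True
      have "relabel_weight d p q (f \<circ> gen i) (gen i ` X) = u_pow 2 * relabel_weight d p q f X"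
        unfolding w w0 using True c0 e0 ng by (simp add: distrib_left u_pow_add add_diff_eq)
      moreover have "relabel X q f \<circ> gen i = relabel X q f"
      proof
        fix z show "(relabel X q f \<circ> gen i) z = relabel X q f z"
          using True m1 \<open>i = 0\<close> by (auto simp: relabel_def gen_0_apply)
      qed
      ultimately show ?thesis using \<open>i = 0\<close> by (simp add: hecke_param_def)
    next
      case False
      then have "ascent (relabel X q f) i" using \<open>i = 0\<close> m1 f1 pq by (auto simp: ascent_def relabel_def)
      moreover have "relabel_weight d p q (f \<circ> gen i) (gen i ` X) = relabel_weight d p q f X"
        unfolding w w0 using False c0 e0 ng by simp
      ultimately show ?thesis by simp
    qed
  next
    case False
    have lt: "f (int i) < f (int i + 1)" using a False by (simp add: ascent_def)
    have Ymem: "int i \<in> Y \<longleftrightarrow> f (int i) = q" "- int i - 1 \<in> Y \<longleftrightarrow> f (int i + 1) = - q"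
      using i False odd[of "int i + 1"] by (auto simp: Y_def letter_positions_def)
    have x: "int i \<in> X \<Longrightarrow> f (int i) = p" "- int i \<in> X \<Longrightarrow> f (int i) = - p"
      "int i + 1 \<in> X \<Longrightarrow> f (int i + 1) = p" "- int i - 1 \<in> X \<Longrightarrow> f (int i + 1) = - p"
      using Xp[of "int i"] Xp[of "- int i"] Xp[of "int i + 1"] Xp[of "- int i - 1"] odd[of "int i"] odd[of "int i + 1"] by auto
    define F G where "F = relabel X q f (int i)" and "G = relabel X q f (int i + 1)"
    have FG: "F = (if int i \<in> X then q else if - int i \<in> X then - q else f (int i))"
      "G = (if int i + 1 \<in> X then q else if - int i - 1 \<in> X then - q else f (int i + 1))"
      by (simp_all add: F_def G_def relabel_def)
    have c: "c = of_bool (f (int i) = q \<and> int i + 1 \<in> X) + of_bool (f (int i + 1) = - q \<and> - int i \<in> X)"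
      unfolding c_def sum_adjacent_pos[OF fin(2,1) False] Ymem ..
    have e: "e = 2 * of_bool (- int i \<in> X \<and> int i + 1 \<in> X)"
      unfolding e_def sum_adjacent_pos[OF finN fin(1) False] N by (auto simp: add.commute)
    have ng: "neg_count (gen i ` X) = neg_count X"
      using neg_count_gen[OF fin(1) nz(1), of i] False by simp
    have "F < G \<and> c = 0 \<and> (q = 0 \<longrightarrow> e = 0) \<or> F = G \<and> (if q = 0 then 2 * c + e = 2 else c = 1)"
      using x lt pq selections_sign[OF X, of "int i"] selections_sign[OF X, of "int i + 1"] unfolding FG c e
      by (cases "int i \<in> X"; cases "- int i \<in> X"; cases "int i + 1 \<in> X"; cases "- int i - 1 \<in> X") auto
    then show ?thesis
    proof
      assume *: "F < G \<and> c = 0 \<and> (q = 0 \<longrightarrow> e = 0)"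
      then have "ascent (relabel X q f) i" using False by (simp add: ascent_def F_def G_def)
      moreover have "relabel_weight d p q (f \<circ> gen i) (gen i ` X) = relabel_weight d p q f X"
        unfolding w w0 ng using * by simp
      ultimately show ?thesis by simp
    next
      assume *: "F = G \<and> (if q = 0 then 2 * c + e = 2 else c = 1)"
      then have "relabel X q f \<circ> gen i = relabel X q f"
        by (intro fixed_if_equal relabel_odd[OF odd X] False) (simp add: F_def G_def)
      moreover have "relabel_weight d p q (f \<circ> gen i) (gen i ` X) = v_pow 2 * relabel_weight d p q f X"
      proof (cases "q = 0")
        case True
        then have ex: "2 * (crossings Y X + c) + (crossings N X + e) - neg_count X = 2 + (2 * crossings Y X + crossings N X - neg_count X)"
          using * by simp
        show ?thesis unfolding w w0 ng if_P[OF True] ex by (simp add: v_pow_add mult.left_commute)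
      next
        case False
        then show ?thesis unfolding w w0 using * by (simp add: distrib_left v_pow_add mult.commute)
      qed
      ultimately show ?thesis using False by (simp add: hecke_param_def)
    qed
  qed
qed

lemma selections_gen:
  assumes "i < d" "X \<in> selections d p b f"
  shows "gen i ` X \<in> selections d p b (f \<circ> gen i)"
proof -
  have "gen i ` X \<subseteq> {- int d..int d}"
    using assms(2) weyl_image[OF gen_weyl[OF assms(1)]] by (auto simp: selections_def)
  moreover have "gen i ` X \<inter> uminus ` gen i ` X = {}"
  proof -
    have "uminus ` gen i ` X = gen i ` uminus ` X" by (simp add: image_image gen_odd)
    then show ?thesis
      using assms(2) inj_gen[of i UNIV] by (simp add: selections_def flip: image_Int)
  qed
  moreover have "card (gen i ` X) = b" using assms(2) by (simp add: selections_def card_image inj_gen)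
  ultimately show ?thesis using assms(2) by (auto simp: selections_def)
qed

context hecke_algebra
begin

text \<open>The value that left multiplication by the multiplier of \<open>B\<close> is going to take on a coset sum.\<close>

definition changed_sum :: "(int \<Rightarrow> int) \<Rightarrow> int \<Rightarrow> int \<Rightarrow> nat \<Rightarrow> (int \<Rightarrow> int) \<Rightarrow> 'h" where
  "changed_sum \<beta> p q b f = (\<Sum>X \<in> selections d p b f. smul (relabel_weight d p q f X) (coset_sum \<beta> (relabel X q f)))"

lemma changed_sum_ascent:
  assumes mono: "\<And>x y. x \<le> y \<Longrightarrow> \<beta> x \<le> \<beta> y" and zero: "\<beta> 0 = 0"
    and odd: "\<And>z. f (- z) = - f z" and a: "ascent f i" and i: "i < d"
    and pq: "0 \<le> p" "0 \<le> q" "q = p + 1 \<or> p = q + 1"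
  shows "changed_sum \<beta> p q b f * T (gen i) = changed_sum \<beta> p q b (f \<circ> gen i)"
proof -
  have gg: "gen i ` gen i ` X = X" for X by (simp add: image_image)
  have ff: "f \<circ> gen i \<circ> gen i = f" by (simp only: o_assoc[symmetric] gen_comp_gen comp_id)
  have "changed_sum \<beta> p q b f * T (gen i)
     = (\<Sum>X \<in> selections d p b f. smul (relabel_weight d p q f X) (coset_sum \<beta> (relabel X q f) * T (gen i)))"
    unfolding changed_sum_def sum_distrib_right smul_mult_left ..
  also have "\<dots> = (\<Sum>X \<in> selections d p b f. smul (relabel_weight d p q (f \<circ> gen i) (gen i ` X)) (coset_sum \<beta> (relabel (gen i ` X) q (f \<circ> gen i))))"
  proof (rule sum.cong[OF refl])
    fix X assume X: "X \<in> selections d p b f"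
    have "ascent (relabel X q f) i \<and> relabel_weight d p q (f \<circ> gen i) (gen i ` X) = relabel_weight d p q f X
      \<or> relabel X q f \<circ> gen i = relabel X q f \<and> relabel_weight d p q (f \<circ> gen i) (gen i ` X) = hecke_param i * relabel_weight d p q f X"
      using pq relabel_weight_step_up[OF odd a i X, of q] relabel_weight_step_down[OF odd a i X, of q] by blast
    then show "smul (relabel_weight d p q f X) (coset_sum \<beta> (relabel X q f) * T (gen i))
        = smul (relabel_weight d p q (f \<circ> gen i) (gen i ` X)) (coset_sum \<beta> (relabel (gen i ` X) q (f \<circ> gen i)))"
    proof
      assume *: "ascent (relabel X q f) i \<and> relabel_weight d p q (f \<circ> gen i) (gen i ` X) = relabel_weight d p q f X"
      then show ?thesis unfolding relabel_gen using coset_sum_ascent[of \<beta> i "relabel X q f", OF mono zero i] by (simp del: o_apply)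
    next
      assume *: "relabel X q f \<circ> gen i = relabel X q f \<and> relabel_weight d p q (f \<circ> gen i) (gen i ` X) = hecke_param i * relabel_weight d p q f X"
      then show ?thesis
        unfolding relabel_gen using coset_sum_fixed[OF i, of "relabel X q f" \<beta>] by (simp only: scale_scale mult.commute)
    qed
  qed
  also have "\<dots> = changed_sum \<beta> p q b (f \<circ> gen i)"
    unfolding changed_sum_def
  proof (rule sum.reindex_bij_witness[of _ "\<lambda>X. gen i ` X" "\<lambda>X. gen i ` X"])
    fix X assume "X \<in> selections d p b (f \<circ> gen i)"
    then show "gen i ` X \<in> selections d p b f" using selections_gen[OF i, of X p b "f \<circ> gen i"] unfolding ff by simp
  qed (simp_all only: gg selections_gen[OF i])
  finally show ?thesis .
qed

text \<open>Left multiplication commutes with right multiplication by generators, and both sides transform in the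
same way under these. So the formula spreads from the trivial coset to all cosets, along a word for
a representative.\<close>

lemma left_mult_coset_sum:
  assumes mono: "\<And>x y. x \<le> y \<Longrightarrow> \<beta> x \<le> \<beta> y" "\<And>x y. x \<le> y \<Longrightarrow> \<gamma> x \<le> \<gamma> y"
    and odd: "\<And>z. \<beta> (- z) = - \<beta> z" "\<And>z. \<gamma> (- z) = - \<gamma> z"
    and pq: "0 \<le> p" "0 \<le> q" "q = p + 1 \<or> p = q + 1"
    and base: "h * coset_sum \<gamma> \<gamma> = changed_sum \<beta> p q b \<gamma>"
    and w: "w \<in> weyl d"
  shows "h * coset_sum \<gamma> (\<gamma> \<circ> w) = changed_sum \<beta> p q b (\<gamma> \<circ> w)"
proof -
  have zero: "\<beta> 0 = 0" "\<gamma> 0 = 0" using odd(1)[of 0] odd(2)[of 0] by simp_all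
  have word: "h * coset_sum \<gamma> (\<gamma> \<circ> word is) = changed_sum \<beta> p q b (\<gamma> \<circ> word is)" if "set is \<subseteq> {..<d}" for "is"
    using that
  proof (induction "is" rule: rev_induct)
    case Nil
    show ?case using base by simp
  next
    case (snoc i "is")
    define f where "f = \<gamma> \<circ> word is"
    have i: "i < d" "set is \<subseteq> {..<d}" using snoc.prems by simp_all
    have W: "word is \<in> weyl d" using i(2) by (rule word_weyl)
    have f_odd: "f (- z) = - f z" for z
      by (simp add: f_def odd weyl_odd[OF W])
    have g_odd: "(f \<circ> gen i) (- z) = - (f \<circ> gen i) z" for z
      by (simp add: f_odd gen_odd)
    have e: "\<gamma> \<circ> word (is @ [i]) = f \<circ> gen i" unfolding f_def word_snoc by (rule o_assoc)
    have ff: "f \<circ> gen i \<circ> gen i = f" by (simp only: o_assoc[symmetric] gen_comp_gen comp_id)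
    have IH: "h * coset_sum \<gamma> f = changed_sum \<beta> p q b f" unfolding f_def by (rule snoc.IH[OF i(2)])
    show ?case
      unfolding e
    proof (rule ascent_trichotomy[of f i, OF f_odd])
      assume a: "ascent f i"
      then show "h * coset_sum \<gamma> (f \<circ> gen i) = changed_sum \<beta> p q b (f \<circ> gen i)"
        using coset_sum_ascent[of \<gamma>, OF mono(2) zero(2) i(1) a] changed_sum_ascent[of \<beta>, OF mono(1) zero(1) f_odd a i(1) pq] IH
        by (simp only: mult.assoc[symmetric]) (metis mult.assoc)
    next
      assume "f \<circ> gen i = f"
      then show "h * coset_sum \<gamma> (f \<circ> gen i) = changed_sum \<beta> p q b (f \<circ> gen i)" using IH by (simp only:)
    next
      assume a: "ascent (f \<circ> gen i) i"
      have 1: "coset_sum \<gamma> (f \<circ> gen i) * T (gen i) = coset_sum \<gamma> f"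
        using coset_sum_ascent[of \<gamma>, OF mono(2) zero(2) i(1) a] unfolding ff .
      have 2: "changed_sum \<beta> p q b (f \<circ> gen i) * T (gen i) = changed_sum \<beta> p q b f"
        using changed_sum_ascent[of \<beta>, OF mono(1) zero(1) g_odd a i(1) pq] unfolding ff .
      have "h * coset_sum \<gamma> (f \<circ> gen i) * T (gen i) = changed_sum \<beta> p q b f"
        unfolding mult.assoc 1 by (rule IH)
      then show "h * coset_sum \<gamma> (f \<circ> gen i) = changed_sum \<beta> p q b (f \<circ> gen i)"
        using mult_T_gen_cancel(1)[OF i(1)] 2 by metis
    qed
  qed
  show ?thesis using word word_exists[OF w] by blast
qed

end

section \<open>Products of coset sums\<close>

text \<open>The change of a matrix caused by moving \<open>t l\<close> units from row \<open>p\<close> to row \<open>q\<close> in each column \<open>l\<close>. Both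
directions \<open>q = p + 1\<close> and \<open>p = q + 1\<close> are treated at once.\<close>

definition shift :: "int \<Rightarrow> int \<Rightarrow> (int \<Rightarrow> int) \<Rightarrow> mat" where
  "shift q p t = (\<lambda>i j. t j * (of_bool (i = q) - of_bool (i = p)) + t (- j) * (of_bool (- i = q) - of_bool (- i = p)))"

abbreviation shifted :: "mat \<Rightarrow> int \<Rightarrow> int \<Rightarrow> (int \<Rightarrow> nat) \<Rightarrow> mat" where
  "shifted A q p t \<equiv> (\<lambda>i j. A i j + shift q p (\<lambda>l. int (t l)) i j)"

text \<open>The matrix of a pattern \<open>f\<close> relative to the blocks of \<open>mu\<close>. For the pattern of a signed permutation
this is the matrix \<open>kappa\<close> of its double coset.\<close>

definition pattern_matrix :: "nat \<Rightarrow> (nat \<Rightarrow> nat) \<Rightarrow> (int \<Rightarrow> int) \<Rightarrow> mat" where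
  "pattern_matrix n mu f i j = int (card {z. f z = i \<and> block_index n mu z = j})"

text \<open>The tuple \<open>t\<close> of the multiplication formulas that belongs to a set \<open>X\<close> of positions.\<close>

definition block_counts :: "nat \<Rightarrow> (nat \<Rightarrow> nat) \<Rightarrow> int set \<Rightarrow> int \<Rightarrow> nat" where
  "block_counts n mu X j = (if j \<in> idx n then card {x \<in> X. block_index n mu x = j} else 0)"

lemma card_of_bool: "finite S \<Longrightarrow> int (card {z \<in> S. P z}) = (\<Sum>z\<in>S. of_bool (P z))"
  by (simp add: of_bool_def sum.If_cases Int_def)

lemma pattern_matrix_sum:
  assumes "mu \<in> Lam n d" "j \<in> idx n"
  shows "pattern_matrix n mu f i j = (\<Sum>z \<in> {- int d..int d}. of_bool (f z = i) * of_bool (block_index n mu z = j))"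
proof -
  have "{z. f z = i \<and> block_index n mu z = j} = {z \<in> {- int d..int d}. f z = i \<and> block_index n mu z = j}"
    using assms(2) block_index_in_idx[OF assms(1)] by (auto simp: abs_le_iff)
  then have "pattern_matrix n mu f i j = (\<Sum>z \<in> {- int d..int d}. of_bool (f z = i \<and> block_index n mu z = j))"
    unfolding pattern_matrix_def by (simp only: card_of_bool[OF finite_atLeastAtMost_int])
  then show ?thesis by (simp only: of_bool_conj)
qed

lemma block_counts_sum:
  assumes "finite S" "X \<subseteq> S" "j \<in> idx n"
  shows "int (block_counts n mu X j) = (\<Sum>z\<in>S. of_bool (z \<in> X) * of_bool (block_index n mu z = j))"
proof -
  have "{x \<in> X. block_index n mu x = j} = {z \<in> S. z \<in> X \<and> block_index n mu z = j}" using assms(2) by auto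
  then show ?thesis
    using assms(3) unfolding block_counts_def by (simp only: card_of_bool[OF assms(1)] of_bool_conj if_True)
qed

text \<open>Each \<open>x \<in> X\<close> moves from row \<open>p\<close> to row \<open>q\<close> in the column of its block, and \<open>-x\<close> moves from row
\<open>-p\<close> to row \<open>-q\<close> in the opposite column.\<close>

lemma pattern_matrix_relabel:
  assumes mu: "mu \<in> Lam n d" and odd: "\<And>z. f (- z) = - f z" and X: "X \<in> selections d p b f" and j: "j \<in> idx n"
  shows "pattern_matrix n mu (relabel X q f) i j = pattern_matrix n mu f i j + shift q p (\<lambda>l. int (block_counts n mu X l)) i j"
proof -
  define I where "I = {- int d..int d}"
  have fin: "finite I" and XI: "X \<subseteq> I" using X by (auto simp: I_def selections_def)
  have NI: "uminus ` X \<subseteq> I" using XI by (auto simp: I_def)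
  have mem: "z \<in> uminus ` X \<longleftrightarrow> - z \<in> X" for z by force
  have pt: "of_bool (relabel X q f z = i) = of_bool (f z = i)
      + of_bool (z \<in> X) * (of_bool (i = q) - of_bool (i = p))
      + of_bool (z \<in> uminus ` X) * (of_bool (- i = q) - of_bool (- i = p) :: int)" for z
    using selections_value[OF X, of z] selections_value[OF X, of "- z"] selections_sign[OF X, of z] odd[of z]
    unfolding mem relabel_def by (cases "z \<in> X"; cases "- z \<in> X") auto
  have neg: "(\<Sum>z\<in>I. of_bool (z \<in> uminus ` X) * of_bool (block_index n mu z = j)) = int (block_counts n mu X (- j))"
  proof -
    have "(\<Sum>z\<in>I. of_bool (z \<in> uminus ` X) * of_bool (block_index n mu z = j))
       = (\<Sum>z\<in>I. of_bool (z \<in> X) * of_bool (block_index n mu z = - j) :: int)"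
      by (rule sum.reindex_bij_witness[of _ uminus uminus]) (auto simp: I_def mem block_index_odd)
    then show ?thesis using block_counts_sum[OF fin XI, of "- j" n mu] j by simp
  qed
  show ?thesis
    unfolding pattern_matrix_sum[OF mu j] shift_def block_counts_sum[OF fin XI j] neg[symmetric] pt I_def[symmetric]
    by (simp only: distrib_left distrib_right sum.distrib sum_distrib_left sum_distrib_right mult_ac)
qed

text \<open>In a weakly increasing pattern no position is on the wrong side.\<close>

lemma relabel_weight_increasing:
  assumes mono: "\<And>x y. x \<le> y \<Longrightarrow> f x \<le> f y" and odd: "\<And>z. f (- z) = - f z" and X: "X \<in> selections d p b f"
    and pq: "0 \<le> p" "0 \<le> q" "q \<noteq> p"
  shows "relabel_weight d p q f X = 1"
proof -
  have Y: "f y = q" if "y \<in> letter_positions d q f" for y using that by (simp add: letter_positions_def)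
  have "crossings X (letter_positions d q f) = 0" if "p < q"
    unfolding crossings_def
  proof (intro sum.neutral ballI)
    fix x y assume "x \<in> X" "y \<in> letter_positions d q f"
    then have "\<not> y < x" using mono[of y x] Y selections_value[OF X] that by force
    then show "of_bool (y < x) = (0 :: int)" by simp
  qed
  moreover have "crossings (letter_positions d q f) X = 0" if "q < p"
    unfolding crossings_def
  proof (intro sum.neutral ballI)
    fix x y assume "y \<in> X" "x \<in> letter_positions d q f"
    then have "\<not> y < x" using mono[of y x] Y selections_value[OF X] that by force
    then show "of_bool (y < x) = (0 :: int)" by simp
  qed
  moreover have "crossings (uminus ` X) X = 0" if "0 < p"
    unfolding crossings_def
  proof (intro sum.neutral ballI)
    fix x y assume "y \<in> X" "x \<in> uminus ` X"
    then have "f y = p" "f x = - p" using selections_value[OF X] odd by auto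
    then have "\<not> y < x" using mono[of y x] that by force
    then show "of_bool (y < x) = (0 :: int)" by simp
  qed
  moreover have "neg_count X = 0" if "0 < p"
    unfolding neg_count_def
  proof (intro sum.neutral ballI)
    fix x assume "x \<in> X"
    then have "\<not> x < 0" using mono[of x 0] odd[of 0] selections_value[OF X, of x] that by force
    then show "of_bool (x < 0) = (0 :: int)" by simp
  qed
  ultimately show ?thesis using pq by (auto simp: relabel_weight_def)
qed

lemma relabel_relabel:
  assumes "\<And>z. f (- z) = - f z" "X \<in> selections d p b f"
  shows "relabel X p (relabel X q f) = f"
  using assms(1) selections_value[OF assms(2)] selections_value[OF assms(2), of "- _"] by (auto simp: relabel_def fun_eq_iff) (metis minus_minus)

lemma selections_relabel:
  assumes "X \<in> selections d p b f"
  shows "X \<in> selections d q b (relabel X q f)"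
  using assms by (auto simp: selections_def relabel_def)

lemma block_counts_tuples:
  assumes mu: "mu \<in> Lam n d" and X: "X \<in> selections d p b f"
  shows "block_counts n mu X \<in> tuples n b"
proof -
  have "(\<Sum>i\<in>idx n. block_counts n mu X i) = (\<Sum>i\<in>idx n. card {x \<in> X. block_index n mu x = i})"
    by (intro sum.cong) (auto simp: block_counts_def)
  also have "\<dots> = card (\<Union>i\<in>idx n. {x \<in> X. block_index n mu x = i})"
    using selections_finite[OF X] by (subst card_UN_disjoint) auto
  also have "(\<Union>i\<in>idx n. {x \<in> X. block_index n mu x = i}) = X"
    using selections_bound[OF X] block_index_in_idx[OF mu] by auto
  also have "card X = b" using X by (simp add: selections_def)
  finally show ?thesis by (simp add: tuples_def block_counts_def)
qed

lemma finite_tuples: "finite (tuples n b)"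
proof (rule finite_subset)
  show "tuples n b \<subseteq> {f. \<forall>x. (x \<in> idx n \<longrightarrow> f x \<in> {..b}) \<and> (x \<notin> idx n \<longrightarrow> f x = 0)}"
  proof clarify
    fix t x assume t: "t \<in> tuples n b"
    have "t x \<le> b" if "x \<in> idx n"
      using member_le_sum[of x "idx n" t] that t by (simp add: tuples_def)
    then show "(x \<in> idx n \<longrightarrow> t x \<in> {..b}) \<and> (x \<notin> idx n \<longrightarrow> t x = 0)"
      using t by (simp add: tuples_def)
  qed
qed (rule finite_set_of_finite_funs; simp)

lemma kappa_pattern_matrix:
  assumes "la \<in> Lam n d" "mu \<in> Lam n d" "w \<in> weyl d"
  shows "kappa la w mu i j = (if i \<in> idx n \<and> j \<in> idx n then pattern_matrix n mu (block_index n la \<circ> w) i j else 0)"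
  by (simp add: kappa_eq[OF assms] pattern_matrix_def)

lemma shift_outside:
  assumes "p \<in> idx n" "q \<in> idx n" "\<And>j. j \<notin> idx n \<Longrightarrow> t j = 0" "i \<notin> idx n \<or> j \<notin> idx n"
  shows "shift q p t i j = 0"
proof (cases "i \<in> idx n")
  case True
  then have "t j = 0" "t (- j) = 0" using assms(3,4) by auto
  then show ?thesis by (simp add: shift_def)
next
  case False
  then have "i \<noteq> p" "i \<noteq> q" "- i \<noteq> p" "- i \<noteq> q" using assms(1,2) by (auto simp: idx_def)
  then show ?thesis by (simp add: shift_def)
qed

lemma pattern_odd:
  assumes "w \<in> weyl d"
  shows "(block_index n nu \<circ> w) (- z) = - (block_index n nu \<circ> w) z"
  by (simp add: weyl_odd[OF assms] block_index_odd)

context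
  fixes n d :: nat and A B :: mat and p q :: int and b :: nat
  assumes A: "A \<in> Xi n d" and B: "B \<in> Xi n d"
    and pq: "0 \<le> p" "0 \<le> q" "q = p + 1 \<or> p = q + 1" and idx: "p \<in> idx n" "q \<in> idx n"
    and diag: "diagonal (\<lambda>i j. B i j - int b * E\<theta> q p i j)" and BA: "col n B = row n A"
begin

lemma pq_ne: "p \<noteq> q" "p \<noteq> - q" using pq by arith+

lemma row_col_Lam: "row_comp n A \<in> Lam n d" "col_comp n A \<in> Lam n d" "row_comp n B \<in> Lam n d" "col_comp n B = row_comp n A"
  using row_Lam(1)[OF A] col_Lam(1)[OF A] row_Lam(1)[OF B] BA by simp_all

text \<open>The off-diagonal entries are prescribed, and the column sums determine the diagonal.\<close>

lemma B_entry:
  assumes "i \<in> idx n" "j \<in> idx n"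
  shows "B i j = of_bool (i = j) * row n A j + shift q p (\<lambda>l. int b * of_bool (l = p)) i j"
proof -
  define M where "M = shift q p (\<lambda>l. int b * of_bool (l = p))"
  have off: "B i j = M i j" if "i \<noteq> j" for i j
  proof -
    have "B i j = int b * E\<theta> q p i j" using diag that by (simp add: diagonal_def)
    then show ?thesis using that by (auto simp: M_def shift_def E\<theta>_def unit_mat_def)
  qed
  have Mcol: "(\<Sum>i\<in>idx n. M i j) = 0" for j
  proof -
    have one: "(\<Sum>i\<in>idx n. of_bool (i = k)) = (1 :: int)" if "k \<in> idx n" for k
      using that by (simp add: of_bool_def)
    have neg: "of_bool (- i = k) = (of_bool (i = - k) :: int)" for i k :: int by auto
    have "(\<Sum>i\<in>idx n. M i j) = int b * of_bool (j = p) * ((\<Sum>i\<in>idx n. of_bool (i = q)) - (\<Sum>i\<in>idx n. of_bool (i = p)))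
       + int b * of_bool (- j = p) * ((\<Sum>i\<in>idx n. of_bool (i = - q)) - (\<Sum>i\<in>idx n. of_bool (i = - p)))"
      unfolding M_def shift_def neg[of _ q] neg[of _ p] by (simp only: sum.distrib sum_distrib_left sum_subtractf right_diff_distrib)
    then show ?thesis using one[of q] one[of p] one[of "- q"] one[of "- p"] idx by simp
  qed
  have "row n A j = (\<Sum>i\<in>idx n. B i j)" using fun_cong[OF BA, of j] by (simp add: col_def)
  also have "\<dots> = (\<Sum>i\<in>idx n. M i j + of_bool (i = j) * (B j j - M j j))"
    using off by (intro sum.cong refl) auto
  also have "\<dots> = B j j - M j j"
    using Mcol assms(2) by (simp add: sum.distrib of_bool_def if_distrib[of "\<lambda>x. x * _"] cong: if_cong)
  finally show ?thesis using off[of i j] by (cases "i = j") (simp_all add: M_def)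
qed

lemma rows_eq:
  assumes t: "t \<in> tuples n b"
  shows "row n (shifted A q p t) = row n B"
    and "col n (shifted A q p t) = col n A"
proof -
  have srow: "(\<Sum>j\<in>idx n. shift q p s k j) = (\<Sum>j\<in>idx n. s j) * (of_bool (k = q) - of_bool (k = p) + of_bool (- k = q) - of_bool (- k = p))" for s k
  proof -
    have "(\<Sum>j\<in>idx n. shift q p s k j) = (\<Sum>j\<in>idx n. s j) * (of_bool (k = q) - of_bool (k = p)) + (\<Sum>j\<in>idx n. s (- j)) * (of_bool (- k = q) - of_bool (- k = p))"
      unfolding shift_def sum.distrib sum_distrib_right ..
    then show ?thesis unfolding sum_idx_uminus by (simp add: algebra_simps)
  qed
  have st: "(\<Sum>j\<in>idx n. int (t j)) = int b" using t by (simp add: tuples_def flip: of_nat_sum)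
  have sb: "(\<Sum>j\<in>idx n. int b * of_bool (j = p)) = int b" using idx by (simp add: of_bool_def if_distrib[of "\<lambda>x. _ * x"] cong: if_cong)
  show "row n (shifted A q p t) = row n B"
  proof
    fix k
    show "row n (shifted A q p t) k = row n B k"
    proof (cases "k \<in> idx n")
      case True
      have "row n B k = (\<Sum>j\<in>idx n. of_bool (k = j) * row n A j) + (\<Sum>j\<in>idx n. shift q p (\<lambda>l. int b * of_bool (l = p)) k j)"
        unfolding row_def[of n B] sum.distrib[symmetric] by (intro sum.cong refl B_entry True)
      also have "(\<Sum>j\<in>idx n. of_bool (k = j) * row n A j) = row n A k"
        using True by (simp add: of_bool_def if_distrib[of "\<lambda>x. x * _"] cong: if_cong)
      finally show ?thesis
        unfolding srow sb using st by (simp add: row_def sum.distrib srow)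
    next
      case False
      then have "row n B k = 0" "row n A k = 0" using XiD(1)[OF B] XiD(1)[OF A] by (simp_all add: row_def)
      moreover have "k \<noteq> p" "k \<noteq> q" "- k \<noteq> p" "- k \<noteq> q" using False idx by (auto simp: idx_def)
      ultimately show ?thesis using srow[of "\<lambda>l. int (t l)" k] by (simp add: row_def sum.distrib)
    qed
  qed
  have scol: "(\<Sum>i\<in>idx n. shift q p s i j) = 0" for s j
  proof -
    have one: "(\<Sum>i\<in>idx n. of_bool (i = k)) = (1 :: int)" if "k \<in> idx n" for k
      using that by (simp add: of_bool_def)
    have neg: "of_bool (- i = k) = (of_bool (i = - k) :: int)" for i k :: int by auto
    have "(\<Sum>i\<in>idx n. shift q p s i j) = s j * ((\<Sum>i\<in>idx n. of_bool (i = q)) - (\<Sum>i\<in>idx n. of_bool (i = p)))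
       + s (- j) * ((\<Sum>i\<in>idx n. of_bool (i = - q)) - (\<Sum>i\<in>idx n. of_bool (i = - p)))"
      unfolding shift_def neg[of _ q] neg[of _ p] by (simp only: sum.distrib sum_distrib_left sum_subtractf right_diff_distrib)
    then show ?thesis using one[of q] one[of p] one[of "- q"] one[of "- p"] idx by simp
  qed
  show "col n (shifted A q p t) = col n A"
    by (rule ext) (simp add: col_def sum.distrib scol)
qed

lemma pattern_matrix_base:
  assumes "i \<in> idx n" "j \<in> idx n"
  shows "pattern_matrix n (row_comp n A) (block_index n (row_comp n A)) i j = of_bool (i = j) * row n A j"
proof (cases "i = j")
  case True
  have "{z. block_index n (row_comp n A) z = j} = block (row_comp n A) j" by (rule card_block_block_index[OF row_col_Lam(1) assms(2)])
  then show ?thesis using True row_Lam(2)[OF A assms(2)] by (simp add: pattern_matrix_def)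
next
  case False
  then have "{z. block_index n (row_comp n A) z = i \<and> block_index n (row_comp n A) z = j} = {}" by auto
  then show ?thesis using False unfolding pattern_matrix_def by (simp only: card.empty) simp
qed

lemma selections_base_block_counts:
  assumes "X \<in> selections d p b (block_index n (row_comp n A))"
  shows "int (block_counts n (row_comp n A) X j) = int b * of_bool (j = p)"
proof -
  have "{x \<in> X. block_index n (row_comp n A) x = j} = (if j = p then X else {})" using selections_value[OF assms] by auto
  then show ?thesis using assms idx by (auto simp: block_counts_def selections_def)
qed

text \<open>The matrix \<open>B\<close> says that the pattern of \<open>w\<close> agrees with the standard pattern except at \<open>b\<close> positions
that carry \<open>q\<close> in place of \<open>p\<close>.\<close>

lemma orbit_B:
  "orbit n d B = (\<Union>X \<in> selections d p b (block_index n (row_comp n A)). {w. w \<in> weyl d \<and> block_index n (row_comp n B) \<circ> w = relabel X q (block_index n (row_comp n A))})"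
  (is "_ = (\<Union>X\<in>?Ad. ?C X)")
proof (intro Set.set_eqI iffI)
  fix w assume "w \<in> (\<Union>X\<in>?Ad. ?C X)"
  then obtain X where X: "X \<in> ?Ad" and w: "w \<in> weyl d" "block_index n (row_comp n B) \<circ> w = relabel X q (block_index n (row_comp n A))" by blast
  have t: "(\<lambda>l. int (block_counts n (row_comp n A) X l)) = (\<lambda>l. int b * of_bool (l = p))"
    using selections_base_block_counts[OF X] by (rule ext)
  have "kappa (row_comp n B) w (row_comp n A) i j = B i j" for i j
  proof (cases "i \<in> idx n \<and> j \<in> idx n")
    case True
    then have ij: "i \<in> idx n" "j \<in> idx n" by auto
    have "kappa (row_comp n B) w (row_comp n A) i j = pattern_matrix n (row_comp n A) (relabel X q (block_index n (row_comp n A))) i j"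
      unfolding kappa_pattern_matrix[OF row_col_Lam(3,1) w(1)] w(2) using ij by simp
    also have "\<dots> = of_bool (i = j) * row n A j + shift q p (\<lambda>l. int b * of_bool (l = p)) i j"
      unfolding pattern_matrix_relabel[OF row_col_Lam(1) block_index_odd X ij(2)] pattern_matrix_base[OF ij] t ..
    finally show ?thesis using B_entry[OF ij] by simp
  next
    case False
    then have "kappa (row_comp n B) w (row_comp n A) i j = 0" by (auto simp: kappa_pattern_matrix[OF row_col_Lam(3,1) w(1)])
    then show ?thesis using False XiD(1)[OF B] by simp
  qed
  then have "kappa (row_comp n B) w (col_comp n B) = B" unfolding row_col_Lam(4) by blast
  then show "w \<in> orbit n d B" using w(1) by (simp add: orbit_def)
next
  fix w assume "w \<in> orbit n d B"
  then have w: "w \<in> weyl d" and k: "kappa (row_comp n B) w (row_comp n A) = B" by (auto simp: orbit_def row_col_Lam(4))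
  define F where "F = block_index n (row_comp n B) \<circ> w"
  define f where "f = block_index n (row_comp n A)"
  have F_odd: "F (- z) = - F z" for z unfolding F_def by (rule pattern_odd[OF w])
  have f_odd: "f (- z) = - f z" for z by (simp add: f_def block_index_odd)
  have Fi: "F z \<in> idx n \<longleftrightarrow> \<bar>z\<bar> \<le> int d" for z
    unfolding F_def using block_index_in_idx[OF row_col_Lam(3)] weyl_range[OF w] by simp
  have fi: "f z \<in> idx n \<longleftrightarrow> \<bar>z\<bar> \<le> int d" for z
    unfolding f_def by (rule block_index_in_idx[OF row_col_Lam(1)])
  define X where "X = {z. F z = q \<and> f z = p}"
  have XI: "X \<subseteq> {- int d..int d}" using fi idx by (auto simp: X_def abs_le_iff)
  have kB: "B i j = (if i \<in> idx n \<and> j \<in> idx n then pattern_matrix n (row_comp n A) F i j else 0)" for i j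
    using fun_cong[OF fun_cong[OF k, of i], of j] kappa_pattern_matrix[OF row_col_Lam(3,1) w, of i j] by (simp only: F_def)
  have "int (card X) = B q p"
    using idx kB[of q p] by (simp add: pattern_matrix_def X_def F_def f_def)
  also have "\<dots> = int b"
    using pq_ne pq B_entry[OF idx(2,1)] by (auto simp: shift_def)
  finally have "card X = b" by simp
  moreover have "X \<inter> uminus ` X = {}"
  proof (rule equals0I)
    fix x assume "x \<in> X \<inter> uminus ` X"
    then have "f x = p" "f (- x) = p" "F x = q" "F (- x) = q" by (auto simp: X_def)
    then have "p = 0" "q = 0" using f_odd[of x] F_odd[of x] by simp_all
    then show False using pq_ne by simp
  qed
  ultimately have X: "X \<in> selections d p b f"
    using XI by (auto simp: selections_def X_def)
  have "F z = relabel X q f z" for z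
  proof (cases "\<bar>z\<bar> \<le> int d")
    case True
    then have ij: "F z \<in> idx n" "f z \<in> idx n" using Fi fi by auto
    have "z \<in> {y. F y = F z \<and> f y = f z}" by simp
    moreover have "finite {y. F y = F z \<and> f y = f z}"
      unfolding f_def by (rule finite_pattern[OF row_col_Lam(1)]) (use ij in \<open>simp add: f_def\<close>)
    ultimately have "card {y. F y = F z \<and> f y = f z} \<noteq> 0" by auto
    then have nz: "B (F z) (f z) \<noteq> 0"
      using ij kB[of "F z" "f z"] by (simp add: pattern_matrix_def F_def f_def)
    show ?thesis
    proof (cases "F z = f z")
      case True
      then have "z \<notin> X" "- z \<notin> X" using pq_ne F_odd[of z] f_odd[of z] by (auto simp: X_def)
      then show ?thesis using True by (simp add: relabel_def)
    next
      case False
      then have "E\<theta> q p (F z) (f z) \<noteq> 0" using nz diag by (auto simp: diagonal_def)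
      then have "F z = q \<and> f z = p \<or> F z = - q \<and> f z = - p"
        by (auto simp: E\<theta>_def unit_mat_def split: if_splits)
      then have "z \<in> X \<and> F z = q \<or> - z \<in> X \<and> F z = - q"
        using F_odd[of z] f_odd[of z] by (auto simp: X_def)
      then show ?thesis using selections_sign[OF X, of z] selections_sign[OF X, of "- z"] by (auto simp: relabel_def)
    qed
  next
    case False
    then have "F z = f z"
      using block_index_outside[OF row_col_Lam(3), of z] block_index_outside[OF row_col_Lam(1), of z] weyl_outside[OF w, of z] by (simp add: F_def f_def)
    moreover have "z \<notin> X" "- z \<notin> X" using selections_bound[OF X, of z] selections_bound[OF X, of "- z"] False by auto
    ultimately show ?thesis by (simp add: relabel_def)
  qed
  then have "F = relabel X q f" by blast
  then show "w \<in> (\<Union>X\<in>?Ad. ?C X)" using X w unfolding F_def f_def by blast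
qed

text \<open>Undoing the change of letters at \<open>X\<close> yields a pattern with matrix \<open>A\<close> exactly when the matrix of \<open>w\<close>
is \<open>A\<close> shifted by the block counts of \<open>X\<close>; this turns the sum over pairs \<open>(f, X)\<close> into a sum over
tuples.\<close>

lemma pattern_matrix_iff:
  assumes w: "w \<in> weyl d" and X: "X \<in> selections d q b (block_index n (row_comp n B) \<circ> w)"
  shows "relabel X p (block_index n (row_comp n B) \<circ> w) \<in> (\<lambda>v. block_index n (row_comp n A) \<circ> v) ` orbit n d A
    \<longleftrightarrow> kappa (row_comp n B) w (col_comp n A) = (\<lambda>i j. A i j + shift q p (\<lambda>l. int (block_counts n (col_comp n A) X l)) i j)"
proof -
  define F where "F = block_index n (row_comp n B) \<circ> w"
  define f where "f = relabel X p F"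
  define t where "t = (\<lambda>l. int (block_counts n (col_comp n A) X l))"
  have F_odd: "F (- z) = - F z" for z unfolding F_def by (rule pattern_odd[OF w])
  have XF: "X \<in> selections d q b F" using X by (simp add: F_def)
  have f_odd: "f (- z) = - f z" for z unfolding f_def by (rule relabel_odd[OF F_odd XF])
  have Fi: "F z \<in> idx n \<longleftrightarrow> \<bar>z\<bar> \<le> int d" for z
    unfolding F_def using block_index_in_idx[OF row_col_Lam(3)] weyl_range[OF w] by simp
  have mat: "pattern_matrix n (col_comp n A) F i j = pattern_matrix n (col_comp n A) f i j + shift q p t i j" if "j \<in> idx n" for i j
    using pattern_matrix_relabel[OF row_col_Lam(2) F_odd XF that, of p i] by (simp add: f_def t_def shift_def algebra_simps)
  have kF: "kappa (row_comp n B) w (col_comp n A) = (\<lambda>i j. A i j + shift q p t i j)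
      \<longleftrightarrow> (\<forall>i\<in>idx n. \<forall>j\<in>idx n. pattern_matrix n (col_comp n A) f i j = A i j)" (is "?L \<longleftrightarrow> ?R")
  proof
    assume L: ?L
    show ?R
    proof (intro ballI)
      fix i j assume ij: "i \<in> idx n" "j \<in> idx n"
      have "pattern_matrix n (col_comp n A) F i j = A i j + shift q p t i j"
        using fun_cong[OF fun_cong[OF L, of i], of j] ij by (simp add: kappa_pattern_matrix[OF row_col_Lam(3,2) w] F_def)
      then show "pattern_matrix n (col_comp n A) f i j = A i j" using mat[OF ij(2)] by simp
    qed
  next
    assume R: ?R
    show ?L
    proof (intro ext)
      fix i j
      show "kappa (row_comp n B) w (col_comp n A) i j = A i j + shift q p t i j"
      proof (cases "i \<in> idx n \<and> j \<in> idx n")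
        case True
        then show ?thesis using R mat[of j i] by (simp add: kappa_pattern_matrix[OF row_col_Lam(3,2) w] F_def)
      next
        case False
        then have "A i j = 0" using XiD(1)[OF A] by blast
        moreover have "shift q p t i j = 0"
          by (rule shift_outside[OF idx]) (use False in \<open>auto simp: t_def block_counts_def\<close>)
        moreover have "kappa (row_comp n B) w (col_comp n A) i j = 0" using False by (auto simp: kappa_pattern_matrix[OF row_col_Lam(3,2) w])
        ultimately show ?thesis by simp
      qed
    qed
  qed
  have "f \<in> (\<lambda>v. block_index n (row_comp n A) \<circ> v) ` orbit n d A \<longleftrightarrow> (\<forall>i\<in>idx n. \<forall>j\<in>idx n. pattern_matrix n (col_comp n A) f i j = A i j)"
    (is "?L \<longleftrightarrow> ?R")
  proof
    assume ?L
    then obtain v where v: "v \<in> weyl d" "kappa (row_comp n A) v (col_comp n A) = A" "f = block_index n (row_comp n A) \<circ> v"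
      by (auto simp: orbit_def)
    show ?R
    proof (intro ballI)
      fix i j assume ij: "i \<in> idx n" "j \<in> idx n"
      then show "pattern_matrix n (col_comp n A) f i j = A i j"
        using fun_cong[OF fun_cong[OF v(2), of i], of j] by (simp add: kappa_pattern_matrix[OF row_col_Lam(1,2) v(1)] v(3))
    qed
  next
    assume R: ?R
    have fi: "f z \<in> idx n" if "\<bar>z\<bar> \<le> int d" for z
      using Fi[of z] that idx by (auto simp: f_def relabel_def)
    have fo: "f z = block_index n (row_comp n A) z" if "int d < \<bar>z\<bar>" for z
    proof -
      have "z \<notin> X" "- z \<notin> X" using selections_bound[OF XF, of z] selections_bound[OF XF, of "- z"] that by auto
      then show ?thesis
        using that block_index_outside[OF row_col_Lam(3), of z] block_index_outside[OF row_col_Lam(1), of z] weyl_outside[OF w, of z]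
        by (simp add: f_def relabel_def F_def)
    qed
    have fI: "f z \<in> idx n \<longleftrightarrow> \<bar>z\<bar> \<le> int d" for z
      using fi[of z] fo[of z] block_index_in_idx[OF row_col_Lam(1), of z] by (cases "\<bar>z\<bar> \<le> int d") auto
    have fc: "card {z. f z = i} = card (block (row_comp n A) i)" if i: "i \<in> idx n" for i
    proof -
      have "{z. f z = i} = (\<Union>j\<in>idx n. {z. f z = i \<and> block_index n (col_comp n A) z = j})"
        using i fI block_index_in_idx[OF row_col_Lam(2)] by auto
      also have "int (card \<dots>) = (\<Sum>j\<in>idx n. pattern_matrix n (col_comp n A) f i j)"
        unfolding pattern_matrix_def using finite_pattern[OF row_col_Lam(2)] by (subst card_UN_disjoint) auto
      also have "\<dots> = row n A i" unfolding row_def using R i by simp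
      also have "\<dots> = int (card (block (row_comp n A) i))" using row_Lam(2)[OF A i] by simp
      finally show ?thesis by simp
    qed
    obtain v where v: "v \<in> weyl d" "block_index n (row_comp n A) \<circ> v = f"
      by (rule pattern_exists[OF row_col_Lam(1) f_odd fo fi fc])
    have "kappa (row_comp n A) v (col_comp n A) = A"
    proof (intro ext)
      fix i j
      show "kappa (row_comp n A) v (col_comp n A) i j = A i j"
        unfolding kappa_pattern_matrix[OF row_col_Lam(1,2) v(1)] v(2) using R XiD(1)[OF A, of i j] by auto
    qed
    then show ?L using v by (auto simp: orbit_def)
  qed
  then show ?thesis using kF unfolding f_def F_def t_def by blast
qed

end

context hecke_algebra
begin

lemma sum_orbit_cosets:
  assumes A: "A \<in> Xi n d"
  shows "sum T (orbit n d A) = (\<Sum>f \<in> (\<lambda>w. block_index n (row_comp n A) \<circ> w) ` orbit n d A. coset_sum (block_index n (row_comp n A)) f)"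
proof -
  have fin: "finite (orbit n d A)"
    by (rule finite_subset[OF _ finite_weyl[of d]]) (auto simp: orbit_def)
  have "sum T (orbit n d A) = (\<Sum>f \<in> (\<lambda>w. block_index n (row_comp n A) \<circ> w) ` orbit n d A. \<Sum>w | w \<in> orbit n d A \<and> block_index n (row_comp n A) \<circ> w = f. T w)"
    using sum.image_gen[OF fin, of T "\<lambda>w. block_index n (row_comp n A) \<circ> w"] .
  also have "\<dots> = (\<Sum>f \<in> (\<lambda>w. block_index n (row_comp n A) \<circ> w) ` orbit n d A. coset_sum (block_index n (row_comp n A)) f)"
    unfolding coset_sum_def
  proof (rule sum.cong[OF refl])
    fix f assume "f \<in> (\<lambda>w. block_index n (row_comp n A) \<circ> w) ` orbit n d A"
    then obtain v where v: "v \<in> orbit n d A" "f = block_index n (row_comp n A) \<circ> v" by blast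
    have vw: "v \<in> weyl d" "kappa (row_comp n A) v (col_comp n A) = A" using v(1) by (auto simp: orbit_def)
    have "w \<in> orbit n d A" if w: "w \<in> weyl d" "block_index n (row_comp n A) \<circ> w = f" for w
    proof -
      have "kappa (row_comp n A) w (col_comp n A) = kappa (row_comp n A) v (col_comp n A)"
        using kappa_pattern_matrix[OF row_Lam(1)[OF A] col_Lam(1)[OF A] w(1)] kappa_pattern_matrix[OF row_Lam(1)[OF A] col_Lam(1)[OF A] vw(1)]
        unfolding w(2) v(2)[symmetric] by (intro ext) simp
      then show ?thesis using w(1) vw(2) by (simp add: orbit_def)
    qed
    then have "{w. w \<in> orbit n d A \<and> block_index n (row_comp n A) \<circ> w = f} = {w. w \<in> weyl d \<and> block_index n (row_comp n A) \<circ> w = f}"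
      by (auto simp: orbit_def)
    then show "(\<Sum>w | w \<in> orbit n d A \<and> block_index n (row_comp n A) \<circ> w = f. T w) = (\<Sum>w | w \<in> weyl d \<and> block_index n (row_comp n A) \<circ> w = f. T w)"
      by simp
  qed
  finally show ?thesis .
qed

text \<open>This is the base case for the propagation along words: on the standard pattern all weights are \<open>1\<close>.\<close>

lemma sum_orbit_B:
  assumes ctx: "A \<in> Xi n d" "B \<in> Xi n d" "0 \<le> p" "0 \<le> q" "q = p + 1 \<or> p = q + 1" "p \<in> idx n" "q \<in> idx n"
    "diagonal (\<lambda>i j. B i j - int b * E\<theta> q p i j)" "col n B = row n A"
  shows "sum T (orbit n d B) = changed_sum (block_index n (row_comp n B)) p q b (block_index n (row_comp n A))"
proof -
  define f where "f = block_index n (row_comp n A)"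
  define C where "C X = {w. w \<in> weyl d \<and> block_index n (row_comp n B) \<circ> w = relabel X q f}" for X
  have f_odd: "f (- z) = - f z" for z by (simp add: f_def block_index_odd)
  have f_mono: "x \<le> y \<Longrightarrow> f x \<le> f y" for x y by (simp add: f_def block_index_mono)
  have rec: "X = {z. relabel X q f z = q \<and> f z = p}" if X: "X \<in> selections d p b f" for X
    using selections_value[OF X] selections_value[OF X, of "- _"] f_odd ctx(3-5) by (auto simp: relabel_def)
  have disj: "C X \<inter> C X' = {}" if "X \<in> selections d p b f" "X' \<in> selections d p b f" "X \<noteq> X'" for X X'
    using rec[OF that(1)] rec[OF that(2)] that(3) by (auto simp: C_def)
  have "sum T (orbit n d B) = sum T (\<Union>X \<in> selections d p b f. C X)"
    using orbit_B[OF ctx] by (simp add: C_def f_def)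
  also have "\<dots> = (\<Sum>X \<in> selections d p b f. sum T (C X))"
    by (rule sum.UNION_disjoint) (use disj finite_selections finite_weyl in \<open>auto simp: C_def\<close>)
  also have "\<dots> = changed_sum (block_index n (row_comp n B)) p q b f"
    unfolding changed_sum_def
  proof (rule sum.cong[OF refl])
    fix X assume X: "X \<in> selections d p b f"
    have "q \<noteq> p" using ctx(5) by auto
    then show "sum T (C X) = smul (relabel_weight d p q f X) (coset_sum (block_index n (row_comp n B)) (relabel X q f))"
      using relabel_weight_increasing[of f, OF f_mono f_odd X ctx(3,4) \<open>q \<noteq> p\<close>] by (simp add: coset_sum_def C_def)
  qed
  finally show ?thesis by (simp add: f_def)
qed

text \<open>Split the double coset of \<open>A\<close> into right cosets, multiply each of them, and collect the coefficient of
each \<open>T w\<close>. It is a sum over the sets \<open>X\<close> for which undoing the change of letters in the pattern of \<open>w\<close>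
leads back to \<open>A\<close>. These sets are grouped by their block counts \<open>t\<close>, and \<open>c t\<close> is their total weight.\<close>

lemma hecke_product:
  assumes ctx: "A \<in> Xi n d" "B \<in> Xi n d" "0 \<le> p" "0 \<le> q" "q = p + 1 \<or> p = q + 1" "p \<in> idx n" "q \<in> idx n"
    "diagonal (\<lambda>i j. B i j - int b * E\<theta> q p i j)" "col n B = row n A"
    and h: "h * x_elt d T (row_comp n A) = sum T (orbit n d B)"
    and TS: "\<And>t. t \<in> TS \<Longrightarrow> t \<in> tuples n b"
      "\<And>t. t \<in> tuples n b \<Longrightarrow> (\<And>i j. 0 \<le> A i j + shift q p (\<lambda>l. int (t l)) i j) \<Longrightarrow> t \<in> TS"
    and c: "\<And>t w. t \<in> TS \<Longrightarrow> w \<in> weyl d \<Longrightarrow> kappa (row_comp n B) w (col_comp n A) = (shifted A q p t)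
      \<Longrightarrow> (\<Sum>X | X \<in> selections d q b (block_index n (row_comp n B) \<circ> w) \<and> block_counts n (col_comp n A) X = t.
             relabel_weight d p q (relabel X p (block_index n (row_comp n B) \<circ> w)) X) = c t"
  shows "h * sum T (orbit n d A) = (\<Sum>t\<in>TS. smul (c t) (sum T (orbit n d (shifted A q p t))))"
proof -
  note L = row_col_Lam[OF ctx]
  define At where "At t = (shifted A q p t)" for t
  define P where "P = (\<lambda>w. block_index n (row_comp n A) \<circ> w) ` orbit n d A"
  define \<beta> where "\<beta> = block_index n (row_comp n B)"
  define mu where "mu = col_comp n A"
  have finO: "finite (orbit n d A)" for A
    by (rule finite_subset[OF _ finite_weyl[of d]]) (auto simp: orbit_def)
  have finP: "finite P" unfolding P_def using finO by simp
  have finTS: "finite TS" by (rule finite_subset[OF _ finite_tuples[of n b]]) (use TS(1) in blast)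
  \<comment> \<open>The multiplier is known on the generator, which is the coset sum of the trivial coset.\<close>
  have base: "h * coset_sum (block_index n (row_comp n A)) (block_index n (row_comp n A)) = changed_sum \<beta> p q b (block_index n (row_comp n A))"
    using h unfolding x_elt_coset_sum[OF L(1)] sum_orbit_B[OF ctx] \<beta>_def .
  have P_odd: "f (- z) = - f z" if "f \<in> P" for f z
    using that pattern_odd by (auto simp: P_def orbit_def)
  have "h * sum T (orbit n d A) = (\<Sum>f\<in>P. h * coset_sum (block_index n (row_comp n A)) f)"
    unfolding sum_orbit_cosets[OF ctx(1)] sum_distrib_left P_def ..
  also have "\<dots> = (\<Sum>f\<in>P. changed_sum \<beta> p q b f)"
  proof (rule sum.cong[OF refl])
    fix f assume "f \<in> P"
    then obtain w where w: "w \<in> weyl d" "f = block_index n (row_comp n A) \<circ> w" by (auto simp: P_def orbit_def)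
    show "h * coset_sum (block_index n (row_comp n A)) f = changed_sum \<beta> p q b f"
      unfolding w(2)
      by (rule left_mult_coset_sum[of \<beta> "block_index n (row_comp n A)", OF _ _ _ _ ctx(3,4,5) base w(1)])
         (simp_all add: \<beta>_def block_index_mono block_index_odd)
  qed
  also have "\<dots> = (\<Sum>f\<in>P. \<Sum>X \<in> selections d p b f. \<Sum>w \<in> weyl d. if \<beta> \<circ> w = relabel X q f then smul (relabel_weight d p q f X) (T w) else 0)"
    unfolding changed_sum_def coset_sum_def scale_sum_right
    by (rule sum.cong[OF refl], rule sum.cong[OF refl]) (rule sum.inter_filter[OF finite_weyl])
  also have "\<dots> = (\<Sum>(f, X) \<in> Sigma P (selections d p b). \<Sum>w \<in> weyl d. if \<beta> \<circ> w = relabel X q f then smul (relabel_weight d p q f X) (T w) else 0)"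
    by (rule sum.Sigma[OF finP]) (simp add: finite_selections)
  also have "\<dots> = (\<Sum>w \<in> weyl d. \<Sum>(f, X) \<in> Sigma P (selections d p b). if \<beta> \<circ> w = relabel X q f then smul (relabel_weight d p q f X) (T w) else 0)"
    unfolding case_prod_beta by (rule sum.swap)
  also have "\<dots> = (\<Sum>w \<in> weyl d. \<Sum>t\<in>TS. if kappa (row_comp n B) w mu = At t then smul (c t) (T w) else 0)"
  proof (rule sum.cong[OF refl])
    fix w assume w: "w \<in> weyl d"
    define F where "F = \<beta> \<circ> w"
    have F_odd: "F (- z) = - F z" for z unfolding F_def \<beta>_def by (rule pattern_odd[OF w])
    have finS: "finite (Sigma P (selections d p b))" using finP finite_selections by blast
    have "(\<Sum>(f, X) \<in> Sigma P (selections d p b). if \<beta> \<circ> w = relabel X q f then smul (relabel_weight d p q f X) (T w) else 0)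
       = (\<Sum>(f, X) \<in> {r \<in> Sigma P (selections d p b). \<beta> \<circ> w = relabel (snd r) q (fst r)}. smul (relabel_weight d p q f X) (T w))"
      unfolding case_prod_beta by (rule sum.inter_filter[OF finS, symmetric])
    also have "\<dots> = (\<Sum>X | X \<in> selections d q b F \<and> relabel X p F \<in> P. smul (relabel_weight d p q (relabel X p F) X) (T w))"
    proof (rule sum.reindex_bij_witness[of _ "\<lambda>X. (relabel X p F, X)" snd])
      fix r assume r: "r \<in> {r \<in> Sigma P (selections d p b). \<beta> \<circ> w = relabel (snd r) q (fst r)}"
      obtain f X where rr: "r = (f, X)" by (cases r)
      have f: "f \<in> P" "X \<in> selections d p b f" "F = relabel X q f" using r rr by (auto simp: F_def)
      have undo: "relabel X p F = f" unfolding f(3) by (rule relabel_relabel[of f, OF P_odd[OF f(1)] f(2)])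
      show "(relabel (snd r) p F, snd r) = r" using undo rr by simp
      show "snd r \<in> {X. X \<in> selections d q b F \<and> relabel X p F \<in> P}"
        using undo rr f selections_relabel[OF f(2), of q] by simp
      show "smul (relabel_weight d p q (relabel (snd r) p F) (snd r)) (T w) = (case r of (f, X) \<Rightarrow> smul (relabel_weight d p q f X) (T w))"
        using undo rr by simp
    next
      fix X assume X: "X \<in> {X. X \<in> selections d q b F \<and> relabel X p F \<in> P}"
      then show "snd (relabel X p F, X) = X" by simp
      show "(relabel X p F, X) \<in> {r \<in> Sigma P (selections d p b). \<beta> \<circ> w = relabel (snd r) q (fst r)}"
        using X selections_relabel[of X d q b F p] relabel_relabel[of F X d q b p, OF F_odd] by (simp add: F_def)
    qed
    also have "{X. X \<in> selections d q b F \<and> relabel X p F \<in> P} = {X \<in> selections d q b F. kappa (row_comp n B) w mu = At (block_counts n mu X)}"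
      using pattern_matrix_iff[OF ctx w] unfolding F_def \<beta>_def P_def mu_def At_def by blast
    also have "(\<Sum>X \<in> {X \<in> selections d q b F. kappa (row_comp n B) w mu = At (block_counts n mu X)}. smul (relabel_weight d p q (relabel X p F) X) (T w))
       = (\<Sum>t\<in>TS. \<Sum>X \<in> {X \<in> {X \<in> selections d q b F. kappa (row_comp n B) w mu = At (block_counts n mu X)}. block_counts n mu X = t}. smul (relabel_weight d p q (relabel X p F) X) (T w))"
    proof (rule sum.group[symmetric])
      show "finite {X \<in> selections d q b F. kappa (row_comp n B) w mu = At (block_counts n mu X)}" using finite_selections by simp
      show "finite TS" by (rule finTS)
      show "block_counts n mu ` {X \<in> selections d q b F. kappa (row_comp n B) w mu = At (block_counts n mu X)} \<subseteq> TS"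
      proof clarify
        fix X assume X: "X \<in> selections d q b F" "kappa (row_comp n B) w mu = At (block_counts n mu X)"
        show "block_counts n mu X \<in> TS"
        proof (rule TS(2))
          show "block_counts n mu X \<in> tuples n b" using block_counts_tuples[OF L(2) X(1)] by (simp add: mu_def)
          show "0 \<le> A i j + shift q p (\<lambda>l. int (block_counts n mu X l)) i j" for i j
            using fun_cong[OF fun_cong[OF X(2), of i], of j] unfolding At_def by (simp add: kappa_def flip: At_def)
        qed
      qed
    qed
    also have "\<dots> = (\<Sum>t\<in>TS. if kappa (row_comp n B) w mu = At t then smul (c t) (T w) else 0)"
    proof (rule sum.cong[OF refl])
      fix t assume t: "t \<in> TS"
      show "(\<Sum>X \<in> {X \<in> {X \<in> selections d q b F. kappa (row_comp n B) w mu = At (block_counts n mu X)}. block_counts n mu X = t}. smul (relabel_weight d p q (relabel X p F) X) (T w))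
        = (if kappa (row_comp n B) w mu = At t then smul (c t) (T w) else 0)"
      proof (cases "kappa (row_comp n B) w mu = At t")
        case True
        then have "{X \<in> {X \<in> selections d q b F. kappa (row_comp n B) w mu = At (block_counts n mu X)}. block_counts n mu X = t} = {X. X \<in> selections d q b F \<and> block_counts n mu X = t}"
          by auto
        then show ?thesis
          using True c[OF t w] unfolding scale_sum_left[symmetric] by (simp add: At_def mu_def F_def \<beta>_def)
      next
        case False
        then have "{X \<in> {X \<in> selections d q b F. kappa (row_comp n B) w mu = At (block_counts n mu X)}. block_counts n mu X = t} = {}"
          by auto
        then show ?thesis using False by (simp only: sum.empty if_False)
      qed
    qed
    finally show "(\<Sum>(f, X) \<in> Sigma P (selections d p b). if \<beta> \<circ> w = relabel X q f then smul (relabel_weight d p q f X) (T w) else 0)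
      = (\<Sum>t\<in>TS. if kappa (row_comp n B) w mu = At t then smul (c t) (T w) else 0)" .
  qed
  also have "\<dots> = (\<Sum>t\<in>TS. \<Sum>w \<in> weyl d. if kappa (row_comp n B) w mu = At t then smul (c t) (T w) else 0)"
    by (rule sum.swap)
  also have "\<dots> = (\<Sum>t\<in>TS. smul (c t) (sum T (orbit n d (At t))))"
  proof (rule sum.cong[OF refl])
    fix t assume "t \<in> TS"
    then have t: "t \<in> tuples n b" by (rule TS(1))
    have o: "orbit n d (At t) = {w \<in> weyl d. kappa (row_comp n B) w mu = At t}"
      unfolding orbit_def mu_def At_def rows_eq[OF ctx t] ..
    show "(\<Sum>w \<in> weyl d. if kappa (row_comp n B) w mu = At t then smul (c t) (T w) else 0) = smul (c t) (sum T (orbit n d (At t)))"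
      unfolding o scale_sum_right by (rule sum.inter_filter[OF finite_weyl, symmetric])
  qed
  finally show ?thesis by (simp add: At_def)
qed

end

section \<open>Structure coefficients\<close>

lemma sum_by_label:
  fixes h :: "int \<Rightarrow> int"
  assumes "finite X" "\<And>x. x \<in> X \<Longrightarrow> m x \<in> idx n"
  shows "(\<Sum>x\<in>X. h (m x)) = (\<Sum>l\<in>idx n. int (card {x \<in> X. m x = l}) * h l)"
proof -
  have "(\<Sum>x\<in>X. h (m x)) = (\<Sum>l\<in>idx n. \<Sum>x \<in> {x \<in> X. m x = l}. h (m x))"
    by (rule sum.group[symmetric]) (use assms in auto)
  also have "\<dots> = (\<Sum>l\<in>idx n. int (card {x \<in> X. m x = l}) * h l)"
    by (rule sum.cong[OF refl]) simp
  finally show ?thesis .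
qed

text \<open>For a monotone labelling, crossings between different labels depend on the numbers of elements with
each label only; the remaining ones are local to a label.\<close>

lemma crossings_by_label:
  assumes fin: "finite X" "finite Z"
    and lab: "\<And>x. x \<in> X \<Longrightarrow> m x \<in> idx n" "\<And>x. x \<in> Z \<Longrightarrow> m x \<in> idx n"
    and mono: "\<And>x y. x \<le> y \<Longrightarrow> m x \<le> m y"
  shows "crossings X Z = (\<Sum>l\<in>idx n. \<Sum>k\<in>idx n. of_bool (k < l) * (int (card {x \<in> X. m x = l}) * int (card {z \<in> Z. m z = k})))
     + (\<Sum>l\<in>idx n. crossings {x \<in> X. m x = l} {z \<in> Z. m z = l})"
proof -
  have pt: "of_bool (z < x) = of_bool (m z < m x) + (of_bool (m z = m x \<and> z < x) :: int)" for x z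
    using mono[of x z] mono[of z x] by (cases "z < x") auto
  have 1: "(\<Sum>x\<in>X. \<Sum>z\<in>Z. of_bool (m z < m x))
     = (\<Sum>l\<in>idx n. \<Sum>k\<in>idx n. of_bool (k < l) * (int (card {x \<in> X. m x = l}) * int (card {z \<in> Z. m z = k})))"
  proof -
    have "(\<Sum>z\<in>Z. of_bool (m z < l)) = (\<Sum>k\<in>idx n. int (card {z \<in> Z. m z = k}) * of_bool (k < l))" for l
      by (rule sum_by_label[where X = Z and m = m and n = n and h = "\<lambda>k. of_bool (k < l)", OF fin(2) lab(2)])
    then have "(\<Sum>x\<in>X. \<Sum>z\<in>Z. of_bool (m z < m x)) = (\<Sum>x\<in>X. \<Sum>k\<in>idx n. int (card {z \<in> Z. m z = k}) * of_bool (k < m x))"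
      by (simp only:)
    also have "\<dots> = (\<Sum>l\<in>idx n. int (card {x \<in> X. m x = l}) * (\<Sum>k\<in>idx n. int (card {z \<in> Z. m z = k}) * of_bool (k < l)))"
      by (rule sum_by_label[OF fin(1) lab(1)])
    finally show ?thesis by (simp only: sum_distrib_left mult_ac)
  qed
  have 2: "(\<Sum>x\<in>X. \<Sum>z\<in>Z. of_bool (m z = m x \<and> z < x)) = (\<Sum>l\<in>idx n. crossings {x \<in> X. m x = l} {z \<in> Z. m z = l})"
  proof -
    have "(\<Sum>x\<in>X. \<Sum>z\<in>Z. of_bool (m z = m x \<and> z < x))
       = (\<Sum>l\<in>idx n. \<Sum>x \<in> {x \<in> X. m x = l}. \<Sum>z\<in>Z. of_bool (m z = m x \<and> z < x) :: int)"
      by (rule sum.group[symmetric]) (use fin lab in auto)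
    also have "\<dots> = (\<Sum>l\<in>idx n. crossings {x \<in> X. m x = l} {z \<in> Z. m z = l})"
      unfolding crossings_def
    proof (rule sum.cong[OF refl], rule sum.cong[OF refl])
      fix l x assume x: "x \<in> {x \<in> X. m x = l}"
      have "(\<Sum>z\<in>Z. of_bool (m z = m x \<and> z < x)) = (\<Sum>z\<in>Z. if m z = l then of_bool (z < x) else 0 :: int)"
        using x by (intro sum.cong refl) auto
      also have "\<dots> = (\<Sum>z \<in> {z \<in> Z. m z = l}. of_bool (z < x))"
        by (rule sum.inter_filter[OF fin(2), symmetric])
      finally show "(\<Sum>z\<in>Z. of_bool (m z = m x \<and> z < x)) = (\<Sum>z \<in> {z \<in> Z. m z = l}. of_bool (z < x) :: int)" .
    qed
    finally show ?thesis .
  qed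
  have "crossings X Z = (\<Sum>x\<in>X. \<Sum>z\<in>Z. of_bool (m z < m x) + of_bool (m z = m x \<and> z < x))"
    unfolding crossings_def by (rule sum.cong[OF refl], rule sum.cong[OF refl], rule pt)
  then show ?thesis by (simp only: sum.distrib 1 2)
qed

text \<open>Solving the factorial identity for \<open>g\<close>: the bar involution scales each factorial by a known power of
\<open>v\<close>.\<close>

lemma bar_gauss:
  assumes "g * qfact b * qfact a = qfact (a + b)"
  shows "bar g = v_pow (- 2 * (int a * int b)) * g"
proof -
  have "bar g * (v_pow (- (int b * (int b - 1))) * qfact b) * (v_pow (- (int a * (int a - 1))) * qfact a)
     = v_pow (- (int (a + b) * (int (a + b) - 1))) * qfact (a + b)"
    using arg_cong[OF assms, of bar] by (simp only: bar_mult bar_qfact)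
  then have "bar g * v_pow (- (int b * (int b - 1)) + - (int a * (int a - 1))) * (qfact b * qfact a)
     = v_pow (- (int (a + b) * (int (a + b) - 1))) * g * (qfact b * qfact a)"
    unfolding assms[symmetric] v_pow_add by (simp only: mult_ac)
  then have *: "bar g * v_pow (- (int b * (int b - 1)) + - (int a * (int a - 1))) = v_pow (- (int (a + b) * (int (a + b) - 1))) * g"
    by simp
  define e where "e = - (int b * (int b - 1)) + - (int a * (int a - 1))"
  have "bar g = bar g * v_pow e * v_pow (- e)" by (simp add: mult.assoc)
  also have "\<dots> = v_pow (- (int (a + b) * (int (a + b) - 1)) + - e) * g"
    using * unfolding e_def[symmetric] v_pow_add by (simp only: mult_ac)
  also have "- (int (a + b) * (int (a + b) - 1)) + - e = - 2 * (int a * int b)"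
    by (simp add: e_def algebra_simps)
  finally show ?thesis .
qed

lemma gauss_bar_qbinom:
  assumes "finite Y" "a + k = card Y" "g * qfact k * qfact a = qfact (card Y)"
  shows "g = v_pow (2 * (int a * int k)) * bar (qbinom (int a + int k) k)"
proof -
  have "g * qfact k * qfact a = qfact (a + k)" using assms(2,3) by simp
  from qbinom_eqI[OF this] have q: "qbinom (int a + int k) k = g" by simp
  have "v_pow (2 * (int a * int k)) * bar g = v_pow (2 * (int a * int k)) * v_pow (- 2 * (int a * int k)) * g"
    using bar_gauss[of g k a] assms(2,3) by (simp add: mult.assoc)
  then show ?thesis unfolding q by (simp flip: v_pow_add)
qed

lemma crossings_uminus:
  "crossings (uminus ` A) (uminus ` B) = crossings B A"
proof -
  have "crossings (uminus ` A) (uminus ` B) = (\<Sum>a\<in>A. \<Sum>b\<in>B. of_bool (- b < - a))"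
    unfolding crossings_def by (simp only: sum.reindex[OF inj_on_subset[OF inj_uminus subset_UNIV]] o_def)
  also have "\<dots> = (\<Sum>b\<in>B. \<Sum>a\<in>A. of_bool (- b < - a))"
    by (rule sum.swap)
  finally show ?thesis by (simp add: crossings_def)
qed

lemma crossings_Un_left:
  "finite A \<Longrightarrow> finite B \<Longrightarrow> A \<inter> B = {} \<Longrightarrow> crossings (A \<union> B) C = crossings A C + crossings B C"
  by (simp add: crossings_def sum.union_disjoint)

text \<open>Every pair of distinct elements with negative sum is crossed twice, once from either side; a negative
element crosses its own negative.\<close>

lemma crossings_neg_self:
  assumes "finite X" "X \<inter> uminus ` X = {}"
  shows "crossings (uminus ` X) X = 2 * neg_pairs X + neg_count X"
proof -
  have "crossings (uminus ` X) X = (\<Sum>a\<in>X. \<Sum>b\<in>X. of_bool (b < - a))"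
    unfolding crossings_def by (simp only: sum.reindex[OF inj_on_subset[OF inj_uminus subset_UNIV]] o_def)
  also have "\<dots> = (\<Sum>a\<in>X. \<Sum>b\<in>X. of_bool (a < b \<and> a + b < 0) + of_bool (b < a \<and> b + a < 0) + of_bool (b = a) * of_bool (a < 0))"
    by (intro sum.cong refl) auto
  also have "\<dots> = neg_pairs X + (\<Sum>a\<in>X. \<Sum>b\<in>X. of_bool (b < a \<and> b + a < 0)) + (\<Sum>a\<in>X. \<Sum>b\<in>X. of_bool (b = a) * of_bool (a < 0))"
    by (simp only: sum.distrib neg_pairs_def)
  also have "(\<Sum>a\<in>X. \<Sum>b\<in>X. of_bool (b < a \<and> b + a < 0)) = neg_pairs X"
    unfolding neg_pairs_def by (rule sum.swap)
  also have "(\<Sum>a\<in>X. \<Sum>b\<in>X. of_bool (b = a) * of_bool (a < 0)) = neg_count X"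
    unfolding neg_count_def
  proof (rule sum.cong[OF refl])
    fix a assume "a \<in> X"
    then have "(\<Sum>b\<in>X. of_bool (b = a)) = (1 :: int)" using assms(1) by (simp add: of_bool_def)
    then show "(\<Sum>b\<in>X. of_bool (b = a) * of_bool (a < 0)) = (of_bool (a < 0) :: int)"
      by (simp only: sum_distrib_right[symmetric])
  qed
  finally show ?thesis by simp
qed

text \<open>Away from the middle column, the blocks \<open>l\<close> and \<open>-l\<close> contribute jointly to the middle row: a position
\<open>x\<close> and its negative cannot both be chosen. The resulting sum is a trinomial coefficient.\<close>

definition trinom :: "int set \<Rightarrow> nat \<Rightarrow> nat \<Rightarrow> laurent" where
  "trinom S t s = (\<Sum>X | X \<subseteq> S \<union> uminus ` S \<and> X \<inter> uminus ` X = {} \<and> card (X \<inter> S) = t \<and> card (X \<inter> uminus ` S) = s.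
     v_pow (2 * (crossings (unused S X \<inter> S) (X \<inter> S) + crossings (unused S X \<inter> uminus ` S) (X \<inter> uminus ` S)
       + crossings (uminus ` (X \<inter> uminus ` S)) (X \<inter> S))))"

lemma trinom_qfact:
  assumes S: "finite S" "\<forall>x\<in>S. 0 < x" and a: "a + t + s = card S"
  shows "trinom S t s * (qfact a * qfact t * qfact s) = qfact (card S)"
proof -
  have neg: "S \<inter> uminus ` S = {}"
  proof (rule equals0I)
    fix x assume "x \<in> S \<inter> uminus ` S"
    then have "0 < x" "0 < - x" using S(2) by auto
    then show False by simp
  qed
  have "trinom S t s = (\<Sum>(X1, X2) \<in> (SIGMA X1 : {X1. X1 \<subseteq> S \<and> card X1 = t}. {X2. X2 \<subseteq> S - X1 \<and> card X2 = s}).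
      v_pow (2 * crossings (S - X1) X1) * v_pow (2 * crossings X2 (S - X1 - X2)))"
    unfolding trinom_def
  proof (rule sum.reindex_bij_witness[of _ "\<lambda>(X1, X2). X1 \<union> uminus ` X2" "\<lambda>X. (X \<inter> S, uminus ` (X \<inter> uminus ` S))"])
    fix X assume X: "X \<in> {X. X \<subseteq> S \<union> uminus ` S \<and> X \<inter> uminus ` X = {} \<and> card (X \<inter> S) = t \<and> card (X \<inter> uminus ` S) = s}"
    define X1 X2 where "X1 = X \<inter> S" and "X2 = uminus ` (X \<inter> uminus ` S)"
    have n2: "uminus ` X2 = X \<inter> uminus ` S" by (simp add: X2_def image_image)
    have X2S: "X2 \<subseteq> S" by (auto simp: X2_def)
    have X12: "X = X1 \<union> uminus ` X2" unfolding n2 X1_def using X by blast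
    have disj: "X1 \<inter> X2 = {}" using X by (auto simp: X1_def X2_def)
    show "(case (X \<inter> S, uminus ` (X \<inter> uminus ` S)) of (X1, X2) \<Rightarrow> X1 \<union> uminus ` X2) = X"
      using X12 by (simp add: X1_def X2_def)
    have "card X2 = card (X \<inter> uminus ` S)" unfolding X2_def by (rule card_image) simp
    then show "(X \<inter> S, uminus ` (X \<inter> uminus ` S)) \<in> (SIGMA X1 : {X1. X1 \<subseteq> S \<and> card X1 = t}. {X2. X2 \<subseteq> S - X1 \<and> card X2 = s})"
      using X X2S disj unfolding X1_def[symmetric] X2_def[symmetric] by (auto simp: X1_def)
    have fin: "finite X1" "finite X2" "finite (S - X1 - X2)" using S(1) X2S finite_subset by (auto simp: X1_def)
    have NN: "uminus ` X = uminus ` X1 \<union> X2" unfolding X12 by (simp add: image_Un image_image)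
    have nX1: "uminus ` X1 \<inter> S = {}" using neg by (auto simp: X1_def)
    have uS: "unused S X \<inter> S = S - X1 - X2"
      using neg nX1 unfolding unused_def NN by (auto simp: X1_def)
    have uN: "unused S X \<inter> uminus ` S = uminus ` (S - X1 - X2)"
    proof -
      have "uminus ` (S - X1 - X2) = uminus ` S - uminus ` X1 - uminus ` X2"
        by (simp add: image_set_diff)
      moreover have "X2 \<inter> uminus ` S = {}" using X2S neg by blast
      ultimately show ?thesis using neg n2 unfolding unused_def NN by auto
    qed
    have "crossings (unused S X \<inter> S) (X \<inter> S) + crossings (unused S X \<inter> uminus ` S) (X \<inter> uminus ` S) + crossings (uminus ` (X \<inter> uminus ` S)) (X \<inter> S)
       = crossings (S - X1 - X2) X1 + crossings X2 (S - X1 - X2) + crossings X2 X1"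
      unfolding uS uN n2[symmetric] crossings_uminus by (simp add: X1_def[symmetric] image_image)
    also have "\<dots> = crossings ((S - X1 - X2) \<union> X2) X1 + crossings X2 (S - X1 - X2)"
      by (subst crossings_Un_left) (use fin in auto)
    also have "(S - X1 - X2) \<union> X2 = S - X1" using X2S disj by blast
    finally show "(case (X \<inter> S, uminus ` (X \<inter> uminus ` S)) of (X1, X2) \<Rightarrow> v_pow (2 * crossings (S - X1) X1) * v_pow (2 * crossings X2 (S - X1 - X2)))
      = v_pow (2 * (crossings (unused S X \<inter> S) (X \<inter> S) + crossings (unused S X \<inter> uminus ` S) (X \<inter> uminus ` S) + crossings (uminus ` (X \<inter> uminus ` S)) (X \<inter> S)))"
      unfolding X1_def[symmetric] X2_def[symmetric] by (simp only: prod.case distrib_left v_pow_add)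
  next
    fix r assume r: "r \<in> (SIGMA X1 : {X1. X1 \<subseteq> S \<and> card X1 = t}. {X2. X2 \<subseteq> S - X1 \<and> card X2 = s})"
    obtain X1 X2 where rr: "r = (X1, X2)" by (cases r)
    have X: "X1 \<subseteq> S" "card X1 = t" "X2 \<subseteq> S - X1" "card X2 = s" using r rr by auto
    have i1: "(X1 \<union> uminus ` X2) \<inter> S = X1" using X neg by blast
    have i2: "(X1 \<union> uminus ` X2) \<inter> uminus ` S = uminus ` X2" using X neg by blast
    show "((case r of (X1, X2) \<Rightarrow> X1 \<union> uminus ` X2) \<inter> S, uminus ` ((case r of (X1, X2) \<Rightarrow> X1 \<union> uminus ` X2) \<inter> uminus ` S)) = r"
      unfolding rr prod.case i1 i2 by (simp add: image_image)
    have "(X1 \<union> uminus ` X2) \<inter> uminus ` (X1 \<union> uminus ` X2) = {}"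
    proof -
      have "uminus ` (X1 \<union> uminus ` X2) = uminus ` X1 \<union> X2" by (simp add: image_Un image_image)
      moreover have "X1 \<inter> uminus ` X1 = {}" "uminus ` X2 \<inter> X2 = {}" using X neg by blast+
      moreover have "uminus ` X2 \<inter> uminus ` X1 = {}" using X(3) by auto
      ultimately show ?thesis using X(3) by blast
    qed
    moreover have "card (uminus ` X2) = s" using X(4) by (simp add: card_image)
    moreover have "X1 \<union> uminus ` X2 \<subseteq> S \<union> uminus ` S" using X by blast
    ultimately show "(case r of (X1, X2) \<Rightarrow> X1 \<union> uminus ` X2) \<in> {X. X \<subseteq> S \<union> uminus ` S \<and> X \<inter> uminus ` X = {} \<and> card (X \<inter> S) = t \<and> card (X \<inter> uminus ` S) = s}"
      unfolding rr prod.case mem_Collect_eq i1 i2 using X(2) by blast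
  qed
  also have "\<dots> = (\<Sum>X1 | X1 \<subseteq> S \<and> card X1 = t. \<Sum>X2 | X2 \<subseteq> S - X1 \<and> card X2 = s. v_pow (2 * crossings (S - X1) X1) * v_pow (2 * crossings X2 (S - X1 - X2)))"
    by (rule sum.Sigma[symmetric]) (use S(1) in auto)
  also have "\<dots> = (\<Sum>X1 | X1 \<subseteq> S \<and> card X1 = t. v_pow (2 * crossings (S - X1) X1) * gauss (S - X1) s)"
    unfolding gauss_def sum_distrib_left ..
  finally have tri: "trinom S t s = (\<Sum>X1 | X1 \<subseteq> S \<and> card X1 = t. v_pow (2 * crossings (S - X1) X1) * gauss (S - X1) s)" .
  have g: "gauss (S - X1) s * qfact s * qfact a = qfact (a + s)" if "X1 \<in> {X1. X1 \<subseteq> S \<and> card X1 = t}" for X1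
  proof -
    have "card (S - X1) = a + s" using that a S(1) finite_subset by (subst card_Diff_subset) auto
    then show ?thesis using gauss_qfact[of "S - X1" a s] S(1) by simp
  qed
  have "trinom S t s * (qfact a * qfact t * qfact s)
     = (\<Sum>X1 | X1 \<subseteq> S \<and> card X1 = t. v_pow (2 * crossings (S - X1) X1) * (gauss (S - X1) s * qfact s * qfact a)) * qfact t"
    unfolding tri sum_distrib_right by (intro sum.cong refl) (simp only: mult_ac)
  also have "\<dots> = (\<Sum>X1 | X1 \<subseteq> S \<and> card X1 = t. v_pow (2 * crossings (S - X1) X1) * qfact (a + s)) * qfact t"
    by (rule arg_cong[of _ _ "\<lambda>x. x * qfact t"], rule sum.cong[OF refl]) (simp only: g)
  also have "\<dots> = (\<Sum>X1 | X1 \<subseteq> S \<and> card X1 = t. v_pow (2 * crossings (S - X1) X1)) * qfact t * qfact (a + s)"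
    by (simp only: sum_distrib_right[symmetric]) (simp only: mult_ac)
  also have "\<dots> = qfact (card S)"
    using gauss_complement_qfact[OF S(1), of "a + s" t] a by simp
  finally show ?thesis .
qed

lemma bar_trinomial:
  assumes "g * (qfact a * qfact t * qfact s) = qfact (a + t + s)"
  shows "bar g = v_pow (int a * (int a - 1) + int t * (int t - 1) + int s * (int s - 1) - int (a + t + s) * (int (a + t + s) - 1)) * g"
proof -
  define e where "e = int a * (int a - 1) + int t * (int t - 1) + int s * (int s - 1)"
  define m where "m = int (a + t + s) * (int (a + t + s) - 1)"
  define D where "D = qfact a * qfact t * qfact s"
  have bD: "bar D = v_pow (- e) * D"
    unfolding D_def bar_mult bar_qfact e_def minus_add_distrib v_pow_add by (simp only: mult_ac)
  have gD: "g * D = qfact (a + t + s)" using assms by (simp only: D_def)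
  have "bar g * bar D = v_pow (- m) * (g * D)"
    unfolding bar_mult[symmetric] gD m_def by (rule bar_qfact)
  then have "bar g * (v_pow (- e) * D) = v_pow (- m) * (g * D)" unfolding bD .
  then have "(bar g * v_pow (- e)) * D = (v_pow (- m) * g) * D" by (simp only: mult.assoc)
  moreover have "D \<noteq> 0" by (simp add: D_def)
  ultimately have *: "bar g * v_pow (- e) = v_pow (- m) * g" by simp
  have "bar g = bar g * v_pow (- e) * v_pow e" by (simp add: mult.assoc)
  also have "\<dots> = v_pow (e - m) * g"
    unfolding * by (simp only: diff_conv_add_uminus v_pow_add mult_ac)
  finally show ?thesis by (simp only: e_def m_def)
qed

lemma bar_gauss_B:
  assumes "g * (qfact_c a * qfact t) = qfact_c (a + t)"
  shows "bar g = u_pow (- 2 * int t) * v_pow (2 * (int a * (int a - 1)) + int t * (int t - 1) - 2 * (int (a + t) * (int (a + t) - 1))) * g"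
proof -
  define e where "e = 2 * (int a * (int a - 1)) + int t * (int t - 1)"
  define m where "m = 2 * (int (a + t) * (int (a + t) - 1))"
  define D where "D = qfact_c a * qfact t"
  have bD: "bar D = u_pow (- 2 * int a) * v_pow (- e) * D"
  proof -
    have e: "- e = - 2 * (int a * (int a - 1)) + - (int t * (int t - 1))" by (simp add: e_def)
    show ?thesis unfolding D_def bar_mult bar_qfact bar_qfact_c e v_pow_add by (simp only: mult_ac)
  qed
  have gD: "g * D = qfact_c (a + t)" using assms by (simp only: D_def)
  have "bar g * bar D = u_pow (- 2 * int (a + t)) * v_pow (- m) * (g * D)"
    unfolding bar_mult[symmetric] gD m_def bar_qfact_c by simp
  then have "bar g * (u_pow (- 2 * int a) * v_pow (- e) * D) = u_pow (- 2 * int (a + t)) * v_pow (- m) * (g * D)" unfolding bD .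
  then have "(bar g * (u_pow (- 2 * int a) * v_pow (- e))) * D = (u_pow (- 2 * int (a + t)) * v_pow (- m) * g) * D" by (simp only: mult.assoc)
  moreover have "D \<noteq> 0" by (simp add: D_def)
  ultimately have *: "bar g * (u_pow (- 2 * int a) * v_pow (- e)) = u_pow (- 2 * int (a + t)) * v_pow (- m) * g" by simp
  have "bar g * (u_pow (- 2 * int a) * v_pow (- e)) * (u_pow (2 * int a) * v_pow e)
     = bar g * (u_pow (- 2 * int a) * u_pow (2 * int a)) * (v_pow (- e) * v_pow e)" by (simp only: mult_ac)
  also have "\<dots> = bar g" by (simp flip: u_pow_add)
  finally have "bar g = u_pow (- 2 * int (a + t)) * v_pow (- m) * g * (u_pow (2 * int a) * v_pow e)"
    unfolding * by simp
  also have "\<dots> = (u_pow (- 2 * int (a + t)) * u_pow (2 * int a)) * (v_pow e * v_pow (- m)) * g" by (simp only: mult_ac)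
  also have "\<dots> = u_pow (- 2 * int t) * v_pow (e - m) * g"
    by (simp add: algebra_simps flip: u_pow_add v_pow_add)
  finally show ?thesis by (simp add: e_def m_def)
qed


text \<open>A fixed signed permutation \<open>w\<close> whose matrix is \<open>A\<close> shifted by \<open>t\<close>. The coefficient of \<open>T w\<close> is the total
weight of the sets \<open>X\<close> of positions with letter \<open>q\<close> that have block counts \<open>t\<close>.\<close>

locale row_pattern =
  fixes n d :: nat and nu mu :: "nat \<Rightarrow> nat" and A :: mat and p q :: int and b :: nat and w :: "int \<Rightarrow> int" and t :: "int \<Rightarrow> nat"
  assumes L: "nu \<in> Lam n d" "mu \<in> Lam n d" and w: "w \<in> weyl d"
    and pq: "0 \<le> p" "0 \<le> q" "q = p + 1 \<or> p = q + 1" and idx: "p \<in> idx n" "q \<in> idx n"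
    and t: "t \<in> tuples n b"
    and k: "kappa nu w mu = (shifted A q p t)"
begin

abbreviation "F \<equiv> block_index n nu \<circ> w"
abbreviation "G \<equiv> letter_positions d q F"
abbreviation "m \<equiv> block_index n mu"

lemma F_odd: "F (- z) = - F z"
  by (rule pattern_odd[OF w])

lemma G_label: "z \<in> G \<Longrightarrow> m z \<in> idx n"
  using block_index_in_idx[OF L(2), of z] by (auto simp: letter_positions_def abs_le_iff)

lemma F_range: "F z = q \<Longrightarrow> \<bar>z\<bar> \<le> int d"
  using idx(2) block_index_in_idx[OF L(1), of "w z"] weyl_range[OF w, of z] by simp

lemma card_row_q:
  assumes "l \<in> idx n"
  shows "int (card {z. F z = q \<and> m z = l}) = A q l + int (t l) + of_bool (q = 0) * int (t (- l))"
proof -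
  have "int (card {z. F z = q \<and> m z = l}) = kappa nu w mu q l"
    using assms idx(2) by (simp add: kappa_eq[OF L w])
  also have "\<dots> = A q l + int (t l) + of_bool (q = 0) * int (t (- l))"
    unfolding k using pq by (auto simp: shift_def)
  finally show ?thesis .
qed

lemma card_G_label:
  assumes "l \<in> idx n"
  shows "int (card {z \<in> G. m z = l}) = A q l + int (t l) + of_bool (q = 0) * (int (t (- l)) - of_bool (l = 0))"
proof -
  define K where "K = {z. F z = q \<and> m z = l}"
  have F0: "F 0 = 0" using F_odd[of 0] by simp
  have "z \<in> G \<longleftrightarrow> F z = q \<and> z \<noteq> 0" for z
    using F_range[of z] by (auto simp: letter_positions_def abs_le_iff)
  then have GK: "{z \<in> G. m z = l} = K - {0}" unfolding K_def by blast
  have K0: "0 \<in> K \<longleftrightarrow> q = 0 \<and> l = 0"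
    using F0 by (auto simp: K_def)
  have fin: "finite K"
    unfolding K_def by (rule finite_pattern[OF L(2) assms])
  have "int (card (K - {0})) = int (card K) - of_bool (0 \<in> K)"
  proof (cases "0 \<in> K")
    case True
    then show ?thesis using card_Suc_Diff1[OF fin True] by simp
  qed simp
  then show ?thesis
    unfolding GK K0 using card_row_q[OF assms, folded K_def] by (simp only: of_bool_conj) (simp add: right_diff_distrib)
qed

lemma sum_t: "(\<Sum>l\<in>idx n. t l) = b" and t_outside: "l \<notin> idx n \<Longrightarrow> t l = 0"
  using t by (auto simp: tuples_def)

lemma card_by_labels:
  assumes "finite X" "\<And>x. x \<in> X \<Longrightarrow> m x \<in> idx n" "\<And>l. l \<in> idx n \<Longrightarrow> card {x \<in> X. m x = l} = t l"
  shows "card X = b" "block_counts n mu X = t"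
proof -
  have "int (card X) = (\<Sum>l\<in>idx n. int (card {x \<in> X. m x = l}))"
    using sum_by_label[where X = X and m = m and n = n and h = "\<lambda>_. 1", OF assms(1,2)] by simp
  also have "\<dots> = int b" using assms(3) sum_t by (simp flip: of_nat_sum)
  finally show "card X = b" by simp
  show "block_counts n mu X = t"
    using assms(3) t_outside by (auto simp: block_counts_def)
qed

lemma tcountD: "block_counts n mu X = t \<Longrightarrow> l \<in> idx n \<Longrightarrow> card {x \<in> X. m x = l} = t l"
  by (auto simp: block_counts_def)

subsection \<open>Nonzero rows\<close>

lemma selections_subsets:
  assumes q: "q \<noteq> 0"
  shows "{X. X \<in> selections d q b F \<and> block_counts n mu X = t} = {X. X \<subseteq> (\<Union>l\<in>idx n. {z \<in> G. m z = l}) \<and> (\<forall>l\<in>idx n. card (X \<inter> {z \<in> G. m z = l}) = t l)}"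
proof (intro Set.set_eqI iffI)
  fix X assume X: "X \<in> {X. X \<in> selections d q b F \<and> block_counts n mu X = t}"
  then have XG: "X \<subseteq> G"
    using selections_not_zero[of X d q b F] by (auto simp: selections_def letter_positions_def)
  then have "X \<inter> {z \<in> G. m z = l} = {x \<in> X. m x = l}" for l by auto
  then show "X \<in> {X. X \<subseteq> (\<Union>l\<in>idx n. {z \<in> G. m z = l}) \<and> (\<forall>l\<in>idx n. card (X \<inter> {z \<in> G. m z = l}) = t l)}"
    using X XG G_label tcountD by auto
next
  fix X assume X: "X \<in> {X. X \<subseteq> (\<Union>l\<in>idx n. {z \<in> G. m z = l}) \<and> (\<forall>l\<in>idx n. card (X \<inter> {z \<in> G. m z = l}) = t l)}"
  then have XG: "X \<subseteq> G" by auto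
  then have e: "X \<inter> {z \<in> G. m z = l} = {x \<in> X. m x = l}" for l by auto
  have fin: "finite X" using XG finite_letter_positions finite_subset by blast
  have c: "card X = b" "block_counts n mu X = t"
    using card_by_labels[OF fin] XG G_label X e by auto
  have "X \<inter> uminus ` X = {}"
  proof (rule equals0I)
    fix x assume "x \<in> X \<inter> uminus ` X"
    then have "F x = q" "F (- x) = q" using XG by (auto simp: letter_positions_def)
    then show False using F_odd[of x] q by simp
  qed
  then show "X \<in> {X. X \<in> selections d q b F \<and> block_counts n mu X = t}"
    using c XG by (auto simp: selections_def letter_positions_def)
qed

text \<open>For \<open>q \<noteq> 0\<close> the negatives of the chosen positions carry the letter \<open>-q\<close> and do not interfere.\<close>

lemma letter_positions_relabel_nonzero:
  assumes q: "q \<noteq> 0" and X: "X \<subseteq> G"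
  shows "letter_positions d q (relabel X p F) = G - X"
proof -
  have "F z \<noteq> q" if "- z \<in> X" for z
    using that X F_odd[of "- z"] q by (auto simp: letter_positions_def)
  moreover have "p \<noteq> q" "- p \<noteq> q" using pq q by arith+
  ultimately show ?thesis using q by (auto simp: letter_positions_def relabel_def)
qed

text \<open>The chosen and the remaining positions with letter \<open>q\<close> cross in two ways. Crossings between different
blocks are determined by the block counts; crossings within a block range over all subsets of the
given size and sum up to a Gaussian binomial coefficient. Passing to the barred coefficient supplies
the diagonal terms \<open>k = l\<close> of the exponent.\<close>

lemma coefficient_nonzero_row:
  assumes q: "q \<noteq> 0" and A: "\<And>i j. 0 \<le> A i j"
  shows "(\<Sum>X | X \<in> selections d q b F \<and> block_counts n mu X = t. relabel_weight d p q (relabel X p F) X)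
    = v_pow (2 * (\<Sum>l\<in>idx n. \<Sum>k\<in>idx n. of_bool (if p < q then k \<le> l else l \<le> k) * (int (t l) * A q k)))
      * (\<Prod>l\<in>idx n. bar (qbinom (A q l + int (t l)) (t l)))"
proof -
  define Gl where "Gl l = {z \<in> G. m z = l}" for l
  have finG: "finite G" by (rule finite_letter_positions)
  have finGl: "finite (Gl l)" for l using finG by (simp add: Gl_def)
  \<comment> \<open>The exponent \<open>E\<close> collects the crossings between different blocks, \<open>loc\<close> those within a block.\<close>
  define E where "E = (\<Sum>l\<in>idx n. \<Sum>k\<in>idx n. of_bool (if p < q then k < l else l < k) * (int (t l) * A q k))"
  define loc where "loc l X = v_pow (2 * (if p < q then crossings X (Gl l - X) else crossings (Gl l - X) X))" for l X
  have cGl: "card (Gl l) = nat (A q l) + t l" if "l \<in> idx n" for l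
    using card_G_label[OF that] q A[of q l] by (simp add: Gl_def)
  have weight: "relabel_weight d p q (relabel X p F) X = v_pow (2 * E) * (\<Prod>l\<in>idx n. loc l (X \<inter> Gl l))"
    if XG: "X \<subseteq> G" and cX: "\<And>l. l \<in> idx n \<Longrightarrow> card (X \<inter> Gl l) = t l" for X
  proof -
    have fX: "finite X" using XG finG finite_subset by blast
    have XGl: "{x \<in> X. m x = l} = X \<inter> Gl l" for l using XG by (auto simp: Gl_def)
    have ZGl: "{z \<in> G - X. m z = l} = Gl l - X \<inter> Gl l" for l by (auto simp: Gl_def)
    have cZ: "int (card (Gl l - X \<inter> Gl l)) = A q l" if "l \<in> idx n" for l
      using cX[OF that] cGl[OF that] A[of q l] card_mono[OF finGl, of "X \<inter> Gl l" l]
      by (simp add: card_Diff_subset finGl)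
    have labX: "m x \<in> idx n" if "x \<in> X" for x using G_label XG that by blast
    have labZ: "m x \<in> idx n" if "x \<in> G - X" for x using G_label that by blast
    show ?thesis
    proof (cases "p < q")
      case True
      have "crossings X (G - X) = (\<Sum>l\<in>idx n. \<Sum>k\<in>idx n. of_bool (k < l) * (int (card (X \<inter> Gl l)) * int (card (Gl k - X \<inter> Gl k))))
        + (\<Sum>l\<in>idx n. crossings (X \<inter> Gl l) (Gl l - X \<inter> Gl l))"
        using crossings_by_label[of X "G - X" m n, OF fX _ labX labZ block_index_mono] finG unfolding XGl ZGl by simp
      also have "(\<Sum>l\<in>idx n. \<Sum>k\<in>idx n. of_bool (k < l) * (int (card (X \<inter> Gl l)) * int (card (Gl k - X \<inter> Gl k)))) = E"
        unfolding E_def using True by (intro sum.cong refl) (simp add: cX cZ)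
      finally have "crossings X (G - X) = E + (\<Sum>l\<in>idx n. crossings (X \<inter> Gl l) (Gl l - X \<inter> Gl l))" .
      then show ?thesis
        using True unfolding relabel_weight_def letter_positions_relabel_nonzero[OF q XG] loc_def
        by (simp add: distrib_left v_pow_add sum_distrib_left v_pow_sum)
    next
      case False
      have "crossings (G - X) X = (\<Sum>l\<in>idx n. \<Sum>k\<in>idx n. of_bool (k < l) * (int (card (Gl l - X \<inter> Gl l)) * int (card (X \<inter> Gl k))))
        + (\<Sum>l\<in>idx n. crossings (Gl l - X \<inter> Gl l) (X \<inter> Gl l))"
        using crossings_by_label[of "G - X" X m n, OF _ fX labZ labX block_index_mono] finG unfolding XGl ZGl by simp
      also have "(\<Sum>l\<in>idx n. \<Sum>k\<in>idx n. of_bool (k < l) * (int (card (Gl l - X \<inter> Gl l)) * int (card (X \<inter> Gl k)))) = E"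
        unfolding E_def by (subst sum.swap, intro sum.cong refl) (use False in \<open>simp add: cX cZ\<close>)
      finally have "crossings (G - X) X = E + (\<Sum>l\<in>idx n. crossings (Gl l - X \<inter> Gl l) (X \<inter> Gl l))" .
      then show ?thesis
        using False q unfolding relabel_weight_def letter_positions_relabel_nonzero[OF q XG] loc_def
        by (simp add: distrib_left v_pow_add sum_distrib_left v_pow_sum)
    qed
  qed
  have locsum: "(\<Sum>X | X \<subseteq> Gl l \<and> card X = t l. loc l X) = v_pow (2 * (int (t l) * A q l)) * bar (qbinom (A q l + int (t l)) (t l))"
    if l: "l \<in> idx n" for l
  proof -
    have "(\<Sum>X | X \<subseteq> Gl l \<and> card X = t l. loc l X) * qfact (t l) * qfact (nat (A q l)) = qfact (card (Gl l))"
    proof (cases "p < q")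
      case True
      then show ?thesis using gauss_qfact[OF finGl[of l], of "nat (A q l)" "t l"] cGl[OF l] by (simp add: loc_def gauss_def)
    next
      case False
      then show ?thesis using gauss_complement_qfact[OF finGl[of l], of "nat (A q l)" "t l"] cGl[OF l] by (simp add: loc_def)
    qed
    from gauss_bar_qbinom[OF finGl[of l] _ this] show ?thesis
      using cGl[OF l] A[of q l] by (simp add: mult.commute)
  qed
  have "(\<Sum>X | X \<in> selections d q b F \<and> block_counts n mu X = t. relabel_weight d p q (relabel X p F) X)
     = (\<Sum>X | X \<subseteq> (\<Union>l\<in>idx n. Gl l) \<and> (\<forall>l\<in>idx n. card (X \<inter> Gl l) = t l). v_pow (2 * E) * (\<Prod>l\<in>idx n. loc l (X \<inter> Gl l)))"
    unfolding selections_subsets[OF q] Gl_def[symmetric]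
  proof (rule sum.cong[OF refl])
    fix X assume X: "X \<in> {X. X \<subseteq> (\<Union>l\<in>idx n. Gl l) \<and> (\<forall>l\<in>idx n. card (X \<inter> Gl l) = t l)}"
    then have "X \<subseteq> G" by (auto simp: Gl_def)
    then show "relabel_weight d p q (relabel X p F) X = v_pow (2 * E) * (\<Prod>l\<in>idx n. loc l (X \<inter> Gl l))"
      by (rule weight) (use X in blast)
  qed
  also have "\<dots> = v_pow (2 * E) * (\<Prod>l\<in>idx n. \<Sum>X | X \<subseteq> Gl l \<and> card X = t l. loc l X)"
    unfolding sum_distrib_left[symmetric]
    by (subst sum_subsets_partition[of "idx n" Gl loc "\<lambda>l X. card X = t l"]) (auto simp: finG Gl_def)
  also have "(\<Prod>l\<in>idx n. \<Sum>X | X \<subseteq> Gl l \<and> card X = t l. loc l X)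
     = v_pow (\<Sum>l\<in>idx n. 2 * (int (t l) * A q l)) * (\<Prod>l\<in>idx n. bar (qbinom (A q l + int (t l)) (t l)))"
    by (simp add: locsum v_pow_sum prod.distrib)
  also have "v_pow (2 * E) * (v_pow (\<Sum>l\<in>idx n. 2 * (int (t l) * A q l)) * (\<Prod>l\<in>idx n. bar (qbinom (A q l + int (t l)) (t l))))
     = v_pow (2 * (E + (\<Sum>l\<in>idx n. int (t l) * A q l))) * (\<Prod>l\<in>idx n. bar (qbinom (A q l + int (t l)) (t l)))"
    by (simp add: v_pow_add distrib_left sum_distrib_left mult.assoc)
  also have "E + (\<Sum>l\<in>idx n. int (t l) * A q l)
     = (\<Sum>l\<in>idx n. \<Sum>k\<in>idx n. of_bool (if p < q then k \<le> l else l \<le> k) * (int (t l) * A q k))"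
  proof -
    have dg: "(\<Sum>l\<in>idx n. int (t l) * A q l) = (\<Sum>l\<in>idx n. \<Sum>k\<in>idx n. of_bool (k = l) * (int (t l) * A q k))"
      by (intro sum.cong refl) (simp add: of_bool_def if_distrib[of "\<lambda>x. x * _"] cong: if_cong)
    show ?thesis
      unfolding dg E_def sum.distrib[symmetric] by (intro sum.cong refl) auto
  qed
  finally show ?thesis .
qed

end

context row_pattern
begin

subsection \<open>The middle row\<close>

text \<open>In the middle row a chosen position also removes its negative from the positions with letter \<open>0\<close>, so
the blocks \<open>l\<close> and \<open>-l\<close> have to be treated together. With \<open>S l\<close> the positive positions with letter \<open>0\<close> in
block \<open>l\<close>, the parts are \<open>Y l = S l \<union> - S l\<close>; the part \<open>Y 0\<close> yields a type B coefficient and the others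
yield trinomial coefficients.\<close>

lemma coefficient_zero_row:
  assumes q: "q = 0" and p: "p = 1" and A: "\<And>i j. 0 \<le> A i j" "odd (A 0 0)" "\<And>j. A 0 (- j) = A 0 j"
  shows "\<exists>S. (\<forall>l. finite (S l) \<and> (\<forall>x\<in>S l. 0 < x))
    \<and> 2 * int (card (S 0)) = A 0 0 - 1 + 2 * int (t 0)
    \<and> (\<forall>l\<in>{1..int n}. int (card (S l)) = A 0 l + int (t l) + int (t (- l)))
    \<and> (\<Sum>X | X \<in> selections d q b F \<and> block_counts n mu X = t. relabel_weight d p q (relabel X p F) X)
     = u_pow (2 * (\<Sum>l\<in>idx n. of_bool (l < 0) * int (t l)))
       * v_pow (2 * (\<Sum>l\<in>idx n. \<Sum>k\<in>idx n. of_bool (k < l) * ((A 0 l - of_bool (l = 0)) * int (t k)))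
           + (\<Sum>l\<in>idx n. \<Sum>k\<in>idx n. of_bool (k + l < 0) * (int (t l) * int (t k)))
           - (\<Sum>l\<in>idx n. of_bool (l < 0) * int (t l)))
       * (gauss_B (S 0) (t 0) * (\<Prod>l = 1..int n. trinom (S l) (t l) (t (- l))))"
proof -
  define S where "S l = {z \<in> G. 0 < z \<and> m z = l}" for l
  define Y where "Y l = S l \<union> uminus ` S l" for l
  define I where "I = {0..int n}"
  have finG: "finite G" by (rule finite_letter_positions)
  have finS: "finite (S l)" for l using finG by (simp add: S_def)
  have posS: "\<forall>x\<in>S l. 0 < x" for l by (simp add: S_def)
  have finY: "finite (Y l)" for l using finS by (simp add: Y_def)
  have Gneg: "z \<in> G \<longleftrightarrow> - z \<in> G" for z
    using F_odd[of z] q by (auto simp: letter_positions_def)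
  have G0: "0 \<notin> G" by (simp add: letter_positions_def)
  have m_pos: "0 \<le> m z" if "0 < z" for z using that by (simp add: block_index_nonneg)
  have memN: "z \<in> uminus ` B \<longleftrightarrow> - z \<in> B" for z and B :: "int set" by force
  have memY: "z \<in> Y l \<longleftrightarrow> z \<in> G \<and> (0 < z \<and> m z = l \<or> z < 0 \<and> m z = - l)" for z l
    using Gneg[of z] by (auto simp: Y_def S_def memN block_index_odd)
  have lab: "z \<in> Y l \<Longrightarrow> \<bar>m z\<bar> = l" if "0 \<le> l" for z l
    using that by (auto simp: memY)
  have Ycover: "(\<Union>l\<in>I. Y l) = G"
  proof (intro Set.set_eqI iffI)
    fix z assume z: "z \<in> G"
    then have zi: "m z \<in> idx n" "z \<noteq> 0" using G_label G0 by auto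
    then have "\<bar>m z\<bar> \<in> I" by (auto simp: I_def idx_def)
    moreover have "z \<in> Y \<bar>m z\<bar>"
    proof (cases "0 < z")
      case True
      then show ?thesis using z m_pos[OF True] by (simp add: memY)
    next
      case False
      then have "z < 0" using zi by simp
      then have "0 \<le> m (- z)" using m_pos[of "- z"] by simp
      then have "m z \<le> 0" by (simp add: block_index_odd)
      then show ?thesis using z \<open>z < 0\<close> by (simp add: memY)
    qed
    ultimately show "z \<in> (\<Union>l\<in>I. Y l)" by blast
  qed (auto simp: memY)
  have Ydisj: "Y i \<inter> Y j = {}" if "i \<in> I" "j \<in> I" "i \<noteq> j" for i j
    using lab[of i] lab[of j] that by (auto simp: I_def)
  have Gp: "m z = l \<longleftrightarrow> z \<in> S l" if "z \<in> G" "0 < l" for z l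
  proof -
    have "z \<noteq> 0" using that(1) G0 by auto
    then show ?thesis using that m_pos[of "- z"] by (cases "0 < z") (auto simp: S_def block_index_odd)
  qed
  have Gn: "m z = - l \<longleftrightarrow> z \<in> uminus ` S l" if "z \<in> G" "0 < l" for z l
    using Gp[of "- z" l] that Gneg[of z] by (auto simp: memN block_index_odd)
  have Gz: "m z = 0 \<longleftrightarrow> z \<in> Y 0" if "z \<in> G" for z
  proof -
    have "z \<noteq> 0" using that G0 by auto
    then show ?thesis using that by (auto simp: memY)
  qed
  have SY: "S l \<subseteq> Y l" "uminus ` S l \<subseteq> Y l" for l by (auto simp: Y_def)
  have part0: "{x \<in> X. m x = 0} = X \<inter> Y 0" if "X \<subseteq> G" for X
    using Gz that by blast
  have partp: "{x \<in> X. m x = l} = X \<inter> Y l \<inter> S l" if "X \<subseteq> G" "0 < l" for X l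
    using Gp that SY(1)[of l] by blast
  have partn: "{x \<in> X. m x = - l} = X \<inter> Y l \<inter> uminus ` S l" if "X \<subseteq> G" "0 < l" for X l
    using Gn that SY(2)[of l] by blast
  have cS0: "2 * int (card (S 0)) = A 0 0 - 1 + 2 * int (t 0)"
  proof -
    have "{z \<in> G. m z = 0} = S 0 \<union> uminus ` S 0"
    proof -
      have "Y 0 \<subseteq> G" by (auto simp: memY)
      then show ?thesis using part0[OF order.refl] by (auto simp: Y_def)
    qed
    moreover have "S 0 \<inter> uminus ` S 0 = {}" by (auto simp: S_def)
    ultimately have "card {z \<in> G. m z = 0} = 2 * card (S 0)"
      using finS by (simp add: card_Un_disjoint card_image)
    then show ?thesis using card_G_label[of 0] q by (simp add: idx_def)
  qed
  have cSl: "int (card (S l)) = A 0 l + int (t l) + int (t (- l))" if l: "0 < l" "l \<le> int n" for l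
  proof -
    have "{z \<in> G. m z = l} = S l" using partp[OF order.refl l(1)] SY[of l] by (auto simp: S_def)
    then show ?thesis using card_G_label[of l] l q by (simp add: idx_def)
  qed
  define W where "W X = G - X - uminus ` X" for X :: "int set"
  define E where "E = 2 * (\<Sum>l\<in>idx n. \<Sum>k\<in>idx n. of_bool (k < l) * ((A 0 l - of_bool (l = 0)) * int (t k)))
           + (\<Sum>l\<in>idx n. \<Sum>k\<in>idx n. of_bool (k + l < 0) * (int (t l) * int (t k)))
           - (\<Sum>l\<in>idx n. of_bool (l < 0) * int (t l))"
  define U where "U = 2 * (\<Sum>l\<in>idx n. of_bool (l < 0) * int (t l))"
  \<comment> \<open>The conditions and the weights localised to the part \<open>Y l\<close>. The product of the local weights misses the constant factors with exponents \<open>U\<close> and \<open>E\<close>.\<close>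
  define P where "P l X \<longleftrightarrow> X \<inter> uminus ` X = {} \<and> (if l = 0 then card X = t 0 else card (X \<inter> S l) = t l \<and> card (X \<inter> uminus ` S l) = t (- l))" for l and X :: "int set"
  define loc where "loc l X = (if l = 0 then u_pow (2 * neg_count X) * v_pow (2 * (crossings (unused (S 0) X) X + neg_pairs X))
     else v_pow (2 * (crossings (unused (S l) X \<inter> S l) (X \<inter> S l) + crossings (unused (S l) X \<inter> uminus ` S l) (X \<inter> uminus ` S l)
       + crossings (uminus ` (X \<inter> uminus ` S l)) (X \<inter> S l))))" for l X
  have sets: "{X. X \<in> selections d q b F \<and> block_counts n mu X = t} = {X. X \<subseteq> (\<Union>l\<in>I. Y l) \<and> (\<forall>l\<in>I. P l (X \<inter> Y l))}"
  proof (intro Set.set_eqI iffI)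
    fix X assume X: "X \<in> {X. X \<in> selections d q b F \<and> block_counts n mu X = t}"
    then have XG: "X \<subseteq> G" using selections_not_zero[of X d q b F] by (auto simp: selections_def letter_positions_def)
    have dis: "X \<inter> uminus ` X = {}" using X by (simp add: selections_def)
    have "P l (X \<inter> Y l)" if l: "l \<in> I" for l
    proof -
      have "(X \<inter> Y l) \<inter> uminus ` (X \<inter> Y l) = {}" using dis by auto
      moreover have "card (X \<inter> Y l) = t 0" if "l = 0"
      proof -
        have "X \<inter> Y l = {x \<in> X. m x = 0}" using part0[OF XG] that by simp
        then show ?thesis using tcountD[of X 0] X by (simp add: idx_def)
      qed
      moreover have "card (X \<inter> Y l \<inter> S l) = t l \<and> card (X \<inter> Y l \<inter> uminus ` S l) = t (- l)" if "l \<noteq> 0"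
      proof -
        have l0: "0 < l" using l that by (simp add: I_def)
        have "X \<inter> Y l \<inter> S l = {x \<in> X. m x = l}" using partp[OF XG l0] ..
        moreover have "X \<inter> Y l \<inter> uminus ` S l = {x \<in> X. m x = - l}" using partn[OF XG l0] ..
        ultimately show ?thesis using tcountD[of X l] tcountD[of X "- l"] X l by (simp add: idx_def I_def)
      qed
      ultimately show ?thesis by (simp add: P_def)
    qed
    then show "X \<in> {X. X \<subseteq> (\<Union>l\<in>I. Y l) \<and> (\<forall>l\<in>I. P l (X \<inter> Y l))}" using XG Ycover by blast
  next
    fix X assume X: "X \<in> {X. X \<subseteq> (\<Union>l\<in>I. Y l) \<and> (\<forall>l\<in>I. P l (X \<inter> Y l))}"
    then have XG: "X \<subseteq> G" using Ycover by blast
    have fin: "finite X" using XG finG finite_subset by blast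
    have "X \<inter> uminus ` X = {}"
    proof (rule equals0I)
      fix x assume x: "x \<in> X \<inter> uminus ` X"
      then have xx: "x \<in> X" "- x \<in> X" by auto
      then obtain l where l: "l \<in> I" "x \<in> Y l" using X by blast
      then have "- x \<in> Y l" using Gneg[of x] by (auto simp: memY block_index_odd)
      then have "x \<in> (X \<inter> Y l) \<inter> uminus ` (X \<inter> Y l)" using xx l by (auto simp: memN)
      then show False using X l(1) by (auto simp: P_def)
    qed
    moreover have "card {x \<in> X. m x = k} = t k" if k: "k \<in> idx n" for k
    proof -
      consider "k = 0" | "0 < k" | "k < 0" by linarith
      then show ?thesis
      proof cases
        case 1
        have "{x \<in> X. m x = k} = X \<inter> Y 0" using part0[OF XG] 1 by simp
        then show ?thesis using X 1 by (auto simp: P_def I_def)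
      next
        case 2
        have "{x \<in> X. m x = k} = X \<inter> Y k \<inter> S k" by (rule partp[OF XG 2])
        then show ?thesis using X 2 k by (auto simp: P_def I_def idx_def)
      next
        case 3
        then have k0: "0 < - k" by simp
        have "{x \<in> X. m x = k} = X \<inter> Y (- k) \<inter> uminus ` S (- k)" using partn[OF XG k0] by simp
        then show ?thesis using X 3 k by (auto simp: P_def I_def idx_def)
      qed
    qed
    ultimately show "X \<in> {X. X \<in> selections d q b F \<and> block_counts n mu X = t}"
      using card_by_labels[OF fin] XG G_label by (auto simp: selections_def letter_positions_def)
  qed
  have weight: "relabel_weight d p q (relabel X p F) X = u_pow U * v_pow E * (\<Prod>l\<in>I. loc l (X \<inter> Y l))"
    if X: "X \<in> {X. X \<in> selections d q b F \<and> block_counts n mu X = t}" for X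
  proof -
    have XG: "X \<subseteq> G" using X selections_not_zero[of X d q b F] by (auto simp: selections_def letter_positions_def)
    have dis: "X \<inter> uminus ` X = {}" using X by (simp add: selections_def)
    have finX: "finite X" using XG finG finite_subset by blast
    have NG: "uminus ` X \<subseteq> G" using XG Gneg by (auto simp: memN)
    have WG: "W X \<subseteq> G" by (auto simp: W_def)
    have finW: "finite (W X)" using WG finG finite_subset by blast
    define Xl where "Xl k = {x \<in> X. m x = k}" for k
    define Wl where "Wl k = {x \<in> W X. m x = k}" for k
    have Nl: "{x \<in> uminus ` X. m x = k} = uminus ` Xl (- k)" for k
      by (auto simp: Xl_def memN block_index_odd)
    have finl: "finite (Xl k)" "finite (Wl k)" for k using finX finW by (simp_all add: Xl_def Wl_def)
    have cX: "card (Xl k) = t k" if "k \<in> idx n" for k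
      using tcountD[of X k] X that by (simp add: Xl_def)
    have cN: "card (uminus ` Xl (- k)) = t (- k)" if "k \<in> idx n" for k
      using cX[of "- k"] that by (simp add: card_image)
    have cW: "int (card (Wl k)) = A 0 k - of_bool (k = 0)" if k: "k \<in> idx n" for k
    proof -
      have "{z \<in> G. m z = k} = Wl k \<union> (Xl k \<union> uminus ` Xl (- k))"
        unfolding Nl[symmetric] using XG NG by (auto simp: Wl_def W_def Xl_def)
      moreover have "Wl k \<inter> (Xl k \<union> uminus ` Xl (- k)) = {}"
        unfolding Nl[symmetric] by (auto simp: Wl_def W_def Xl_def)
      moreover have "Xl k \<inter> uminus ` Xl (- k) = {}"
        unfolding Nl[symmetric] using dis by (auto simp: Xl_def)
      ultimately have "card {z \<in> G. m z = k} = card (Wl k) + (t k + t (- k))"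
        using cX[OF k] cN[OF k] finl by (simp add: card_Un_disjoint)
      then show ?thesis using card_G_label[OF k] q by simp
    qed
    have labX: "m x \<in> idx n" if "x \<in> X" for x using G_label XG that by blast
    have labN: "m x \<in> idx n" if "x \<in> uminus ` X" for x using G_label NG that by blast
    have labW: "m x \<in> idx n" if "x \<in> W X" for x using G_label WG that by blast
    have c1: "crossings (W X) X = (\<Sum>l\<in>idx n. \<Sum>k\<in>idx n. of_bool (k < l) * ((A 0 l - of_bool (l = 0)) * int (t k)))
       + (\<Sum>l\<in>idx n. crossings (Wl l) (Xl l))"
    proof -
      have "(\<Sum>l\<in>idx n. \<Sum>k\<in>idx n. of_bool (k < l) * (int (card (Wl l)) * int (card (Xl k))))
         = (\<Sum>l\<in>idx n. \<Sum>k\<in>idx n. of_bool (k < l) * ((A 0 l - of_bool (l = 0)) * int (t k)))"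
        by (rule sum.cong[OF refl], rule sum.cong[OF refl]) (simp only: cW cX)
      then show ?thesis
        using crossings_by_label[of "W X" X m n, OF finW finX labW labX block_index_mono] unfolding Wl_def[symmetric] Xl_def[symmetric] by simp
    qed
    have c2: "crossings (uminus ` X) X = (\<Sum>l\<in>idx n. \<Sum>k\<in>idx n. of_bool (k + l < 0) * (int (t l) * int (t k)))
       + (\<Sum>l\<in>idx n. crossings (uminus ` Xl (- l)) (Xl l))"
    proof -
      have "(\<Sum>l\<in>idx n. \<Sum>k\<in>idx n. of_bool (k < l) * (int (card (uminus ` Xl (- l))) * int (card (Xl k))))
         = (\<Sum>l\<in>idx n. \<Sum>k\<in>idx n. of_bool (k + - l < 0) * (int (t (- l)) * int (t k)))"
        by (rule sum.cong[OF refl], rule sum.cong[OF refl]) (simp add: cN cX)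
      also have "\<dots> = (\<Sum>l\<in>idx n. \<Sum>k\<in>idx n. of_bool (k + l < 0) * (int (t l) * int (t k)))"
        by (rule sum_idx_uminus)
      finally show ?thesis
        using crossings_by_label[of "uminus ` X" X m n, OF finite_imageI[OF finX] finX labN labX block_index_mono]
        unfolding Nl Xl_def[symmetric] by simp
    qed
    \<comment> \<open>The summands for \<open>l\<close> and \<open>- l\<close> agree; the one for \<open>l = 0\<close> counts pairs with negative sum.\<close>
    have l2: "(\<Sum>l\<in>idx n. crossings (uminus ` Xl (- l)) (Xl l))
       = 2 * neg_pairs (Xl 0) + neg_count (Xl 0) + (\<Sum>l = 1..int n. 2 * crossings (uminus ` Xl (- l)) (Xl l))"
    proof -
      have "crossings (uminus ` Xl (- 0)) (Xl 0) = 2 * neg_pairs (Xl 0) + neg_count (Xl 0)"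
        using crossings_neg_self[of "Xl 0"] finl dis by (auto simp: Xl_def)
      moreover have "crossings (uminus ` Xl (- (- l))) (Xl (- l)) = crossings (uminus ` Xl (- l)) (Xl l)" for l
        using crossings_uminus[of "Xl l" "uminus ` Xl (- l)"] by (simp add: image_image)
      ultimately show ?thesis unfolding sum_idx_halves by simp
    qed
    have ng: "neg_count X = (\<Sum>l\<in>idx n. of_bool (l < 0) * int (t l)) + neg_count (Xl 0)"
    proof -
      have total: "neg_count X = (\<Sum>l\<in>idx n. neg_count (Xl l))"
        unfolding neg_count_def Xl_def by (rule sum.group[symmetric]) (use finX labX in auto)
      have "neg_count (Xl l) = 0" if "0 < l" for l
      proof -
        have "\<not> x < 0" if "x \<in> Xl l" for x
          using that \<open>0 < l\<close> m_pos[of "- x"] by (auto simp: Xl_def block_index_odd)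
        then show ?thesis by (simp add: neg_count_def)
      qed
      moreover have "neg_count (Xl l) = int (t l)" if l: "l < 0" "l \<in> idx n" for l
      proof -
        have "x < 0" if "x \<in> Xl l" for x
        proof -
          have "m x < 0" "x \<noteq> 0" using that l XG G0 by (auto simp: Xl_def)
          then show ?thesis using m_pos[of x] by linarith
        qed
        then show ?thesis using cX[OF l(2)] by (simp add: neg_count_def)
      qed
      ultimately have pt: "neg_count (Xl l) = of_bool (l < 0) * int (t l) + of_bool (l = 0) * neg_count (Xl 0)" if "l \<in> idx n" for l
        using that by (cases "l < 0"; cases "l = 0") simp_all
      have "(\<Sum>l\<in>idx n. of_bool (l = 0) * neg_count (Xl 0)) = neg_count (Xl 0)"
        using sum_idx_halves[of "\<lambda>l. of_bool (l = 0) * neg_count (Xl 0)"] by simp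
      moreover have "(\<Sum>l\<in>idx n. neg_count (Xl l)) = (\<Sum>l\<in>idx n. of_bool (l < 0) * int (t l) + of_bool (l = 0) * neg_count (Xl 0))"
        by (rule sum.cong[OF refl pt])
      ultimately show ?thesis using total by (simp only: sum.distrib)
    qed
    have un: "unused (S l) (X \<inter> Y l) = W X \<inter> Y l" for l
      using Ycover Gneg by (auto simp: unused_def W_def memN Y_def S_def)
    have XY0: "X \<inter> Y 0 = Xl 0" "W X \<inter> Y 0 = Wl 0"
      unfolding Xl_def Wl_def part0[OF XG] part0[OF WG] by simp_all
    have XYl: "X \<inter> Y l \<inter> S l = Xl l" "X \<inter> Y l \<inter> uminus ` S l = Xl (- l)"
        "W X \<inter> Y l \<inter> S l = Wl l" "W X \<inter> Y l \<inter> uminus ` S l = Wl (- l)" if "0 < l" for l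
      unfolding Xl_def Wl_def partp[OF XG that] partp[OF WG that] partn[OF XG that] partn[OF WG that] by simp_all
    have loc0: "loc 0 (X \<inter> Y 0) = u_pow (2 * neg_count (Xl 0)) * v_pow (2 * (crossings (Wl 0) (Xl 0) + neg_pairs (Xl 0)))"
    proof -
      have "unused (S 0) (Xl 0) = Wl 0" using un[of 0] unfolding XY0 .
      then show ?thesis unfolding loc_def XY0 by simp
    qed
    have locl: "loc l (X \<inter> Y l) = v_pow (2 * (crossings (Wl l) (Xl l) + crossings (Wl (- l)) (Xl (- l)) + crossings (uminus ` Xl (- l)) (Xl l)))"
      if "0 < l" for l
      using that unfolding loc_def un XYl[OF that] by simp
    have "I = insert 0 {1..int n}" by (auto simp: I_def)
    then have "(\<Prod>l\<in>I. loc l (X \<inter> Y l)) = u_pow (2 * neg_count (Xl 0)) * v_pow (2 * (crossings (Wl 0) (Xl 0) + neg_pairs (Xl 0)))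
       * v_pow (\<Sum>l = 1..int n. 2 * (crossings (Wl l) (Xl l) + crossings (Wl (- l)) (Xl (- l)) + crossings (uminus ` Xl (- l)) (Xl l)))"
      by (simp add: loc0 locl v_pow_sum)
    then have rhs: "u_pow U * v_pow E * (\<Prod>l\<in>I. loc l (X \<inter> Y l))
       = u_pow (U + 2 * neg_count (Xl 0)) * v_pow (E + 2 * (crossings (Wl 0) (Xl 0) + neg_pairs (Xl 0))
          + (\<Sum>l = 1..int n. 2 * (crossings (Wl l) (Xl l) + crossings (Wl (- l)) (Xl (- l)) + crossings (uminus ` Xl (- l)) (Xl l))))"
      by (simp only: u_pow_add v_pow_add mult_ac)
    have "letter_positions d q (relabel X p F) = W X"
      using XG p q by (auto simp: letter_positions_def relabel_def W_def memN)
    then have lhs: "relabel_weight d p q (relabel X p F) X = u_pow (2 * neg_count X) * v_pow (2 * crossings (W X) X + crossings (uminus ` X) X - neg_count X)"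
      using p q by (simp add: relabel_weight_def)
    have "U + 2 * neg_count (Xl 0) = 2 * neg_count X" unfolding ng U_def by simp
    moreover have "2 * crossings (W X) X + crossings (uminus ` X) X - neg_count X = E + 2 * (crossings (Wl 0) (Xl 0) + neg_pairs (Xl 0))
          + (\<Sum>l = 1..int n. 2 * (crossings (Wl l) (Xl l) + crossings (Wl (- l)) (Xl (- l)) + crossings (uminus ` Xl (- l)) (Xl l)))"
      unfolding c1 c2 l2 ng E_def sum_idx_halves[of "\<lambda>l. crossings (Wl l) (Xl l)"]
      by (simp add: sum.distrib sum_distrib_left algebra_simps)
    ultimately show ?thesis unfolding lhs rhs by simp
  qed
  have locsum: "(\<Sum>X | X \<subseteq> Y l \<and> P l X. loc l X) = (if l = 0 then gauss_B (S 0) (t 0) else trinom (S l) (t l) (t (- l)))"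
    for l
  proof (cases "l = 0")
    case True
    have "{X. X \<subseteq> Y l \<and> P l X} = {X. X \<in> signed (S 0) \<and> card X = t 0}"
      using True by (auto simp: signed_def P_def Y_def)
    then show ?thesis using True by (simp add: loc_def gauss_B_def)
  next
    case False
    then show ?thesis by (simp add: trinom_def Y_def P_def loc_def)
  qed
  have "(\<Sum>X | X \<in> selections d q b F \<and> block_counts n mu X = t. relabel_weight d p q (relabel X p F) X)
     = (\<Sum>X | X \<subseteq> (\<Union>l\<in>I. Y l) \<and> (\<forall>l\<in>I. P l (X \<inter> Y l)). u_pow U * v_pow E * (\<Prod>l\<in>I. loc l (X \<inter> Y l)))"
    unfolding sets[symmetric] by (rule sum.cong[OF refl weight])
  also have "\<dots> = u_pow U * v_pow E * (\<Prod>l\<in>I. \<Sum>X | X \<subseteq> Y l \<and> P l X. loc l X)"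
    unfolding sum_distrib_left[symmetric]
    by (subst sum_subsets_partition[of I Y loc P]) (auto simp: finY Ydisj I_def)
  also have "(\<Prod>l\<in>I. \<Sum>X | X \<subseteq> Y l \<and> P l X. loc l X) = gauss_B (S 0) (t 0) * (\<Prod>l = 1..int n. trinom (S l) (t l) (t (- l)))"
  proof -
    have "I = insert 0 {1..int n}" by (auto simp: I_def)
    then show ?thesis by (simp add: locsum)
  qed
  finally have coeff: "(\<Sum>X | X \<in> selections d q b F \<and> block_counts n mu X = t. relabel_weight d p q (relabel X p F) X)
     = u_pow U * v_pow E * (gauss_B (S 0) (t 0) * (\<Prod>l = 1..int n. trinom (S l) (t l) (t (- l))))" .
  show ?thesis
  proof (intro exI[of _ S] conjI allI ballI)
    show "finite (S l)" for l by (rule finS)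
    show "0 < x" if "x \<in> S l" for l x using that posS by blast
    show "int (card (S l)) = A 0 l + int (t l) + int (t (- l))" if "l \<in> {1..int n}" for l using that cSl by simp
  qed (rule cS0, rule coeff[unfolded U_def E_def])
qed


text \<open>The barred quotients of quantum factorials appear by solving for the local factors. The powers of \<open>u\<close>
and \<open>v\<close> produced by the bar involution depend on \<open>A\<close> and \<open>t\<close> only. The exponent of \<open>u\<close> is
\<open>2 * t 0\<close>, and that of \<open>v\<close> adds up over the columns to
\<open>2 * (\<Sum>l. t l * A 0 l) + (\<Sum>l. t l * t (- l)) - 3 * t 0\<close>.\<close>

lemma coefficient_zero_row_bar:
  assumes q: "q = 0" and p: "p = 1" and A: "\<And>i j. 0 \<le> A i j" "odd (A 0 0)" "\<And>j. A 0 (- j) = A 0 j"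
  shows "(\<Sum>X | X \<in> selections d q b F \<and> block_counts n mu X = t. relabel_weight d p q (relabel X p F) X)
     = u_pow (2 * (\<Sum>l\<in>idx n. of_bool (l < 0) * int (t l)) + 2 * int (t 0))
       * v_pow (2 * (\<Sum>l\<in>idx n. \<Sum>k\<in>idx n. of_bool (k < l) * ((A 0 l - of_bool (l = 0)) * int (t k)))
           + (\<Sum>l\<in>idx n. \<Sum>k\<in>idx n. of_bool (k + l < 0) * (int (t l) * int (t k)))
           - (\<Sum>l\<in>idx n. of_bool (l < 0) * int (t l))
           + (2 * (\<Sum>l\<in>idx n. int (t l) * A 0 l) + (\<Sum>l\<in>idx n. int (t l) * int (t (- l))) - 3 * int (t 0)))
       * bar (exact_div (qfact_c (nat (natural A 0 0) + t 0)) (qfact_c (nat (natural A 0 0)) * qfact (t 0))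
           * (\<Prod>l = 1..int n. exact_div (qfact (nat (A 0 l) + t l + t (- l))) (qfact (nat (A 0 l)) * qfact (t l) * qfact (t (- l)))))"
proof -
  obtain S where S: "\<forall>l. finite (S l) \<and> (\<forall>x\<in>S l. 0 < x)"
    and S0: "2 * int (card (S 0)) = A 0 0 - 1 + 2 * int (t 0)"
    and Sl: "\<forall>l\<in>{1..int n}. int (card (S l)) = A 0 l + int (t l) + int (t (- l))"
    and coeff: "(\<Sum>X | X \<in> selections d q b F \<and> block_counts n mu X = t. relabel_weight d p q (relabel X p F) X)
     = u_pow (2 * (\<Sum>l\<in>idx n. of_bool (l < 0) * int (t l)))
       * v_pow (2 * (\<Sum>l\<in>idx n. \<Sum>k\<in>idx n. of_bool (k < l) * ((A 0 l - of_bool (l = 0)) * int (t k)))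
           + (\<Sum>l\<in>idx n. \<Sum>k\<in>idx n. of_bool (k + l < 0) * (int (t l) * int (t k)))
           - (\<Sum>l\<in>idx n. of_bool (l < 0) * int (t l)))
       * (gauss_B (S 0) (t 0) * (\<Prod>l = 1..int n. trinom (S l) (t l) (t (- l))))"
    using coefficient_zero_row[OF q p A] by (elim exE conjE)
  define a where "a = nat (natural A 0 0)"
  have a: "A 0 0 = 2 * int a + 1"
  proof -
    obtain k where k: "A 0 0 = 2 * k + 1" using A(2) by (rule oddE)
    then have "0 \<le> k" using A(1)[of 0 0] by presburger
    then show ?thesis using k by (simp add: a_def natural_def)
  qed
  define g0 where "g0 = exact_div (qfact_c (a + t 0)) (qfact_c a * qfact (t 0))"
  define g where "g l = exact_div (qfact (nat (A 0 l) + t l + t (- l))) (qfact (nat (A 0 l)) * qfact (t l) * qfact (t (- l)))" for l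
  have c0: "a + t 0 = card (S 0)" using S0 a by simp
  have G0: "gauss_B (S 0) (t 0) * (qfact_c a * qfact (t 0)) = qfact_c (a + t 0)"
    using gauss_B_qfact[OF _ _ c0] S c0 by simp
  have e0: "gauss_B (S 0) (t 0) = g0"
    unfolding g0_def by (rule exact_div_eqI[OF _ G0, symmetric]) simp
  have b0: "g0 = u_pow (2 * int (t 0)) * v_pow (2 * (2 * int a * int (t 0)) + int (t 0) * int (t 0) - int (t 0)) * bar g0"
  proof -
    define r where "r = 2 * (2 * int a * int (t 0)) + int (t 0) * int (t 0) - int (t 0)"
    have "bar g0 = u_pow (- 2 * int (t 0)) * v_pow (2 * (int a * (int a - 1)) + int (t 0) * (int (t 0) - 1) - 2 * (int (a + t 0) * (int (a + t 0) - 1))) * g0"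
      using bar_gauss_B[OF G0] unfolding e0 .
    also have "2 * (int a * (int a - 1)) + int (t 0) * (int (t 0) - 1) - 2 * (int (a + t 0) * (int (a + t 0) - 1)) = - r"
      by (simp add: r_def algebra_simps)
    also have "- 2 * int (t 0) = - (2 * int (t 0))" by simp
    finally have "u_pow (2 * int (t 0)) * v_pow r * bar g0 = (u_pow (2 * int (t 0)) * u_pow (- (2 * int (t 0)))) * (v_pow r * v_pow (- r)) * g0"
      by (simp only: mult.assoc mult.left_commute[of "v_pow r"])
    then show ?thesis unfolding r_def[symmetric] by simp
  qed
  have el: "trinom (S l) (t l) (t (- l)) = v_pow ((2 * (int (t l) * A 0 l) + int (t l) * int (t (- l))) + (2 * (int (t (- l)) * A 0 (- l)) + int (t (- l)) * int (t (- (- l))))) * bar (g l)"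
    if l: "l \<in> {1..int n}" for l
  proof -
    define r where "r = 2 * (int (t l) * A 0 l) + int (t l) * int (t (- l)) + (2 * (int (t (- l)) * A 0 (- l)) + int (t (- l)) * int (t (- (- l))))"
    have na: "int (nat (A 0 l)) = A 0 l" using A(1) by simp
    have "int (nat (A 0 l) + t l + t (- l)) = int (card (S l))"
      unfolding bspec[OF Sl l] of_nat_add na ..
    then have card_S: "nat (A 0 l) + t l + t (- l) = card (S l)" by (simp only: of_nat_eq_iff)
    have G: "trinom (S l) (t l) (t (- l)) * (qfact (nat (A 0 l)) * qfact (t l) * qfact (t (- l))) = qfact (nat (A 0 l) + t l + t (- l))"
      using trinom_qfact[OF _ _ card_S] S card_S by simp
    have e: "trinom (S l) (t l) (t (- l)) = g l"
      unfolding g_def by (rule exact_div_eqI[OF _ G, symmetric]) simp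
    have "bar (g l) = v_pow (int (nat (A 0 l)) * (int (nat (A 0 l)) - 1) + int (t l) * (int (t l) - 1) + int (t (- l)) * (int (t (- l)) - 1)
       - int (nat (A 0 l) + t l + t (- l)) * (int (nat (A 0 l) + t l + t (- l)) - 1)) * g l"
      using bar_trinomial[OF G] unfolding e .
    also have "int (nat (A 0 l)) * (int (nat (A 0 l)) - 1) + int (t l) * (int (t l) - 1) + int (t (- l)) * (int (t (- l)) - 1)
       - int (nat (A 0 l) + t l + t (- l)) * (int (nat (A 0 l) + t l + t (- l)) - 1) = - r"
      unfolding r_def of_nat_add na A(3) minus_minus by (simp add: algebra_simps)
    finally have "v_pow r * bar (g l) = (v_pow r * v_pow (- r)) * g l" by (simp only: mult.assoc)
    then show ?thesis unfolding e r_def[symmetric] by simp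
  qed
  define R where "R = (\<Sum>l = 1..int n. (2 * (int (t l) * A 0 l) + int (t l) * int (t (- l))) + (2 * (int (t (- l)) * A 0 (- l)) + int (t (- l)) * int (t (- (- l)))))"
  have R: "2 * (2 * int a * int (t 0)) + int (t 0) * int (t 0) - int (t 0) + R
     = 2 * (\<Sum>l\<in>idx n. int (t l) * A 0 l) + (\<Sum>l\<in>idx n. int (t l) * int (t (- l))) - 3 * int (t 0)"
  proof -
    have "2 * (\<Sum>l\<in>idx n. int (t l) * A 0 l) + (\<Sum>l\<in>idx n. int (t l) * int (t (- l)))
       = (\<Sum>l\<in>idx n. 2 * (int (t l) * A 0 l) + int (t l) * int (t (- l)))"
      by (simp only: sum.distrib sum_distrib_left)
    also have "\<dots> = 2 * (int (t 0) * A 0 0) + int (t 0) * int (t 0) + R"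
      unfolding sum_idx_halves R_def by simp
    finally show ?thesis unfolding a by (simp add: algebra_simps)
  qed
  have "(\<Prod>l = 1..int n. trinom (S l) (t l) (t (- l))) = v_pow R * bar (\<Prod>l = 1..int n. g l)"
    unfolding R_def v_pow_sum[OF finite_atLeastAtMost_int] bar_prod prod.distrib[symmetric]
    by (rule prod.cong[OF refl el])
  then show ?thesis
    unfolding coeff e0 R[symmetric] g0_def[symmetric] g_def[symmetric] a_def[symmetric] bar_mult v_pow_add[of _ "_ + R"] v_pow_add[of _ R] u_pow_add
    by (subst b0) (simp only: mult_ac)
qed


end

section \<open>Exponents\<close>

text \<open>Weighted sums are again kept in unevaluated form.\<close>

declare sum_of_bool_mult_eq [simp del] sum_mult_of_bool_eq [simp del]

text \<open>Most of the identities between exponents are equalities of quadratic forms written with different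
coefficient matrices; they are checked entry by entry after symmetrisation.\<close>

lemma double_sum_symmetrize:
  fixes f g :: "'a \<Rightarrow> 'a \<Rightarrow> int"
  assumes "\<And>l k. l \<in> I \<Longrightarrow> k \<in> I \<Longrightarrow> f l k + f k l = g l k + g k l"
  shows "(\<Sum>l\<in>I. \<Sum>k\<in>I. f l k) = (\<Sum>l\<in>I. \<Sum>k\<in>I. g l k)"
proof -
  have two: "2 * (\<Sum>l\<in>I. \<Sum>k\<in>I. f l k) = (\<Sum>l\<in>I. \<Sum>k\<in>I. f l k + f k l)" for f :: "'a \<Rightarrow> 'a \<Rightarrow> int"
    using sum.swap[of f I I] by (simp add: sum.distrib)
  have "(\<Sum>l\<in>I. \<Sum>k\<in>I. f l k + f k l) = (\<Sum>l\<in>I. \<Sum>k\<in>I. g l k + g k l)"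
    by (rule sum.cong[OF refl], rule sum.cong[OF refl], rule assms)
  then show ?thesis using two[of f] two[of g] by simp
qed

lemma sum_as_double_sum:
  fixes f :: "int \<Rightarrow> int"
  shows "(\<Sum>l\<in>idx n. f l) = (\<Sum>l\<in>idx n. \<Sum>k\<in>idx n. of_bool (k = l) * f l)"
proof (rule sum.cong[OF refl])
  fix l assume "l \<in> idx n"
  then have "(\<Sum>k\<in>idx n. of_bool (k = l)) = (1 :: int)" by (simp add: of_bool_def)
  then show "f l = (\<Sum>k\<in>idx n. of_bool (k = l) * f l)" by (simp only: sum_distrib_right[symmetric])
qed

lemma sum_reflect_inner:
  fixes t :: "int \<Rightarrow> int"
  shows "(\<Sum>l\<in>idx n. \<Sum>k\<in>idx n. of_bool (k < l) * (t l * t (- k))) = (\<Sum>l\<in>idx n. \<Sum>k\<in>idx n. of_bool (0 < k + l) * (t l * t k))"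
proof (rule sum.cong[OF refl])
  fix l
  have "(\<Sum>k\<in>idx n. of_bool (k < l) * (t l * t (- k))) = (\<Sum>k\<in>idx n. of_bool (- (- k) < l) * (t l * t (- k)))" by simp
  also have "\<dots> = (\<Sum>k\<in>idx n. of_bool (- k < l) * (t l * t k))" by (rule sum_idx_uminus)
  also have "\<dots> = (\<Sum>k\<in>idx n. of_bool (0 < k + l) * (t l * t k))"
    by (rule sum.cong[OF refl]) (auto intro!: arg_cong2[of _ _ _ _ "(*)"] arg_cong[of _ _ of_bool])
  finally show "(\<Sum>k\<in>idx n. of_bool (k < l) * (t l * t (- k))) = (\<Sum>k\<in>idx n. of_bool (0 < k + l) * (t l * t k))" .
qed

context
  fixes n :: nat and t a c :: "int \<Rightarrow> int"
begin

abbreviation "pairing P x \<equiv> (\<Sum>l\<in>idx n. \<Sum>k\<in>idx n. of_bool (P l k) * (t l * x k))"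

lemma pairing_trichotomy:
  "(\<Sum>l\<in>idx n. t l) * (\<Sum>k\<in>idx n. x k) = pairing (<) x + pairing (\<lambda>l k. k \<le> l) x"
  "(\<Sum>l\<in>idx n. t l) * (\<Sum>k\<in>idx n. x k) = pairing (\<lambda>l k. k < l) x + pairing (\<le>) x"
  "pairing (\<le>) x = pairing (<) x + (\<Sum>l\<in>idx n. t l * x l)"
proof -
  show "(\<Sum>l\<in>idx n. t l) * (\<Sum>k\<in>idx n. x k) = pairing (<) x + pairing (\<lambda>l k. k \<le> l) x"
    unfolding sum_product sum.distrib[symmetric] by (rule sum.cong[OF refl], rule sum.cong[OF refl]) auto
  show "(\<Sum>l\<in>idx n. t l) * (\<Sum>k\<in>idx n. x k) = pairing (\<lambda>l k. k < l) x + pairing (\<le>) x"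
    unfolding sum_product sum.distrib[symmetric] by (rule sum.cong[OF refl], rule sum.cong[OF refl]) auto
  show "pairing (\<le>) x = pairing (<) x + (\<Sum>l\<in>idx n. t l * x l)"
    unfolding sum_as_double_sum[of "\<lambda>l. t l * x l"] sum.distrib[symmetric]
    by (rule sum.cong[OF refl], rule sum.cong[OF refl]) auto
qed

lemma pairing_swap: "pairing (<) t = pairing (\<lambda>l k. k < l) t"
  by (rule double_sum_symmetrize) (auto simp: algebra_simps)

text \<open>The change of \<open>ne_form\<close> under a move, in terms of pairings.\<close>

lemma row_shift_form:
  "(\<Sum>l\<in>idx n. t l * (\<Sum>k\<in>idx n. of_bool (l < k) * (2 * a k + t k) - of_bool (k < l) * (2 * c k - t k - of_bool e * t (- k))))
   = 2 * pairing (<) a + pairing (<) t - 2 * pairing (\<lambda>l k. k < l) c + pairing (\<lambda>l k. k < l) t + of_bool e * pairing (\<lambda>l k. 0 < k + l) t"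
  unfolding sum_reflect_inner[symmetric]
  unfolding sum_distrib_left sum.distrib[symmetric] sum_subtractf[symmetric]
  by (rule sum.cong[OF refl], rule sum.cong[OF refl]) (simp add: algebra_simps)

text \<open>Both sides are quadratic forms in \<open>t\<close> with the same symmetrisation, which depends only on the sign of
\<open>k + l\<close> and on whether \<open>k = l\<close>.\<close>

lemma pairing_positive:
  "pairing (\<lambda>l k. 0 < k + l) t = 2 * pairing (\<lambda>l k. - l < k \<and> k < l) t + (\<Sum>l\<in>idx n. of_bool (0 < l) * (t l * t l))"
  unfolding sum_as_double_sum[of "\<lambda>l. of_bool (0 < l) * (t l * t l)"]
  unfolding sum_distrib_left sum.distrib[symmetric]
proof (rule double_sum_symmetrize)
  fix l k
  show "of_bool (0 < k + l) * (t l * t k) + of_bool (0 < l + k) * (t k * t l)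
    = 2 * (of_bool (- l < k \<and> k < l) * (t l * t k)) + of_bool (k = l) * (of_bool (0 < l) * (t l * t l))
     + (2 * (of_bool (- k < l \<and> l < k) * (t k * t l)) + of_bool (l = k) * (of_bool (0 < k) * (t k * t k)))"
    by (cases "k < l"; cases "l < k"; cases "0 < k + l") (auto simp: algebra_simps)
qed

lemma pairing_nonpositive:
  "pairing (\<lambda>l k. 0 < k + l) t + 2 * pairing (\<lambda>l k. k + l < 0) t + 2 * (\<Sum>l\<in>idx n. t l * t (- l)) - (\<Sum>l\<in>idx n. t l) * (\<Sum>l\<in>idx n. t l)
   = 2 * pairing (\<lambda>l k. l < k \<and> k \<le> - l) t + (\<Sum>l\<in>idx n. of_bool (l \<le> 0) * (t l * t l))"
proof -
  have anti: "(\<Sum>l\<in>idx n. t l * t (- l)) = pairing (\<lambda>l k. k + l = 0) t"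
  proof (rule sum.cong[OF refl])
    fix l assume "l \<in> idx n"
    then have "(\<Sum>k\<in>idx n. of_bool (k = - l)) = (1 :: int)" by (simp add: of_bool_def)
    then have "t l * t (- l) = (\<Sum>k\<in>idx n. of_bool (k = - l) * (t l * t (- l)))" by (simp only: sum_distrib_right[symmetric])
    also have "\<dots> = (\<Sum>k\<in>idx n. of_bool (k + l = 0) * (t l * t k))"
    proof (rule sum.cong[OF refl])
      fix k
      show "of_bool (k = - l) * (t l * t (- l)) = of_bool (k + l = 0) * (t l * t k)"
      proof (cases "k = - l")
        case False
        then have "k + l \<noteq> 0" by linarith
        with False show ?thesis by simp
      qed simp
    qed
    finally show "t l * t (- l) = (\<Sum>k\<in>idx n. of_bool (k + l = 0) * (t l * t k))" .
  qed
  show ?thesis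
    unfolding sum_as_double_sum[of "\<lambda>l. of_bool (l \<le> 0) * (t l * t l)"] anti sum_product
    unfolding sum_distrib_left sum.distrib[symmetric] sum_subtractf[symmetric]
  proof (rule double_sum_symmetrize)
    fix l k
    show "of_bool (0 < k + l) * (t l * t k) + 2 * (of_bool (k + l < 0) * (t l * t k)) + 2 * (of_bool (k + l = 0) * (t l * t k)) - t l * t k
       + (of_bool (0 < l + k) * (t k * t l) + 2 * (of_bool (l + k < 0) * (t k * t l)) + 2 * (of_bool (l + k = 0) * (t k * t l)) - t k * t l)
      = 2 * (of_bool (l < k \<and> k \<le> - l) * (t l * t k)) + of_bool (k = l) * (of_bool (l \<le> 0) * (t l * t l))
       + (2 * (of_bool (k < l \<and> l \<le> - k) * (t k * t l)) + of_bool (l = k) * (of_bool (k \<le> 0) * (t k * t k)))"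
    proof (cases "k = l")
      case True
      then show ?thesis by (cases "0 < l"; cases "l = 0") (auto simp: algebra_simps)
    next
      case False
      then show ?thesis by (cases "k < l"; cases "0 < k + l"; cases "k + l = 0") (auto simp: algebra_simps)
    qed
  qed
qed

end

lemma sum_pairs_of_bool:
  "(\<Sum>(k, l) \<in> {(k, l) \<in> idx n \<times> idx n. P k l}. f k l) = (\<Sum>l\<in>idx n. \<Sum>k\<in>idx n. of_bool (P k l) * f k l)"
  for f :: "int \<Rightarrow> int \<Rightarrow> int"
  unfolding sum_filter_of_bool[OF finite_idx finite_idx] by (rule sum.swap)

lemma beta_form:
  "2 * beta n h A t = 2 * pairing n (\<lambda>l. int (t l)) (\<lambda>l k. k \<le> l) (A h)
     - 2 * pairing n (\<lambda>l. int (t l)) (\<lambda>l k. k < l) (A (h - 1)) + 2 * pairing n (\<lambda>l. int (t l)) (\<lambda>l k. k < l) (\<lambda>l. int (t l))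
     + of_bool (h = 1) * (2 * pairing n (\<lambda>l. int (t l)) (\<lambda>l k. - l < k \<and> k < l) (\<lambda>l. int (t l))
         + (\<Sum>l\<in>idx n. of_bool (0 < l) * (int (t l) * int (t l))) + 3 * (\<Sum>l\<in>idx n. of_bool (0 < l) * int (t l)))"
proof -
  have half: "2 * (\<Sum>l \<in> {l \<in> idx n. l > 0}. int (t l) * (int (t l) + 3) div 2)
      = (\<Sum>l\<in>idx n. of_bool (0 < l) * (int (t l) * int (t l))) + 3 * (\<Sum>l\<in>idx n. of_bool (0 < l) * int (t l))"
  proof -
    have ev: "2 * (x * (x + 3) div 2) = x * x + 3 * x" for x :: int
    proof -
      have "even (x * (x + 3))" by simp
      then show ?thesis by (simp add: algebra_simps)
    qed
    have "2 * (\<Sum>l \<in> {l \<in> idx n. l > 0}. int (t l) * (int (t l) + 3) div 2) = (\<Sum>l \<in> {l \<in> idx n. l > 0}. int (t l) * int (t l) + 3 * int (t l))"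
      unfolding sum_distrib_left ev ..
    also have "\<dots> = (\<Sum>l\<in>idx n. if 0 < l then int (t l) * int (t l) + 3 * int (t l) else 0)"
      by (rule sum.inter_filter) simp
    also have "\<dots> = (\<Sum>l\<in>idx n. of_bool (0 < l) * (int (t l) * int (t l)) + 3 * (of_bool (0 < l) * int (t l)))"
      by (rule sum.cong[OF refl]) simp
    finally show ?thesis by (simp add: sum.distrib sum_distrib_left)
  qed
  have split: "pairing n (\<lambda>l. int (t l)) (\<lambda>l k. k < l) (\<lambda>k. A (h - 1) k - int (t k))
     = pairing n (\<lambda>l. int (t l)) (\<lambda>l k. k < l) (A (h - 1)) - pairing n (\<lambda>l. int (t l)) (\<lambda>l k. k < l) (\<lambda>l. int (t l))"
    by (simp only: right_diff_distrib sum_subtractf)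
  show ?thesis
    unfolding beta_def sum_pairs_of_bool split using half by (simp add: algebra_simps)
qed

lemma beta'_form:
  "2 * beta' n h A t = 2 * pairing n (\<lambda>l. int (t l)) (\<le>) (A (h - 1))
     - 2 * pairing n (\<lambda>l. int (t l)) (<) (A h) + 2 * pairing n (\<lambda>l. int (t l)) (<) (\<lambda>l. int (t l))"
proof -
  have split: "pairing n (\<lambda>l. int (t l)) (<) (\<lambda>k. A h k - int (t k))
     = pairing n (\<lambda>l. int (t l)) (<) (A h) - pairing n (\<lambda>l. int (t l)) (<) (\<lambda>l. int (t l))"
    by (simp only: right_diff_distrib sum_subtractf)
  show ?thesis
    unfolding beta'_def sum_pairs_of_bool split by (simp add: algebra_simps)
qed

lemma beta''_form:
  "2 * beta'' n A t = 2 * pairing n (\<lambda>l. int (t l)) (\<le>) (A 0)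
     - 2 * pairing n (\<lambda>l. int (t l)) (<) (A 1) + 2 * pairing n (\<lambda>l. int (t l)) (<) (\<lambda>l. int (t l))
     + 2 * pairing n (\<lambda>l. int (t l)) (\<lambda>l k. l < k \<and> k \<le> - l) (\<lambda>l. int (t l))
     + (\<Sum>l\<in>idx n. of_bool (l \<le> 0) * (int (t l) * int (t l))) - 3 * (\<Sum>l\<in>idx n. of_bool (l \<le> 0) * int (t l))"
proof -
  have half: "2 * (\<Sum>l \<in> {l \<in> idx n. l \<le> 0}. int (t l) * (int (t l) - 3) div 2)
      = (\<Sum>l\<in>idx n. of_bool (l \<le> 0) * (int (t l) * int (t l))) - 3 * (\<Sum>l\<in>idx n. of_bool (l \<le> 0) * int (t l))"
  proof -
    have ev: "2 * (x * (x - 3) div 2) = x * x - 3 * x" for x :: int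
    proof -
      have "even (x * (x - 3))" by simp
      then show ?thesis by (simp add: algebra_simps)
    qed
    have "2 * (\<Sum>l \<in> {l \<in> idx n. l \<le> 0}. int (t l) * (int (t l) - 3) div 2) = (\<Sum>l \<in> {l \<in> idx n. l \<le> 0}. int (t l) * int (t l) - 3 * int (t l))"
      unfolding sum_distrib_left ev ..
    also have "\<dots> = (\<Sum>l\<in>idx n. if l \<le> 0 then int (t l) * int (t l) - 3 * int (t l) else 0)"
      by (rule sum.inter_filter) simp
    also have "\<dots> = (\<Sum>l\<in>idx n. of_bool (l \<le> 0) * (int (t l) * int (t l)) - 3 * (of_bool (l \<le> 0) * int (t l)))"
      by (rule sum.cong[OF refl]) simp
    finally show ?thesis by (simp add: sum_subtractf sum_distrib_left)
  qed
  have split: "pairing n (\<lambda>l. int (t l)) (<) (\<lambda>k. A 1 k - int (t k))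
     = pairing n (\<lambda>l. int (t l)) (<) (A 1) - pairing n (\<lambda>l. int (t l)) (<) (\<lambda>l. int (t l))"
    by (simp only: right_diff_distrib sum_subtractf)
  show ?thesis
    unfolding beta''_def sum_pairs_of_bool split using half by (simp add: algebra_simps)
qed

lemma move_uminus: "move h (\<lambda>l. - t l) i j = - move h t i j"
  by (simp add: move_def algebra_simps)

text \<open>The terms that depend on \<open>h = 1\<close> arise because the rows \<open>0\<close> and \<open>-0\<close> coincide: a move into or out of
the middle row also sees its own mirror image.\<close>

lemma ell_hat_a_up:
  assumes h: "1 \<le> h" "h \<le> int n" and A: "central_symm A" "odd (A 0 0)" and A1: "odd (A 0 0 + move h t 0 0)"
  shows "2 * ell_hat_a n (\<lambda>i j. A i j + move h t i j) - 2 * ell_hat_a n A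
     = 2 * pairing n t (<) (A h) + 2 * pairing n t (\<lambda>l k. k < l) t - 2 * pairing n t (\<lambda>l k. k < l) (A (h - 1))
       + of_bool (h = 1) * (pairing n t (\<lambda>l k. 0 < k + l) t + 3 * (\<Sum>l\<in>idx n. of_bool (0 < l) * t l))"
proof -
  have s: "central_symm (\<lambda>i j. A i j + move h t i j)" using A(1) central_symm_move by (simp add: central_symm_def)
  show ?thesis
    using ne_form_move[OF h A(1), of t] west_sum_move[OF h, of A t] ell_hat_a_eq[OF A, of n] ell_hat_a_eq[OF s A1, of n]
      row_shift_form[where n = n and t = t and a = "A h" and c = "A (h - 1)" and e = "h = 1"] pairing_swap[where n = n and t = t]
    by (simp add: algebra_simps)
qed

lemma ell_hat_a_down:
  assumes h: "1 \<le> h" "h \<le> int n" and A: "central_symm A" "odd (A 0 0)" and A1: "odd (A 0 0 - move h t 0 0)"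
  shows "2 * ell_hat_a n (\<lambda>i j. A i j - move h t i j) - 2 * ell_hat_a n A
     = - 2 * pairing n t (<) (A h) + 2 * pairing n t (\<lambda>l k. k < l) t + 2 * pairing n t (\<lambda>l k. k < l) (A (h - 1))
       + of_bool (h = 1) * (pairing n t (\<lambda>l k. 0 < k + l) t - 3 * (\<Sum>l\<in>idx n. of_bool (0 < l) * t l))"
  using ell_hat_a_up[OF h A, of "\<lambda>l. - t l"] A1 by (simp add: move_uminus sum_negf)

lemma forms_cong:
  assumes "\<And>i j. i \<in> idx n \<Longrightarrow> j \<in> idx n \<Longrightarrow> B i j = D i j"
  shows "ne_form n B B = ne_form n D D" "west_sum n B = west_sum n D"
  unfolding ne_form_def west_sum_def by (intro sum.cong refl; simp add: assms)+

lemma sum_at: "k \<in> idx n \<Longrightarrow> (\<Sum>j\<in>idx n. f j * of_bool (j = k)) = (f k :: int)"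
  by (simp add: of_bool_def if_distrib[of "\<lambda>x. _ * x"] cong: if_cong)

text \<open>The matrices \<open>B\<close> and \<open>C\<close> arise from a diagonal matrix by one move concentrated in a single column, so
their lengths follow from the change formulas, starting from the value \<open>0\<close> on diagonal matrices.\<close>

lemma ell_hat_almost_diagonal:
  assumes h: "1 \<le> h" "h \<le> int n" and B: "central_symm B" "odd (B 0 0)" and r: "\<And>j. r (- j) = r j"
    and k: "k = h - 1 \<and> s = b \<or> k = h \<and> s = - b"
    and BD: "\<And>i j. i \<in> idx n \<Longrightarrow> j \<in> idx n \<Longrightarrow> B i j = of_bool (i = j) * r j + move h (\<lambda>l. s * of_bool (l = k)) i j"
  shows "ell_hat_c n B = of_bool (h = 1 \<and> k = h) * b"
    and "2 * ell_hat_a n B = 2 * b * (if k = h then r (h - 1) else r h) + of_bool (h = 1 \<and> k = h) * (b * b - 3 * b)"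
proof -
  define D where "D = (\<lambda>i j. of_bool (i = j) * r j :: int)"
  define T where "T = (\<lambda>l. s * of_bool (l = k) :: int)"
  have D: "diagonal D" "central_symm D" using r by (auto simp: D_def diagonal_def central_symm_def)
  have kn: "k \<in> idx n" using h k by (auto simp: idx_def)
  have at: "(\<Sum>j\<in>idx n. T j * f j) = s * f k" for f :: "int \<Rightarrow> int"
    using sum_at[OF kn, of "\<lambda>j. s * f j"] by (simp add: T_def mult_ac)
  have pick: "(\<Sum>y\<in>idx n. f y) = f x" if "x \<in> idx n" "\<And>y. y \<noteq> x \<Longrightarrow> f y = 0" for x and f :: "int \<Rightarrow> int"
    using that by (subst sum.remove[of _ x]) auto
  have "ne_form n B B = ne_form n D D + (\<Sum>j\<in>idx n. T j * (\<Sum>y\<in>idx n. of_bool (j < y) * (2 * D h y + T y)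
          - of_bool (y < j) * (2 * D (h - 1) y - T y - of_bool (h = 1) * T (- y))))"
    using forms_cong(1)[of n B "\<lambda>i j. D i j + move h T i j"] BD ne_form_move[OF h D(2), of T] by (simp add: D_def T_def)
  also have "\<dots> = s * (\<Sum>y\<in>idx n. of_bool (k < y) * (2 * D h y + T y)
          - of_bool (y < k) * (2 * D (h - 1) y - T y - of_bool (h = 1) * T (- y)))"
    by (simp add: at ne_form_diagonal[OF D(1)])
  also have "\<dots> = 2 * b * (if k = h then r (h - 1) else r h) + of_bool (h = 1 \<and> k = h) * (b * b)"
  proof (cases "k = h")
    case True
    then have s: "s = - b" using k by auto
    have "(\<Sum>y\<in>idx n. of_bool (k < y) * (2 * D h y + T y) - of_bool (y < k) * (2 * D (h - 1) y - T y - of_bool (h = 1) * T (- y)))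
       = (\<Sum>y\<in>idx n. - 2 * r (h - 1) * of_bool (y = h - 1)) + (\<Sum>y\<in>idx n. of_bool (h = 1) * s * of_bool (y = - 1))"
      unfolding sum.distrib[symmetric] by (rule sum.cong[OF refl]) (use True in \<open>auto simp: D_def T_def\<close>)
    also have "\<dots> = - 2 * r (h - 1) + of_bool (h = 1) * s"
    proof -
      have "h - 1 \<in> idx n" "- 1 \<in> idx n" using h by (auto simp: idx_def)
      then show ?thesis by (simp only: sum_at)
    qed
    finally show ?thesis using True s by (simp only:) (simp add: algebra_simps)
  next
    case False
    then have s: "k = h - 1" "s = b" using k by auto
    have "(\<Sum>y\<in>idx n. of_bool (k < y) * (2 * D h y + T y) - of_bool (y < k) * (2 * D (h - 1) y - T y - of_bool (h = 1) * T (- y)))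
       = (\<Sum>y\<in>idx n. 2 * r h * of_bool (y = h))"
      by (rule sum.cong[OF refl]) (use s in \<open>auto simp: D_def T_def\<close>)
    also have "\<dots> = 2 * r h" using h by (subst sum_at) (auto simp: idx_def)
    finally show ?thesis using False s by simp
  qed
  finally have ne: "ne_form n B B = 2 * b * (if k = h then r (h - 1) else r h) + of_bool (h = 1 \<and> k = h) * (b * b)" .
  have "west_sum n B = - of_bool (h = 1) * (\<Sum>l\<in>idx n. of_bool (0 < l) * T l)"
    using forms_cong(2)[of n B "\<lambda>i j. D i j + move h T i j"] BD west_sum_move[OF h, of D T] west_sum_diagonal[OF D(1)]
    by (simp add: D_def T_def)
  also have "(\<Sum>l\<in>idx n. of_bool (0 < l) * T l) = s * of_bool (0 < k)"
    using at[of "\<lambda>l. of_bool (0 < l)"] by (simp add: mult_ac)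
  finally have west: "west_sum n B = of_bool (h = 1 \<and> k = h) * b" using k by auto
  show "ell_hat_c n B = of_bool (h = 1 \<and> k = h) * b" using ell_hat_c_eq[OF B(1)] west by simp
  show "2 * ell_hat_a n B = 2 * b * (if k = h then r (h - 1) else r h) + of_bool (h = 1 \<and> k = h) * (b * b - 3 * b)"
    using ell_hat_a_eq[OF B, of n] ne west by (simp add: algebra_simps)
qed


section \<open>The multiplication formulas\<close>

lemma shift_eq_move: "shift h (h - 1) t = move h t" "shift (h - 1) h t i j = - move h t i j"
  by (simp_all add: shift_def move_def fun_eq_iff algebra_simps)

lemma sum_E\<theta>:
  assumes "t \<in> tuples n b"
  shows "(\<Sum>l\<in>idx n. int (t l) * E\<theta> k l x y) = int (t y) * of_bool (x = k) + int (t (- y)) * of_bool (- x = k)"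
proof -
  have at: "(\<Sum>l\<in>idx n. int (t l) * of_bool (l = z)) = int (t z)" for z
  proof (cases "z \<in> idx n")
    case True
    then show ?thesis by (rule sum_at)
  next
    case False
    then have "t z = 0" using assms by (simp add: tuples_def)
    moreover have "(\<Sum>l\<in>idx n. int (t l) * of_bool (l = z)) = 0"
      by (rule sum.neutral) (use False in auto)
    ultimately show ?thesis by simp
  qed
  have "(\<Sum>l\<in>idx n. int (t l) * E\<theta> k l x y)
     = (\<Sum>l\<in>idx n. of_bool (x = k) * (int (t l) * of_bool (l = y)) + of_bool (- x = k) * (int (t l) * of_bool (l = - y)))"
    by (rule sum.cong[OF refl]) (auto simp: E\<theta>_def unit_mat_def)
  then show ?thesis
    by (simp only: sum.distrib sum_distrib_left[symmetric] at mult.commute)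
qed

lemma check_mat_shift:
  "t \<in> tuples n b \<Longrightarrow> check_mat n A t h = (shifted A h (h - 1) t)"
  unfolding check_mat_def sum_E\<theta> shift_def by (simp add: algebra_simps)

lemma hat_mat_shift:
  "t \<in> tuples n b \<Longrightarrow> hat_mat n A t h = (shifted A (h - 1) h t)"
  unfolding hat_mat_def sum_E\<theta> shift_def by (simp add: algebra_simps)

lemma row_uminus: "central_symm A \<Longrightarrow> row n A (- k) = row n A k"
  unfolding row_def by (subst sum_idx_uminus[symmetric]) (simp add: central_symm_def)

text \<open>The tuples for which the shifted matrix has nonnegative entries. Leaving the middle row \<open>p = 0\<close> takes
\<open>t i + t (- i)\<close> units away from column \<open>i\<close>.\<close>

definition movable :: "nat \<Rightarrow> mat \<Rightarrow> int \<Rightarrow> nat \<Rightarrow> (int \<Rightarrow> nat) set" where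
  "movable n A p b = {t \<in> tuples n b. \<forall>i\<in>idx n. int (t i) + of_bool (p = 0) * int (t (- i)) \<le> A p i}"

lemma shift_nonneg:
  assumes A: "A \<in> Xi n d" and pq: "0 \<le> p" "0 \<le> q" "p \<noteq> q" "p \<in> idx n" and t: "t \<in> tuples n b"
  shows "(\<forall>i j. 0 \<le> A i j + shift q p (\<lambda>l. int (t l)) i j) \<longleftrightarrow> t \<in> movable n A p b"
proof
  assume *: "\<forall>i j. 0 \<le> A i j + shift q p (\<lambda>l. int (t l)) i j"
  have "int (t j) + of_bool (p = 0) * int (t (- j)) \<le> A p j" for j
    using *[rule_format, of p j] pq by (cases "p = 0") (auto simp: shift_def split: if_splits)
  then show "t \<in> movable n A p b" using t by (simp add: movable_def)
next
  assume m: "t \<in> movable n A p b"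
  have le: "int (t j) + of_bool (p = 0) * int (t (- j)) \<le> A p j" for j
  proof (cases "j \<in> idx n")
    case True
    then show ?thesis using m by (simp add: movable_def)
  next
    case False
    then have "t j = 0" "t (- j) = 0" using t by (auto simp: tuples_def)
    then show ?thesis using XiD(2)[OF A] by simp
  qed
  have np: "A (- p) j = A p (- j)" for j using XiD(3)[OF A, of p "- j"] by simp
  show "\<forall>i j. 0 \<le> A i j + shift q p (\<lambda>l. int (t l)) i j"
  proof (intro allI)
    fix i j
    consider "i = p" | "i \<noteq> p" "- i = p" | "i \<noteq> p" "- i \<noteq> p" by blast
    then show "0 \<le> A i j + shift q p (\<lambda>l. int (t l)) i j"
    proof cases
      case 1
      then show ?thesis using le[of j] pq by (cases "p = 0") (auto simp: shift_def)
    next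
      case 2
      then have "i = - p" "p \<noteq> 0" by auto
      then show ?thesis using le[of "- j"] np[of j] pq by (auto simp: shift_def)
    next
      case 3
      then show ?thesis using XiD(2)[OF A, of i j] by (auto simp: shift_def)
    qed
  qed
qed

lemma shift_Xi:
  assumes ctx: "A \<in> Xi n d" "B \<in> Xi n d" "0 \<le> p" "0 \<le> q" "q = p + 1 \<or> p = q + 1" "p \<in> idx n" "q \<in> idx n"
    "diagonal (\<lambda>i j. B i j - int b * E\<theta> q p i j)" "col n B = row n A"
    and t: "t \<in> movable n A p b"
  shows "(shifted A q p t) \<in> Xi n d"
proof -
  have tt: "t \<in> tuples n b" using t by (simp add: movable_def)
  have ne: "p \<noteq> q" using ctx(5) by auto
  have "A i j + shift q p (\<lambda>l. int (t l)) i j = 0" if "i \<notin> idx n \<or> j \<notin> idx n" for i j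
    using XiD(1)[OF ctx(1) that] shift_outside[OF ctx(6,7) _ that, of "\<lambda>l. int (t l)"] tt by (simp add: tuples_def)
  moreover have "0 \<le> A i j + shift q p (\<lambda>l. int (t l)) i j" for i j
    using shift_nonneg[OF ctx(1,3,4) ne ctx(6) tt] t by blast
  moreover have "A i j + shift q p (\<lambda>l. int (t l)) i j = A (- i) (- j) + shift q p (\<lambda>l. int (t l)) (- i) (- j)" for i j
    using XiD(3)[OF ctx(1), of i j] by (simp add: shift_def)
  moreover have "odd (A 0 0 + shift q p (\<lambda>l. int (t l)) 0 0)"
    using XiD(4)[OF ctx(1)] by (simp add: shift_def)
  moreover have "(\<Sum>i\<in>idx n. \<Sum>j\<in>idx n. A i j + shift q p (\<lambda>l. int (t l)) i j) = 2 * int d + 1"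
    using rows_eq(1)[OF ctx tt] XiD(5)[OF ctx(2)] unfolding row_def by (simp add: fun_eq_iff)
  ultimately show ?thesis unfolding Xi_def by blast
qed

text \<open>A structure coefficient is a monomial times a factor \<open>P\<close> that is left alone by the normalisation of the
standard basis, so the normalisation amounts to two equations between exponents.\<close>

lemma std_coeff_mult:
  assumes "- ell_hat_c n B - ell_hat_c n A + U = U' - ell_hat_c n M" "- ell_hat_a n B - ell_hat_a n A + V = V' - ell_hat_a n M"
  shows "std_coeff n B * std_coeff n A * (u_pow U * v_pow V * P) = u_pow U' * v_pow V' * P * std_coeff n M"
proof -
  have u: "u_pow (- ell_hat_c n B) * u_pow (- ell_hat_c n A) * u_pow U = u_pow U' * u_pow (- ell_hat_c n M)"
    using arg_cong[OF assms(1), of u_pow] by (simp only: diff_conv_add_uminus u_pow_add)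
  have v: "v_pow (- ell_hat_a n B) * v_pow (- ell_hat_a n A) * v_pow V = v_pow V' * v_pow (- ell_hat_a n M)"
    using arg_cong[OF assms(2), of v_pow] by (simp only: diff_conv_add_uminus v_pow_add)
  have "std_coeff n B * std_coeff n A * (u_pow U * v_pow V * P)
     = (u_pow (- ell_hat_c n B) * u_pow (- ell_hat_c n A) * u_pow U) * (v_pow (- ell_hat_a n B) * v_pow (- ell_hat_a n A) * v_pow V) * P"
    unfolding std_coeff_def by (simp only: mult_ac)
  also have "\<dots> = u_pow U' * v_pow V' * P * std_coeff n M"
    unfolding u v std_coeff_def by (simp only: mult_ac)
  finally show ?thesis .
qed

text \<open>What remains for each of the three formulas is the total weight \<open>c t\<close> and its normalisation \<open>f t\<close>.\<close>

lemma (in hecke_algebra) std_basis_product_shift: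
  assumes ctx: "A \<in> Xi n d" "B \<in> Xi n d" "0 \<le> p" "0 \<le> q" "q = p + 1 \<or> p = q + 1" "p \<in> idx n" "q \<in> idx n"
    "diagonal (\<lambda>i j. B i j - int b * E\<theta> q p i j)" "col n B = row n A"
    and coeff: "\<And>t w. t \<in> movable n A p b \<Longrightarrow> w \<in> weyl d \<Longrightarrow> kappa (row_comp n B) w (col_comp n A) = (shifted A q p t)
      \<Longrightarrow> (\<Sum>X | X \<in> selections d q b (block_index n (row_comp n B) \<circ> w) \<and> block_counts n (col_comp n A) X = t. relabel_weight d p q (relabel X p (block_index n (row_comp n B) \<circ> w)) X) = c t"
    and exps: "\<And>t. t \<in> movable n A p b \<Longrightarrow>
      std_coeff n B * std_coeff n A * c t = f t * std_coeff n (shifted A q p t)"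
    and M: "\<And>t. t \<in> movable n A p b \<Longrightarrow> M t = (shifted A q p t)"
  shows "std_basis n d smul T B \<otimes>\<^bsub>schur_algebra n d smul T\<^esub> std_basis n d smul T A
     = (\<Oplus>\<^bsub>schur_algebra n d smul T\<^esub> t\<in>movable n A p b.
          f t \<odot>\<^bsub>schur_algebra n d smul T\<^esub> std_basis n d smul T (M t))"
proof (rule std_basis_product[OF ctx(1,2)])
  have sub: "t \<in> tuples n b" if "t \<in> movable n A p b" for t using that by (simp add: movable_def)
  show "col_comp n B = row_comp n A" using ctx(9) by simp
  show "finite (movable n A p b)" by (rule finite_subset[OF _ finite_tuples[of n b]]) (use sub in blast)
  show "M t \<in> Xi n d \<and> row_comp n (M t) = row_comp n B \<and> col_comp n (M t) = col_comp n A" if "t \<in> movable n A p b" for t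
    using shift_Xi[OF ctx that] rows_eq[OF ctx sub[OF that]] M[OF that] by simp
  fix h assume h: "h * x_elt d T (row_comp n A) = sum T (orbit n d B)"
  have ne: "p \<noteq> q" using ctx(5) by auto
  have "h * sum T (orbit n d A) = (\<Sum>t\<in>movable n A p b. smul (c t) (sum T (orbit n d (shifted A q p t))))"
    by (rule hecke_product[OF ctx h sub _ coeff]) (use shift_nonneg[OF ctx(1,3,4) ne ctx(6)] in blast)+
  then show "smul (std_coeff n B * std_coeff n A) (h * sum T (orbit n d A))
     = (\<Sum>t\<in>movable n A p b. smul (f t * std_coeff n (M t)) (sum T (orbit n d (M t))))"
    by (simp add: scale_sum_right exps[symmetric] M)
qed

lemma sum_tuple: "t \<in> tuples n b \<Longrightarrow> int b = (\<Sum>l\<in>idx n. int (t l))"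
  by (auto simp: tuples_def)

text \<open>The powers of \<open>u\<close> and \<open>v\<close> in the first formula: the pairing on the left comes from the structure
coefficient.\<close>

lemma ell_hat_up:
  assumes ctx: "A \<in> Xi n d" "B \<in> Xi n d" "diagonal (\<lambda>i j. B i j - int b * E\<theta> h (h - 1) i j)" "col n B = row n A"
    and h: "1 \<le> h" "h \<le> int n" and t: "t \<in> movable n A (h - 1) b"
  shows "- ell_hat_c n B - ell_hat_c n A + 0
      = - of_bool (h = 1) * (\<Sum>l\<in>idx n. of_bool (0 < l) * int (t l)) - ell_hat_c n (shifted A h (h - 1) t)"
    and "- ell_hat_a n B - ell_hat_a n A + 2 * pairing n (\<lambda>l. int (t l)) (\<lambda>l k. k \<le> l) (A h)
      = beta n h A t - ell_hat_a n (shifted A h (h - 1) t)"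
proof -
  have hn: "h - 1 \<in> idx n" "h \<in> idx n" using h by (auto simp: idx_def)
  have full: "A \<in> Xi n d" "B \<in> Xi n d" "0 \<le> h - 1" "0 \<le> h" "h = (h - 1) + 1 \<or> h - 1 = h + 1" "h - 1 \<in> idx n" "h \<in> idx n"
    "diagonal (\<lambda>i j. B i j - int b * E\<theta> h (h - 1) i j)" "col n B = row n A"
    using ctx h hn by auto
  have tt: "t \<in> tuples n b" using t by (simp add: movable_def)
  have central_symm: "central_symm A" "central_symm B" and odd: "odd (A 0 0)" "odd (B 0 0)"
    using XiD(3,4)[OF ctx(1)] XiD(3,4)[OF ctx(2)] by (simp_all add: central_symm_def)
  note M = shift_Xi[OF full t, unfolded shift_eq_move]
  have oM: "odd (A 0 0 + move h (\<lambda>l. int (t l)) 0 0)" using XiD(4)[OF M] .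
  have sM: "central_symm (\<lambda>i j. A i j + move h (\<lambda>l. int (t l)) i j)" using XiD(3)[OF M] by (simp add: central_symm_def)
  have B: "ell_hat_c n B = 0" "2 * ell_hat_a n B = 2 * int b * row n A h"
    using ell_hat_almost_diagonal[of h n B "row n A" "h - 1" "int b" "int b", OF h central_symm(2) odd(2) row_uminus[OF central_symm(1)]]
      B_entry[OF full] by (simp_all add: shift_eq_move)
  have bsum: "int b * row n A h = pairing n (\<lambda>l. int (t l)) (<) (A h) + pairing n (\<lambda>l. int (t l)) (\<lambda>l k. k \<le> l) (A h)"
    unfolding row_def sum_tuple[OF tt] by (rule pairing_trichotomy(1))
  show "- ell_hat_c n B - ell_hat_c n A + 0
      = - of_bool (h = 1) * (\<Sum>l\<in>idx n. of_bool (0 < l) * int (t l)) - ell_hat_c n (shifted A h (h - 1) t)"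
    unfolding shift_eq_move ell_hat_c_eq[OF central_symm(1)] ell_hat_c_eq[OF sM] west_sum_move[OF h] B by simp
  show "- ell_hat_a n B - ell_hat_a n A + 2 * pairing n (\<lambda>l. int (t l)) (\<lambda>l k. k \<le> l) (A h)
      = beta n h A t - ell_hat_a n (shifted A h (h - 1) t)"
  proof (cases "h = 1")
    case True
    then have z: "of_bool (h = 1) = (1 :: int)" by simp
    show ?thesis
      using ell_hat_a_up[OF h central_symm(1) odd(1) oM] beta_form[of n h A t] pairing_positive[where n = n and t = "\<lambda>l. int (t l)"] B(2) bsum
      unfolding shift_eq_move z mult_1_left by linarith
  next
    case False
    then have z: "of_bool (h = 1) = (0 :: int)" by simp
    show ?thesis
      using ell_hat_a_up[OF h central_symm(1) odd(1) oM] beta_form[of n h A t] B(2) bsum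
      unfolding shift_eq_move z by linarith
  qed
qed

text \<open>The same for moves in the other direction. For \<open>h = 1\<close> the exponents of the structure coefficient and of
the barred factors are those of the middle row.\<close>

lemma ell_hat_down:
  assumes ctx: "A \<in> Xi n d" "C \<in> Xi n d" "diagonal (\<lambda>i j. C i j - int b * E\<theta> (h - 1) h i j)" "col n C = row n A"
    and h: "1 \<le> h" "h \<le> int n" and t: "t \<in> movable n A h b"
  shows "h \<noteq> 1 \<Longrightarrow> - ell_hat_c n C - ell_hat_c n A + 0 = 0 - ell_hat_c n (shifted A (h - 1) h t)"
    and "h \<noteq> 1 \<Longrightarrow> - ell_hat_a n C - ell_hat_a n A + 2 * pairing n (\<lambda>l. int (t l)) (\<le>) (A (h - 1))
      = beta' n h A t - ell_hat_a n (shifted A (h - 1) h t)"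
    and "h = 1 \<Longrightarrow> - ell_hat_c n C - ell_hat_c n A + (2 * (\<Sum>l\<in>idx n. of_bool (l < 0) * int (t l)) + 2 * int (t 0))
      = (\<Sum>l\<in>idx n. of_bool (l \<le> 0) * int (t l)) - ell_hat_c n (shifted A (h - 1) h t)"
    and "h = 1 \<Longrightarrow> - ell_hat_a n C - ell_hat_a n A
        + (2 * (\<Sum>l\<in>idx n. \<Sum>k\<in>idx n. of_bool (k < l) * ((A 0 l - of_bool (l = 0)) * int (t k)))
           + pairing n (\<lambda>l. int (t l)) (\<lambda>l k. k + l < 0) (\<lambda>l. int (t l))
           - (\<Sum>l\<in>idx n. of_bool (l < 0) * int (t l))
           + (2 * (\<Sum>l\<in>idx n. int (t l) * A 0 l) + (\<Sum>l\<in>idx n. int (t l) * int (t (- l))) - 3 * int (t 0)))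
      = beta'' n A t - ell_hat_a n (shifted A (h - 1) h t)"
proof -
  have hn: "h - 1 \<in> idx n" "h \<in> idx n" "0 \<in> idx n" using h by (auto simp: idx_def)
  have full: "A \<in> Xi n d" "C \<in> Xi n d" "0 \<le> h" "0 \<le> h - 1" "h - 1 = h + 1 \<or> h = (h - 1) + 1" "h \<in> idx n" "h - 1 \<in> idx n"
    "diagonal (\<lambda>i j. C i j - int b * E\<theta> (h - 1) h i j)" "col n C = row n A"
    using ctx h hn by auto
  have tt: "t \<in> tuples n b" using t by (simp add: movable_def)
  have central_symm: "central_symm A" "central_symm C" and odd: "odd (A 0 0)" "odd (C 0 0)"
    using XiD(3,4)[OF ctx(1)] XiD(3,4)[OF ctx(2)] by (simp_all add: central_symm_def)
  have sh: "(shifted A (h - 1) h t) = (\<lambda>i j. A i j - move h (\<lambda>l. int (t l)) i j)"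
    by (simp add: shift_eq_move)
  note M = shift_Xi[OF full t, unfolded sh]
  have oM: "odd (A 0 0 - move h (\<lambda>l. int (t l)) 0 0)" using XiD(4)[OF M] .
  have sM: "central_symm (\<lambda>i j. A i j - move h (\<lambda>l. int (t l)) i j)" using XiD(3)[OF M] by (simp add: central_symm_def)
  have CD: "C i j = of_bool (i = j) * row n A j + move h (\<lambda>l. - int b * of_bool (l = h)) i j" if "i \<in> idx n" "j \<in> idx n" for i j
    using B_entry[OF full that] move_uminus[of h "\<lambda>l. int b * of_bool (l = h)" i j] by (simp add: shift_eq_move)
  have C: "ell_hat_c n C = of_bool (h = 1) * int b"
    "2 * ell_hat_a n C = 2 * int b * row n A (h - 1) + of_bool (h = 1) * (int b * int b - 3 * int b)"
    using ell_hat_almost_diagonal[of h n C "row n A" h "- int b" "int b", OF h central_symm(2) odd(2) row_uminus[OF central_symm(1)] _ CD]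
    by simp_all
  have bsum: "int b * row n A (h - 1) = pairing n (\<lambda>l. int (t l)) (\<lambda>l k. k < l) (A (h - 1)) + pairing n (\<lambda>l. int (t l)) (\<le>) (A (h - 1))"
    unfolding row_def sum_tuple[OF tt] by (rule pairing_trichotomy(2))
  have west: "west_sum n (\<lambda>i j. A i j - move h (\<lambda>l. int (t l)) i j) = west_sum n A + of_bool (h = 1) * (\<Sum>l\<in>idx n. of_bool (0 < l) * int (t l))"
    using west_sum_move[OF h, of A "\<lambda>l. - int (t l)"] by (simp add: move_uminus sum_negf)
  have cM: "ell_hat_c n (\<lambda>i j. A i j - move h (\<lambda>l. int (t l)) i j) = ell_hat_c n A + of_bool (h = 1) * (\<Sum>l\<in>idx n. of_bool (0 < l) * int (t l))"
    unfolding ell_hat_c_eq[OF central_symm(1)] ell_hat_c_eq[OF sM] west ..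
  have aM: "2 * ell_hat_a n (\<lambda>i j. A i j - move h (\<lambda>l. int (t l)) i j) - 2 * ell_hat_a n A
     = - 2 * pairing n (\<lambda>l. int (t l)) (<) (A h) + 2 * pairing n (\<lambda>l. int (t l)) (\<lambda>l k. k < l) (\<lambda>l. int (t l)) + 2 * pairing n (\<lambda>l. int (t l)) (\<lambda>l k. k < l) (A (h - 1))
       + of_bool (h = 1) * (pairing n (\<lambda>l. int (t l)) (\<lambda>l k. 0 < k + l) (\<lambda>l. int (t l)) - 3 * (\<Sum>l\<in>idx n. of_bool (0 < l) * int (t l)))"
    by (rule ell_hat_a_down[OF h central_symm(1) odd(1) oM])
  note swap = pairing_swap[where n = n and t = "\<lambda>l. int (t l)"]
  show "- ell_hat_c n C - ell_hat_c n A + 0 = 0 - ell_hat_c n (shifted A (h - 1) h t)" if "h \<noteq> 1"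
    unfolding sh using C(1) cM that by simp
  show "- ell_hat_a n C - ell_hat_a n A + 2 * pairing n (\<lambda>l. int (t l)) (\<le>) (A (h - 1))
      = beta' n h A t - ell_hat_a n (shifted A (h - 1) h t)" if "h \<noteq> 1"
  proof -
    have z: "of_bool (h = 1) = (0 :: int)" using that by simp
    show ?thesis
      unfolding sh using aM C(2) bsum beta'_form[of n h A t] swap unfolding z by linarith
  qed
  have parts: "(\<Sum>l\<in>idx n. int (t l)) = (\<Sum>l\<in>idx n. of_bool (0 < l) * int (t l)) + (\<Sum>l\<in>idx n. of_bool (l \<le> 0) * int (t l))"
    "(\<Sum>l\<in>idx n. of_bool (l \<le> 0) * int (t l)) = (\<Sum>l\<in>idx n. of_bool (l < 0) * int (t l)) + int (t 0)"
  proof -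
    show "(\<Sum>l\<in>idx n. int (t l)) = (\<Sum>l\<in>idx n. of_bool (0 < l) * int (t l)) + (\<Sum>l\<in>idx n. of_bool (l \<le> 0) * int (t l))"
      unfolding sum.distrib[symmetric] by (rule sum.cong[OF refl]) auto
    show "(\<Sum>l\<in>idx n. of_bool (l \<le> 0) * int (t l)) = (\<Sum>l\<in>idx n. of_bool (l < 0) * int (t l)) + int (t 0)"
      unfolding sum_at[OF hn(3), of "\<lambda>l. int (t l)", symmetric] sum.distrib[symmetric] by (rule sum.cong[OF refl]) auto
  qed
  show "- ell_hat_c n C - ell_hat_c n A + (2 * (\<Sum>l\<in>idx n. of_bool (l < 0) * int (t l)) + 2 * int (t 0))
      = (\<Sum>l\<in>idx n. of_bool (l \<le> 0) * int (t l)) - ell_hat_c n (shifted A (h - 1) h t)" if "h = 1"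
  proof -
    have z: "of_bool (h = 1) = (1 :: int)" using that by simp
    show ?thesis unfolding sh using C(1) cM parts sum_tuple[OF tt] unfolding z by linarith
  qed
  show "- ell_hat_a n C - ell_hat_a n A
        + (2 * (\<Sum>l\<in>idx n. \<Sum>k\<in>idx n. of_bool (k < l) * ((A 0 l - of_bool (l = 0)) * int (t k)))
           + pairing n (\<lambda>l. int (t l)) (\<lambda>l k. k + l < 0) (\<lambda>l. int (t l))
           - (\<Sum>l\<in>idx n. of_bool (l < 0) * int (t l))
           + (2 * (\<Sum>l\<in>idx n. int (t l) * A 0 l) + (\<Sum>l\<in>idx n. int (t l) * int (t (- l))) - 3 * int (t 0)))
      = beta'' n A t - ell_hat_a n (shifted A (h - 1) h t)" if h1: "h = 1"
  proof -
    have z: "of_bool (h = 1) = (1 :: int)" "h - 1 = 0" using h1 by simp_all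
    have mid: "(\<Sum>l\<in>idx n. \<Sum>k\<in>idx n. of_bool (k < l) * ((A 0 l - of_bool (l = 0)) * int (t k)))
       = pairing n (\<lambda>l. int (t l)) (<) (A 0) - (\<Sum>l\<in>idx n. of_bool (l < 0) * int (t l))"
    proof -
      have "(\<Sum>l\<in>idx n. \<Sum>k\<in>idx n. of_bool (k < l) * ((A 0 l - of_bool (l = 0)) * int (t k)))
         = (\<Sum>k\<in>idx n. \<Sum>l\<in>idx n. of_bool (k < l) * (int (t k) * A 0 l) - of_bool (k < 0) * int (t k) * of_bool (l = 0))"
        by (subst sum.swap, rule sum.cong[OF refl], rule sum.cong[OF refl]) (auto simp: algebra_simps)
      then show ?thesis by (simp only: sum_subtractf sum_at[OF hn(3)])
    qed
    \<comment> \<open>Adding up the equations is linear once the sums are treated as unknowns.\<close>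
    have lin: "- aC - aA + (2 * (p9 - N) + p8 - N + (2 * ct + tr - 3 * t0)) = bt - aM"
      if "2 * aM - 2 * aA = - 2 * p1 + 2 * p2 + 2 * p3 + (p4 - 3 * S)" "2 * aC = 2 * br + (bq - 3 * s)" "br = p3 + p5"
        "2 * bt = 2 * p5 - 2 * p1 + 2 * p6 + 2 * p7 + q0 - 3 * Z" "p6 = p2" "p4 + 2 * p8 + 2 * tr - bq = 2 * p7 + q0"
        "s = S + Z" "Z = N + t0" "p5 = p9 + ct"
      for aM aA aC p1 p2 p3 p4 p5 p6 p7 p8 p9 q0 br bq bt s S Z N t0 ct tr :: int
      using that by (smt (verit))
    have row: "2 * ell_hat_a n C = 2 * (int b * row n A 0) + (int b * int b - 3 * int b)"
      using C(2) unfolding z mult_1_left mult.assoc .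
    show ?thesis
      unfolding sh mid unfolding h1
      by (rule lin[OF aM[unfolded z mult_1_left, unfolded h1] row bsum[unfolded z] beta''_form swap
            pairing_nonpositive[where n = n and t = "\<lambda>l. int (t l)", folded sum_tuple[OF tt]]
            parts(1)[folded sum_tuple[OF tt]] parts(2) pairing_trichotomy(3)])
  qed
qed


theorem theoremA:
  fixes n d b c :: nat
    and h :: int
    and A B C :: mat
    and smul :: "laurent \<Rightarrow> 'h::ring_1 \<Rightarrow> 'h"
    and T :: "(int \<Rightarrow> int) \<Rightarrow> 'h"
  assumes "hecke_algebra smul d T"
    and "A \<in> Xi n d" and "B \<in> Xi n d" and "C \<in> Xi n d"
    and "1 \<le> h" and "h \<le> int n"
  shows "let S = schur_algebra n d smul T; std = std_basis n d smul T in
    (diagonal (\<lambda>i j. B i j - int b * E\<theta> h (h - 1) i j) \<and> col n B = row n A \<longrightarrow>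
       std B \<otimes>\<^bsub>S\<^esub> std A =
         (\<Oplus>\<^bsub>S\<^esub> t \<in> {t \<in> tuples n b.
              if h = 1 then \<forall>i \<in> idx n. int (t i) + int (t (- i)) \<le> A (h - 1) i
              else \<forall>i \<in> idx n. int (t i) \<le> A (h - 1) i}.
            (u_pow (if h = 1 then - (\<Sum>l = 1..int n. int (t l)) else 0)
             * v_pow (beta n h A t)
             * (\<Prod>l \<in> idx n. bar (qbinom (A h l + int (t l)) (t l))))
            \<odot>\<^bsub>S\<^esub> std (check_mat n A t h)))
    \<and>
    (diagonal (\<lambda>i j. C i j - int c * E\<theta> (h - 1) h i j) \<and> col n C = row n A \<longrightarrow>
       (h \<noteq> 1 \<longrightarrow>
          std C \<otimes>\<^bsub>S\<^esub> std A =
            (\<Oplus>\<^bsub>S\<^esub> t \<in> {t \<in> tuples n c. \<forall>i \<in> idx n. int (t i) \<le> A h i}.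
               (v_pow (beta' n h A t)
                * (\<Prod>l \<in> idx n. bar (qbinom (A (h - 1) l + int (t l)) (t l))))
               \<odot>\<^bsub>S\<^esub> std (hat_mat n A t h))) \<and>
       (h = 1 \<longrightarrow>
          std C \<otimes>\<^bsub>S\<^esub> std A =
            (\<Oplus>\<^bsub>S\<^esub> t \<in> {t \<in> tuples n c. \<forall>i \<in> idx n. int (t i) \<le> A h i}.
               (u_pow (\<Sum>l = - int n..0. int (t l))
                * v_pow (beta'' n A t)
                * bar (exact_div (qfact_c (nat (natural A 0 0) + t 0))
                                 (qfact_c (nat (natural A 0 0)) * qfact (t 0))
                       * (\<Prod>l = 1..int n.
                            exact_div (qfact (nat (A 0 l) + t l + t (- l)))
                                      (qfact (nat (A 0 l)) * qfact (t l) * qfact (t (- l))))))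
               \<odot>\<^bsub>S\<^esub> std (hat_mat n A t 1))))"
proof -
  interpret H: hecke_algebra smul d T by (rule assms(1))
  note A = assms(2) and B = assms(3) and C = assms(4) and h = assms(5,6)
  let ?S = "schur_algebra n d smul T"
  let ?std = "std_basis n d smul T"
  have hn: "h - 1 \<in> idx n" "h \<in> idx n" using h by (auto simp: idx_def)
  have tup: "t \<in> tuples n e" if "t \<in> movable n A p e" for t p e using that by (simp add: movable_def)
  have up: "?std B \<otimes>\<^bsub>?S\<^esub> ?std A =
         (\<Oplus>\<^bsub>?S\<^esub> t \<in> {t \<in> tuples n b.
              if h = 1 then \<forall>i \<in> idx n. int (t i) + int (t (- i)) \<le> A (h - 1) i
              else \<forall>i \<in> idx n. int (t i) \<le> A (h - 1) i}.
            (u_pow (if h = 1 then - (\<Sum>l = 1..int n. int (t l)) else 0)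
             * v_pow (beta n h A t)
             * (\<Prod>l \<in> idx n. bar (qbinom (A h l + int (t l)) (t l))))
            \<odot>\<^bsub>?S\<^esub> ?std (check_mat n A t h))"
    if D: "diagonal (\<lambda>i j. B i j - int b * E\<theta> h (h - 1) i j)" "col n B = row n A"
  proof -
    have full: "A \<in> Xi n d" "B \<in> Xi n d" "0 \<le> h - 1" "0 \<le> h" "h = (h - 1) + 1 \<or> h - 1 = h + 1" "h - 1 \<in> idx n" "h \<in> idx n"
      "diagonal (\<lambda>i j. B i j - int b * E\<theta> h (h - 1) i j)" "col n B = row n A"
      using A B D h hn by auto
    define P where "P t = (\<Prod>l \<in> idx n. bar (qbinom (A h l + int (t l)) (t l)))" for t
    define f where "f t = u_pow (- of_bool (h = 1) * (\<Sum>l\<in>idx n. of_bool (0 < l) * int (t l))) * v_pow (beta n h A t) * P t" for t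
    have set_eq: "{t \<in> tuples n b.
              if h = 1 then \<forall>i \<in> idx n. int (t i) + int (t (- i)) \<le> A (h - 1) i
              else \<forall>i \<in> idx n. int (t i) \<le> A (h - 1) i} = movable n A (h - 1) b"
      by (auto simp: movable_def)
    have u: "(if h = 1 then - (\<Sum>l = 1..int n. int (t l)) else 0) = - of_bool (h = 1) * (\<Sum>l\<in>idx n. of_bool (0 < l) * int (t l))" for t
    proof -
      have "{l \<in> idx n. 0 < l} = {1..int n}" by (auto simp: idx_def)
      then have "(\<Sum>l = 1..int n. int (t l)) = (\<Sum>l\<in>idx n. if 0 < l then int (t l) else 0)"
        using sum.inter_filter[OF finite_idx, of "\<lambda>l. int (t l)" n "\<lambda>l. 0 < l"] by simp
      also have "\<dots> = (\<Sum>l\<in>idx n. of_bool (0 < l) * int (t l))" by (rule sum.cong[OF refl]) simp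
      finally show ?thesis by simp
    qed
    have "?std B \<otimes>\<^bsub>?S\<^esub> ?std A = (\<Oplus>\<^bsub>?S\<^esub> t\<in>movable n A (h - 1) b. f t \<odot>\<^bsub>?S\<^esub> ?std (check_mat n A t h))"
    proof (rule H.std_basis_product_shift[OF full])
      fix t w assume t: "t \<in> movable n A (h - 1) b" and w: "w \<in> weyl d"
        and k: "kappa (row_comp n B) w (col_comp n A) = (shifted A h (h - 1) t)"
      show "(\<Sum>X | X \<in> selections d h b (block_index n (row_comp n B) \<circ> w) \<and> block_counts n (col_comp n A) X = t. relabel_weight d (h - 1) h (relabel X (h - 1) (block_index n (row_comp n B) \<circ> w)) X)
        = u_pow 0 * v_pow (2 * pairing n (\<lambda>l. int (t l)) (\<lambda>l k. k \<le> l) (A h)) * P t"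
        using row_pattern.coefficient_nonzero_row[OF row_pattern.intro[OF row_col_Lam(3,2)[OF full] w full(3-7) tup[OF t] k] _ XiD(2)[OF A]] h by (simp add: P_def)
    next
      fix t assume t: "t \<in> movable n A (h - 1) b"
      show "std_coeff n B * std_coeff n A * (u_pow 0 * v_pow (2 * pairing n (\<lambda>l. int (t l)) (\<lambda>l k. k \<le> l) (A h)) * P t)
        = f t * std_coeff n (shifted A h (h - 1) t)"
        unfolding f_def by (rule std_coeff_mult[OF ell_hat_up[OF A B D h t]])
    qed (rule check_mat_shift[OF tup])
    then show ?thesis unfolding set_eq u f_def P_def .
  qed
  have "?std C \<otimes>\<^bsub>?S\<^esub> ?std A =
            (\<Oplus>\<^bsub>?S\<^esub> t \<in> {t \<in> tuples n c. \<forall>i \<in> idx n. int (t i) \<le> A h i}. f t \<odot>\<^bsub>?S\<^esub> ?std (hat_mat n A t h))"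
    if D: "diagonal (\<lambda>i j. C i j - int c * E\<theta> (h - 1) h i j)" "col n C = row n A"
    and f: "\<And>t. t \<in> movable n A h c \<Longrightarrow> f t = u_pow (U' t) * v_pow (V' t) * P t"
    and exps: "\<And>t. t \<in> movable n A h c \<Longrightarrow>
        - ell_hat_c n C - ell_hat_c n A + U t = U' t - ell_hat_c n (shifted A (h - 1) h t)
      \<and> - ell_hat_a n C - ell_hat_a n A + V t = V' t - ell_hat_a n (shifted A (h - 1) h t)"
    and coeff: "\<And>t w. t \<in> movable n A h c \<Longrightarrow> w \<in> weyl d \<Longrightarrow> kappa (row_comp n C) w (col_comp n A) = (shifted A (h - 1) h t) \<Longrightarrow>
      (\<Sum>X | X \<in> selections d (h - 1) c (block_index n (row_comp n C) \<circ> w) \<and> block_counts n (col_comp n A) X = t. relabel_weight d h (h - 1) (relabel X h (block_index n (row_comp n C) \<circ> w)) X)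
        = u_pow (U t) * v_pow (V t) * P t"
    for f P :: "(int \<Rightarrow> nat) \<Rightarrow> laurent" and U V U' V' :: "(int \<Rightarrow> nat) \<Rightarrow> int"
  proof -
    have full: "A \<in> Xi n d" "C \<in> Xi n d" "0 \<le> h" "0 \<le> h - 1" "h - 1 = h + 1 \<or> h = (h - 1) + 1" "h \<in> idx n" "h - 1 \<in> idx n"
      "diagonal (\<lambda>i j. C i j - int c * E\<theta> (h - 1) h i j)" "col n C = row n A"
      using A C D h hn by auto
    have set_eq: "{t \<in> tuples n c. \<forall>i \<in> idx n. int (t i) \<le> A h i} = movable n A h c"
      using h by (auto simp: movable_def)
    have "?std C \<otimes>\<^bsub>?S\<^esub> ?std A = (\<Oplus>\<^bsub>?S\<^esub> t\<in>movable n A h c. f t \<odot>\<^bsub>?S\<^esub> ?std (hat_mat n A t h))"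
    proof (rule H.std_basis_product_shift[OF full])
      show "(\<Sum>X | X \<in> selections d (h - 1) c (block_index n (row_comp n C) \<circ> w) \<and> block_counts n (col_comp n A) X = t. relabel_weight d h (h - 1) (relabel X h (block_index n (row_comp n C) \<circ> w)) X)
          = u_pow (U t) * v_pow (V t) * P t"
        if "t \<in> movable n A h c" "w \<in> weyl d" "kappa (row_comp n C) w (col_comp n A) = (shifted A (h - 1) h t)" for t w
        by (rule coeff[OF that])
    next
      fix t assume t: "t \<in> movable n A h c"
      show "std_coeff n C * std_coeff n A * (u_pow (U t) * v_pow (V t) * P t)
        = f t * std_coeff n (shifted A (h - 1) h t)"
        unfolding f[OF t] by (rule std_coeff_mult) (use exps[OF t] in blast)+
    qed (rule hat_mat_shift[OF tup])
    then show ?thesis unfolding set_eq .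
  qed
  note down = this
  have down_ne: "?std C \<otimes>\<^bsub>?S\<^esub> ?std A =
            (\<Oplus>\<^bsub>?S\<^esub> t \<in> {t \<in> tuples n c. \<forall>i \<in> idx n. int (t i) \<le> A h i}.
               (v_pow (beta' n h A t)
                * (\<Prod>l \<in> idx n. bar (qbinom (A (h - 1) l + int (t l)) (t l))))
               \<odot>\<^bsub>?S\<^esub> ?std (hat_mat n A t h))"
    if D: "diagonal (\<lambda>i j. C i j - int c * E\<theta> (h - 1) h i j)" "col n C = row n A" and h1: "h \<noteq> 1"
  proof (rule down[OF D, where P = "\<lambda>t. \<Prod>l \<in> idx n. bar (qbinom (A (h - 1) l + int (t l)) (t l))" and U = "\<lambda>t. 0" and U' = "\<lambda>t. 0"
      and V' = "beta' n h A" and V = "\<lambda>t. 2 * pairing n (\<lambda>l. int (t l)) (\<le>) (A (h - 1))"], simp)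
    fix t assume t: "t \<in> movable n A h c"
    show "- ell_hat_c n C - ell_hat_c n A + 0 = 0 - ell_hat_c n (shifted A (h - 1) h t)
      \<and> - ell_hat_a n C - ell_hat_a n A + 2 * pairing n (\<lambda>l. int (t l)) (\<le>) (A (h - 1))
        = beta' n h A t - ell_hat_a n (shifted A (h - 1) h t)"
      using ell_hat_down(1,2)[OF A C D h t h1] by blast
  next
    fix t w assume t: "t \<in> movable n A h c" and w: "w \<in> weyl d"
      and k: "kappa (row_comp n C) w (col_comp n A) = (shifted A (h - 1) h t)"
    have full: "A \<in> Xi n d" "C \<in> Xi n d" "0 \<le> h" "0 \<le> h - 1" "h - 1 = h + 1 \<or> h = (h - 1) + 1" "h \<in> idx n" "h - 1 \<in> idx n"
      "diagonal (\<lambda>i j. C i j - int c * E\<theta> (h - 1) h i j)" "col n C = row n A"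
      using A C D h hn by auto
    show "(\<Sum>X | X \<in> selections d (h - 1) c (block_index n (row_comp n C) \<circ> w) \<and> block_counts n (col_comp n A) X = t. relabel_weight d h (h - 1) (relabel X h (block_index n (row_comp n C) \<circ> w)) X)
        = u_pow 0 * v_pow (2 * pairing n (\<lambda>l. int (t l)) (\<le>) (A (h - 1))) * (\<Prod>l \<in> idx n. bar (qbinom (A (h - 1) l + int (t l)) (t l)))"
      using row_pattern.coefficient_nonzero_row[OF row_pattern.intro[OF row_col_Lam(3,2)[OF full] w full(3-7) tup[OF t] k] _ XiD(2)[OF A]] h1 by simp
  qed
  have down_1: "?std C \<otimes>\<^bsub>?S\<^esub> ?std A =
            (\<Oplus>\<^bsub>?S\<^esub> t \<in> {t \<in> tuples n c. \<forall>i \<in> idx n. int (t i) \<le> A h i}.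
               (u_pow (\<Sum>l = - int n..0. int (t l))
                * v_pow (beta'' n A t)
                * bar (exact_div (qfact_c (nat (natural A 0 0) + t 0))
                                 (qfact_c (nat (natural A 0 0)) * qfact (t 0))
                       * (\<Prod>l = 1..int n.
                            exact_div (qfact (nat (A 0 l) + t l + t (- l)))
                                      (qfact (nat (A 0 l)) * qfact (t l) * qfact (t (- l))))))
               \<odot>\<^bsub>?S\<^esub> ?std (hat_mat n A t h))"
    if D: "diagonal (\<lambda>i j. C i j - int c * E\<theta> (h - 1) h i j)" "col n C = row n A" and h1: "h = 1"
  proof (rule down[OF D, where P = "\<lambda>t. bar (exact_div (qfact_c (nat (natural A 0 0) + t 0))
                                 (qfact_c (nat (natural A 0 0)) * qfact (t 0))
                       * (\<Prod>l = 1..int n.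
                            exact_div (qfact (nat (A 0 l) + t l + t (- l)))
                                      (qfact (nat (A 0 l)) * qfact (t l) * qfact (t (- l)))))"
      and U = "\<lambda>t. 2 * (\<Sum>l\<in>idx n. of_bool (l < 0) * int (t l)) + 2 * int (t 0)"
      and U' = "\<lambda>t. \<Sum>l\<in>idx n. of_bool (l \<le> 0) * int (t l)" and V' = "beta'' n A"
      and V = "\<lambda>t. 2 * (\<Sum>l\<in>idx n. \<Sum>k\<in>idx n. of_bool (k < l) * ((A 0 l - of_bool (l = 0)) * int (t k)))
           + pairing n (\<lambda>l. int (t l)) (\<lambda>l k. k + l < 0) (\<lambda>l. int (t l))
           - (\<Sum>l\<in>idx n. of_bool (l < 0) * int (t l))
           + (2 * (\<Sum>l\<in>idx n. int (t l) * A 0 l) + (\<Sum>l\<in>idx n. int (t l) * int (t (- l))) - 3 * int (t 0))"])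
    fix t assume t: "t \<in> movable n A h c"
    have "{l \<in> idx n. l \<le> 0} = {- int n..0}" by (auto simp: idx_def)
    then have "(\<Sum>l = - int n..0. int (t l)) = (\<Sum>l\<in>idx n. if l \<le> 0 then int (t l) else 0)"
      using sum.inter_filter[OF finite_idx, of "\<lambda>l. int (t l)" n "\<lambda>l. l \<le> 0"] by simp
    also have "\<dots> = (\<Sum>l\<in>idx n. of_bool (l \<le> 0) * int (t l))" by (rule sum.cong[OF refl]) simp
    finally show "u_pow (\<Sum>l = - int n..0. int (t l)) * v_pow (beta'' n A t) * bar (exact_div (qfact_c (nat (natural A 0 0) + t 0))
                                 (qfact_c (nat (natural A 0 0)) * qfact (t 0))
                       * (\<Prod>l = 1..int n.
                            exact_div (qfact (nat (A 0 l) + t l + t (- l)))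
                                      (qfact (nat (A 0 l)) * qfact (t l) * qfact (t (- l)))))
       = u_pow (\<Sum>l\<in>idx n. of_bool (l \<le> 0) * int (t l)) * v_pow (beta'' n A t) * bar (exact_div (qfact_c (nat (natural A 0 0) + t 0))
                                 (qfact_c (nat (natural A 0 0)) * qfact (t 0))
                       * (\<Prod>l = 1..int n.
                            exact_div (qfact (nat (A 0 l) + t l + t (- l)))
                                      (qfact (nat (A 0 l)) * qfact (t l) * qfact (t (- l)))))"
      by (simp only:)
  next
    fix t assume t: "t \<in> movable n A h c"
    show "- ell_hat_c n C - ell_hat_c n A + (2 * (\<Sum>l\<in>idx n. of_bool (l < 0) * int (t l)) + 2 * int (t 0))
        = (\<Sum>l\<in>idx n. of_bool (l \<le> 0) * int (t l)) - ell_hat_c n (shifted A (h - 1) h t)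
      \<and> - ell_hat_a n C - ell_hat_a n A
        + (2 * (\<Sum>l\<in>idx n. \<Sum>k\<in>idx n. of_bool (k < l) * ((A 0 l - of_bool (l = 0)) * int (t k)))
           + pairing n (\<lambda>l. int (t l)) (\<lambda>l k. k + l < 0) (\<lambda>l. int (t l))
           - (\<Sum>l\<in>idx n. of_bool (l < 0) * int (t l))
           + (2 * (\<Sum>l\<in>idx n. int (t l) * A 0 l) + (\<Sum>l\<in>idx n. int (t l) * int (t (- l))) - 3 * int (t 0)))
      = beta'' n A t - ell_hat_a n (shifted A (h - 1) h t)"
      using ell_hat_down(3,4)[OF A C D h t h1] by blast
  next
    fix t w assume t: "t \<in> movable n A h c" and w: "w \<in> weyl d"
      and k: "kappa (row_comp n C) w (col_comp n A) = (shifted A (h - 1) h t)"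
    have full: "A \<in> Xi n d" "C \<in> Xi n d" "0 \<le> h" "0 \<le> h - 1" "h - 1 = h + 1 \<or> h = (h - 1) + 1" "h \<in> idx n" "h - 1 \<in> idx n"
      "diagonal (\<lambda>i j. C i j - int c * E\<theta> (h - 1) h i j)" "col n C = row n A"
      using A C D h hn by auto
    have "A 0 (- j) = A 0 j" for j using XiD(3)[OF A, of 0 j] by simp
    then show "(\<Sum>X | X \<in> selections d (h - 1) c (block_index n (row_comp n C) \<circ> w) \<and> block_counts n (col_comp n A) X = t. relabel_weight d h (h - 1) (relabel X h (block_index n (row_comp n C) \<circ> w)) X)
        = u_pow (2 * (\<Sum>l\<in>idx n. of_bool (l < 0) * int (t l)) + 2 * int (t 0))
         * v_pow (2 * (\<Sum>l\<in>idx n. \<Sum>k\<in>idx n. of_bool (k < l) * ((A 0 l - of_bool (l = 0)) * int (t k)))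
           + pairing n (\<lambda>l. int (t l)) (\<lambda>l k. k + l < 0) (\<lambda>l. int (t l))
           - (\<Sum>l\<in>idx n. of_bool (l < 0) * int (t l))
           + (2 * (\<Sum>l\<in>idx n. int (t l) * A 0 l) + (\<Sum>l\<in>idx n. int (t l) * int (t (- l))) - 3 * int (t 0)))
         * bar (exact_div (qfact_c (nat (natural A 0 0) + t 0)) (qfact_c (nat (natural A 0 0)) * qfact (t 0))
           * (\<Prod>l = 1..int n. exact_div (qfact (nat (A 0 l) + t l + t (- l))) (qfact (nat (A 0 l)) * qfact (t l) * qfact (t (- l)))))"
      by (intro row_pattern.coefficient_zero_row_bar[OF row_pattern.intro[OF row_col_Lam(3,2)[OF full] w full(3-7) tup[OF t] k]] XiD(2,4)[OF A]) (use h1 in simp_all)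
  qed
  show ?thesis
    unfolding Let_def
    by (intro conjI impI; elim conjE) (rule up, assumption+, rule down_ne, assumption+, frule(2) down_1, simp only:)
qed

end
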